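(* Let $w$ be an annular web of degree $n$. For every hook partition $\lambda=(k,1^{n-k})\vdash n$, the coefficient of the Schur function $s_\lambda$ in the Schur expansion of the chromatic symmetric function $X_w$ is $$[s_\lambda]X_w=\sum_{T\in\mathcal T_\lambda(w)}q^{\mathrm{inv}_w(T)}\in\mathbb Z_{\ge0}[q^{\pm1}],$$ where $\mathcal T_\lambda(w)$ is the set of $w$-tableaux of shape $\lambda$.
   Context: **Annular webs.** Let $\mathbb A=[0,1]\times[0,1]/\big((x,0)\sim(x,1)\big)$ be the annulus, with $H_1(\mathbb A;\mathbb Z)\cong\mathbb Z$ normalized so that an upward vertical circle represents $+1$ (the class of an oriented circle is its winding number); left/right refer to the first coordinate, upward to the second. An annular web $w$ is a finite trivalent graph embedded in $\mathbb A$ (vertex-free essential circles are allowed as edges), all of whose edges are oriented upward (the second coordinate increases along each edge), together with a thickness $t(e)\in\mathbb Z_{>0}$ for each edge $e$, such that at every vertex the total incoming thickness equals the total outgoing thickness. Every vertex is a merge (two incoming edges, one outgoing) or a split (one incoming, two outgoing). The degree $\deg(w)$ is $\sum t(e)$ over the edges crossed by any radial (horizontal) segment transverse to $w$ and avoiding vertices. **Colorings and $X_w$.** Let $\mathbb N=\{1,2,\dots\}$. A coloring $c$ of $w$ assigns to each edge $e$ a finite set $c(e)\subset\mathbb N$ with $|c(e)|=t(e)$ such that at every vertex the union of the color sets on incoming edges equals the union on outgoing edges; $\mathcal C(w)$ is the set of colorings. For finite $A,B\subset\mathbb N$, $\mathrm{inv}(A,B)=\sum_{a\in A,b\in B}\mathrm{sgn}(a-b)$.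 Put $\mathrm{inv}_w(c)=\sum_m\mathrm{inv}(c(e_R),c(e_L))$ over all merges $m$, where $e_L,e_R$ are the left and right incoming edges of $m$. $\Gamma_i(c)$ is the union of edges $e$ with $i\in c(e)$ (a disjoint union of circles), $x^c=\prod_ix_i^{|\Gamma_i(c)|}$ with $|\cdot|$ the number of components, and $X_w=\sum_{c\in\mathcal C(w)}q^{\mathrm{inv}_w(c)}x^c$, which is a symmetric function, homogeneous of degree $\deg(w)$. **$w$-arrays.** A loop in $w$ is a union of edges forming a circle oriented consistently with the edges. For loops $L_1,L_2$, write $L_1\prec L_2$ if $L_2$ lies in the right-hand region of the complement of $L_1$ (in particular they are disjoint). A loop decomposition of $w$ is a multiset of loops such that each edge $e$ is contained in exactly $t(e)$ of them (with multiplicity). For a weak composition $\alpha$ of $n=\deg(w)$ (a finite sequence of nonnegative integers with sum $n$), a $w$-array $T$ of shape $\alpha$ assigns a loop $T_{i,j}$ to each box $(i,j)$, $1\le j\le\alpha_i$, so that the multiset of assigned loops is a loop decomposition of $w$ and $T_{i,1}\prec T_{i,2}\prec\cdots\prec T_{i,\alpha_i}$ in each row $i$. $T$ determines a coloring $c$ by $c(e)=\{i: e\text{ is contained in a loop in row }i\text{ of }T\}$, and $\mathrm{inv}_w(T):=\mathrm{inv}_w(c)$. **The operation $\mathrm{SW}_{(i,j)}$.** A cell $(i,j)$ with $i>1$ is admissible if $1\le j\le\min(\alpha_i,\alpha_{i-1}+1)$. For such a cell let $A=\bigsqcup_{k\ge j}T_{i-1,k}$ and $B=\bigsqcup_{k>j}T_{i,k}$.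 Let $\Gamma_{A,B}$ be the union of edges belonging to exactly one of $A,B$, with $B$-edges keeping their orientation and $A$-edges reversed; it is a disjoint union of oriented circles. Let $\Gamma^*_{A,B}$ be the union of its components with nonzero winding number. Regard edges of $A$ as colored $i-1$ and edges of $B$ as colored $i$, and swap the colors $i-1$ and $i$ along $\Gamma^*_{A,B}$; let $A'$ be the resulting family of loops of color $i$ and $B'$ the resulting family of loops of color $i-1$ (edges in both $A$ and $B$ lie in both $A'$ and $B'$). Then $|A'|=|A|$, $|B'|=|B|$ as numbers of loops. $\mathrm{SW}_{(i,j)}(T)$ is obtained from $T$ by replacing row $i-1$ by $T_{i-1,1},\dots,T_{i-1,j-1}$ followed by the loops of $B'$ in $\prec$-order, and row $i$ by $T_{i,1},\dots,T_{i,j}$ followed by the loops of $A'$ in $\prec$-order. It has shape $(\dots,\alpha_{i-2},\alpha_i-1,\alpha_{i-1}+1,\alpha_{i+1},\dots)$ but need not be a $w$-array (the row-order condition may fail). **$w$-tableaux.** $T$ is invertible at an admissible cell $(i,j)$ if $\mathrm{SW}_{(i,j)}(T)$ is again a $w$-array; $T$ is invertible if it is invertible at some admissible cell. A $w$-tableau is a $w$-array that is not invertible. *)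

theory Defs
  imports
    "HOL-Complex_Analysis.Complex_Analysis"
    "HOL-Library.Poly_Mapping"
    "HOL-Library.Multiset"
    "HOL-Library.FuncSet"
begin

section \<open>Annular webs\<close>

text \<open>The annulus \<open>[0,1] \<times> [0,1] / ((x,0) \<sim> (x,1))\<close> is realised in \<open>\<real> \<times> \<complex>\<close> through
  \<open>(x, y) \<mapsto> (x, cis (2 * pi * y))\<close>.\<close>

definition annulus :: "(real \<times> complex) set" where
  "annulus = {0..1} \<times> sphere 0 1"

text \<open>\<open>h\<close> is a lift of the second coordinate to the universal cover \<open>\<real>\<close> of the circle.\<close>

definition upward :: "(real \<Rightarrow> real \<times> complex) \<Rightarrow> bool" where
  "upward g \<longleftrightarrow> (\<exists>h :: real \<Rightarrow> real. continuous_on {0..1} h \<and> strict_mono_on {0..1} h \<and>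
      (\<forall>s\<in>{0..1}. snd (g s) = cis (2 * pi * h s)))"

record 'e web =
  verts :: "(real \<times> complex) set"
  edges :: "'e set"
  curve :: "'e \<Rightarrow> real \<Rightarrow> real \<times> complex"
  thick :: "'e \<Rightarrow> nat"

definition in_edges :: "'e web \<Rightarrow> real \<times> complex \<Rightarrow> 'e set" where
  "in_edges w v = {e \<in> edges w. pathfinish (curve w e) = v}"

definition out_edges :: "'e web \<Rightarrow> real \<times> complex \<Rightarrow> 'e set" where
  "out_edges w v = {e \<in> edges w. pathstart (curve w e) = v}"

definition merges :: "'e web \<Rightarrow> (real \<times> complex) set" where
  "merges w = {v \<in> verts w. card (in_edges w v) = 2 \<and> card (out_edges w v) = 1}"

definition splits :: "'e web \<Rightarrow> (real \<times> complex) set" where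
  "splits w = {v \<in> verts w. card (in_edges w v) = 1 \<and> card (out_edges w v) = 2}"

text \<open>An edge is either an embedded curve running from a vertex to a vertex and otherwise avoiding
  the vertices, or a vertex-free circle (parametrised from an arbitrary base point).\<close>

definition annular_web :: "'e web \<Rightarrow> bool" where
  "annular_web w \<longleftrightarrow>
     finite (verts w) \<and> finite (edges w) \<and> verts w \<subseteq> annulus \<and>
     (\<forall>e\<in>edges w.
        simple_path (curve w e) \<and> path_image (curve w e) \<subseteq> annulus \<and> upward (curve w e) \<and>
        0 < thick w e \<and>
        (pathstart (curve w e) \<in> verts w \<and> pathfinish (curve w e) \<in> verts w \<and>
           curve w e ` {0<..<1} \<inter> verts w = {}
         \<or> pathstart (curve w e) = pathfinish (curve w e) \<and>
           path_image (curve w e) \<inter> verts w = {})) \<and>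
     (\<forall>e\<in>edges w. \<forall>e'\<in>edges w. e \<noteq> e' \<longrightarrow>
        path_image (curve w e) \<inter> path_image (curve w e') \<subseteq> verts w) \<and>
     verts w = merges w \<union> splits w \<and>
     (\<forall>v\<in>verts w. (\<Sum>e\<in>in_edges w v. thick w e) = (\<Sum>e\<in>out_edges w v. thick w e))"

text \<open>An edge winding several times around the annulus crosses a radial segment several times and
  is counted with that multiplicity. The result does not depend on the segment, as long as it avoids the
  vertices.\<close>

definition crossing_thickness :: "'e web \<Rightarrow> complex \<Rightarrow> nat" where
  "crossing_thickness w z =
     (\<Sum>e\<in>edges w. thick w e * card {p \<in> path_image (curve w e). snd p = z})"

definition web_degree :: "'e web \<Rightarrow> nat" where
  "web_degree w = crossing_thickness w (SOME z. z \<in> sphere 0 1 \<and> z \<notin> snd ` verts w)"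

definition carrier_of :: "'e web \<Rightarrow> 'e set \<Rightarrow> (real \<times> complex) set" where
  "carrier_of w S = (\<Union>e\<in>S. path_image (curve w e))"

text \<open>The connected components of the union of the edges in \<open>S\<close>, each given by its set of edges.\<close>

definition comps :: "'e web \<Rightarrow> 'e set \<Rightarrow> 'e set set" where
  "comps w S = (\<lambda>C. {e \<in> S. path_image (curve w e) \<subseteq> C}) ` components (carrier_of w S)"

section \<open>The chromatic symmetric function of a web\<close>

text \<open>For edges ending at a common vertex: sufficiently close to that vertex, points of \<open>e\<close> lie to the
  left of the points of \<open>e'\<close> on the same radial segment.\<close>

definition enters_left_of :: "'e web \<Rightarrow> 'e \<Rightarrow> 'e \<Rightarrow> bool" where
  "enters_left_of w e e' \<longleftrightarrow> (\<exists>\<epsilon>>0. \<forall>s\<in>{1-\<epsilon><..<1}. \<forall>s'\<in>{1-\<epsilon><..<1}.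
      snd (curve w e s) = snd (curve w e' s') \<longrightarrow> fst (curve w e s) < fst (curve w e' s'))"

definition left_in :: "'e web \<Rightarrow> real \<times> complex \<Rightarrow> 'e" where
  "left_in w m = (THE e. e \<in> in_edges w m \<and> (\<exists>e'\<in>in_edges w m. enters_left_of w e e'))"

definition right_in :: "'e web \<Rightarrow> real \<times> complex \<Rightarrow> 'e" where
  "right_in w m = (THE e. e \<in> in_edges w m \<and> (\<exists>e'\<in>in_edges w m. enters_left_of w e' e))"

text \<open>The colors are the positive integers.\<close>

definition colorings :: "'e web \<Rightarrow> ('e \<Rightarrow> nat set) set" where
  "colorings w =
     {c \<in> (\<Pi>\<^sub>E e\<in>edges w. {S. finite S \<and> 0 \<notin> S \<and> card S = thick w e}).
        \<forall>v\<in>verts w. (\<Union>e\<in>in_edges w v. c e) = (\<Union>e\<in>out_edges w v. c e)}"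

definition inv_sets :: "nat set \<Rightarrow> nat set \<Rightarrow> int" where
  "inv_sets A B = (\<Sum>a\<in>A. \<Sum>b\<in>B. sgn (int a - int b))"

definition inv_coloring :: "'e web \<Rightarrow> ('e \<Rightarrow> nat set) \<Rightarrow> int" where
  "inv_coloring w c = (\<Sum>m\<in>merges w. inv_sets (c (right_in w m)) (c (left_in w m)))"

definition color_edges :: "'e web \<Rightarrow> ('e \<Rightarrow> nat set) \<Rightarrow> nat \<Rightarrow> 'e set" where
  "color_edges w c i = {e \<in> edges w. i \<in> c e}"

text \<open>A monomial in \<open>x\<^sub>1, x\<^sub>2, \<dots>\<close> is given by its exponent function. A formal power series
  over \<open>\<int>[q\<^sup>\<plusminus>\<^sup>1]\<close> is given by its coefficient function on monomials.\<close>

type_synonym monomial = "nat \<Rightarrow> nat"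

type_synonym laurent = "int \<Rightarrow>\<^sub>0 int"

type_synonym series = "monomial \<Rightarrow> laurent"

definition q_power :: "int \<Rightarrow> laurent" where
  "q_power m = Poly_Mapping.single m 1"

definition coloring_monomial :: "'e web \<Rightarrow> ('e \<Rightarrow> nat set) \<Rightarrow> monomial" where
  "coloring_monomial w c = (\<lambda>i. card (comps w (color_edges w c i)))"

definition chromatic_function :: "'e web \<Rightarrow> series" where
  "chromatic_function w =
     (\<lambda>\<mu>. \<Sum>c | c \<in> colorings w \<and> coloring_monomial w c = \<mu>. q_power (inv_coloring w c))"

section \<open>Schur functions\<close>

definition is_partition :: "nat list \<Rightarrow> bool" where
  "is_partition \<nu> \<longleftrightarrow> sorted_wrt (\<ge>) \<nu> \<and> 0 \<notin> set \<nu>"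

text \<open>Semistandard Young tableaux, as lists of rows, with positive entries.\<close>

definition ssyt :: "nat list \<Rightarrow> nat list list set" where
  "ssyt \<nu> = {T. map length T = \<nu> \<and> 0 \<notin> set (concat T) \<and> (\<forall>r\<in>set T. sorted_wrt (\<le>) r) \<and>
     (\<forall>i j. Suc i < length T \<and> j < length (T ! Suc i) \<longrightarrow> T ! i ! j < T ! Suc i ! j)}"

definition schur :: "nat list \<Rightarrow> series" where
  "schur \<nu> = (\<lambda>\<mu>. of_nat (card {T \<in> ssyt \<nu>. (\<lambda>i. count_list (concat T) i) = \<mu>}))"

definition schur_expansion :: "series \<Rightarrow> (nat list \<Rightarrow> laurent) \<Rightarrow> bool" where
  "schur_expansion f a \<longleftrightarrow> finite {\<nu>. a \<nu> \<noteq> 0} \<and> (\<forall>\<nu>. a \<nu> \<noteq> 0 \<longrightarrow> is_partition \<nu>) \<and>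
     f = (\<lambda>\<mu>. \<Sum>\<nu> | a \<nu> \<noteq> 0. a \<nu> * schur \<nu> \<mu>)"

text \<open>Every symmetric function of bounded degree has exactly one Schur expansion.\<close>

definition schur_coeff :: "nat list \<Rightarrow> series \<Rightarrow> laurent" where
  "schur_coeff \<nu> f = (THE a. schur_expansion f a) \<nu>"

definition hook :: "nat \<Rightarrow> nat \<Rightarrow> nat list" where
  "hook n k = k # replicate (n - k) 1"

section \<open>Loops and arrays\<close>

text \<open>A loop is given by its set of edges; the list \<open>es\<close> runs once around the circle.\<close>

definition is_loop :: "'e web \<Rightarrow> 'e set \<Rightarrow> bool" where
  "is_loop w L \<longleftrightarrow> L \<subseteq> edges w \<and>
     (\<exists>es. es \<noteq> [] \<and> set es = L \<and> distinct (map (\<lambda>e. pathstart (curve w e)) es) \<and>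
        (\<forall>k<length es. pathfinish (curve w (es ! k)) =
                         pathstart (curve w (es ! (Suc k mod length es)))))"

text \<open>A loop winds exactly once around the annulus, so it meets every radial segment in exactly one
  point; the right-hand region consists of the points to the right of it.\<close>

definition right_region :: "'e web \<Rightarrow> 'e set \<Rightarrow> (real \<times> complex) set" where
  "right_region w L =
     {p \<in> annulus. \<forall>p'\<in>carrier_of w L. snd p' = snd p \<longrightarrow> fst p' < fst p}"

definition loop_prec :: "'e web \<Rightarrow> 'e set \<Rightarrow> 'e set \<Rightarrow> bool" where
  "loop_prec w L L' \<longleftrightarrow> carrier_of w L' \<subseteq> right_region w L"

definition loop_decomposition :: "'e web \<Rightarrow> 'e set multiset \<Rightarrow> bool" where
  "loop_decomposition w M \<longleftrightarrow> (\<forall>L\<in>#M. is_loop w L) \<and>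
     (\<forall>e\<in>edges w. size {#L \<in># M. e \<in> L#} = thick w e)"

text \<open>An array is the list of its rows, each row being the list of its loops. Hence row \<open>i\<close> is
  \<open>T ! (i - 1)\<close>, and the entry of box \<open>(i, j)\<close> is \<open>T ! (i - 1) ! (j - 1)\<close>.\<close>

definition shape :: "'e set list list \<Rightarrow> nat list" where
  "shape T = map length T"

definition web_array :: "'e web \<Rightarrow> 'e set list list \<Rightarrow> bool" where
  "web_array w T \<longleftrightarrow> sum_list (shape T) = web_degree w \<and>
     loop_decomposition w (mset (concat T)) \<and>
     (\<forall>r\<in>set T. sorted_wrt (loop_prec w) r)"

definition array_coloring :: "'e web \<Rightarrow> 'e set list list \<Rightarrow> 'e \<Rightarrow> nat set" where
  "array_coloring w T =
     (\<lambda>e\<in>edges w. {i \<in> {1..length T}. \<exists>L\<in>set (T ! (i - 1)). e \<in> L})"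

definition inv_array :: "'e web \<Rightarrow> 'e set list list \<Rightarrow> int" where
  "inv_array w T = inv_coloring w (array_coloring w T)"

section \<open>The operation SW and tableaux\<close>

definition admissible :: "'e set list list \<Rightarrow> nat \<Rightarrow> nat \<Rightarrow> bool" where
  "admissible T i j \<longleftrightarrow> 1 < i \<and> i \<le> length T \<and> 1 \<le> j \<and>
     j \<le> min (length (T ! (i - 1))) (length (T ! (i - 2)) + 1)"

text \<open>The winding number of an edge is its (possibly fractional) total angle divided by \<open>2 * pi\<close>; for
  circles made up of edges of \<open>B\<close> and reversed edges of \<open>A\<close> these contributions add up to the
  winding number of the circle.\<close>

definition edge_winding :: "'e web \<Rightarrow> 'e \<Rightarrow> real" where
  "edge_winding w e = Re (winding_number (snd \<circ> curve w e) 0)"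

definition comp_winding :: "'e web \<Rightarrow> 'e set \<Rightarrow> 'e set \<Rightarrow> 'e set \<Rightarrow> real" where
  "comp_winding w A B C = (\<Sum>e\<in>C \<inter> B. edge_winding w e) - (\<Sum>e\<in>C \<inter> A. edge_winding w e)"

definition Gamma :: "'e set \<Rightarrow> 'e set \<Rightarrow> 'e set" where
  "Gamma A B = (A - B) \<union> (B - A)"

definition Gamma_star :: "'e web \<Rightarrow> 'e set \<Rightarrow> 'e set \<Rightarrow> 'e set" where
  "Gamma_star w A B = \<Union>{C \<in> comps w (Gamma A B). comp_winding w A B C \<noteq> 0}"

definition ordered_loops :: "'e web \<Rightarrow> 'e set \<Rightarrow> 'e set list" where
  "ordered_loops w S = (THE Ls. set Ls = comps w S \<and> sorted_wrt (loop_prec w) Ls)"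

definition SW :: "'e web \<Rightarrow> nat \<Rightarrow> nat \<Rightarrow> 'e set list list \<Rightarrow> 'e set list list" where
  "SW w i j T =
    (let A = \<Union>(set (drop (j - 1) (T ! (i - 2))));
         B = \<Union>(set (drop j (T ! (i - 1))));
         G = Gamma_star w A B;
         A' = (B - G) \<union> (A \<inter> G);
         B' = (A - G) \<union> (B \<inter> G)
     in T[i - 2 := take (j - 1) (T ! (i - 2)) @ ordered_loops w B',
          i - 1 := take j (T ! (i - 1)) @ ordered_loops w A'])"

definition invertible_at :: "'e web \<Rightarrow> 'e set list list \<Rightarrow> nat \<Rightarrow> nat \<Rightarrow> bool" where
  "invertible_at w T i j \<longleftrightarrow> admissible T i j \<and> web_array w (SW w i j T)"

definition invertible_array :: "'e web \<Rightarrow> 'e set list list \<Rightarrow> bool" where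
  "invertible_array w T \<longleftrightarrow> (\<exists>i j. invertible_at w T i j)"

definition web_tableaux :: "'e web \<Rightarrow> nat list \<Rightarrow> 'e set list list set" where
  "web_tableaux w \<alpha> = {T. web_array w T \<and> shape T = \<alpha> \<and> \<not> invertible_array w T}"

definition nonneg_laurent :: "laurent set" where
  "nonneg_laurent = {p. \<forall>m. 0 \<le> Poly_Mapping.lookup p m}"

end

theory Submission
  imports Defs
begin

text \<open>For a symmetric function \<open>f\<close> of degree \<open>n\<close>, the coefficient of the Schur function of the hook
  \<open>(k, 1, \<dots>, 1)\<close> is the alternating sum of the coefficients of \<open>x\<^sup>\<alpha>\<close> in \<open>f\<close> over the compositions
  \<open>\<alpha>\<close> of \<open>n\<close> with \<open>\<alpha>\<^sub>1 \<ge> k\<close>, with sign \<open>(-1)\<close> to the power \<open>n - k + 1 + length \<alpha>\<close>.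
  The colorings of a web with monomial \<open>x\<^sup>\<alpha>\<close> are its arrays of shape \<open>\<alpha>\<close>. Splitting a loop off a row, or
  joining it to the adjacent row, is a sign-reversing involution on the arrays that preserves \<open>inv\<close>.
  On an array of hook shape the operation \<open>SW\<close> only moves row \<open>i - 1\<close> to the end of row \<open>i\<close>, and the
  fixed points of the involution are exactly the tableaux of hook shape.

  The chromatic function is symmetric because the colors \<open>i\<close> and \<open>i + 1\<close> can be exchanged along
  the components of nonzero winding number of the edges carrying exactly one of them. This changes
  \<open>inv\<close> by twice the difference between the numbers of left-turning and right-turning local maxima of such a
  component. Both sides of an essential curve are connected, which bounds the number of
  maxima of one kind by the number of minima of the other kind. Conservation of each single color at the
  vertices gives the remaining relation, so the two kinds of maxima are equally frequent.\<close>

section \<open>Kostka numbers\<close>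

text \<open>The hook coefficient is defined through a Schur expansion, so it exists only once the
  chromatic function is known to be symmetric, and this is the hard half. Exchanging two colors
  along every circle would change \<open>inv\<close>: a contractible circle has one more maximum of
  one kind than of the other. Contractible circles are therefore left alone, which does not disturb
  the monomial, because their signed crossings with a radial segment cancel. The edges are actual
  curves, and no Jordan curve theorem is applied to them. Cutting at finitely many angles turns the
  web into strands that are linearly ordered from left to right in each slab. Sides of a curve,
  winding numbers and connected regions become statements about sets of strands, and connectedness
  of a side becomes an edge count in a finite graph. The same order shows that disjoint upward loops
  wind exactly once: a return map that preserves a finite linear order is the identity.\<close>

definition interlacing :: "(nat \<Rightarrow> nat) \<Rightarrow> (nat \<Rightarrow> nat) set" where
  "interlacing \<nu> = {\<mu>. \<forall>i. \<nu> (Suc i) \<le> \<mu> i \<and> \<mu> i \<le> \<nu> i}"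

definition partition_fun :: "nat \<Rightarrow> (nat \<Rightarrow> nat) \<Rightarrow> bool" where
  "partition_fun d \<nu> \<longleftrightarrow> (\<forall>i. \<nu> (Suc i) \<le> \<nu> i) \<and> (\<forall>i\<ge>d. \<nu> i = 0)"

text \<open>The list is the content read from the largest entry downwards: removing the boxes with the
  largest entry of a semistandard tableau leaves a shape interlacing with the given one. Shapes are
  functions vanishing from \<open>d\<close> on.\<close>

fun kostka :: "nat \<Rightarrow> (nat \<Rightarrow> nat) \<Rightarrow> nat list \<Rightarrow> nat" where
  "kostka d \<nu> [] = (if \<nu> = (\<lambda>_. 0) then 1 else 0)"
| "kostka d \<nu> (a # as) =
     (\<Sum>\<mu> | \<mu> \<in> interlacing \<nu> \<and> sum \<nu> {..<d} = sum \<mu> {..<d} + a. kostka d \<mu> as)"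

lemma partition_fun_interlacing:
  assumes "partition_fun d \<nu>" "\<mu> \<in> interlacing \<nu>"
  shows "partition_fun d \<mu>"
  unfolding partition_fun_def
proof (intro conjI allI impI)
  fix i
  show "\<mu> (Suc i) \<le> \<mu> i"
    using assms(2) le_trans[of "\<mu> (Suc i)" "\<nu> (Suc i)" "\<mu> i"] by (simp add: interlacing_def)
  show "\<mu> i = 0" if "i \<ge> d"
    using assms that by (metis (mono_tags, lifting) interlacing_def le_zero_eq mem_Collect_eq partition_fun_def)
qed

lemma finite_interlacing:
  assumes "partition_fun d \<nu>"
  shows "finite (interlacing \<nu>)"
proof (rule finite_subset)
  show "interlacing \<nu> \<subseteq> {f. \<forall>x. (x \<in> {..<d} \<longrightarrow> f x \<in> {..sum \<nu> {..<d}}) \<and> (x \<notin> {..<d} \<longrightarrow> f x = 0)}"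
  proof clarify
    fix \<mu> x assume \<mu>: "\<mu> \<in> interlacing \<nu>"
    have le: "\<mu> x \<le> \<nu> x" using \<mu> by (simp add: interlacing_def)
    show "(x \<in> {..<d} \<longrightarrow> \<mu> x \<in> {..sum \<nu> {..<d}}) \<and> (x \<notin> {..<d} \<longrightarrow> \<mu> x = 0)"
    proof (intro conjI impI)
      assume "x \<in> {..<d}"
      then have "\<nu> x \<le> sum \<nu> {..<d}" by (intro member_le_sum) auto
      with le show "\<mu> x \<in> {..sum \<nu> {..<d}}" by simp
    next
      assume "x \<notin> {..<d}" with le assms show "\<mu> x = 0" by (simp add: partition_fun_def)
    qed
  qed
  show "finite {f. \<forall>x. (x \<in> {..<d} \<longrightarrow> f x \<in> {..sum \<nu> {..<d}}) \<and> (x \<notin> {..<d} \<longrightarrow> f x = (0::nat))}"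
    by (rule finite_set_of_finite_funs) auto
qed

section \<open>Chains of three interlacing shapes and the symmetry of Kostka numbers\<close>

definition lower_bound :: "(nat \<Rightarrow> nat) \<Rightarrow> (nat \<Rightarrow> nat) \<Rightarrow> nat \<Rightarrow> nat" where
  "lower_bound \<nu> \<rho> i = max (\<rho> i) (\<nu> (Suc i))"

definition upper_bound :: "(nat \<Rightarrow> nat) \<Rightarrow> (nat \<Rightarrow> nat) \<Rightarrow> nat \<Rightarrow> nat" where
  "upper_bound \<nu> \<rho> i = (case i of 0 \<Rightarrow> \<nu> 0 | Suc j \<Rightarrow> min (\<nu> (Suc j)) (\<rho> j))"

text \<open>The conditions on \<open>\<mu>\<close> never compare two of its values with each other,
  so the shapes between fixed \<open>\<nu>\<close> and \<open>\<rho>\<close> form a product of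
  intervals. This is what makes a coordinatewise reflection possible.\<close>

lemma interlacing_bounds:
  "\<mu> \<in> interlacing \<nu> \<and> \<rho> \<in> interlacing \<mu> \<longleftrightarrow>
     (\<forall>i. lower_bound \<nu> \<rho> i \<le> \<mu> i \<and> \<mu> i \<le> upper_bound \<nu> \<rho> i)"
proof
  assume L: "\<mu> \<in> interlacing \<nu> \<and> \<rho> \<in> interlacing \<mu>"
  show "\<forall>i. lower_bound \<nu> \<rho> i \<le> \<mu> i \<and> \<mu> i \<le> upper_bound \<nu> \<rho> i"
  proof
    fix i show "lower_bound \<nu> \<rho> i \<le> \<mu> i \<and> \<mu> i \<le> upper_bound \<nu> \<rho> i"
      using L by (cases i) (auto simp: interlacing_def lower_bound_def upper_bound_def)
  qed
next
  assume R: "\<forall>i. lower_bound \<nu> \<rho> i \<le> \<mu> i \<and> \<mu> i \<le> upper_bound \<nu> \<rho> i"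
  have 1: "\<rho> i \<le> \<mu> i \<and> \<nu> (Suc i) \<le> \<mu> i" for i
    using R[rule_format, of i] by (auto simp: lower_bound_def)
  have 2: "\<mu> i \<le> \<nu> i" for i
    using R[rule_format, of i] by (cases i) (auto simp: upper_bound_def)
  have 3: "\<mu> (Suc i) \<le> \<rho> i" for i
    using R[rule_format, of "Suc i"] by (auto simp: upper_bound_def)
  show "\<mu> \<in> interlacing \<nu> \<and> \<rho> \<in> interlacing \<mu>"
    using 1 2 3 by (auto simp: interlacing_def)
qed

text \<open>Telescopes because \<open>max (\<rho> i) (\<nu> (Suc i))\<close> and the next upper
  bound \<open>min (\<nu> (Suc i)) (\<rho> i)\<close> add up to
  \<open>\<rho> i + \<nu> (Suc i)\<close>.\<close>

lemma sum_bounds: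
  "(\<Sum>i<d. lower_bound \<nu> \<rho> i + upper_bound \<nu> \<rho> i) + upper_bound \<nu> \<rho> d = sum \<nu> {..d} + sum \<rho> {..<d}"
proof (induction d)
  case (Suc d)
  have "lower_bound \<nu> \<rho> d + upper_bound \<nu> \<rho> (Suc d) = \<rho> d + \<nu> (Suc d)"
    by (auto simp: lower_bound_def upper_bound_def max_def min_def)
  with Suc show ?case by simp
qed (simp add: upper_bound_def)

text \<open>The Bender-Knuth involution on chains of shapes: reflecting the middle shape in its
  product of intervals replaces its size by \<open>|\<nu>| + |\<rho>| - |\<mu>|\<close>, which
  exchanges the strip sizes \<open>a\<close> and \<open>b\<close> and keeps
  \<open>\<rho>\<close>.\<close>

lemma kostka_swap_head:
  assumes \<nu>: "partition_fun d \<nu>"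
  shows "kostka d \<nu> (a # b # as) = kostka d \<nu> (b # a # as)"
proof -
  define P where "P a b = (SIGMA \<mu>:{\<mu>. \<mu> \<in> interlacing \<nu> \<and> sum \<nu> {..<d} = sum \<mu> {..<d} + a}.
      {\<rho>. \<rho> \<in> interlacing \<mu> \<and> sum \<mu> {..<d} = sum \<rho> {..<d} + b})" for a b
  have fin: "finite {\<mu>. \<mu> \<in> interlacing \<nu> \<and> Q \<mu>}" for Q
    using finite_interlacing[OF \<nu>] by simp
  have fin': "finite {\<rho>. \<rho> \<in> interlacing \<mu> \<and> Q \<rho>}" if "\<mu> \<in> interlacing \<nu>" for \<mu> Q
    using finite_interlacing[OF partition_fun_interlacing[OF \<nu> that]] by simp
  have "kostka d \<nu> (a # b # as) = (\<Sum>(\<mu>,\<rho>)\<in>P a b. kostka d \<rho> as)" for a b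
    unfolding P_def kostka.simps
    by (subst sum.Sigma) (use fin fin' in auto)
  moreover have "(\<Sum>(\<mu>,\<rho>)\<in>P a b. kostka d \<rho> as) = (\<Sum>(\<mu>,\<rho>)\<in>P b a. kostka d \<rho> as)"
  proof -
    define refl where
      "refl = (\<lambda>(\<mu>,\<rho>). (\<lambda>i. lower_bound \<nu> \<rho> i + upper_bound \<nu> \<rho> i - \<mu> i :: nat, \<rho> :: nat \<Rightarrow> nat))"
    have r: "refl p \<in> P b a \<and> refl (refl p) = p" if p: "p \<in> P a b" for a b p
    proof -
      obtain \<mu> \<rho> where [simp]: "p = (\<mu>, \<rho>)" by (cases p)
      have \<mu>\<rho>: "\<mu> \<in> interlacing \<nu>" "\<rho> \<in> interlacing \<mu>" "sum \<nu> {..<d} = sum \<mu> {..<d} + a"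
          "sum \<mu> {..<d} = sum \<rho> {..<d} + b"
        using p by (auto simp: P_def)
      have bd: "lower_bound \<nu> \<rho> i \<le> \<mu> i" "\<mu> i \<le> upper_bound \<nu> \<rho> i" for i
        using interlacing_bounds[of \<mu> \<nu> \<rho>] \<mu>\<rho> by auto
      define \<mu>' where "\<mu>' = (\<lambda>i. lower_bound \<nu> \<rho> i + upper_bound \<nu> \<rho> i - \<mu> i)"
      have bd': "lower_bound \<nu> \<rho> i \<le> \<mu>' i \<and> \<mu>' i \<le> upper_bound \<nu> \<rho> i" for i
        using bd[of i] by (auto simp: \<mu>'_def)
      then have int: "\<mu>' \<in> interlacing \<nu>" "\<rho> \<in> interlacing \<mu>'"
        using interlacing_bounds[of \<mu>' \<nu> \<rho>] by auto
      \<comment> \<open>Removes the boundary term of \<open>sum_bounds\<close>: it is at most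
        \<open>\<nu> d\<close>, and row \<open>d\<close> of \<open>\<nu>\<close> is empty.\<close>
      have "upper_bound \<nu> \<rho> d = 0"
        using \<nu> by (cases d) (auto simp: upper_bound_def partition_fun_def)
      moreover have "sum \<nu> {..d} = sum \<nu> {..<d}"
        using \<nu> by (simp add: partition_fun_def lessThan_Suc_atMost[symmetric])
      ultimately have "(\<Sum>i<d. lower_bound \<nu> \<rho> i + upper_bound \<nu> \<rho> i) = sum \<nu> {..<d} + sum \<rho> {..<d}"
        using sum_bounds[of \<nu> \<rho> d] by simp
      moreover have "sum \<mu>' {..<d} + sum \<mu> {..<d} = (\<Sum>i<d. lower_bound \<nu> \<rho> i + upper_bound \<nu> \<rho> i)"
        unfolding sum.distrib[symmetric] \<mu>'_def
        by (rule sum.cong) (use bd in \<open>simp_all add: trans_le_add2\<close>)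
      ultimately have "sum \<mu>' {..<d} + sum \<mu> {..<d} = sum \<nu> {..<d} + sum \<rho> {..<d}" by simp
      then have "(\<mu>', \<rho>) \<in> P b a"
        using int \<mu>\<rho> by (auto simp: P_def)
      moreover have "refl p = (\<mu>', \<rho>)" by (simp add: refl_def \<mu>'_def)
      moreover have "refl (\<mu>', \<rho>) = (\<mu>, \<rho>)"
        using bd by (simp add: refl_def \<mu>'_def fun_eq_iff trans_le_add2)
      ultimately show ?thesis by simp
    qed
    have snd: "snd (refl p) = snd p" for p by (simp add: refl_def split: prod.splits)
    show ?thesis
    proof (rule sum.reindex_bij_witness[of _ refl refl])
      fix p assume "p \<in> P a b"
      from r[OF this] show "refl (refl p) = p" "refl p \<in> P b a" by blast+
      show "(case refl p of (\<mu>, \<rho>) \<Rightarrow> kostka d \<rho> as) = (case p of (\<mu>, \<rho>) \<Rightarrow> kostka d \<rho> as)"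
        using snd[of p] by (simp add: case_prod_unfold)
    next
      fix p assume "p \<in> P b a"
      from r[OF this] show "refl (refl p) = p" "refl p \<in> P a b" by blast+
    qed
  qed
  ultimately show ?thesis by (simp only:)
qed

lemma kostka_swap:
  assumes "partition_fun d \<nu>"
  shows "kostka d \<nu> (xs @ a # b # ys) = kostka d \<nu> (xs @ b # a # ys)"
  using assms
proof (induction xs arbitrary: \<nu>)
  case Nil
  then show ?case using kostka_swap_head by simp
next
  case (Cons x xs)
  show ?case unfolding append_Cons kostka.simps
    by (rule sum.cong) (use Cons partition_fun_interlacing in auto)
qed

section \<open>Semistandard tableaux counted by their content\<close>

definition row_tableaux :: "nat \<Rightarrow> (nat \<Rightarrow> nat) \<Rightarrow> nat \<Rightarrow> nat list list set" where
  "row_tableaux d \<nu> m = {T. length T = d \<and> (\<forall>i<d. length (T ! i) = \<nu> i \<and> sorted (T ! i) \<and> set (T ! i) \<subseteq> {1..m}) \<and>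
     (\<forall>i j. Suc i < d \<and> j < \<nu> (Suc i) \<longrightarrow> T ! i ! j < T ! Suc i ! j)}"

lemma finite_row_tableaux: "finite (row_tableaux d \<nu> m)"
proof (rule finite_subset)
  let ?R = "{r. set r \<subseteq> {1..m} \<and> length r \<le> sum \<nu> {..<d}}"
  show "row_tableaux d \<nu> m \<subseteq> {T. set T \<subseteq> ?R \<and> length T = d}"
  proof
    fix T assume T: "T \<in> row_tableaux d \<nu> m"
    have len: "length T = d" and row: "\<And>i. i < d \<Longrightarrow> length (T ! i) = \<nu> i \<and> set (T ! i) \<subseteq> {1..m}"
      using T unfolding row_tableaux_def by blast+
    have "r \<in> ?R" if r: "r \<in> set T" for r
    proof -
      obtain i where i: "i < d" "T ! i = r" using r len by (auto simp: in_set_conv_nth)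
      have "\<nu> i \<le> sum \<nu> {..<d}" using i(1) by (intro member_le_sum) auto
      then show ?thesis using row[OF i(1)] i(2) by simp
    qed
    then show "T \<in> {T. set T \<subseteq> ?R \<and> length T = d}" using len by blast
  qed
  have "finite ?R" by (rule finite_lists_length_le) simp
  then show "finite {T. set T \<subseteq> ?R \<and> length T = d}" by (rule finite_lists_length_eq)
qed

lemma count_list_concat: "count_list (concat T) v = (\<Sum>r\<leftarrow>T. count_list r v)"
  by (induction T) auto

lemma count_list_concat_nth: "count_list (concat T) v = (\<Sum>i<length T. count_list (T ! i) v)"
  unfolding count_list_concat by (simp add: sum_list_sum_nth atLeast0LessThan)

lemma sorted_split_max:
  assumes "sorted r" "set r \<subseteq> {1..Suc m}"
  shows "r = filter (\<lambda>x. x \<le> m) r @ replicate (length r - length (filter (\<lambda>x. x \<le> m) r)) (Suc m)"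
  using assms
proof (induction r)
  case (Cons x r)
  show ?case
  proof (cases "x \<le> m")
    case True
    have IH: "r = filter (\<lambda>x. x \<le> m) r @ replicate (length r - length (filter (\<lambda>x. x \<le> m) r)) (Suc m)"
      by (rule Cons.IH) (use Cons.prems in auto)
    have "filter (\<lambda>x. x \<le> m) (x # r) = x # filter (\<lambda>x. x \<le> m) r" using True by simp
    then show ?thesis
      by (simp only: length_Cons diff_Suc_Suc append_Cons list.inject simp_thms) (rule IH)
  next
    case False
    then have "x = Suc m" using Cons.prems by auto
    then have "\<forall>y\<in>set r. y = Suc m" using Cons.prems by (force intro: antisym)
    then obtain k where "r = replicate k (Suc m)" by (metis replicate_length_same)
    then show ?thesis using \<open>x = Suc m\<close> by simp
  qed
qed simp

lemma count_list_filter: "count_list (filter P r) v = (if P v then count_list r v else 0)"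
  by (induction r) auto

lemma count_list_replicate': "count_list (replicate k a) v = (if a = v then k else 0)"
  by (induction k) auto

text \<open>Induction on the bound for the entries: the boxes containing \<open>Suc m\<close> sit at
  the ends of the rows and form a horizontal strip, so deleting them is one step of the recursion
  for \<open>kostka\<close>. Rows may become empty but are kept, so that all shapes of the chain
  share the same \<open>d\<close>.\<close>

lemma card_row_tableaux_eq_kostka:
  assumes "partition_fun d \<nu>"
  shows "card {T \<in> row_tableaux d \<nu> m. \<forall>v\<in>{1..m}. count_list (concat T) v = \<beta> v} =
    kostka d \<nu> (map \<beta> (rev [1..<Suc m]))"
  using assms
proof (induction m arbitrary: \<nu>)
  case 0
  have "row_tableaux d \<nu> 0 = (if \<nu> = (\<lambda>_. 0) then {replicate d []} else {})"
  proof (cases "\<nu> = (\<lambda>_. 0)")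
    case True
    then have "T = replicate d []" if "T \<in> row_tableaux d \<nu> 0" for T
      using that by (auto simp: row_tableaux_def intro!: nth_equalityI)
    moreover have "replicate d [] \<in> row_tableaux d \<nu> 0" using True by (auto simp: row_tableaux_def)
    ultimately have "row_tableaux d \<nu> 0 = {replicate d []}" by blast
    then show ?thesis using True by simp
  next
    case False
    then obtain i where i: "\<nu> i \<noteq> 0" by auto
    then have "i < d" using 0 unfolding partition_fun_def by (metis not_less)
    then have "row_tableaux d \<nu> 0 = {}" using i by (fastforce simp: row_tableaux_def)
    then show ?thesis using False by simp
  qed
  then show ?case by simp
next
  case (Suc m)
  define Y where "Y \<mu> m = {T \<in> row_tableaux d \<mu> m. \<forall>v\<in>{1..m}. count_list (concat T) v = \<beta> v}" for \<mu> m
  define M where "M = {\<mu>. \<mu> \<in> interlacing \<nu> \<and> sum \<nu> {..<d} = sum \<mu> {..<d} + \<beta> (Suc m)}"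
  define f where "f T = ((\<lambda>i. if i < d then length (filter (\<lambda>x. x \<le> m) (T ! i)) else 0),
      map (filter (\<lambda>x. x \<le> m)) T)" for T :: "nat list list"
  define g where "g = (\<lambda>(\<mu>, T'). map (\<lambda>i. T' ! i @ replicate (\<nu> i - \<mu> i) (Suc m)) [0..<d])"
  have mono: "\<nu> (Suc i) \<le> \<nu> i" for i using Suc.prems by (auto simp: partition_fun_def)
  have zero: "\<nu> i = 0" if "i \<ge> d" for i using Suc.prems that by (auto simp: partition_fun_def)
  have f: "f T \<in> Sigma M (\<lambda>\<mu>. Y \<mu> m) \<and> g (f T) = T" if T: "T \<in> Y \<nu> (Suc m)" for T
  proof -
    define \<mu> where "\<mu> = (\<lambda>i. if i < d then length (filter (\<lambda>x. x \<le> m) (T ! i)) else 0)"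
    have len: "length T = d" and Ti: "length (T ! i) = \<nu> i" "sorted (T ! i)" "set (T ! i) \<subseteq> {1..Suc m}"
      if "i < d" for i using T that by (auto simp: Y_def row_tableaux_def)
    have len: "length T = d" using T by (auto simp: Y_def row_tableaux_def)
    have col: "T ! i ! j < T ! Suc i ! j" if "Suc i < d" "j < \<nu> (Suc i)" for i j
      using T that by (auto simp: Y_def row_tableaux_def)
    have split: "T ! i = filter (\<lambda>x. x \<le> m) (T ! i) @ replicate (\<nu> i - \<mu> i) (Suc m)" if "i < d" for i
      using sorted_split_max[OF Ti(2,3)[OF that]] Ti(1)[OF that] that by (simp add: \<mu>_def)
    have \<mu>le: "\<mu> i \<le> \<nu> i" for i using Ti(1)[of i] length_filter_le[of "\<lambda>x. x \<le> m" "T ! i"] by (cases "i < d") (simp_all add: \<mu>_def)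
    have nthle: "T ! i ! j \<le> m \<longleftrightarrow> j < \<mu> i" if "i < d" "j < \<nu> i" for i j
    proof -
      have [simp]: "length (filter (\<lambda>x. x \<le> m) (T ! i)) = \<mu> i" using that by (simp add: \<mu>_def)
      have eq: "T ! i ! j = (if j < \<mu> i then filter (\<lambda>x. x \<le> m) (T ! i) ! j else replicate (\<nu> i - \<mu> i) (Suc m) ! (j - \<mu> i))"
        by (subst split[OF that(1)]) (simp add: nth_append)
      show ?thesis
      proof (cases "j < \<mu> i")
        case True
        then have "filter (\<lambda>x. x \<le> m) (T ! i) ! j \<in> set (filter (\<lambda>x. x \<le> m) (T ! i))"
          by (intro nth_mem) simp
        then show ?thesis using eq True by auto
      next
        case False then show ?thesis using eq that by simp
      qed
    qed
    have \<mu>int: "\<mu> \<in> interlacing \<nu>"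
    proof -
      \<comment> \<open>Above the last box of row \<open>Suc i\<close> lies a box of row
        \<open>i\<close> with a strictly smaller entry, hence one that is at most \<open>m\<close>
        and survives the deletion.\<close>
      have "\<nu> (Suc i) \<le> \<mu> i" for i
      proof (cases "\<nu> (Suc i) = 0")
        case False
        then have "Suc i < d" using zero by (meson not_less)
        have j: "\<nu> (Suc i) - 1 < \<nu> (Suc i)" using False by simp
        have "T ! Suc i ! (\<nu> (Suc i) - 1) \<in> set (T ! Suc i)"
          using j Ti(1)[OF \<open>Suc i < d\<close>] by (intro nth_mem) auto
        then have "T ! Suc i ! (\<nu> (Suc i) - 1) \<le> Suc m" using Ti(3)[OF \<open>Suc i < d\<close>] by auto
        then have "T ! i ! (\<nu> (Suc i) - 1) \<le> m" using col[OF \<open>Suc i < d\<close> j] by simp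
        moreover have "\<nu> (Suc i) - 1 < \<nu> i" using j mono[of i] by linarith
        ultimately have "\<nu> (Suc i) - 1 < \<mu> i" using nthle[of i] \<open>Suc i < d\<close> by auto
        then show ?thesis by simp
      qed simp
      then show ?thesis using \<mu>le by (simp add: interlacing_def)
    qed
    have cnt: "count_list (concat T) (Suc m) = (\<Sum>i<d. \<nu> i - \<mu> i)"
      unfolding count_list_concat_nth len
    proof (rule sum.cong)
      fix i assume "i \<in> {..<d}"
      then show "count_list (T ! i) (Suc m) = \<nu> i - \<mu> i"
        by (subst split) (auto simp: count_list_filter count_list_replicate')
    qed simp
    have "sum \<nu> {..<d} = sum \<mu> {..<d} + (\<Sum>i<d. \<nu> i - \<mu> i)"
      unfolding sum.distrib[symmetric] by (rule sum.cong) (use \<mu>le in auto)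
    moreover have "count_list (concat T) (Suc m) = \<beta> (Suc m)" using T by (auto simp: Y_def)
    ultimately have "\<mu> \<in> M" using \<mu>int cnt by (simp add: M_def)
    moreover have "map (filter (\<lambda>x. x \<le> m)) T \<in> Y \<mu> m"
    proof -
      have "map (filter (\<lambda>x. x \<le> m)) T \<in> row_tableaux d \<mu> m"
        unfolding row_tableaux_def
      proof (intro CollectI conjI allI impI)
        fix i assume "i < d"
        then show "length (map (filter (\<lambda>x. x \<le> m)) T ! i) = \<mu> i" "sorted (map (filter (\<lambda>x. x \<le> m)) T ! i)"
          "set (map (filter (\<lambda>x. x \<le> m)) T ! i) \<subseteq> {1..m}"
          using Ti[of i] len by (auto simp: \<mu>_def sorted_filter[where f=id, simplified])
      next
        fix i j assume ij: "Suc i < d \<and> j < \<mu> (Suc i)"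
        then have "j < \<mu> i" using \<mu>le[of "Suc i"] partition_fun_interlacing[OF Suc.prems \<mu>int]
          by (auto simp: partition_fun_def intro: less_le_trans)
        have a: "map (filter (\<lambda>x. x \<le> m)) T ! i' ! j = T ! i' ! j" if "i' < d" "j < \<mu> i'" for i'
        proof -
          have "T ! i' ! j = (filter (\<lambda>x. x \<le> m) (T ! i') @ replicate (\<nu> i' - \<mu> i') (Suc m)) ! j"
            using split[OF that(1)] by simp
          then show ?thesis using that len by (simp add: nth_append \<mu>_def)
        qed
        show "map (filter (\<lambda>x. x \<le> m)) T ! i ! j < map (filter (\<lambda>x. x \<le> m)) T ! Suc i ! j"
          using a[of i] a[of "Suc i"] ij \<open>j < \<mu> i\<close> col[of i j] \<mu>le[of "Suc i"] by auto
      qed (use len in simp)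
      moreover have "count_list (concat (map (filter (\<lambda>x. x \<le> m)) T)) v = \<beta> v" if "v \<in> {1..m}" for v
      proof -
        have "count_list (concat (map (filter (\<lambda>x. x \<le> m)) T)) v = count_list (concat T) v"
          unfolding count_list_concat using that by (simp add: count_list_filter o_def)
        then show ?thesis using T that by (simp add: Y_def)
      qed
      ultimately show ?thesis by (simp add: Y_def)
    qed
    moreover have "f T = (\<mu>, map (filter (\<lambda>x. x \<le> m)) T)" by (simp add: f_def \<mu>_def)
    moreover have "g (\<mu>, map (filter (\<lambda>x. x \<le> m)) T) = T"
      unfolding g_def by (rule nth_equalityI) (use len split in auto)
    ultimately show ?thesis by simp
  qed
  have g: "g p \<in> Y \<nu> (Suc m) \<and> f (g p) = p" if p: "p \<in> Sigma M (\<lambda>\<mu>. Y \<mu> m)" for p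
  proof -
    obtain \<mu> T where pe: "p = (\<mu>, T)" by (cases p)
    have \<mu>: "\<mu> \<in> M" and T: "T \<in> Y \<mu> m" using p pe by auto
    have int: "\<nu> (Suc i) \<le> \<mu> i" "\<mu> i \<le> \<nu> i" for i using \<mu> by (auto simp: M_def interlacing_def)
    have len: "length T = d" and Ti: "\<And>i. i < d \<Longrightarrow> length (T ! i) = \<mu> i" "\<And>i. i < d \<Longrightarrow> sorted (T ! i)"
        "\<And>i. i < d \<Longrightarrow> set (T ! i) \<subseteq> {1..m}"
      and col: "\<And>i j. Suc i < d \<Longrightarrow> j < \<mu> (Suc i) \<Longrightarrow> T ! i ! j < T ! Suc i ! j"
      using T by (auto simp: Y_def row_tableaux_def)
    define G where "G = map (\<lambda>i. T ! i @ replicate (\<nu> i - \<mu> i) (Suc m)) [0..<d]"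
    have Gi: "G ! i = T ! i @ replicate (\<nu> i - \<mu> i) (Suc m)" if "i < d" for i using that by (simp add: G_def)
    have GR: "G \<in> row_tableaux d \<nu> (Suc m)"
      unfolding row_tableaux_def
    proof (intro CollectI conjI allI impI)
      show "length G = d" by (simp add: G_def)
    next
      fix i assume i: "i < d"
      show "length (G ! i) = \<nu> i" using i Gi Ti int[of i] by auto
      show "sorted (G ! i)" using i Gi Ti(2)[OF i] Ti(3)[OF i] by (fastforce simp: sorted_append)
      show "set (G ! i) \<subseteq> {1..Suc m}" using i Gi Ti(3)[OF i] by fastforce
    next
      fix i j assume ij: "Suc i < d \<and> j < \<nu> (Suc i)"
      have "j < \<mu> i" using ij int(1)[of i] by linarith
      then have 1: "G ! i ! j = T ! i ! j" using ij Gi Ti(1)[of i] by (simp add: nth_append)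
      have "T ! i ! j \<in> set (T ! i)" using \<open>j < \<mu> i\<close> ij Ti(1)[of i] by (intro nth_mem) simp
      then have "T ! i ! j \<le> m" using Ti(3)[of i] ij by auto
      show "G ! i ! j < G ! Suc i ! j"
      proof (cases "j < \<mu> (Suc i)")
        case True then show ?thesis using 1 col[of i j] ij Gi Ti(1)[of "Suc i"] by (simp add: nth_append)
      next
        case False
        then have "G ! Suc i ! j = Suc m" using ij Gi[of "Suc i"] Ti(1)[of "Suc i"]
            less_diff_iff[of "\<mu> (Suc i)" j "\<nu> (Suc i)"] int(2)[of "Suc i"] by (simp add: nth_append)
        then show ?thesis using 1 \<open>T ! i ! j \<le> m\<close> by simp
      qed
    qed
    have lenG: "length G = d" by (simp add: G_def)
    have cnt: "count_list (concat G) v = \<beta> v" if v: "v \<in> {1..Suc m}" for v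
    proof (cases "v = Suc m")
      case True
      have "count_list (G ! i) (Suc m) = \<nu> i - \<mu> i" if "i < d" for i
      proof -
        have "Suc m \<notin> set (T ! i)" using Ti(3)[OF that] by auto
        then show ?thesis using Gi[OF that] by (simp add: count_list_replicate')
      qed
      then have "count_list (concat G) v = (\<Sum>i<d. \<nu> i - \<mu> i)" unfolding count_list_concat_nth lenG using True by simp
      moreover have "sum \<nu> {..<d} = sum \<mu> {..<d} + (\<Sum>i<d. \<nu> i - \<mu> i)"
        unfolding sum.distrib[symmetric] by (rule sum.cong) (use int in auto)
      ultimately show ?thesis using \<mu> True by (simp add: M_def)
    next
      case False
      then have "count_list (G ! i) v = count_list (T ! i) v" if "i < d" for i
        using Gi[OF that] by (simp add: count_list_replicate')
      then have "count_list (concat G) v = count_list (concat T) v"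
        unfolding count_list_concat_nth lenG len by simp
      then show ?thesis using T v False by (simp add: Y_def)
    qed
    have flt: "filter (\<lambda>x. x \<le> m) (G ! i) = T ! i" if "i < d" for i
    proof -
      have "filter (\<lambda>x. x \<le> m) (T ! i) = T ! i" using Ti(3)[OF that] by (auto simp: filter_id_conv)
      then show ?thesis using Gi[OF that] by (simp add: filter_empty_conv)
    qed
    have "map (filter (\<lambda>x. x \<le> m)) G = T" by (rule nth_equalityI) (use lenG len flt in auto)
    moreover have "(\<lambda>i. if i < d then length (filter (\<lambda>x. x \<le> m) (G ! i)) else 0) = \<mu>"
    proof
      fix i show "(if i < d then length (filter (\<lambda>x. x \<le> m) (G ! i)) else 0) = \<mu> i"
        using flt Ti(1) int(2)[of i] zero[of i] by auto
    qed
    ultimately have "f G = (\<mu>, T)" by (simp add: f_def)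
    moreover have "g p = G" by (simp add: g_def pe G_def)
    moreover have "G \<in> Y \<nu> (Suc m)" using GR cnt by (simp add: Y_def)
    ultimately show ?thesis using pe by simp
  qed
  have "bij_betw f (Y \<nu> (Suc m)) (Sigma M (\<lambda>\<mu>. Y \<mu> m))"
  proof (rule bij_betw_byWitness[where f' = g])
    show "f ` Y \<nu> (Suc m) \<subseteq> Sigma M (\<lambda>\<mu>. Y \<mu> m)" using f by blast
    show "g ` Sigma M (\<lambda>\<mu>. Y \<mu> m) \<subseteq> Y \<nu> (Suc m)" using g by blast
    show "\<forall>T\<in>Y \<nu> (Suc m). g (f T) = T" using f by simp
    show "\<forall>p\<in>Sigma M (\<lambda>\<mu>. Y \<mu> m). f (g p) = p" using g by simp
  qed
  then have "card (Y \<nu> (Suc m)) = card (Sigma M (\<lambda>\<mu>. Y \<mu> m))" by (rule bij_betw_same_card)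
  also have "\<dots> = (\<Sum>\<mu>\<in>M. card (Y \<mu> m))"
  proof (rule card_SigmaI)
    show "finite M" unfolding M_def using finite_interlacing[OF Suc.prems] by simp
    show "\<forall>\<mu>\<in>M. finite (Y \<mu> m)" by (simp add: Y_def finite_row_tableaux)
  qed
  also have "\<dots> = (\<Sum>\<mu>\<in>M. kostka d \<mu> (map \<beta> (rev [1..<Suc m])))"
  proof (rule sum.cong)
    fix \<mu> assume "\<mu> \<in> M"
    then have "partition_fun d \<mu>" using partition_fun_interlacing[OF Suc.prems] by (simp add: M_def)
    from Suc.IH[OF this] show "card (Y \<mu> m) = kostka d \<mu> (map \<beta> (rev [1..<Suc m]))"
      unfolding Y_def .
  qed simp
  also have "\<dots> = kostka d \<nu> (\<beta> (Suc m) # map \<beta> (rev [1..<Suc m]))"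
    unfolding kostka.simps M_def ..
  also have "\<beta> (Suc m) # map \<beta> (rev [1..<Suc m]) = map \<beta> (rev [1..<Suc (Suc m)])"
    by simp
  finally show ?case unfolding Y_def .
qed

section \<open>Schur expansions\<close>

definition monomial_of :: "nat list \<Rightarrow> monomial" where
  "monomial_of \<alpha> = (\<lambda>i. if 1 \<le> i \<and> i \<le> length \<alpha> then \<alpha> ! (i - 1) else 0)"

definition shape_fun :: "nat list \<Rightarrow> nat \<Rightarrow> nat" where
  "shape_fun \<nu> i = (if i < length \<nu> then \<nu> ! i else 0)"

text \<open>On the content of a tableau this is the sum of its entries. It decreases when a
  partition moves up in dominance order, and as a natural number it carries the inductions for which
  dominance is commonly used.\<close>

definition weight :: "monomial \<Rightarrow> nat" where
  "weight \<mu> = (\<Sum>i | \<mu> i \<noteq> 0. i * \<mu> i)"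

text \<open>Adjacent transpositions generate all finite permutations. Index \<open>0\<close> is left
  out because it names no variable.\<close>

definition symmetric_series :: "series \<Rightarrow> bool" where
  "symmetric_series f \<longleftrightarrow> (\<forall>i\<ge>1. \<forall>\<mu>. f (\<mu> \<circ> Transposition.transpose i (Suc i)) = f \<mu>)"

definition homogeneous :: "nat \<Rightarrow> series \<Rightarrow> bool" where
  "homogeneous n f \<longleftrightarrow> (\<forall>\<mu>. f \<mu> \<noteq> 0 \<longrightarrow>
     \<mu> 0 = 0 \<and> finite {i. \<mu> i \<noteq> 0} \<and> (\<Sum>i | \<mu> i \<noteq> 0. \<mu> i) = n)"

definition partitions_of :: "nat \<Rightarrow> nat list set" where
  "partitions_of n = {\<nu>. is_partition \<nu> \<and> sum_list \<nu> = n}"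

lemma is_partition_nth_mono:
  assumes "is_partition \<nu>" "i \<le> j" "j < length \<nu>"
  shows "\<nu> ! j \<le> \<nu> ! i"
  using assms sorted_wrt_nth_less[of "(\<ge>)" \<nu> i j] by (cases "i = j") (auto simp: is_partition_def)

lemma partition_fun_shape_fun:
  assumes "is_partition \<nu>"
  shows "partition_fun (length \<nu>) (shape_fun \<nu>)"
  using is_partition_nth_mono[OF assms] by (auto simp: partition_fun_def shape_fun_def)

lemma ssyt_eq_row_tableaux:
  assumes "is_partition \<nu>" "\<mu> 0 = 0" "\<forall>v>M. \<mu> v = 0"
  shows "{T \<in> ssyt \<nu>. (\<lambda>i. count_list (concat T) i) = \<mu>} =
    {T \<in> row_tableaux (length \<nu>) (shape_fun \<nu>) M. \<forall>v\<in>{1..M}. count_list (concat T) v = \<mu> v}"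
    (is "?L = ?R")
proof (intro set_eqI iffI)
  fix T assume T: "T \<in> ?L"
  have map: "map length T = \<nu>" and rows: "\<forall>r\<in>set T. sorted r"
    and col: "\<And>i j. Suc i < length T \<Longrightarrow> j < length (T ! Suc i) \<Longrightarrow> T ! i ! j < T ! Suc i ! j"
    and cnt: "\<And>i. count_list (concat T) i = \<mu> i"
    using T by (auto simp: ssyt_def fun_eq_iff)
  have len: "length T = length \<nu>" using map by auto
  have leni: "length (T ! i) = \<nu> ! i" if "i < length \<nu>" for i using map that by auto
  have "set (T ! i) \<subseteq> {1..M}" if "i < length \<nu>" for i
  proof
    fix x assume "x \<in> set (T ! i)"
    then have "x \<in> set (concat T)" using that len by auto
    then have "\<mu> x \<noteq> 0" using cnt[of x] by (metis count_list_0_iff)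
    then show "x \<in> {1..M}" using assms(2,3) by (metis One_nat_def Suc_leI atLeastAtMost_iff gr0I not_le)
  qed
  moreover have "sorted (T ! i)" if "i < length \<nu>" for i using that rows len by simp
  ultimately have "T \<in> row_tableaux (length \<nu>) (shape_fun \<nu>) M"
    unfolding row_tableaux_def using len leni col by (simp add: shape_fun_def)
  then show "T \<in> ?R" using cnt by blast
next
  fix T assume T: "T \<in> ?R"
  have len: "length T = length \<nu>"
    and row: "\<And>i. i < length \<nu> \<Longrightarrow> length (T ! i) = \<nu> ! i \<and> sorted (T ! i) \<and> set (T ! i) \<subseteq> {1..M}"
    and col: "\<And>i j. Suc i < length \<nu> \<Longrightarrow> j < \<nu> ! Suc i \<Longrightarrow> T ! i ! j < T ! Suc i ! j"
    and cnt: "\<And>v. v \<in> {1..M} \<Longrightarrow> count_list (concat T) v = \<mu> v"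
    using T unfolding row_tableaux_def shape_fun_def by auto
  have map: "map length T = \<nu>" using len row by (intro nth_equalityI) auto
  have rows: "sorted r \<and> set r \<subseteq> {1..M}" if "r \<in> set T" for r
    using that len row by (metis in_set_conv_nth)
  then have sub: "set (concat T) \<subseteq> {1..M}" by auto
  have "count_list (concat T) v = \<mu> v" for v
  proof (cases "v \<in> {1..M}")
    case False
    then have "\<mu> v = 0" using assms(2,3) by (cases "v = 0") auto
    moreover have "count_list (concat T) v = 0" using False sub by (intro count_notin) blast
    ultimately show ?thesis by simp
  qed (use cnt in simp)
  moreover have "T \<in> ssyt \<nu>"
  proof -
    have "0 \<notin> set (concat T)" using sub by (meson atLeastAtMost_iff not_one_le_zero subsetD)
    moreover have "T ! i ! j < T ! Suc i ! j" if "Suc i < length T \<and> j < length (T ! Suc i)" for i j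
      using col[of i j] row[of "Suc i"] that len by simp
    ultimately show ?thesis unfolding ssyt_def using map rows by blast
  qed
  ultimately show "T \<in> ?L" by auto
qed

lemma schur_eq_kostka:
  assumes "is_partition \<nu>" "\<mu> 0 = 0" "\<forall>v>M. \<mu> v = 0"
  shows "schur \<nu> \<mu> = of_nat (kostka (length \<nu>) (shape_fun \<nu>) (map \<mu> (rev [1..<Suc M])))"
  unfolding schur_def ssyt_eq_row_tableaux[OF assms]
    card_row_tableaux_eq_kostka[OF partition_fun_shape_fun[OF assms(1)]] ..

lemma schur_monomial_of:
  assumes "is_partition \<nu>"
  shows "schur \<nu> (monomial_of \<alpha>) = of_nat (kostka (length \<nu>) (shape_fun \<nu>) (rev \<alpha>))"
proof -
  have "map (monomial_of \<alpha>) [1..<Suc (length \<alpha>)] = \<alpha>"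
    by (rule nth_equalityI) (auto simp: monomial_of_def nth_append simp del: upt_Suc)
  then have "map (monomial_of \<alpha>) (rev [1..<Suc (length \<alpha>)]) = rev \<alpha>"
    by (simp only: rev_map[symmetric])
  then show ?thesis
    using schur_eq_kostka[OF assms, of "monomial_of \<alpha>" "length \<alpha>"] by (simp add: monomial_of_def)
qed

lemma schur_nonzeroD:
  assumes "schur \<nu> \<mu> \<noteq> 0"
  obtains T where "T \<in> ssyt \<nu>" "count_list (concat T) = \<mu>"
proof -
  have "{T \<in> ssyt \<nu>. (\<lambda>i. count_list (concat T) i) = \<mu>} \<noteq> {}"
    using assms unfolding schur_def by (metis card.empty of_nat_0)
  then show ?thesis using that by blast
qed

lemma count_list_support:
  assumes "\<And>i. count_list xs i = \<mu> i"
  shows "{i. \<mu> i \<noteq> 0} = set xs"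
  using assms by (metis (mono_tags, lifting) Collect_cong Collect_mem_eq count_list_0_iff)

lemma homogeneous_schur: "homogeneous (sum_list \<nu>) (schur \<nu>)"
  unfolding homogeneous_def
proof (intro allI impI)
  fix \<mu> assume "schur \<nu> \<mu> \<noteq> 0"
  then obtain T where T: "T \<in> ssyt \<nu>" and "count_list (concat T) = \<mu>"
    by (rule schur_nonzeroD)
  then have cnt: "\<And>i. count_list (concat T) i = \<mu> i" by blast
  have sup: "{i. \<mu> i \<noteq> 0} = set (concat T)" using cnt by (rule count_list_support)
  have "0 \<notin> set (concat T)" using T by (simp add: ssyt_def)
  then have "\<mu> 0 = 0" using sup by auto
  moreover have "(\<Sum>i | \<mu> i \<noteq> 0. \<mu> i) = length (concat T)"
    unfolding sup using sum_count_set[of "concat T" "set (concat T)"] cnt by simp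
  moreover have "length (concat T) = sum_list \<nu>" using T by (auto simp: ssyt_def length_concat)
  ultimately show "\<mu> 0 = 0 \<and> finite {i. \<mu> i \<noteq> 0} \<and> (\<Sum>i | \<mu> i \<noteq> 0. \<mu> i) = sum_list \<nu>"
    using sup by (metis finite_set)
qed

lemma finite_support_bounded:
  assumes "finite {i::nat. \<mu> i \<noteq> (0::nat)}"
  obtains M where "k \<le> M" "\<forall>v>M. \<mu> v = 0"
proof
  show "k \<le> Max (insert k {i. \<mu> i \<noteq> 0})" using assms by simp
  show "\<forall>v>Max (insert k {i. \<mu> i \<noteq> 0}). \<mu> v = 0"
  proof (intro allI impI)
    fix v assume v: "Max (insert k {i. \<mu> i \<noteq> 0}) < v"
    show "\<mu> v = 0"
    proof (rule ccontr)
      assume "\<mu> v \<noteq> 0"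
      then have "v \<le> Max (insert k {i. \<mu> i \<noteq> 0})" using assms by (intro Max_ge) auto
      with v show False by simp
    qed
  qed
qed

lemma finite_support_transpose:
  "finite {i. (\<mu> \<circ> Transposition.transpose a b) i \<noteq> (0::nat)} \<longleftrightarrow> finite {i. \<mu> i \<noteq> 0}"
proof -
  have "{i. (\<mu> \<circ> Transposition.transpose a b) i \<noteq> 0} = Transposition.transpose a b ` {i. \<mu> i \<noteq> 0}"
    by (force simp: image_iff intro: exI[of _ "Transposition.transpose a b _"])
  then show ?thesis by (simp add: finite_image_iff)
qed

text \<open>Transposing two adjacent exponents transposes two adjacent letters of the content list,
  so \<open>kostka_swap\<close> applies. Exponent functions with infinite support or with
  \<open>\<mu> 0 \<noteq> 0\<close> have coefficient zero on both sides.\<close>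

lemma symmetric_schur:
  assumes "is_partition \<nu>"
  shows "symmetric_series (schur \<nu>)"
  unfolding symmetric_series_def
proof (intro allI impI)
  fix i :: nat and \<mu> :: monomial assume i: "1 \<le> i"
  have z: "(\<mu> \<circ> Transposition.transpose i (Suc i)) 0 = \<mu> 0" using i by (simp add: transpose_def)
  show "schur \<nu> (\<mu> \<circ> Transposition.transpose i (Suc i)) = schur \<nu> \<mu>"
  proof (cases "\<mu> 0 = 0 \<and> finite {i. \<mu> i \<noteq> 0}")
    case False
    then have "schur \<nu> \<mu> = 0" "schur \<nu> (\<mu> \<circ> Transposition.transpose i (Suc i)) = 0"
      using homogeneous_schur[of \<nu>] z unfolding homogeneous_def
      by (metis, metis finite_support_transpose)
    then show ?thesis by simp
  next
    case True
    obtain M where M: "Suc i \<le> M" "\<forall>v>M. \<mu> v = 0" using finite_support_bounded True by blast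
    have M': "\<forall>v>M. (\<mu> \<circ> Transposition.transpose i (Suc i)) v = 0" using M by (auto simp: transpose_def)
    have upt: "[1..<Suc M] = [1..<i] @ [i, Suc i] @ [Suc (Suc i)..<Suc M]"
    proof -
      have "[1..<Suc M] = [1..<i] @ [i..<Suc M]" using i M upt_add_eq_append[of 1 i "Suc M - i"] by (simp del: upt_Suc)
      also have "[i..<Suc M] = i # Suc i # [Suc (Suc i)..<Suc M]"
        using M upt_conv_Cons[of i "Suc M"] upt_conv_Cons[of "Suc i" "Suc M"] by (simp del: upt_Suc)
      finally show ?thesis by simp
    qed
    define xs ys where "xs = map \<mu> (rev [Suc (Suc i)..<Suc M])" and "ys = map \<mu> (rev [1..<i])"
    have eq: "map (\<mu> \<circ> Transposition.transpose i (Suc i)) (rev [Suc (Suc i)..<Suc M]) = xs"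
      "map (\<mu> \<circ> Transposition.transpose i (Suc i)) (rev [1..<i]) = ys"
      unfolding xs_def ys_def by (intro map_cong; auto simp: transpose_def)+
    have "map (\<mu> \<circ> Transposition.transpose i (Suc i)) (rev [1..<Suc M]) = xs @ \<mu> i # \<mu> (Suc i) # ys"
      unfolding upt rev_append map_append eq by simp
    moreover have "map \<mu> (rev [1..<Suc M]) = xs @ \<mu> (Suc i) # \<mu> i # ys"
      unfolding upt rev_append map_append xs_def ys_def by simp
    ultimately show ?thesis
      using schur_eq_kostka[OF assms _ M'] schur_eq_kostka[OF assms _ M(2)] True z
        kostka_swap[OF partition_fun_shape_fun[OF assms]] by metis
  qed
qed

section \<open>Triangularity and uniqueness of the Schur expansion\<close>

lemma weight_count_list:
  assumes "\<And>i. count_list xs i = \<mu> i"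
  shows "weight \<mu> = sum_list xs"
proof -
  have "weight \<mu> = (\<Sum>i\<in>set xs. count_list xs i * i)"
    unfolding weight_def count_list_support[of xs \<mu>, OF assms] using assms by (simp add: mult.commute)
  also have "\<dots> = sum_list xs" using sum_list_map_eq_sum_count[of "\<lambda>x. x" xs] by simp
  finally show ?thesis .
qed

lemma sum_list_ge_replicate:
  assumes "\<forall>x\<in>set r. (c::nat) \<le> x"
  shows "c * length r \<le> sum_list r" "sum_list r = c * length r \<Longrightarrow> r = replicate (length r) c"
proof -
  have "c * length r \<le> sum_list r \<and> (sum_list r = c * length r \<longrightarrow> (\<forall>x\<in>set r. x = c))"
    using assms by (induction r) auto
  then show "c * length r \<le> sum_list r" "sum_list r = c * length r \<Longrightarrow> r = replicate (length r) c"
    by (auto intro: replicate_eqI)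
qed

definition highest_tableau :: "nat list \<Rightarrow> nat list list" where
  "highest_tableau \<nu> = map (\<lambda>i. replicate (\<nu> ! i) (Suc i)) [0..<length \<nu>]"

lemma highest_tableau:
  assumes "is_partition \<nu>"
  shows "highest_tableau \<nu> \<in> ssyt \<nu>" "count_list (concat (highest_tableau \<nu>)) i = monomial_of \<nu> i"
proof -
  have "map length (highest_tableau \<nu>) = \<nu>" by (rule nth_equalityI) (auto simp: highest_tableau_def)
  then show "highest_tableau \<nu> \<in> ssyt \<nu>"
    using is_partition_nth_mono[OF assms] unfolding ssyt_def
    by (auto simp: highest_tableau_def order_less_le_trans)
  have "count_list (concat (highest_tableau \<nu>)) i = (\<Sum>j<length \<nu>. if Suc j = i then \<nu> ! j else 0)"
    unfolding count_list_concat_nth by (simp add: highest_tableau_def count_list_replicate')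
  also have "\<dots> = monomial_of \<nu> i"
  proof (cases i)
    case (Suc k)
    then have "(\<Sum>j<length \<nu>. if Suc j = i then \<nu> ! j else 0) = (\<Sum>j<length \<nu>. if j = k then \<nu> ! k else 0)"
      by (intro sum.cong) auto
    then show ?thesis using Suc by (auto simp: monomial_of_def sum.delta)
  qed (simp add: monomial_of_def)
  finally show "count_list (concat (highest_tableau \<nu>)) i = monomial_of \<nu> i" .
qed

text \<open>Column strictness forces every entry of the row with index \<open>i\<close> to be at
  least \<open>Suc i\<close>. Equality of the totals is then possible only row by row, with all
  entries minimal.\<close>

lemma ssyt_weight:
  assumes \<nu>: "is_partition \<nu>" and T: "T \<in> ssyt \<nu>"
  shows "sum_list (concat (highest_tableau \<nu>)) \<le> sum_list (concat T)"
    "sum_list (concat T) = sum_list (concat (highest_tableau \<nu>)) \<Longrightarrow> T = highest_tableau \<nu>"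
proof -
  have map: "map length T = \<nu>" and pos: "0 \<notin> set (concat T)"
    and col: "\<And>i j. Suc i < length T \<Longrightarrow> j < length (T ! Suc i) \<Longrightarrow> T ! i ! j < T ! Suc i ! j"
    using T by (auto simp: ssyt_def)
  have len: "length T = length \<nu>" using map by auto
  have leni: "length (T ! i) = \<nu> ! i" if "i < length \<nu>" for i using map that by auto
  have ge: "Suc i \<le> T ! i ! j" if "i < length \<nu>" "j < \<nu> ! i" for i j
    using that
  proof (induction i)
    case 0
    have "T ! 0 ! j \<in> set (T ! 0)" using 0 leni by simp
    then have "T ! 0 ! j \<in> set (concat T)" using 0 len by auto
    then show ?case using pos by (metis One_nat_def Suc_leI gr0I)
  next
    case (Suc i)
    have "j < \<nu> ! i" using Suc.prems is_partition_nth_mono[OF \<nu>, of i "Suc i"] by simp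
    then have "Suc i \<le> T ! i ! j" using Suc by simp
    then show ?case using col[of i j] Suc.prems len leni by force
  qed
  have row: "\<forall>x\<in>set (T ! i). Suc i \<le> x" if "i < length \<nu>" for i
    using ge[OF that] leni[OF that] by (auto simp: in_set_conv_nth)
  have lenH: "length (highest_tableau \<nu>) = length \<nu>" by (simp add: highest_tableau_def)
  have sl: "sum_list (concat S) = (\<Sum>i<length S. sum_list (S ! i))" for S :: "nat list list"
  proof -
    have "sum_list (concat S) = sum_list (map sum_list S)" by (induction S) auto
    then show ?thesis by (simp add: sum_list_sum_nth atLeast0LessThan)
  qed
  have H: "sum_list (highest_tableau \<nu> ! i) = Suc i * (\<nu> ! i)" if "i < length \<nu>" for i
    using that by (simp add: highest_tableau_def sum_list_replicate)
  have le: "sum_list (highest_tableau \<nu> ! i) \<le> sum_list (T ! i)" if "i < length \<nu>" for i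
    using sum_list_ge_replicate(1)[OF row[OF that]] leni[OF that] H[OF that] by simp
  then show "sum_list (concat (highest_tableau \<nu>)) \<le> sum_list (concat T)"
    unfolding sl lenH len by (intro sum_mono) auto
  assume eq: "sum_list (concat T) = sum_list (concat (highest_tableau \<nu>))"
  have "T ! i = highest_tableau \<nu> ! i" if i: "i < length \<nu>" for i
  proof -
    have "sum_list (highest_tableau \<nu> ! i) = sum_list (T ! i)"
      using eq unfolding sl lenH len
      by (intro sum_mono_inv[of "\<lambda>i. sum_list (highest_tableau \<nu> ! i)" "{..<length \<nu>}"]) (use le i in auto)
    then have "T ! i = replicate (length (T ! i)) (Suc i)"
      using sum_list_ge_replicate(2)[OF row[OF i]] leni[OF i] H[OF i] by simp
    then show ?thesis using leni[OF i] i by (simp add: highest_tableau_def)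
  qed
  then show "T = highest_tableau \<nu>" using len lenH by (intro nth_equalityI) auto
qed

lemma monomial_of_inject:
  assumes "is_partition \<nu>" "is_partition \<nu>'" "monomial_of \<nu> = monomial_of \<nu>'"
  shows "\<nu> = \<nu>'"
proof -
  have nz: "monomial_of \<nu> (Suc i) \<noteq> 0 \<longleftrightarrow> i < length \<nu>" if "is_partition \<nu>" for \<nu> i
  proof -
    have "\<nu> ! i \<noteq> 0" if "i < length \<nu>" using \<open>is_partition \<nu>\<close> nth_mem[OF that] by (metis is_partition_def)
    then show ?thesis by (auto simp: monomial_of_def)
  qed
  have "i < length \<nu> \<longleftrightarrow> i < length \<nu>'" for i using nz[OF assms(1)] nz[OF assms(2)] assms(3) by metis
  then have len: "length \<nu> = length \<nu>'" by (metis less_irrefl linorder_neqE_nat)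
  moreover have "\<nu> ! i = \<nu>' ! i" if "i < length \<nu>" for i
    using fun_cong[OF assms(3), of "Suc i"] that len by (simp add: monomial_of_def)
  ultimately show ?thesis by (rule nth_equalityI)
qed

text \<open>Triangularity of the Kostka matrix, with \<open>weight\<close> in place of dominance:
  the entries of a tableau cannot sum to less than those of the highest tableau of its
  shape.\<close>

lemma schur_triangular:
  assumes "is_partition \<nu>" "is_partition \<kappa>" "schur \<nu> (monomial_of \<kappa>) \<noteq> 0"
  shows "weight (monomial_of \<nu>) \<le> weight (monomial_of \<kappa>)"
    "weight (monomial_of \<kappa>) = weight (monomial_of \<nu>) \<Longrightarrow> \<kappa> = \<nu>"
proof -
  obtain T where T: "T \<in> ssyt \<nu>" "count_list (concat T) = monomial_of \<kappa>"
    using schur_nonzeroD[OF assms(3)] .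
  have w: "weight (monomial_of \<kappa>) = sum_list (concat T)" "weight (monomial_of \<nu>) = sum_list (concat (highest_tableau \<nu>))"
    using weight_count_list[of "concat T"] weight_count_list[OF highest_tableau(2)[OF assms(1)]] T(2) by auto
  then show "weight (monomial_of \<nu>) \<le> weight (monomial_of \<kappa>)"
    using ssyt_weight(1)[OF assms(1) T(1)] by simp
  assume "weight (monomial_of \<kappa>) = weight (monomial_of \<nu>)"
  then have "T = highest_tableau \<nu>" using ssyt_weight(2)[OF assms(1) T(1)] w by simp
  then have "monomial_of \<kappa> = monomial_of \<nu>" using T(2) highest_tableau(2)[OF assms(1)] by auto
  then show "\<kappa> = \<nu>" using monomial_of_inject assms by blast
qed

lemma schur_diagonal:
  assumes "is_partition \<nu>"
  shows "schur \<nu> (monomial_of \<nu>) = 1"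
proof -
  have "{T \<in> ssyt \<nu>. (\<lambda>i. count_list (concat T) i) = monomial_of \<nu>} = {highest_tableau \<nu>}"
  proof (intro set_eqI iffI)
    fix T assume "T \<in> {T \<in> ssyt \<nu>. (\<lambda>i. count_list (concat T) i) = monomial_of \<nu>}"
    then have T: "T \<in> ssyt \<nu>" "\<And>i. count_list (concat T) i = monomial_of \<nu> i" by (auto simp: fun_eq_iff)
    then have "sum_list (concat T) = sum_list (concat (highest_tableau \<nu>))"
      using weight_count_list highest_tableau(2)[OF assms] by metis
    then show "T \<in> {highest_tableau \<nu>}" using ssyt_weight(2)[OF assms T(1)] by simp
  qed (use highest_tableau[OF assms] in auto)
  then show ?thesis by (simp add: schur_def)
qed

text \<open>Evaluate at the monomial of a partition of least weight among those where
  \<open>a\<close> and \<open>b\<close> differ: triangularity kills the differences at all other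
  partitions.\<close>

lemma schur_expansion_unique:
  assumes a: "schur_expansion f a" and b: "schur_expansion f b"
  shows "a = b"
proof (rule ccontr)
  assume "a \<noteq> b"
  define U where "U = {\<nu>. a \<nu> \<noteq> 0} \<union> {\<nu>. b \<nu> \<noteq> 0}"
  have fin: "finite U" using a b by (simp add: U_def schur_expansion_def)
  have part: "is_partition \<nu>" if "\<nu> \<in> U" for \<nu> using that a b by (auto simp: U_def schur_expansion_def)
  have fa: "f \<mu> = (\<Sum>\<nu>\<in>U. a \<nu> * schur \<nu> \<mu>)" for \<mu>
  proof -
    have "f \<mu> = (\<Sum>\<nu> | a \<nu> \<noteq> 0. a \<nu> * schur \<nu> \<mu>)" using a unfolding schur_expansion_def by meson
    also have "\<dots> = (\<Sum>\<nu>\<in>U. a \<nu> * schur \<nu> \<mu>)"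
      by (rule sum.mono_neutral_left) (use fin in \<open>auto simp: U_def\<close>)
    finally show ?thesis .
  qed
  have fb: "f \<mu> = (\<Sum>\<nu>\<in>U. b \<nu> * schur \<nu> \<mu>)" for \<mu>
  proof -
    have "f \<mu> = (\<Sum>\<nu> | b \<nu> \<noteq> 0. b \<nu> * schur \<nu> \<mu>)" using b unfolding schur_expansion_def by meson
    also have "\<dots> = (\<Sum>\<nu>\<in>U. b \<nu> * schur \<nu> \<mu>)"
      by (rule sum.mono_neutral_left) (use fin in \<open>auto simp: U_def\<close>)
    finally show ?thesis .
  qed
  obtain \<nu>0 where "a \<nu>0 \<noteq> b \<nu>0" using \<open>a \<noteq> b\<close> by auto
  then obtain \<nu> where \<nu>: "a \<nu> \<noteq> b \<nu>"
    and min: "\<And>\<kappa>. a \<kappa> \<noteq> b \<kappa> \<Longrightarrow> weight (monomial_of \<nu>) \<le> weight (monomial_of \<kappa>)"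
    using ex_has_least_nat[of "\<lambda>\<nu>. a \<nu> \<noteq> b \<nu>" \<nu>0 "\<lambda>\<nu>. weight (monomial_of \<nu>)"] by blast
  have \<nu>U: "\<nu> \<in> U" using \<nu> by (auto simp: U_def)
  have "0 = (\<Sum>\<kappa>\<in>U. (a \<kappa> - b \<kappa>) * schur \<kappa> (monomial_of \<nu>))"
    using fa[of "monomial_of \<nu>"] fb[of "monomial_of \<nu>"] by (simp add: left_diff_distrib sum_subtractf)
  also have "\<dots> = (\<Sum>\<kappa>\<in>U. if \<kappa> = \<nu> then a \<nu> - b \<nu> else 0)"
  proof (rule sum.cong)
    fix \<kappa> assume \<kappa>: "\<kappa> \<in> U"
    show "(a \<kappa> - b \<kappa>) * schur \<kappa> (monomial_of \<nu>) = (if \<kappa> = \<nu> then a \<nu> - b \<nu> else 0)"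
    proof (cases "\<kappa> = \<nu>")
      case True then show ?thesis using schur_diagonal[OF part[OF \<nu>U]] by simp
    next
      case False
      have "schur \<kappa> (monomial_of \<nu>) = 0" if "a \<kappa> \<noteq> b \<kappa>"
        using schur_triangular[OF part[OF \<kappa>] part[OF \<nu>U]] min[OF that] False by (metis antisym)
      then show ?thesis using False by force
    qed
  qed simp
  also have "\<dots> = a \<nu> - b \<nu>" using fin \<nu>U by simp
  finally show False using \<nu> by simp
qed

section \<open>Existence of the Schur expansion\<close>

lemma weight_bounded:
  assumes "\<forall>v>M. \<mu> v = 0"
  shows "weight \<mu> = (\<Sum>v\<le>M. v * \<mu> v)"
  unfolding weight_def by (rule sum.mono_neutral_left) (use assms in \<open>auto simp: not_less[symmetric]\<close>)

lemma weight_transpose_less: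
  assumes "finite {i. \<mu> i \<noteq> 0}" "\<mu> i < \<mu> (Suc i)"
  shows "weight (\<mu> \<circ> Transposition.transpose i (Suc i)) < weight \<mu>"
proof -
  let ?t = "Transposition.transpose i (Suc i)"
  obtain M where M: "Suc i \<le> M" "\<forall>v>M. \<mu> v = 0" using finite_support_bounded assms(1) by blast
  have M': "\<forall>v>M. (\<mu> \<circ> ?t) v = 0" using M by (auto simp: Transposition.transpose_def)
  have split: "(\<Sum>v\<le>M. g v) = g i + g (Suc i) + (\<Sum>v\<in>{..M} - {i, Suc i}. g v)" for g :: "nat \<Rightarrow> nat"
  proof -
    have "{..M} = insert i (insert (Suc i) ({..M} - {i, Suc i}))" using M(1) by auto
    then have "(\<Sum>v\<le>M. g v) = (\<Sum>v\<in>insert i (insert (Suc i) ({..M} - {i, Suc i})). g v)" by simp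
    then show ?thesis by simp
  qed
  have "(\<Sum>v\<in>{..M} - {i, Suc i}. v * (\<mu> \<circ> ?t) v) = (\<Sum>v\<in>{..M} - {i, Suc i}. v * \<mu> v)"
    by (rule sum.cong) (auto simp: Transposition.transpose_def)
  then show ?thesis
    unfolding weight_bounded[OF M(2)] weight_bounded[OF M'] split using assms(2)
    by (simp add: Transposition.transpose_def algebra_simps)
qed

lemma sorted_monomial_partition:
  assumes "finite {i. \<mu> i \<noteq> 0}" "\<mu> 0 = 0" "\<And>i. 1 \<le> i \<Longrightarrow> \<mu> (Suc i) \<le> \<mu> i"
  obtains \<nu> where "is_partition \<nu>" "monomial_of \<nu> = \<mu>" "sum_list \<nu> = (\<Sum>i | \<mu> i \<noteq> 0. \<mu> i)"
proof -
  obtain M where M: "\<forall>v>M. \<mu> v = 0" using finite_support_bounded[OF assms(1), of 0] by blast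
  define L where "L = (LEAST L. \<mu> (Suc L) = 0)"
  have L0: "\<mu> (Suc L) = 0" unfolding L_def by (rule LeastI[of _ M]) (use M in simp)
  have Lpos: "\<mu> (Suc i) \<noteq> 0" if "i < L" for i using not_less_Least[of i "\<lambda>L. \<mu> (Suc L) = 0"] that L_def by auto
  have mono: "\<mu> (Suc j) \<le> \<mu> (Suc i)" if "i \<le> j" for i j
    by (rule lift_Suc_antimono_le[of "\<lambda>i. \<mu> (Suc i)"]) (use assms(3) that in auto)
  have zero: "\<mu> v = 0" if "v > L" for v
    using mono[of L "v - 1"] L0 that by (cases v) auto
  define \<nu> where "\<nu> = map (\<lambda>i. \<mu> (Suc i)) [0..<L]"
  have "sorted_wrt (\<ge>) \<nu>"
    unfolding \<nu>_def sorted_wrt_map by (rule sorted_wrt_mono_rel[of _ "(<)"]) (use mono in auto)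
  moreover have "0 \<notin> set \<nu>"
  proof
    assume "0 \<in> set \<nu>"
    then obtain i where "i < L" "\<mu> (Suc i) = 0" by (auto simp: \<nu>_def)
    then show False using Lpos by blast
  qed
  ultimately have "is_partition \<nu>" by (simp add: is_partition_def)
  moreover have mon: "monomial_of \<nu> = \<mu>"
  proof
    fix i show "monomial_of \<nu> i = \<mu> i"
      using zero[of i] assms(2) by (cases i) (auto simp: monomial_of_def \<nu>_def)
  qed
  moreover have "sum_list \<nu> = (\<Sum>i | \<mu> i \<noteq> 0. \<mu> i)"
  proof -
    have "{i. \<mu> i \<noteq> 0} = Suc ` {..<L}"
    proof (intro set_eqI iffI)
      fix i assume "i \<in> {i. \<mu> i \<noteq> 0}"
      then have "i \<noteq> 0" "i \<le> L" using zero[of i] assms(2) by (metis mem_Collect_eq, metis mem_Collect_eq not_less)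
      then show "i \<in> Suc ` {..<L}" by (cases i) auto
    qed (use Lpos in auto)
    then have "(\<Sum>i | \<mu> i \<noteq> 0. \<mu> i) = (\<Sum>i<L. \<mu> (Suc i))" by (simp add: sum.reindex)
    then show ?thesis by (simp add: \<nu>_def interv_sum_list_conv_sum_set_nat atLeast0LessThan)
  qed
  ultimately show ?thesis using that by blast
qed

text \<open>An ascent among the exponents can be removed by an adjacent transposition, which lowers
  the weight and keeps the coefficient. Exponents without ascents form a partition.\<close>

lemma symmetric_series_zero:
  assumes "symmetric_series f" "homogeneous n f" "\<And>\<nu>. \<nu> \<in> partitions_of n \<Longrightarrow> f (monomial_of \<nu>) = 0"
  shows "f \<mu> = 0"
proof (induction "weight \<mu>" arbitrary: \<mu> rule: less_induct)
  case less
  show ?case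
  proof (rule ccontr)
    assume nz: "f \<mu> \<noteq> 0"
    then have hom: "\<mu> 0 = 0" "finite {i. \<mu> i \<noteq> 0}" "(\<Sum>i | \<mu> i \<noteq> 0. \<mu> i) = n"
      using assms(2) by (auto simp: homogeneous_def)
    show False
    proof (cases "\<exists>i\<ge>1. \<mu> i < \<mu> (Suc i)")
      case True
      then obtain i where i: "i \<ge> 1" "\<mu> i < \<mu> (Suc i)" by blast
      have "f (\<mu> \<circ> Transposition.transpose i (Suc i)) = 0"
        by (rule less) (rule weight_transpose_less[OF hom(2) i(2)])
      then show False using assms(1) i nz by (simp add: symmetric_series_def)
    next
      case False
      then have "\<mu> (Suc i) \<le> \<mu> i" if "1 \<le> i" for i using that by (meson not_less)
      then obtain \<nu> where "is_partition \<nu>" "monomial_of \<nu> = \<mu>" "sum_list \<nu> = n"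
        using sorted_monomial_partition[OF hom(2,1)] hom(3) by metis
      then show False using assms(3)[of \<nu>] nz by (simp add: partitions_of_def)
    qed
  qed
qed

lemma length_le_sum_list: "0 \<notin> set xs \<Longrightarrow> length xs \<le> sum_list (xs :: nat list)"
  by (induction xs) auto

lemma finite_partitions_of: "finite (partitions_of n)"
proof (rule finite_subset)
  show "partitions_of n \<subseteq> {xs. set xs \<subseteq> {..n} \<and> length xs \<le> n}"
    using length_le_sum_list member_le_sum_list by (fastforce simp: partitions_of_def is_partition_def)
  show "finite {xs. set xs \<subseteq> {..n} \<and> length xs \<le> n}" by (rule finite_lists_length_le) simp
qed

lemma weight_partition_le:
  assumes "\<nu> \<in> partitions_of n"
  shows "weight (monomial_of \<nu>) \<le> n * n"
proof -
  have len: "length \<nu> \<le> n" using assms length_le_sum_list by (auto simp: partitions_of_def is_partition_def)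
  have s: "sum_list \<nu> = n" using assms by (simp add: partitions_of_def)
  have "weight (monomial_of \<nu>) = (\<Sum>v\<le>length \<nu>. v * monomial_of \<nu> v)"
    by (rule weight_bounded) (auto simp: monomial_of_def)
  also have "\<dots> \<le> (\<Sum>v\<le>length \<nu>. n * monomial_of \<nu> v)"
    by (rule sum_mono) (use len in \<open>auto intro: mult_le_mono1\<close>)
  also have "\<dots> = n * (\<Sum>v\<le>length \<nu>. monomial_of \<nu> v)" by (simp add: sum_distrib_left)
  also have "(\<Sum>v\<le>length \<nu>. monomial_of \<nu> v) = (\<Sum>v<length \<nu>. monomial_of \<nu> (Suc v))"
    by (simp add: sum.atMost_shift monomial_of_def)
  also have "\<dots> = sum_list \<nu>"
    unfolding sum_list_sum_nth atLeast0LessThan by (rule sum.cong) (auto simp: monomial_of_def)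
  finally show ?thesis using s by simp
qed

lemma symmetric_series_diff:
  assumes "symmetric_series f" "\<And>\<nu>. \<nu> \<in> P \<Longrightarrow> is_partition \<nu>"
  shows "symmetric_series (\<lambda>\<mu>. f \<mu> - (\<Sum>\<nu>\<in>P. a \<nu> * schur \<nu> \<mu>))"
  unfolding symmetric_series_def
proof (intro allI impI)
  fix i :: nat and \<mu> :: monomial assume i: "1 \<le> i"
  have "(\<Sum>\<nu>\<in>P. a \<nu> * schur \<nu> (\<mu> \<circ> Transposition.transpose i (Suc i))) = (\<Sum>\<nu>\<in>P. a \<nu> * schur \<nu> \<mu>)"
    by (rule sum.cong) (use symmetric_schur[OF assms(2)] i in \<open>auto simp: symmetric_series_def\<close>)
  then show "f (\<mu> \<circ> Transposition.transpose i (Suc i)) - (\<Sum>\<nu>\<in>P. a \<nu> * schur \<nu> (\<mu> \<circ> Transposition.transpose i (Suc i))) =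
      f \<mu> - (\<Sum>\<nu>\<in>P. a \<nu> * schur \<nu> \<mu>)"
    using assms(1) i by (simp add: symmetric_series_def)
qed

lemma homogeneous_diff:
  assumes "homogeneous n f" "P \<subseteq> partitions_of n"
  shows "homogeneous n (\<lambda>\<mu>. f \<mu> - (\<Sum>\<nu>\<in>P. a \<nu> * schur \<nu> \<mu>))"
  unfolding homogeneous_def
proof (intro allI impI)
  fix \<mu> assume nz: "f \<mu> - (\<Sum>\<nu>\<in>P. a \<nu> * schur \<nu> \<mu>) \<noteq> 0"
  show "\<mu> 0 = 0 \<and> finite {i. \<mu> i \<noteq> 0} \<and> (\<Sum>i | \<mu> i \<noteq> 0. \<mu> i) = n"
  proof (cases "f \<mu> = 0")
    case True
    then have "(\<Sum>\<nu>\<in>P. a \<nu> * schur \<nu> \<mu>) \<noteq> 0" using nz by simp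
    then obtain \<nu> where "\<nu> \<in> P" "a \<nu> * schur \<nu> \<mu> \<noteq> 0" by (rule sum.not_neutral_contains_not_neutral)
    then have "schur \<nu> \<mu> \<noteq> 0" "sum_list \<nu> = n" using assms(2) by (auto simp: partitions_of_def)
    then show ?thesis using homogeneous_schur[of \<nu>] by (auto simp: homogeneous_def)
  next
    case False then show ?thesis using assms(1) by (simp add: homogeneous_def)
  qed
qed

text \<open>Gaussian elimination along the weight: subtracting multiples of the Schur functions of
  weight exactly \<open>m\<close> raises the bound below which \<open>f\<close> vanishes. The
  measure \<open>n * n + 1 - m\<close> works because partitions of \<open>n\<close> have weight at
  most \<open>n * n\<close>.\<close>

lemma schur_expansion_exists_aux:
  assumes "symmetric_series f" "homogeneous n f"
    "\<And>\<nu>. \<nu> \<in> partitions_of n \<Longrightarrow> weight (monomial_of \<nu>) < m \<Longrightarrow> f (monomial_of \<nu>) = 0"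
  shows "\<exists>a. \<forall>\<mu>. f \<mu> = (\<Sum>\<nu>\<in>partitions_of n. a \<nu> * schur \<nu> \<mu>)"
  using assms
proof (induction "n * n + 1 - m" arbitrary: f m)
  case 0
  then have "f \<mu> = 0" for \<mu>
    using symmetric_series_zero[OF 0(2,3)] weight_partition_le by fastforce
  then show ?case by (intro exI[of _ "\<lambda>_. 0"]) simp
next
  case (Suc k)
  define P where "P = {\<nu> \<in> partitions_of n. weight (monomial_of \<nu>) = m}"
  define g where "g = (\<lambda>\<mu>. f \<mu> - (\<Sum>\<nu>\<in>P. f (monomial_of \<nu>) * schur \<nu> \<mu>))"
  have fin: "finite P" by (simp add: P_def finite_partitions_of)
  have "\<exists>a. \<forall>\<mu>. g \<mu> = (\<Sum>\<nu>\<in>partitions_of n. a \<nu> * schur \<nu> \<mu>)"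
  proof (rule Suc.hyps(1)[of "Suc m"])
    show "k = n * n + 1 - Suc m" using Suc.hyps(2) by simp
    show "symmetric_series g" unfolding g_def
      by (rule symmetric_series_diff[OF Suc.prems(1)]) (simp add: P_def partitions_of_def)
    show "homogeneous n g" unfolding g_def
      by (rule homogeneous_diff[OF Suc.prems(2)]) (auto simp: P_def)
    fix \<kappa> assume \<kappa>: "\<kappa> \<in> partitions_of n" "weight (monomial_of \<kappa>) < Suc m"
    have \<kappa>p: "is_partition \<kappa>" using \<kappa> by (simp add: partitions_of_def)
    have "(\<Sum>\<nu>\<in>P. f (monomial_of \<nu>) * schur \<nu> (monomial_of \<kappa>)) =
        (\<Sum>\<nu>\<in>P. if \<nu> = \<kappa> then f (monomial_of \<kappa>) else 0)"
    proof (rule sum.cong)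
      fix \<nu> assume "\<nu> \<in> P"
      then have \<nu>: "is_partition \<nu>" "weight (monomial_of \<nu>) = m" by (auto simp: P_def partitions_of_def)
      show "f (monomial_of \<nu>) * schur \<nu> (monomial_of \<kappa>) = (if \<nu> = \<kappa> then f (monomial_of \<kappa>) else 0)"
      proof (cases "\<nu> = \<kappa>")
        case True then show ?thesis using schur_diagonal[OF \<kappa>p] by simp
      next
        case False
        then have "schur \<nu> (monomial_of \<kappa>) = 0"
          using schur_triangular[OF \<nu>(1) \<kappa>p] \<nu>(2) \<kappa>(2) by (metis less_Suc_eq_le antisym)
        then show ?thesis using False by simp
      qed
    qed simp
    also have "\<dots> = (if \<kappa> \<in> P then f (monomial_of \<kappa>) else 0)" using fin by simp
    also have "\<dots> = f (monomial_of \<kappa>)" using Suc.prems(3)[OF \<kappa>(1)] \<kappa> by (auto simp: P_def)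
    finally show "g (monomial_of \<kappa>) = 0" by (simp add: g_def)
  qed
  then obtain a where a: "\<And>\<mu>. g \<mu> = (\<Sum>\<nu>\<in>partitions_of n. a \<nu> * schur \<nu> \<mu>)" by blast
  have "f \<mu> = (\<Sum>\<nu>\<in>partitions_of n. (a \<nu> + (if \<nu> \<in> P then f (monomial_of \<nu>) else 0)) * schur \<nu> \<mu>)" for \<mu>
  proof -
    have "(\<Sum>\<nu>\<in>P. f (monomial_of \<nu>) * schur \<nu> \<mu>) =
        (\<Sum>\<nu>\<in>partitions_of n. (if \<nu> \<in> P then f (monomial_of \<nu>) else 0) * schur \<nu> \<mu>)"
      by (rule sum.mono_neutral_cong_left) (auto simp: P_def finite_partitions_of)
    then have "f \<mu> = g \<mu> + (\<Sum>\<nu>\<in>partitions_of n. (if \<nu> \<in> P then f (monomial_of \<nu>) else 0) * schur \<nu> \<mu>)"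
      by (simp add: g_def)
    then show ?thesis unfolding a by (simp only: sum.distrib[symmetric] distrib_right)
  qed
  then show ?case by (intro exI[of _ "\<lambda>\<nu>. a \<nu> + (if \<nu> \<in> P then f (monomial_of \<nu>) else 0)"]) simp
qed

lemma schur_expansion_exists:
  assumes "symmetric_series f" "homogeneous n f"
  obtains a where "schur_expansion f a" "\<And>\<nu>. a \<nu> \<noteq> 0 \<Longrightarrow> \<nu> \<in> partitions_of n"
proof -
  obtain a where a: "\<And>\<mu>. f \<mu> = (\<Sum>\<nu>\<in>partitions_of n. a \<nu> * schur \<nu> \<mu>)"
    using schur_expansion_exists_aux[OF assms, of 0] by auto
  define b where "b \<nu> = (if \<nu> \<in> partitions_of n then a \<nu> else 0)" for \<nu>
  have sub: "{\<nu>. b \<nu> \<noteq> 0} \<subseteq> partitions_of n" by (auto simp: b_def)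
  have "schur_expansion f b"
    unfolding schur_expansion_def
  proof (intro conjI ext)
    show "finite {\<nu>. b \<nu> \<noteq> 0}" using sub finite_partitions_of finite_subset by blast
    show "\<forall>\<nu>. b \<nu> \<noteq> 0 \<longrightarrow> is_partition \<nu>" by (simp add: b_def partitions_of_def)
    fix \<mu>
    have "(\<Sum>\<nu> | b \<nu> \<noteq> 0. b \<nu> * schur \<nu> \<mu>) = (\<Sum>\<nu>\<in>partitions_of n. b \<nu> * schur \<nu> \<mu>)"
      by (rule sum.mono_neutral_left) (use sub finite_partitions_of in auto)
    also have "\<dots> = f \<mu>" unfolding a by (rule sum.cong) (auto simp: b_def)
    finally show "f \<mu> = (\<Sum>\<nu> | b \<nu> \<noteq> 0. b \<nu> * schur \<nu> \<mu>)" by simp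
  qed
  then show ?thesis using that sub by blast
qed

section \<open>The coefficient of a hook\<close>

definition compositions :: "nat \<Rightarrow> nat \<Rightarrow> nat list set" where
  "compositions n k = {\<alpha>. sum_list \<alpha> = n \<and> 0 \<notin> set \<alpha> \<and> \<alpha> \<noteq> [] \<and> k \<le> hd \<alpha>}"

definition hook_functional :: "nat \<Rightarrow> nat \<Rightarrow> series \<Rightarrow> laurent" where
  "hook_functional n k f =
     (\<Sum>\<alpha>\<in>compositions n k. (-1) ^ (n - k + 1 + length \<alpha>) * f (monomial_of \<alpha>))"

lemma finite_compositions: "finite (compositions n k)"
proof (rule finite_subset)
  show "compositions n k \<subseteq> {xs. set xs \<subseteq> {..n} \<and> length xs \<le> n}"
    using length_le_sum_list member_le_sum_list by (fastforce simp: compositions_def)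
  show "finite {xs. set xs \<subseteq> {..n} \<and> length xs \<le> n}" by (rule finite_lists_length_le) simp
qed

section \<open>Signed sums of Kostka numbers\<close>

definition hook_fun :: "nat \<Rightarrow> nat \<Rightarrow> nat \<Rightarrow> nat" where
  "hook_fun k j i = (if i = 0 then k else if i \<le> j then 1 else 0)"

lemma hook_fun_inject: "hook_fun k i = hook_fun k j \<longleftrightarrow> i = j"
proof
  assume "hook_fun k i = hook_fun k j"
  then have "hook_fun k i (Suc (min i j)) = hook_fun k j (Suc (min i j))" by simp
  then show "i = j" by (auto simp: hook_fun_def min_def split: if_splits)
qed simp

text \<open>The value that the signed Kostka sum will turn out to have. The exponent is the number
  of rows of a hook whose leg has \<open>j\<close> boxes.\<close>

definition hook_sign :: "nat \<Rightarrow> (nat \<Rightarrow> nat) \<Rightarrow> int" where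
  "hook_sign k \<nu> = (if \<exists>j. \<nu> = hook_fun k j then (-1) ^ Suc (THE j. \<nu> = hook_fun k j) else 0)"

lemma hook_sign_hook_fun [simp]: "hook_sign k (hook_fun k j) = (-1) ^ Suc j"
  by (auto simp: hook_sign_def hook_fun_inject)

lemma hook_sign_nonhook: "(\<And>j. \<nu> \<noteq> hook_fun k j) \<Longrightarrow> hook_sign k \<nu> = 0"
  by (simp add: hook_sign_def)

text \<open>If \<open>\<nu>\<close> has \<open>L \<ge> 2\<close> rows, a hook interlacing with it
  has \<open>L - 1\<close> or \<open>L\<close> rows. Either both hooks occur or neither, and their
  signs are opposite. Only a shape with at most one row leaves a term, that of the one-row
  hook.\<close>

lemma sum_hook_sign_interlacing:
  assumes \<nu>: "partition_fun d \<nu>" and k: "1 \<le> k"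
  shows "(\<Sum>\<mu>\<in>interlacing \<nu>. hook_sign k \<mu>) = (if k \<le> \<nu> 0 \<and> (\<forall>i. \<nu> (Suc i) = 0) then -1 else 0)"
proof -
  define J where "J = {j. hook_fun k j \<in> interlacing \<nu>}"
  have "(\<Sum>\<mu>\<in>interlacing \<nu>. hook_sign k \<mu>) = (\<Sum>\<mu>\<in>hook_fun k ` J. hook_sign k \<mu>)"
  proof (rule sum.mono_neutral_right)
    show "\<forall>\<mu>\<in>interlacing \<nu> - hook_fun k ` J. hook_sign k \<mu> = 0"
      by (auto intro!: hook_sign_nonhook simp: J_def)
  qed (use finite_interlacing[OF \<nu>] in \<open>auto simp: J_def\<close>)
  also have "\<dots> = (\<Sum>j\<in>J. (-1) ^ Suc j)"
    by (subst sum.reindex) (auto simp: inj_on_def hook_fun_inject)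
  also have "\<dots> = (if k \<le> \<nu> 0 \<and> (\<forall>i. \<nu> (Suc i) = 0) then -1 else 0)"
  proof (cases "\<forall>i. \<nu> (Suc i) = 0")
    case True
    have "j \<in> J \<longleftrightarrow> j = 0 \<and> k \<le> \<nu> 0" for j
    proof
      assume j: "j \<in> J"
      then have le: "hook_fun k j i \<le> \<nu> i" for i by (simp add: J_def interlacing_def)
      have "j = 0"
      proof (rule ccontr)
        assume "j \<noteq> 0"
        then have "1 \<le> \<nu> 1" using le[of 1] by (simp add: hook_fun_def)
        then show False using True[rule_format, of 0] by simp
      qed
      then show "j = 0 \<and> k \<le> \<nu> 0" using le[of 0] by (simp add: hook_fun_def)
    next
      assume "j = 0 \<and> k \<le> \<nu> 0"
      then show "j \<in> J" using True by (auto simp: J_def interlacing_def hook_fun_def)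
    qed
    then have "J = (if k \<le> \<nu> 0 then {0} else {})" by auto
    then show ?thesis using True by simp
  next
    case False
    have mono: "\<nu> (Suc i) \<le> \<nu> i" for i using \<nu> by (simp add: partition_fun_def)
    have anti: "\<nu> j \<le> \<nu> i" if "i \<le> j" for i j by (rule lift_Suc_antimono_le[of \<nu>]) (use mono that in auto)
    define L where "L = (LEAST L. \<nu> L = 0)"
    have L0: "\<nu> L = 0" unfolding L_def by (rule LeastI[of _ d]) (use \<nu> in \<open>simp add: partition_fun_def\<close>)
    have pos: "1 \<le> \<nu> i" if "i < L" for i
      using not_less_Least[of i "\<lambda>L. \<nu> L = 0"] that by (simp add: L_def)
    have zero: "\<nu> i = 0" if "L \<le> i" for i using anti[OF that] L0 by simp
    have L2: "2 \<le> L"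
    proof (rule ccontr)
      assume "\<not> 2 \<le> L"
      then have "\<nu> (Suc i) = 0" for i by (intro zero) simp
      then show False using False by blast
    qed
    have sub: "j = L - 2 \<or> j = L - 1" if "j \<in> J" for j
    proof -
      have int: "\<nu> (Suc i) \<le> hook_fun k j i" "hook_fun k j i \<le> \<nu> i" for i
        using that by (auto simp: J_def interlacing_def)
      have "j < L"
      proof (rule ccontr)
        assume "\<not> j < L"
        then show False using int(2)[of j] zero[of j] L2 k by (auto simp: hook_fun_def split: if_splits)
      qed
      moreover have "L \<le> j + 2"
      proof (rule ccontr)
        assume "\<not> L \<le> j + 2"
        then show False using int(1)[of "Suc j"] pos[of "Suc (Suc j)"] by (auto simp: hook_fun_def)
      qed
      ultimately show ?thesis by linarith
    qed
    \<comment> \<open>The two hooks differ only at index \<open>L - 1\<close>, where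
      \<open>\<nu>\<close> permits both values \<open>0\<close> and \<open>1\<close>.\<close>
    have "hook_fun k (L - 2) \<in> interlacing \<nu> \<longleftrightarrow> hook_fun k (L - 1) \<in> interlacing \<nu>"
    proof -
      have same: "hook_fun k (L - 2) i = hook_fun k (L - 1) i" if "i \<noteq> L - 1" for i
        using that L2 by (auto simp: hook_fun_def)
      have "hook_fun k (L - 2) (L - 1) = 0" "hook_fun k (L - 1) (L - 1) = 1"
        using L2 by (auto simp: hook_fun_def)
      moreover have "\<nu> (Suc (L - 1)) = 0" "1 \<le> \<nu> (L - 1)" using L2 L0 pos by auto
      ultimately have "(\<nu> (Suc i) \<le> hook_fun k (L - 2) i \<and> hook_fun k (L - 2) i \<le> \<nu> i) \<longleftrightarrow>
          (\<nu> (Suc i) \<le> hook_fun k (L - 1) i \<and> hook_fun k (L - 1) i \<le> \<nu> i)" for i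
        using same[of i] by (cases "i = L - 1") auto
      then show ?thesis by (simp add: interlacing_def)
    qed
    then have "J = {} \<or> J = {L - 2, L - 1}" using sub by (auto simp: J_def)
    moreover have "(\<Sum>j\<in>{L - 2, L - 1}. (-1) ^ Suc j) = (0::int)"
    proof -
      have "L - 1 = Suc (L - 2)" using L2 by simp
      then show ?thesis by simp
    qed
    ultimately have "(\<Sum>j\<in>J. (-1) ^ Suc j) = (0::int)" by (metis sum.empty)
    then show ?thesis using False by simp
  qed
  finally show ?thesis .
qed

text \<open>\<open>kostka\<close> reads a content from the largest entry, so the distinguished first
  part moves to the end of the list, out of reach of the recursion on the head.\<close>

definition rev_compositions :: "nat \<Rightarrow> nat \<Rightarrow> nat list set" where
  "rev_compositions n k = {\<beta>. sum_list \<beta> = n \<and> 0 \<notin> set \<beta> \<and> \<beta> \<noteq> [] \<and> k \<le> last \<beta>}"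

lemma rev_compositions_eq: "rev_compositions n k = rev ` compositions n k"
proof (intro set_eqI iffI)
  fix \<beta> assume "\<beta> \<in> rev_compositions n k"
  then have "rev \<beta> \<in> compositions n k" by (auto simp: rev_compositions_def compositions_def hd_rev sum_list_rev)
  then show "\<beta> \<in> rev ` compositions n k" by (metis image_eqI rev_rev_ident)
qed (auto simp: rev_compositions_def compositions_def last_rev sum_list_rev)

lemma rev_compositions_rec:
  assumes "1 \<le> k"
  shows "rev_compositions n k =
    (if k \<le> n then {[n]} else {}) \<union> (\<lambda>(a, \<beta>). a # \<beta>) ` (SIGMA a:{1..n}. rev_compositions (n - a) k)"
    (is "_ = ?R")
proof (intro set_eqI iffI)
  fix \<beta> assume b: "\<beta> \<in> rev_compositions n k"
  then obtain a \<beta>' where \<beta>: "\<beta> = a # \<beta>'" by (cases \<beta>) (auto simp: rev_compositions_def)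
  show "\<beta> \<in> ?R"
  proof (cases "\<beta>' = []")
    case True then show ?thesis using b \<beta> by (auto simp: rev_compositions_def)
  next
    case False
    then have "\<beta>' \<in> rev_compositions (n - a) k" "a \<in> {1..n}"
      using b \<beta> by (auto simp: rev_compositions_def)
    then show ?thesis using \<beta> by force
  qed
qed (use assms in \<open>auto simp: rev_compositions_def split: if_splits\<close>)

text \<open>Splitting off the head \<open>a \<ge> 1\<close> runs over all shapes interlacing with
  \<open>\<nu>\<close> except \<open>\<nu>\<close> itself, with \<open>a\<close> determined by the
  sizes. By induction they contribute minus the sum of their \<open>hook_sign\<close>. The full sum,
  known from \<open>sum_hook_sign_interlacing\<close>, cancels the contribution of the one-part
  composition, and the omitted term \<open>hook_sign k \<nu>\<close> remains.\<close>

lemma signed_kostka_hook: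
  assumes "partition_fun d \<nu>" "1 \<le> k"
  shows "(\<Sum>\<beta>\<in>rev_compositions (sum \<nu> {..<d}) k. (-1) ^ length \<beta> * int (kostka d \<nu> \<beta>)) = hook_sign k \<nu>"
  using assms(1)
proof (induction "sum \<nu> {..<d}" arbitrary: \<nu> rule: less_induct)
  case less
  note \<nu> = less.prems
  let ?n = "sum \<nu> {..<d}"
  define F where "F \<mu> = (\<Sum>\<beta>\<in>rev_compositions (sum \<mu> {..<d}) k. (-1) ^ length \<beta> * int (kostka d \<mu> \<beta>))" for \<mu>
  define I where "I a = {\<mu>. \<mu> \<in> interlacing \<nu> \<and> sum \<nu> {..<d} = sum \<mu> {..<d} + a}" for a
  have fin: "finite (rev_compositions m k)" for m
    by (simp add: rev_compositions_eq finite_compositions)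
  have finI: "finite (I a)" for a using finite_interlacing[OF \<nu>] by (simp add: I_def)
  have le: "sum \<mu> {..<d} \<le> ?n" if "\<mu> \<in> interlacing \<nu>" for \<mu>
    by (rule sum_mono) (use that in \<open>auto simp: interlacing_def\<close>)
  have eqD: "\<mu> = \<nu>" if "\<mu> \<in> interlacing \<nu>" "sum \<mu> {..<d} = ?n" for \<mu>
  proof
    fix i
    have i: "\<mu> i \<le> \<nu> i" for i using that(1) by (simp add: interlacing_def)
    show "\<mu> i = \<nu> i"
    proof (cases "i < d")
      case True
      then show ?thesis using sum_mono_inv[OF that(2), of i] i by auto
    next
      case False then show ?thesis using i[of i] \<nu> by (simp add: partition_fun_def)
    qed
  qed
  have \<nu>int: "\<nu> \<in> interlacing \<nu>" using \<nu> by (auto simp: interlacing_def partition_fun_def)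
  have head: "kostka d \<nu> [?n] = (if \<forall>i. \<nu> (Suc i) = 0 then 1 else 0)"
  proof -
    have "kostka d \<nu> [?n] = (\<Sum>\<mu>\<in>I ?n. if \<mu> = (\<lambda>_. 0) then 1 else 0)" by (simp add: I_def)
    also have "\<dots> = (if (\<lambda>_. 0) \<in> I ?n then 1 else 0)" using finI by simp
    also have "(\<lambda>_. 0) \<in> I ?n \<longleftrightarrow> (\<forall>i. \<nu> (Suc i) = 0)" by (simp add: I_def interlacing_def)
    finally show ?thesis .
  qed
  have "F \<nu> = (\<Sum>\<beta>\<in>(if k \<le> ?n then {[?n]} else {}). (-1) ^ length \<beta> * int (kostka d \<nu> \<beta>)) +
     (\<Sum>\<beta>\<in>(\<lambda>(a, \<beta>). a # \<beta>) ` (SIGMA a:{1..?n}. rev_compositions (?n - a) k). (-1) ^ length \<beta> * int (kostka d \<nu> \<beta>))"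
    unfolding F_def rev_compositions_rec[OF assms(2), of ?n]
    by (rule sum.union_disjoint) (use fin in \<open>auto simp: rev_compositions_def\<close>)
  also have "(\<Sum>\<beta>\<in>(if k \<le> ?n then {[?n]} else {}). (-1) ^ length \<beta> * int (kostka d \<nu> \<beta>)) =
      (if k \<le> ?n \<and> (\<forall>i. \<nu> (Suc i) = 0) then -1 else 0)"
    using head by (simp del: kostka.simps)
  also have "(\<Sum>\<beta>\<in>(\<lambda>(a, \<beta>). a # \<beta>) ` (SIGMA a:{1..?n}. rev_compositions (?n - a) k). (-1) ^ length \<beta> * int (kostka d \<nu> \<beta>)) =
      (\<Sum>a\<in>{1..?n}. \<Sum>\<beta>\<in>rev_compositions (?n - a) k. (-1) ^ length (a # \<beta>) * int (kostka d \<nu> (a # \<beta>)))"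
    by (subst sum.reindex) (use fin in \<open>auto simp: inj_on_def sum.Sigma simp del: kostka.simps intro!: sum.cong\<close>)
  also have "\<dots> = (\<Sum>a\<in>{1..?n}. - (\<Sum>\<mu>\<in>I a. F \<mu>))"
  proof (rule sum.cong)
    fix a assume a: "a \<in> {1..?n}"
    have "(\<Sum>\<beta>\<in>rev_compositions (?n - a) k. (-1) ^ length (a # \<beta>) * int (kostka d \<nu> (a # \<beta>))) =
       - (\<Sum>\<beta>\<in>rev_compositions (?n - a) k. \<Sum>\<mu>\<in>I a. (-1) ^ length \<beta> * int (kostka d \<mu> \<beta>))"
      by (simp add: I_def sum_distrib_left sum_negf)
    also have "\<dots> = - (\<Sum>\<mu>\<in>I a. \<Sum>\<beta>\<in>rev_compositions (?n - a) k. (-1) ^ length \<beta> * int (kostka d \<mu> \<beta>))"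
      by (subst sum.swap) simp
    also have "\<dots> = - (\<Sum>\<mu>\<in>I a. F \<mu>)"
      unfolding F_def by (intro arg_cong[of _ _ uminus] sum.cong) (auto simp: I_def)
    finally show "(\<Sum>\<beta>\<in>rev_compositions (?n - a) k. (-1) ^ length (a # \<beta>) * int (kostka d \<nu> (a # \<beta>))) = - (\<Sum>\<mu>\<in>I a. F \<mu>)" .
  qed simp
  also have "\<dots> = - (\<Sum>\<mu>\<in>interlacing \<nu> - {\<nu>}. F \<mu>)"
  proof -
    have "interlacing \<nu> - {\<nu>} = (\<Union>a\<in>{1..?n}. I a)"
    proof (intro set_eqI iffI)
      fix \<mu> assume \<mu>: "\<mu> \<in> interlacing \<nu> - {\<nu>}"
      then have "sum \<mu> {..<d} < ?n" using le[of \<mu>] eqD[of \<mu>] by fastforce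
      then have "\<mu> \<in> I (?n - sum \<mu> {..<d})" "?n - sum \<mu> {..<d} \<in> {1..?n}" using \<mu> by (auto simp: I_def)
      then show "\<mu> \<in> (\<Union>a\<in>{1..?n}. I a)" by blast
    qed (auto simp: I_def)
    moreover have "(\<Sum>\<mu>\<in>(\<Union>a\<in>{1..?n}. I a). F \<mu>) = (\<Sum>a\<in>{1..?n}. \<Sum>\<mu>\<in>I a. F \<mu>)"
      by (rule sum.UNION_disjoint) (use finI in \<open>auto simp: I_def\<close>)
    ultimately show ?thesis by (simp add: sum_negf)
  qed
  also have "(\<Sum>\<mu>\<in>interlacing \<nu> - {\<nu>}. F \<mu>) = (\<Sum>\<mu>\<in>interlacing \<nu> - {\<nu>}. hook_sign k \<mu>)"
  proof (rule sum.cong)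
    fix \<mu> assume \<mu>: "\<mu> \<in> interlacing \<nu> - {\<nu>}"
    then have "sum \<mu> {..<d} < ?n" using le[of \<mu>] eqD[of \<mu>] by fastforce
    then show "F \<mu> = hook_sign k \<mu>"
      unfolding F_def using less.hyps partition_fun_interlacing[OF \<nu>] \<mu> by blast
  qed simp
  also have "\<dots> = (\<Sum>\<mu>\<in>interlacing \<nu>. hook_sign k \<mu>) - hook_sign k \<nu>"
    using \<nu>int finite_interlacing[OF \<nu>] by (simp add: sum_diff1)
  also have "(\<Sum>\<mu>\<in>interlacing \<nu>. hook_sign k \<mu>) = (if k \<le> ?n \<and> (\<forall>i. \<nu> (Suc i) = 0) then -1 else 0)"
  proof -
    have n0: "?n = \<nu> 0" if "\<forall>i. \<nu> (Suc i) = 0"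
    proof (cases d)
      case 0 then show ?thesis using \<nu> by (simp add: partition_fun_def)
    next
      case (Suc d') then show ?thesis using that by (simp add: sum.lessThan_Suc_shift del: sum.lessThan_Suc)
    qed
    show ?thesis unfolding sum_hook_sign_interlacing[OF \<nu> assms(2)]
      using n0 by (cases "\<forall>i. \<nu> (Suc i) = 0") simp_all
  qed
  finally show ?case by (simp add: F_def)
qed

lemma shape_fun_eq_hook_fun:
  assumes "is_partition \<nu>" "1 \<le> k"
  shows "shape_fun \<nu> = hook_fun k j \<longleftrightarrow> \<nu> = k # replicate j 1"
proof
  assume eq: "shape_fun \<nu> = hook_fun k j"
  have pos: "shape_fun \<nu> i \<noteq> 0 \<longleftrightarrow> i < length \<nu>" for i
    using assms(1) nth_mem[of i \<nu>] unfolding shape_fun_def is_partition_def by metis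
  have "i < length \<nu> \<longleftrightarrow> i \<le> j" for i
    using pos[of i] assms(2) unfolding eq by (auto simp: hook_fun_def split: if_splits)
  then have len: "length \<nu> = Suc j" by (metis less_Suc_eq_le less_irrefl linorder_neqE_nat)
  show "\<nu> = k # replicate j 1"
  proof (rule nth_equalityI)
    fix i assume i: "i < length \<nu>"
    then have "\<nu> ! i = hook_fun k j i" using fun_cong[OF eq, of i] by (simp add: shape_fun_def)
    then show "\<nu> ! i = (k # replicate j 1) ! i" using i len by (cases i) (auto simp: hook_fun_def)
  qed (simp add: len)
next
  assume "\<nu> = k # replicate j 1"
  then show "shape_fun \<nu> = hook_fun k j"
    by (auto simp: shape_fun_def hook_fun_def fun_eq_iff nth_Cons')
qed

lemma sum_monomial_of: "(\<Sum>i | monomial_of \<alpha> i \<noteq> 0. monomial_of \<alpha> i) = sum_list \<alpha>"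
proof -
  have "(\<Sum>i | monomial_of \<alpha> i \<noteq> 0. monomial_of \<alpha> i) = (\<Sum>i\<in>Suc ` {..<length \<alpha>}. monomial_of \<alpha> i)"
  proof (rule sum.mono_neutral_left)
    show "{i. monomial_of \<alpha> i \<noteq> 0} \<subseteq> Suc ` {..<length \<alpha>}"
    proof
      fix i assume "i \<in> {i. monomial_of \<alpha> i \<noteq> 0}"
      then show "i \<in> Suc ` {..<length \<alpha>}" by (cases i) (auto simp: monomial_of_def split: if_splits)
    qed
  qed auto
  also have "\<dots> = sum_list \<alpha>"
    unfolding sum_list_sum_nth atLeast0LessThan by (subst sum.reindex) (auto simp: monomial_of_def)
  finally show ?thesis .
qed

lemma hook_functional_schur:
  assumes \<nu>: "is_partition \<nu>" and k: "1 \<le> k" "k \<le> n"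
  shows "hook_functional n k (schur \<nu>) = (if \<nu> = hook n k then 1 else 0)"
proof (cases "sum_list \<nu> = n")
  case False
  have z: "schur \<nu> (monomial_of \<alpha>) = 0" if "\<alpha> \<in> compositions n k" for \<alpha>
  proof (rule ccontr)
    assume "schur \<nu> (monomial_of \<alpha>) \<noteq> 0"
    then have "(\<Sum>i | monomial_of \<alpha> i \<noteq> 0. monomial_of \<alpha> i) = sum_list \<nu>"
      using homogeneous_schur by (simp add: homogeneous_def)
    then show False using that False unfolding sum_monomial_of by (simp add: compositions_def)
  qed
  have "sum_list (hook n k) = n" using k by (simp add: hook_def sum_list_replicate)
  then show ?thesis using False z by (auto simp: hook_functional_def)
next
  case True
  let ?d = "length \<nu>"
  have pf: "partition_fun ?d (shape_fun \<nu>)" using partition_fun_shape_fun[OF \<nu>] .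
  have n: "sum (shape_fun \<nu>) {..<?d} = n"
    using True unfolding sum_list_sum_nth atLeast0LessThan by (simp add: shape_fun_def)
  have "hook_functional n k (schur \<nu>) =
      (\<Sum>\<alpha>\<in>compositions n k. of_int ((-1) ^ (n - k + 1 + length \<alpha>) * int (kostka ?d (shape_fun \<nu>) (rev \<alpha>))))"
    unfolding hook_functional_def schur_monomial_of[OF \<nu>] by (rule sum.cong) simp_all
  also have "\<dots> = of_int ((-1) ^ (n - k + 1) * (\<Sum>\<alpha>\<in>compositions n k. (-1) ^ length (rev \<alpha>) * int (kostka ?d (shape_fun \<nu>) (rev \<alpha>))))"
    by (simp add: sum_distrib_left power_add mult.assoc)
  also have "(\<Sum>\<alpha>\<in>compositions n k. (-1) ^ length (rev \<alpha>) * int (kostka ?d (shape_fun \<nu>) (rev \<alpha>))) =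
      (\<Sum>\<beta>\<in>rev_compositions n k. (-1) ^ length \<beta> * int (kostka ?d (shape_fun \<nu>) \<beta>))"
    unfolding rev_compositions_eq by (subst sum.reindex) (auto simp: inj_on_def)
  also have "\<dots> = hook_sign k (shape_fun \<nu>)" using signed_kostka_hook[OF pf k(1)] unfolding n .
  \<comment> \<open>The factor \<open>(-1) ^ (n - k + 1)\<close> is the \<open>hook_sign\<close> of
    the hook with leg \<open>n - k\<close>, so it normalises the value to \<open>1\<close>.\<close>
  also have "of_int ((-1) ^ (n - k + 1) * hook_sign k (shape_fun \<nu>)) = (if \<nu> = hook n k then 1 else (0::laurent))"
  proof (cases "\<exists>j. shape_fun \<nu> = hook_fun k j")
    case ex: True
    then obtain j where j: "shape_fun \<nu> = hook_fun k j" by blast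
    then have "\<nu> = k # replicate j 1" using shape_fun_eq_hook_fun[OF \<nu> k(1)] by simp
    then have "n - k = j" "\<nu> = hook n k" using True by (auto simp: sum_list_replicate hook_def)
    then show ?thesis using j by (simp flip: power_add mult_2)
  next
    case False
    then have "\<nu> \<noteq> hook n k" using shape_fun_eq_hook_fun[OF \<nu> k(1), of "n - k"] by (auto simp: hook_def)
    then show ?thesis using False by (simp add: hook_sign_def)
  qed
  finally show ?thesis .
qed

lemma schur_coeff_hook:
  assumes "symmetric_series f" "homogeneous n f" "1 \<le> k" "k \<le> n"
  shows "schur_coeff (hook n k) f = hook_functional n k f"
proof -
  obtain a where a: "schur_expansion f a"
    using schur_expansion_exists[OF assms(1,2)] by blast
  then have "(THE a. schur_expansion f a) = a" using schur_expansion_unique by blast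
  then have coeff: "schur_coeff (hook n k) f = a (hook n k)" by (simp add: schur_coeff_def)
  have fin: "finite {\<nu>. a \<nu> \<noteq> 0}" and part: "\<And>\<nu>. a \<nu> \<noteq> 0 \<Longrightarrow> is_partition \<nu>"
    and f: "\<And>\<mu>. f \<mu> = (\<Sum>\<nu> | a \<nu> \<noteq> 0. a \<nu> * schur \<nu> \<mu>)"
    using a unfolding schur_expansion_def by (blast, blast, meson)
  have "hook_functional n k f = (\<Sum>\<alpha>\<in>compositions n k. \<Sum>\<nu> | a \<nu> \<noteq> 0.
      a \<nu> * ((-1) ^ (n - k + 1 + length \<alpha>) * schur \<nu> (monomial_of \<alpha>)))"
    unfolding hook_functional_def f by (simp add: sum_distrib_left mult.left_commute)
  also have "\<dots> = (\<Sum>\<nu> | a \<nu> \<noteq> 0. a \<nu> * hook_functional n k (schur \<nu>))"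
    unfolding hook_functional_def by (subst sum.swap) (simp add: sum_distrib_left)
  also have "\<dots> = (\<Sum>\<nu> | a \<nu> \<noteq> 0. if \<nu> = hook n k then a \<nu> else 0)"
    by (rule sum.cong) (use hook_functional_schur part assms(3,4) in auto)
  also have "\<dots> = a (hook n k)" using fin by (simp add: sum.delta')
  finally show ?thesis using coeff by simp
qed

section \<open>Maxima of closed curves in the annulus\<close>

text \<open>An edge with exactly one end in the current set adds one vertex and is then used up, so
  a closed set is reached after at most \<open>card E\<close> additions.\<close>

lemma card_reachable_le_aux:
  assumes "finite E" "finite R"
  shows "\<exists>S. R \<subseteq> S \<and> (\<forall>e\<in>E. a e \<in> S \<longleftrightarrow> b e \<in> S) \<and> finite S \<and> card S \<le> card R + card E"
  using assms
proof (induction "card E" arbitrary: E R)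
  case 0
  then show ?case by auto
next
  case (Suc k)
  show ?case
  proof (cases "\<forall>e\<in>E. a e \<in> R \<longleftrightarrow> b e \<in> R")
    case True
    moreover have "card R \<le> card R + card E" by simp
    ultimately show ?thesis using Suc.prems(2) by blast
  next
    case False
    then obtain e where e: "e \<in> E" "(a e \<in> R) \<noteq> (b e \<in> R)" by blast
    define R' where "R' = insert (a e) (insert (b e) R)"
    have cR: "card R' = Suc (card R)"
    proof (cases "a e \<in> R")
      case True
      then have "R' = insert (b e) R" "b e \<notin> R" using e by (auto simp: R'_def)
      then show ?thesis using Suc.prems(2) by simp
    next
      case False
      then have "R' = insert (a e) R" using e by (auto simp: R'_def)
      then show ?thesis using Suc.prems(2) False by simp
    qed
    have cE: "k = card (E - {e})" using e(1) Suc.hyps(2) Suc.prems(1) by simp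
    have "finite (E - {e})" "finite R'" using Suc.prems by (auto simp: R'_def)
    from Suc.hyps(1)[OF cE this] obtain S where S: "R' \<subseteq> S" "\<forall>e\<in>E - {e}. a e \<in> S \<longleftrightarrow> b e \<in> S"
        "finite S" "card S \<le> card R' + card (E - {e})" by blast
    have "\<forall>e\<in>E. a e \<in> S \<longleftrightarrow> b e \<in> S" using S(1,2) by (auto simp: R'_def)
    moreover have "R \<subseteq> S" using S(1) by (auto simp: R'_def)
    moreover have "card S \<le> card R + card E" using S(4) cR cE Suc.hyps(2) by linarith
    ultimately show ?thesis using S(3) by blast
  qed
qed

text \<open>A connected graph with edges \<open>E\<close> whose vertices include \<open>V\<close> and a further vertex \<open>r\<close> has at least
  \<open>card V\<close> edges; connectedness is stated through sets closed under adjacency.\<close>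

lemma card_reachable_le:
  assumes "finite E" "finite V" "r \<notin> V"
    and closed: "\<And>S. r \<in> S \<Longrightarrow> (\<And>e. e \<in> E \<Longrightarrow> a e \<in> S \<longleftrightarrow> b e \<in> S) \<Longrightarrow> V \<subseteq> S"
  shows "card V \<le> card E"
proof -
  obtain S where S: "{r} \<subseteq> S" "\<forall>e\<in>E. a e \<in> S \<longleftrightarrow> b e \<in> S" "finite S" "card S \<le> card {r} + card E"
    using card_reachable_le_aux[OF assms(1), of "{r}" a b] by blast
  then have "insert r V \<subseteq> S" using closed by blast
  then have "card (insert r V) \<le> card S" using S(3) by (rule card_mono[rotated])
  then show ?thesis using S(4) assms(2,3) by simp
qed

lemma ex_max_on:
  fixes f :: "'b \<Rightarrow> real"
  assumes "finite Z" "Z \<noteq> {}"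
  obtains x where "x \<in> Z" "\<And>y. y \<in> Z \<Longrightarrow> f y \<le> f x"
proof -
  have "Max (f ` Z) \<in> f ` Z" using assms by (intro Max_in) auto
  then obtain x where x: "x \<in> Z" "Max (f ` Z) = f x" by blast
  have "f y \<le> f x" if "y \<in> Z" for y
    unfolding x(2)[symmetric] using assms(1) that by (intro Max_ge) auto
  then show ?thesis using that x(1) by blast
qed

text \<open>Radial segments cut the annulus into slabs. A strand rises through one slab from \<open>src\<close> to \<open>tgt\<close>,
  and \<open>xi\<close> is its horizontal position in the slab, which is identified by the angle of its lower boundary.\<close>

locale strands =
  fixes S :: "'s set" and src tgt :: "'s \<Rightarrow> real \<times> complex" and xi :: "'s \<Rightarrow> real"
  assumes finite_S: "finite S"
    and same_slab: "s \<in> S \<Longrightarrow> s' \<in> S \<Longrightarrow> snd (src s) = snd (src s') \<longleftrightarrow> snd (tgt s) = snd (tgt s')"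
    and xi_inj: "s \<in> S \<Longrightarrow> s' \<in> S \<Longrightarrow> snd (src s) = snd (src s') \<Longrightarrow> xi s = xi s' \<Longrightarrow> s = s'"
    and xi_mono: "s \<in> S \<Longrightarrow> s' \<in> S \<Longrightarrow> snd (src s) = snd (src s') \<Longrightarrow> xi s < xi s' \<Longrightarrow>
      fst (src s) \<le> fst (src s') \<and> fst (tgt s) \<le> fst (tgt s')"
begin

lemma tgt_less_imp_xi_less:
  assumes "s \<in> S" "s' \<in> S" "snd (tgt s) = snd (tgt s')" "fst (tgt s) < fst (tgt s')"
  shows "xi s < xi s'"
  using xi_mono[of s' s] same_slab[of s s'] xi_inj[of s s'] assms by (cases "xi s = xi s'") force+

lemma src_less_imp_xi_less:
  assumes "s \<in> S" "s' \<in> S" "snd (src s) = snd (src s')" "fst (src s) < fst (src s')"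
  shows "xi s < xi s'"
  using xi_mono[of s' s] xi_inj[of s s'] assms by (cases "xi s = xi s'") force+

end

text \<open>A connected closed curve made of strands, where \<open>eps\<close> is \<open>1\<close> on the strands traversed upwards and
  \<open>-1\<close> on the others.\<close>

locale strand_curve = strands +
  fixes C :: "'a set" and eps :: "'a \<Rightarrow> int"
  assumes C_sub: "C \<subseteq> S"
    and eps: "s \<in> C \<Longrightarrow> eps s = 1 \<or> eps s = -1"
    and local_type: "p \<in> src ` C \<union> tgt ` C \<Longrightarrow>
      (\<exists>s s'. {s \<in> C. tgt s = p} = {s} \<and> {s \<in> C. src s = p} = {s'} \<and> eps s = eps s') \<or>
      (\<exists>l r. {s \<in> C. tgt s = p} = {l, r} \<and> {s \<in> C. src s = p} = {} \<and> xi l < xi r \<and> eps l = - eps r) \<or>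
      (\<exists>l r. {s \<in> C. src s = p} = {l, r} \<and> {s \<in> C. tgt s = p} = {} \<and> xi l < xi r \<and> eps l = - eps r)"
    and connected_C: "D \<subseteq> C \<Longrightarrow> D \<noteq> {} \<Longrightarrow>
      (\<And>p s s'. s \<in> D \<Longrightarrow> s' \<in> C \<Longrightarrow> p \<in> {src s, tgt s} \<Longrightarrow> p \<in> {src s', tgt s'} \<Longrightarrow> s' \<in> D) \<Longrightarrow> D = C"
begin

definition points where "points = src ` C \<union> tgt ` C"
definition into where "into p = {s \<in> C. tgt s = p}"
definition out where "out p = {s \<in> C. src s = p}"

definition through where "through e = {p. \<exists>s s'. into p = {s} \<and> out p = {s'} \<and> eps s = e \<and> eps s' = e}"
text \<open>The argument is the sign of the right strand. For maxima and minima alike,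
  \<open>1\<close> means that the curve turns left there and \<open>-1\<close> that it turns
  right.\<close>

definition maxima where
  "maxima e = {p. \<exists>l r. into p = {l, r} \<and> out p = {} \<and> xi l < xi r \<and> eps l = - e \<and> eps r = e}"
definition minima where
  "minima e = {p. \<exists>l r. out p = {l, r} \<and> into p = {} \<and> xi l < xi r \<and> eps l = - e \<and> eps r = e}"

lemma finite_C: "finite C" using C_sub finite_S by (rule finite_subset)
lemma finite_points: "finite points" by (simp add: points_def finite_C)

lemma in_S: "s \<in> C \<Longrightarrow> s \<in> S" using C_sub by blast

lemma point_cases:
  assumes "p \<in> points"
  obtains (through) s s' e where "into p = {s}" "out p = {s'}" "eps s = e" "eps s' = e" "e = 1 \<or> e = -1"
  | (max) l r e where "into p = {l, r}" "out p = {}" "xi l < xi r" "eps l = - e" "eps r = e" "e = 1 \<or> e = -1"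
  | (min) l r e where "out p = {l, r}" "into p = {}" "xi l < xi r" "eps l = - e" "eps r = e" "e = 1 \<or> e = -1"
proof -
  have C: "s \<in> C" if "s \<in> into p \<or> s \<in> out p" for s using that by (auto simp: into_def out_def)
  have "p \<in> src ` C \<union> tgt ` C" using assms by (simp only: points_def)
  from local_type[OF this] consider
      (1) "\<exists>s s'. {s \<in> C. tgt s = p} = {s} \<and> {s \<in> C. src s = p} = {s'} \<and> eps s = eps s'"
    | (2) "\<exists>l r. {s \<in> C. tgt s = p} = {l, r} \<and> {s \<in> C. src s = p} = {} \<and> xi l < xi r \<and> eps l = - eps r"
    | (3) "\<exists>l r. {s \<in> C. src s = p} = {l, r} \<and> {s \<in> C. tgt s = p} = {} \<and> xi l < xi r \<and> eps l = - eps r"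
    by (elim disjE)
  then show ?thesis
  proof cases
    case 1
    then obtain s s' where s: "into p = {s}" "out p = {s'}" "eps s = eps s'"
      by (simp only: into_def out_def) (elim exE conjE)
    have "s \<in> into p" by (simp add: s(1))
    then have "eps s = 1 \<or> eps s = -1" using eps[OF C] by blast
    then show ?thesis using through[OF s(1,2) refl s(3)[symmetric]] by blast
  next
    case 2
    then obtain l r where s: "into p = {l, r}" "out p = {}" "xi l < xi r" "eps l = - eps r"
      by (simp only: into_def out_def) (elim exE conjE)
    have "r \<in> into p" by (simp add: s(1))
    then have "eps r = 1 \<or> eps r = -1" using eps[OF C] by blast
    then show ?thesis using max[OF s refl] by blast
  next
    case 3
    then obtain l r where s: "out p = {l, r}" "into p = {}" "xi l < xi r" "eps l = - eps r"
      by (simp only: into_def out_def) (elim exE conjE)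
    have "r \<in> out p" by (simp add: s(1))
    then have "eps r = 1 \<or> eps r = -1" using eps[OF C] by blast
    then show ?thesis using min[OF s refl] by blast
  qed
qed

lemma points_iff: "p \<in> points \<longleftrightarrow> into p \<noteq> {} \<or> out p \<noteq> {}"
  unfolding points_def into_def out_def by blast

lemma maxima_iff:
  assumes "into p = {l, r}" "out p = {}" "xi l < xi r" "eps l = - eps r"
  shows "p \<in> maxima e \<longleftrightarrow> eps r = e"
proof
  assume "p \<in> maxima e"
  then obtain l' r' where "{l, r} = {l', r'}" "xi l' < xi r'" "eps r' = e"
    using assms(1) unfolding maxima_def by auto
  then show "eps r = e" using assms(3) unfolding doubleton_eq_iff by auto
next
  assume "eps r = e"
  then show "p \<in> maxima e" unfolding maxima_def using assms by blast
qed

lemma minima_iff: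
  assumes "out p = {l, r}" "into p = {}" "xi l < xi r" "eps l = - eps r"
  shows "p \<in> minima e \<longleftrightarrow> eps r = e"
proof
  assume "p \<in> minima e"
  then obtain l' r' where "{l, r} = {l', r'}" "xi l' < xi r'" "eps r' = e"
    using assms(1) unfolding minima_def by auto
  then show "eps r = e" using assms(3) unfolding doubleton_eq_iff by auto
next
  assume "eps r = e"
  then show "p \<in> minima e" unfolding minima_def using assms by blast
qed

lemma sum_pair: "xi l < xi r \<Longrightarrow> sum h {l, r} = h l + h r"
  by (cases "l = r") auto

lemma into_out_sum:
  assumes "p \<in> points" shows "sum eps (into p) = sum eps (out p)"
  using assms by (cases rule: point_cases) (auto simp: sum_pair)

lemma sum_by_tgt: "(\<Sum>s | s \<in> C \<and> Q (tgt s). h s) = (\<Sum>p | p \<in> points \<and> Q p. \<Sum>s\<in>into p. h s)"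
proof -
  have "{s \<in> C. Q (tgt s)} = (\<Union>p\<in>{p \<in> points. Q p}. into p)" by (auto simp: into_def points_def)
  also have "sum h \<dots> = (\<Sum>p | p \<in> points \<and> Q p. \<Sum>s\<in>into p. h s)"
    by (rule sum.UNION_disjoint) (use finite_points finite_C in \<open>auto simp: into_def\<close>)
  finally show ?thesis .
qed

lemma sum_by_src: "(\<Sum>s | s \<in> C \<and> Q (src s). h s) = (\<Sum>p | p \<in> points \<and> Q p. \<Sum>s\<in>out p. h s)"
proof -
  have "{s \<in> C. Q (src s)} = (\<Union>p\<in>{p \<in> points. Q p}. out p)" by (auto simp: out_def points_def)
  also have "sum h \<dots> = (\<Sum>p | p \<in> points \<and> Q p. \<Sum>s\<in>out p. h s)"
    by (rule sum.UNION_disjoint) (use finite_points finite_C in \<open>auto simp: out_def\<close>)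
  finally show ?thesis .
qed

lemma eps_balance: "(\<Sum>s | s \<in> C \<and> Q (tgt s). eps s) = (\<Sum>s | s \<in> C \<and> Q (src s). eps s)"
  unfolding sum_by_tgt sum_by_src by (rule sum.cong) (use into_out_sum in auto)

text \<open>Sets of strands of the curve to the left of something: \<open>seg\<close> inside the
  slab of a strand, the other four inside the slabs directly below and above the level of a point.
  Sums of \<open>eps\<close> over such sets are partial winding numbers.\<close>

definition seg where "seg s = {s' \<in> C. snd (src s') = snd (src s) \<and> xi s' \<le> xi s}"
definition below_le where "below_le p = {s \<in> C. snd (tgt s) = snd p \<and> fst (tgt s) \<le> fst p}"
definition above_le where "above_le p = {s \<in> C. snd (src s) = snd p \<and> fst (src s) \<le> fst p}"
definition below_less where "below_less p = {s \<in> C. snd (tgt s) = snd p \<and> fst (tgt s) < fst p}"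
definition above_less where "above_less p = {s \<in> C. snd (src s) = snd p \<and> fst (src s) < fst p}"

lemma below_le_eq: "below_le p = below_less p \<union> into p"
  by (auto simp: below_le_def below_less_def into_def prod_eq_iff)

lemma above_le_eq: "above_le p = above_less p \<union> out p"
  by (auto simp: above_le_def above_less_def out_def prod_eq_iff)

text \<open>The order inside a slab agrees with the order of the upper ends; only strands ending in
  the same point have to be told apart by \<open>xi\<close>.\<close>

lemma seg_into:
  assumes "s \<in> into p" shows "seg s = below_less p \<union> {s' \<in> into p. xi s' \<le> xi s}"
proof -
  have s: "s \<in> C" "tgt s = p" using assms by (auto simp: into_def)
  show ?thesis
  proof (intro set_eqI iffI)
    fix s' assume "s' \<in> seg s"
    then have s': "s' \<in> C" "snd (src s') = snd (src s)" "xi s' \<le> xi s" by (auto simp: seg_def)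
    have t: "snd (tgt s') = snd p" using same_slab[of s' s] s s' in_S by blast
    have "fst (tgt s') \<le> fst p"
      using xi_mono[of s' s] xi_inj[of s' s] s s' in_S by (cases "xi s' = xi s") force+
    then show "s' \<in> below_less p \<union> {s' \<in> into p. xi s' \<le> xi s}"
      using s' t by (auto simp: below_less_def into_def prod_eq_iff)
  next
    fix s' assume "s' \<in> below_less p \<union> {s' \<in> into p. xi s' \<le> xi s}"
    then show "s' \<in> seg s"
    proof
      assume "s' \<in> below_less p"
      then have "s' \<in> C" "snd (tgt s') = snd (tgt s)" "fst (tgt s') < fst (tgt s)"
        using s by (auto simp: below_less_def)
      then show ?thesis using tgt_less_imp_xi_less[of s' s] same_slab[of s' s] s in_S
        by (auto simp: seg_def)
    next
      assume "s' \<in> {s' \<in> into p. xi s' \<le> xi s}"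
      then show ?thesis using same_slab[of s' s] s in_S by (auto simp: seg_def into_def)
    qed
  qed
qed

lemma seg_out:
  assumes "s \<in> out p" shows "seg s = above_less p \<union> {s' \<in> out p. xi s' \<le> xi s}"
proof -
  have s: "s \<in> C" "src s = p" using assms by (auto simp: out_def)
  show ?thesis
  proof (intro set_eqI iffI)
    fix s' assume "s' \<in> seg s"
    then have s': "s' \<in> C" "snd (src s') = snd (src s)" "xi s' \<le> xi s" by (auto simp: seg_def)
    have "fst (src s') \<le> fst p"
      using xi_mono[of s' s] xi_inj[of s' s] s s' in_S by (cases "xi s' = xi s") force+
    then show "s' \<in> above_less p \<union> {s' \<in> out p. xi s' \<le> xi s}"
      using s s' by (auto simp: above_less_def out_def prod_eq_iff)
  next
    fix s' assume "s' \<in> above_less p \<union> {s' \<in> out p. xi s' \<le> xi s}"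
    then show "s' \<in> seg s"
    proof
      assume "s' \<in> above_less p"
      then have "s' \<in> C" "snd (src s') = snd (src s)" "fst (src s') < fst (src s)"
        using s by (auto simp: above_less_def)
      then show ?thesis using src_less_imp_xi_less[of s' s] s in_S by (auto simp: seg_def)
    qed (use s in \<open>auto simp: seg_def out_def\<close>)
  qed
qed

lemma finite_segs: "finite (seg s)" "finite (below_less p)" "finite (above_less p)" "finite (into p)" "finite (out p)"
  using finite_C by (auto simp: seg_def below_less_def above_less_def into_def out_def)

lemma disjoint_less: "below_less p \<inter> into p = {}" "above_less p \<inter> out p = {}"
  by (auto simp: below_less_def above_less_def into_def out_def)

lemma balance_less: "sum eps (below_less p) = sum eps (above_less p)"
  unfolding below_less_def above_less_def
  using eps_balance[of "\<lambda>q. snd q = snd p \<and> fst q < fst p"] .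

lemma balance_le: "sum eps (below_le p) = sum eps (above_le p)"
  unfolding below_le_def above_le_def
  using eps_balance[of "\<lambda>q. snd q = snd p \<and> fst q \<le> fst p"] .

text \<open>A gap between strands of the curve in a slab is encoded by the set of strands on its left:
  \<open>left_seg\<close> is the gap on the left of a strand oriented upward by \<open>eps\<close> and on the right of a strand
  oriented downward, so it always lies on the same side of the curve.\<close>

definition left_seg where "left_seg s = (if eps s = 1 then seg s - {s} else seg s)"

lemma seg_self: "s \<in> C \<Longrightarrow> s \<in> seg s" by (simp add: seg_def)

text \<open>Follows the gap on the left side of the curve past a point. Where the curve turns left,
  both strands border the same gap, the one between them. Where it turns right, they border the two
  outer gaps, which become a single gap on the other side of the level.\<close>

lemma left_seg_cases:
  assumes "p \<in> points"
  obtains (through_up) s s' where "into p = {s}" "out p = {s'}" "eps s = 1" "eps s' = 1"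
      "left_seg s = below_less p" "left_seg s' = above_less p"
  | (through_down) s s' where "into p = {s}" "out p = {s'}" "eps s = -1" "eps s' = -1"
      "left_seg s = below_le p" "left_seg s' = above_le p"
  | (max_pos) l r where "into p = {l, r}" "out p = {}" "left_seg l = left_seg r" "eps l = -1" "eps r = 1" "xi l < xi r"
  | (max_neg) l r where "into p = {l, r}" "out p = {}" "left_seg l = below_less p" "left_seg r = below_le p"
      "above_le p = above_less p" "eps l = 1" "eps r = -1" "xi l < xi r"
  | (min_pos) l r where "into p = {}" "out p = {l, r}" "left_seg l = left_seg r" "eps l = -1" "eps r = 1" "xi l < xi r"
  | (min_neg) l r where "into p = {}" "out p = {l, r}" "left_seg l = above_less p" "left_seg r = above_le p"
      "below_le p = below_less p" "eps l = 1" "eps r = -1" "xi l < xi r"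
  using assms
proof (cases rule: point_cases)
  case (through s s' e)
  have seg: "seg s = below_less p \<union> {s}" "seg s' = above_less p \<union> {s'}" "s \<notin> below_less p" "s' \<notin> above_less p"
    using seg_into[of s p] seg_out[of s' p] disjoint_less[of p] through by auto
  show ?thesis
  proof (cases "e = 1")
    case True
    then show ?thesis using through seg by (intro that(1)[of s s']) (auto simp: left_seg_def)
  next
    case False
    then show ?thesis using through seg below_le_eq[of p] above_le_eq[of p]
      by (intro that(2)[of s s']) (auto simp: left_seg_def)
  qed
next
  case (max l r e)
  have seg: "seg l = below_less p \<union> {l}" "seg r = below_less p \<union> {l, r}" "l \<notin> below_less p" "r \<notin> below_less p" "l \<noteq> r"
    using seg_into[of l p] seg_into[of r p] disjoint_less[of p] max by auto
  show ?thesis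
  proof (cases "e = 1")
    case True
    then show ?thesis using max seg by (intro that(3)[of l r]) (auto simp: left_seg_def)
  next
    case False
    then show ?thesis using max seg below_le_eq[of p] above_le_eq[of p]
      by (intro that(4)[of l r]) (auto simp: left_seg_def)
  qed
next
  case (min l r e)
  have seg: "seg l = above_less p \<union> {l}" "seg r = above_less p \<union> {l, r}" "l \<notin> above_less p" "r \<notin> above_less p" "l \<noteq> r"
    using seg_out[of l p] seg_out[of r p] disjoint_less[of p] min by auto
  show ?thesis
  proof (cases "e = 1")
    case True
    then show ?thesis using min seg by (intro that(5)[of l r]) (auto simp: left_seg_def)
  next
    case False
    then show ?thesis using min seg below_le_eq[of p] above_le_eq[of p]
      by (intro that(6)[of l r]) (auto simp: left_seg_def)
  qed
qed

lemma closed_eq_C: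
  assumes "D \<subseteq> C" "D \<noteq> {}"
    and "\<And>p s s'. p \<in> points \<Longrightarrow> s \<in> into p \<union> out p \<Longrightarrow> s' \<in> into p \<union> out p \<Longrightarrow> s \<in> D \<Longrightarrow> s' \<in> D"
  shows "D = C"
proof (rule connected_C[OF assms(1,2)])
  fix p s s' assume "s \<in> D" "s' \<in> C" "p \<in> {src s, tgt s}" "p \<in> {src s', tgt s'}"
  then show "s' \<in> D" using assms(1) by (intro assms(3)[of p s s']) (auto simp: points_def into_def out_def)
qed

text \<open>Passing a point keeps the gap, or leads to the gap at the same place in the adjacent
  slab, or to the other outer gap of a turn. By \<open>balance_le\<close> and
  \<open>balance_less\<close> the signed count of strands to the left survives each of these
  moves.\<close>

lemma left_seg_sum_constant:
  assumes "s \<in> C" "s' \<in> C"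
  shows "sum eps (left_seg s) = sum eps (left_seg s')"
proof -
  define D where "D = {t \<in> C. sum eps (left_seg t) = sum eps (left_seg s)}"
  have "D = C"
  proof (rule closed_eq_C)
    fix p t t' assume p: "p \<in> points" and t: "t \<in> into p \<union> out p" "t' \<in> into p \<union> out p" "t \<in> D"
    have "t' \<in> C" using t by (auto simp: into_def out_def)
    moreover have "sum eps (left_seg t') = sum eps (left_seg t)"
      using p
    proof (cases rule: left_seg_cases)
      case (max_neg l r)
      have "sum eps (below_le p) = sum eps (below_less p)" using balance_le[of p] balance_less[of p] max_neg by simp
      then show ?thesis using t max_neg by auto
    next
      case (min_neg l r)
      have "sum eps (above_le p) = sum eps (above_less p)" using balance_le[of p] balance_less[of p] min_neg by simp
      then show ?thesis using t min_neg by auto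
    qed (use t balance_less[of p] balance_le[of p] in auto)
    ultimately show "t' \<in> D" using t by (simp add: D_def)
  qed (use assms in \<open>auto simp: D_def\<close>)
  then have "s' \<in> D" using assms by simp
  then show ?thesis by (simp add: D_def)
qed

context
  fixes z :: complex
  assumes winding: "0 < (\<Sum>s | s \<in> C \<and> snd (src s) = z. eps s)"
begin

text \<open>With positive winding the leftmost strand over \<open>z\<close> points upward: otherwise
  its count would be \<open>-1\<close>, while the count at the rightmost strand is not negative. So
  the leftmost gap lies on the left side of the curve, and the constant count is that of this
  gap.\<close>

lemma left_seg_sum_zero:
  obtains s0 where "s0 \<in> C" "left_seg s0 = {}" "\<forall>s\<in>C. sum eps (left_seg s) = 0"
proof -
  define Z where "Z = {s \<in> C. snd (src s) = z}"
  have wZ: "0 < sum eps Z" using winding by (simp add: Z_def)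
  have Z: "finite Z" "Z \<noteq> {}" using finite_C wZ by (simp add: Z_def, metis less_irrefl sum.empty)
  obtain s1 where s1: "s1 \<in> Z" "\<And>s. s \<in> Z \<Longrightarrow> xi s1 \<le> xi s"
    using Z by (metis (no_types, lifting) arg_min_if_finite(1) arg_min_least)
  obtain s2 where s2: "s2 \<in> Z" "\<And>s. s \<in> Z \<Longrightarrow> xi s \<le> xi s2"
    using ex_max_on[OF Z, where f = xi] by blast
  have seg1: "seg s1 = {s1}"
    using s1 xi_inj[of _ s1] in_S by (force simp: seg_def Z_def)
  have seg2: "seg s2 = Z" using s2 by (auto simp: seg_def Z_def)
  have C12: "s1 \<in> C" "s2 \<in> C" using s1 s2 by (auto simp: Z_def)
  have sum2: "sum eps (left_seg s2) \<ge> 0"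
  proof (cases "eps s2 = 1")
    case True
    then have "sum eps (left_seg s2) = sum eps Z - 1"
      using Z s2(1) by (simp add: left_seg_def seg2 sum_diff1)
    then show ?thesis using winding by (simp add: Z_def)
  next
    case False then show ?thesis using winding by (simp add: left_seg_def seg2 Z_def)
  qed
  have eps1: "eps s1 = 1"
  proof (rule ccontr)
    assume "eps s1 \<noteq> 1"
    then have "sum eps (left_seg s1) = -1" using eps[OF C12(1)] by (simp add: left_seg_def seg1)
    then show False using sum2 left_seg_sum_constant[OF C12] by simp
  qed
  then have "left_seg s1 = {}" by (simp add: left_seg_def seg1)
  then show ?thesis using that[of s1] C12(1) left_seg_sum_constant[OF C12(1)] by force
qed

text \<open>The gaps on the left side of the curve form a connected graph: the points \<open>p\<close> with
  \<open>sum eps (below_le p) = 0\<close> join the gap on the right of \<open>p\<close> below it to the one above it. Besides the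
  leftmost gap \<open>{}\<close>, this graph has a vertex for each strand with \<open>eps s = -1\<close>.\<close>

lemma card_maxima_le: "card (maxima 1) \<le> card (minima (-1))"
proof -
  obtain s0 where s0: "s0 \<in> C" "left_seg s0 = {}" and "\<forall>s\<in>C. sum eps (left_seg s) = 0"
    using left_seg_sum_zero .
  then have zero: "\<And>s. s \<in> C \<Longrightarrow> sum eps (left_seg s) = 0" by blast
  define N where "N = {s \<in> C. eps s = -1}"
  define E where "E = {p \<in> points. sum eps (below_le p) = 0}"
  \<comment> \<open>At left turns and at upward passages the gap on the right of \<open>p\<close>
    has count \<open>1\<close>, so it lies on the other side of the curve.\<close>
  have E_eq: "E = through (-1) \<union> maxima (-1) \<union> minima (-1)"
  proof (intro set_eqI iffI)
    fix p assume p: "p \<in> E"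
    then have "p \<in> points" by (simp add: E_def)
    then show "p \<in> through (-1) \<union> maxima (-1) \<union> minima (-1)"
    proof (cases rule: left_seg_cases)
      case (through_up s s')
      have "sum eps (below_le p) = sum eps (left_seg s) + 1"
        using through_up below_le_eq[of p] disjoint_less[of p] finite_segs by (simp add: add.commute)
      then show ?thesis using zero[of s] through_up p by (auto simp: E_def into_def)
    next
      case (max_pos l r)
      have "left_seg l = below_less p \<union> {l}"
        using seg_into[of l p] max_pos by (auto simp: left_seg_def)
      then have "sum eps (below_less p) = 1" using zero[of l] max_pos disjoint_less[of p] finite_segs
        by (auto simp: into_def)
      then have "sum eps (below_le p) = 1"
        using balance_le[of p] balance_less[of p] max_pos above_le_eq[of p] by simp
      then show ?thesis using p by (simp add: E_def)
    next
      case (min_pos l r)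
      have "left_seg l = above_less p \<union> {l}"
        using seg_out[of l p] min_pos by (auto simp: left_seg_def)
      then have "sum eps (above_less p) = 1" using zero[of l] min_pos disjoint_less[of p] finite_segs
        by (auto simp: out_def)
      then have "sum eps (below_le p) = 1"
        using balance_less[of p] min_pos below_le_eq[of p] by simp
      then show ?thesis using p by (simp add: E_def)
    qed (auto simp: through_def maxima_def minima_def)
  next
    fix p assume a: "p \<in> through (-1) \<union> maxima (-1) \<union> minima (-1)"
    then have p: "p \<in> points"
      by (auto simp: through_def maxima_def minima_def points_iff)
    have "sum eps (below_le p) = 0"
      using p
    proof (cases rule: left_seg_cases)
      case (through_down s s') then show ?thesis using zero[of s] by (auto simp: into_def)
    next
      case (max_neg l r) then show ?thesis using zero[of r] by (auto simp: into_def)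
    next
      case (min_neg l r)
      then show ?thesis using zero[of r] balance_le[of p] by (auto simp: out_def)
    qed (use a in \<open>auto simp: through_def maxima_def minima_def doubleton_eq_iff\<close>)
    then show "p \<in> E" using p by (simp add: E_def)
  qed
  have "card (seg ` N) \<le> card E"
  proof (rule card_reachable_le[where a = below_le and b = above_le and r = "{}"])
    show "finite E" using finite_points by (simp add: E_def)
    show "finite (seg ` N)" using finite_C by (simp add: N_def)
    show "{} \<notin> seg ` N" using seg_self by (auto simp: N_def)
  next
    fix G assume G: "{} \<in> G" "\<And>p. p \<in> E \<Longrightarrow> below_le p \<in> G \<longleftrightarrow> above_le p \<in> G"
    \<comment> \<open>The gap on the left of \<open>p\<close> crosses the level as well. In the
      graph it is the gap on the right of \<open>q\<close>, the nearest point of the curve to the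
      left of \<open>p\<close>, or the leftmost gap if there is no such point.\<close>
    have less: "below_less p \<in> G \<longleftrightarrow> above_less p \<in> G" if "sum eps (below_less p) = 0" for p
    proof -
      define X where "X = {q \<in> points. snd q = snd p \<and> fst q < fst p}"
      have X: "tgt x \<in> X" if "x \<in> below_less p" for x using that by (simp add: X_def points_def below_less_def)
      have X': "src x \<in> X" if "x \<in> above_less p" for x using that by (simp add: X_def points_def above_less_def)
      show ?thesis
      proof (cases "X = {}")
        case True
        then have "below_less p = {}" "above_less p = {}" using X X' by blast+
        then show ?thesis by simp
      next
        case False
        have "finite X" using finite_points by (simp add: X_def)
        then obtain q where q: "q \<in> X" "\<And>q'. q' \<in> X \<Longrightarrow> fst q' \<le> fst q"
          using False ex_max_on[of X fst] by blast
        have qp: "q \<in> points" "snd q = snd p" "fst q < fst p" using q(1) by (auto simp: X_def)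
        have "below_less p = below_le q"
          using q(2)[OF X] qp by (auto simp: below_less_def below_le_def)
        moreover have "above_less p = above_le q"
          using q(2)[OF X'] qp by (auto simp: above_less_def above_le_def)
        moreover have "q \<in> E" using qp(1) that calculation by (simp add: E_def)
        ultimately show ?thesis using G(2) by simp
      qed
    qed
    define D where "D = {s \<in> C. left_seg s \<in> G}"
    have "D = C"
    proof (rule closed_eq_C)
      fix p t t' assume p: "p \<in> points" and t: "t \<in> into p \<union> out p" "t' \<in> into p \<union> out p" "t \<in> D"
      have "t' \<in> C" using t by (auto simp: into_def out_def)
      moreover have "left_seg t' \<in> G \<longleftrightarrow> left_seg t \<in> G"
        using p
      proof (cases rule: left_seg_cases)
        case (through_up s s')
        then have "sum eps (below_less p) = 0" using zero[of s] by (auto simp: into_def)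
        then show ?thesis using less[of p] through_up t by auto
      next
        case (through_down s s')
        then have "p \<in> E" using p zero[of s] by (auto simp: E_def into_def)
        then show ?thesis using G(2)[of p] through_down t by auto
      next
        case (max_neg l r)
        then have "p \<in> E" "sum eps (below_less p) = 0" using p zero[of r] zero[of l] by (auto simp: E_def into_def)
        then show ?thesis using G(2)[of p] less[of p] max_neg t by auto
      next
        case (min_neg l r)
        then have "sum eps (below_less p) = 0" using zero[of l] balance_less[of p] by (auto simp: out_def)
        moreover have "p \<in> E" using min_neg p calculation by (simp add: E_def)
        ultimately show ?thesis using G(2)[of p] less[of p] min_neg t by auto
      qed (use t in auto)
      ultimately show "t' \<in> D" using t by (simp add: D_def)
    qed (use s0 G(1) in \<open>auto simp: D_def\<close>)
    have "seg s \<in> G" if "s \<in> N" for s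
    proof -
      have "s \<in> D" using that \<open>D = C\<close> by (simp add: N_def)
      then have "left_seg s \<in> G" by (simp add: D_def)
      then show ?thesis using that by (simp add: left_seg_def N_def)
    qed
    then show "seg ` N \<subseteq> G" by blast
  qed
  moreover have "inj_on seg N"
  proof (rule inj_onI)
    fix s s' assume ss: "s \<in> N" "s' \<in> N" "seg s = seg s'"
    then have "s \<in> seg s'" "s' \<in> seg s" using seg_self by (auto simp: N_def)
    then show "s = s'" using xi_inj[of s s'] in_S by (auto simp: seg_def)
  qed
  ultimately have le: "card N \<le> card E" by (simp add: card_image)
  have disj: "through (-1) \<inter> maxima e = {}" "through (-1) \<inter> minima e = {}" "maxima e \<inter> minima e' = {}"
    "maxima 1 \<inter> maxima (-1) = {}" for e e'
    by (auto simp: through_def maxima_def minima_def doubleton_eq_iff)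
  have sub: "through e \<subseteq> points" "maxima e \<subseteq> points" "minima e \<subseteq> points" for e
    by (auto simp: through_def maxima_def minima_def points_iff)
  then have fin: "finite (through e)" "finite (maxima e)" "finite (minima e)" for e
    using finite_points finite_subset by metis+
  \<comment> \<open>The downward strands are counted by their upper ends: exactly one of them ends
    at every maximum of either kind.\<close>
  have "bij_betw tgt N (through (-1) \<union> maxima 1 \<union> maxima (-1))"
    unfolding bij_betw_def
  proof
    show "inj_on tgt N"
    proof (rule inj_onI)
      fix s s' assume ss: "s \<in> N" "s' \<in> N" "tgt s = tgt s'"
      then have i: "s \<in> into (tgt s)" "s' \<in> into (tgt s)" by (auto simp: N_def into_def)
      have "tgt s \<in> points" using ss by (auto simp: points_def N_def)
      then show "s = s'" by (cases rule: left_seg_cases) (use i ss in \<open>auto simp: N_def\<close>)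
    qed
    show "tgt ` N = through (-1) \<union> maxima 1 \<union> maxima (-1)"
    proof (intro set_eqI iffI)
      fix p assume "p \<in> tgt ` N"
      then obtain s where s: "s \<in> into p" "eps s = -1" by (auto simp: N_def into_def)
      then have "p \<in> points" by (auto simp: points_def into_def)
      then show "p \<in> through (-1) \<union> maxima 1 \<union> maxima (-1)"
      proof (cases rule: left_seg_cases)
        case (max_pos l r) then show ?thesis by (auto simp: maxima_def)
      next
        case (max_neg l r) then show ?thesis by (auto simp: maxima_def)
      qed (use s in \<open>auto simp: through_def\<close>)
    next
      fix p assume "p \<in> through (-1) \<union> maxima 1 \<union> maxima (-1)"
      then obtain s where "s \<in> into p" "eps s = -1" by (auto simp: through_def maxima_def)
      then show "p \<in> tgt ` N" by (auto simp: N_def into_def)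
    qed
  qed
  then have "card N = card (through (-1) \<union> maxima 1 \<union> maxima (-1))" by (rule bij_betw_same_card)
  also have "\<dots> = card (through (-1)) + card (maxima 1) + card (maxima (-1))"
    using disj fin by (simp add: card_Un_disjoint Int_Un_distrib2)
  finally have "card N = card (through (-1)) + card (maxima 1) + card (maxima (-1))" .
  \<comment> \<open>In \<open>card N \<le> card E\<close> the terms for \<open>through (-1)\<close>
    and \<open>maxima (-1)\<close> cancel.\<close>
  moreover have "card E = card (through (-1)) + card (maxima (-1)) + card (minima (-1))"
    unfolding E_eq using disj fin by (simp add: card_Un_disjoint Int_Un_distrib2)
  ultimately show ?thesis using le by simp
qed

end

text \<open>\<open>g\<close> is a conserved flow, in the application a single color, that restricts
  on the curve to the strands of direction \<open>e\<close>. Let \<open>W s\<close> be the amount of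
  flow to the left of \<open>s\<close>. The total of \<open>eps s * W s\<close> is the same whether
  grouped by upper or by lower ends of strands. Points where the curve passes through contribute
  equally to both. At a maximum or minimum the two strands see flows that differ by the flow on the
  left one, so exactly those of type \<open>-e\<close> contribute an extra
  \<open>-e\<close>.\<close>

lemma card_maxima_eq_minima:
  fixes g :: "'a \<Rightarrow> int"
  assumes e: "e = 1 \<or> e = -1"
    and flow: "\<And>p. (\<Sum>s | s \<in> S \<and> tgt s = p. g s) = (\<Sum>s | s \<in> S \<and> src s = p. g s)"
    and gC: "\<And>s. s \<in> C \<Longrightarrow> g s = (if eps s = e then 1 else 0)"
    and g_tgt: "\<And>s s'. s \<in> S - C \<Longrightarrow> s' \<in> C \<Longrightarrow> tgt s = tgt s' \<Longrightarrow> g s = 0"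
    and g_src: "\<And>s s'. s \<in> S - C \<Longrightarrow> s' \<in> C \<Longrightarrow> src s = src s' \<Longrightarrow> g s = 0"
  shows "card (maxima (-e)) = card (minima (-e))"
proof -
  define W where "W s = (\<Sum>s' | s' \<in> S \<and> snd (src s') = snd (src s) \<and> xi s' < xi s. g s')" for s
  define G where "G p = (\<Sum>s | s \<in> S \<and> snd (tgt s) = snd p \<and> fst (tgt s) < fst p. g s)" for p
  have fin: "finite {s \<in> S. P s}" for P using finite_S by simp
  \<comment> \<open>Conservation at all points of the level: the flow to the left of
    \<open>p\<close> is the same directly above the level as directly below it.\<close>
  have G': "G p = (\<Sum>s | s \<in> S \<and> snd (src s) = snd p \<and> fst (src s) < fst p. g s)" for p
  proof -
    define X where "X = {q \<in> src ` S \<union> tgt ` S. snd q = snd p \<and> fst q < fst p}"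
    have X: "finite X" using finite_S by (simp add: X_def)
    have "{s \<in> S. snd (tgt s) = snd p \<and> fst (tgt s) < fst p} = (\<Union>q\<in>X. {s \<in> S. tgt s = q})"
      by (auto simp: X_def)
    then have "G p = (\<Sum>q\<in>X. \<Sum>s | s \<in> S \<and> tgt s = q. g s)"
      unfolding G_def using X finite_S by (simp only:) (rule sum.UNION_disjoint; auto)
    also have "\<dots> = (\<Sum>q\<in>X. \<Sum>s | s \<in> S \<and> src s = q. g s)" by (simp add: flow)
    also have "\<dots> = sum g (\<Union>q\<in>X. {s \<in> S. src s = q})"
      by (rule sum.UNION_disjoint[symmetric]) (use X finite_S in auto)
    also have "(\<Union>q\<in>X. {s \<in> S. src s = q}) = {s \<in> S. snd (src s) = snd p \<and> fst (src s) < fst p}"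
      by (auto simp: X_def)
    finally show ?thesis .
  qed
  have W_in: "W s = G p + (\<Sum>s' | s' \<in> into p \<and> xi s' < xi s. g s')" if "s \<in> into p" for s p
  proof -
    have s: "s \<in> C" "s \<in> S" "tgt s = p" using that in_S by (auto simp: into_def)
    have eq: "{s' \<in> S. snd (src s') = snd (src s) \<and> xi s' < xi s} =
        {s \<in> S. snd (tgt s) = snd p \<and> fst (tgt s) < fst p} \<union> {s' \<in> S. tgt s' = p \<and> xi s' < xi s}"
    proof (intro set_eqI iffI)
      fix s' assume "s' \<in> {s' \<in> S. snd (src s') = snd (src s) \<and> xi s' < xi s}"
      then show "s' \<in> {s \<in> S. snd (tgt s) = snd p \<and> fst (tgt s) < fst p} \<union> {s' \<in> S. tgt s' = p \<and> xi s' < xi s}"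
        using same_slab[of s' s] xi_mono[of s' s] s by (auto simp: prod_eq_iff)
    next
      fix s' assume "s' \<in> {s \<in> S. snd (tgt s) = snd p \<and> fst (tgt s) < fst p} \<union> {s' \<in> S. tgt s' = p \<and> xi s' < xi s}"
      then show "s' \<in> {s' \<in> S. snd (src s') = snd (src s) \<and> xi s' < xi s}"
        using same_slab[of s' s] tgt_less_imp_xi_less[of s' s] s by auto
    qed
    have "W s = G p + (\<Sum>s' | s' \<in> S \<and> tgt s' = p \<and> xi s' < xi s. g s')"
      unfolding W_def G_def eq by (rule sum.union_disjoint) (use fin in auto)
    also have "(\<Sum>s' | s' \<in> S \<and> tgt s' = p \<and> xi s' < xi s. g s') = (\<Sum>s' | s' \<in> into p \<and> xi s' < xi s. g s')"
      by (rule sum.mono_neutral_right) (use fin in_S g_tgt[OF _ s(1)] s(3) in \<open>auto simp: into_def\<close>)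
    finally show ?thesis .
  qed
  have W_out: "W s = G p + (\<Sum>s' | s' \<in> out p \<and> xi s' < xi s. g s')" if "s \<in> out p" for s p
  proof -
    have s: "s \<in> C" "s \<in> S" "src s = p" using that in_S by (auto simp: out_def)
    have eq: "{s' \<in> S. snd (src s') = snd (src s) \<and> xi s' < xi s} =
        {s \<in> S. snd (src s) = snd p \<and> fst (src s) < fst p} \<union> {s' \<in> S. src s' = p \<and> xi s' < xi s}"
    proof (intro set_eqI iffI)
      fix s' assume "s' \<in> {s' \<in> S. snd (src s') = snd (src s) \<and> xi s' < xi s}"
      then show "s' \<in> {s \<in> S. snd (src s) = snd p \<and> fst (src s) < fst p} \<union> {s' \<in> S. src s' = p \<and> xi s' < xi s}"
        using xi_mono[of s' s] s by (auto simp: prod_eq_iff)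
    next
      fix s' assume "s' \<in> {s \<in> S. snd (src s) = snd p \<and> fst (src s) < fst p} \<union> {s' \<in> S. src s' = p \<and> xi s' < xi s}"
      then show "s' \<in> {s' \<in> S. snd (src s') = snd (src s) \<and> xi s' < xi s}"
        using src_less_imp_xi_less[of s' s] s by auto
    qed
    have "W s = G p + (\<Sum>s' | s' \<in> S \<and> src s' = p \<and> xi s' < xi s. g s')"
      unfolding W_def G' eq by (rule sum.union_disjoint) (use fin in auto)
    also have "(\<Sum>s' | s' \<in> S \<and> src s' = p \<and> xi s' < xi s. g s') = (\<Sum>s' | s' \<in> out p \<and> xi s' < xi s. g s')"
      by (rule sum.mono_neutral_right) (use fin in_S g_src[OF _ s(1)] s(3) in \<open>auto simp: out_def\<close>)
    finally show ?thesis .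
  qed
  have pair: "(\<Sum>s\<in>{l, r}. eps s * (c + (\<Sum>s' | s' \<in> {l, r} \<and> xi s' < xi s. g s'))) =
      c * (\<Sum>s\<in>{l, r}. eps s) + (if eps r = - e then - e else 0)"
    if "xi l < xi r" "eps l = - eps r" "l \<in> C" "r \<in> C" for l r c
  proof -
    have sets: "{s'. (s' = l \<or> s' = r) \<and> xi s' < xi l} = {}" "{s'. (s' = l \<or> s' = r) \<and> xi s' < xi r} = {l}" "l \<noteq> r"
      using that(1) by auto
    have "(\<Sum>s' | (s' = l \<or> s' = r) \<and> xi s' < xi l. g s') = 0"
      "(\<Sum>s' | (s' = l \<or> s' = r) \<and> xi s' < xi r. g s') = g l"
      unfolding sets by simp_all
    then have "(\<Sum>s\<in>{l, r}. eps s * (c + (\<Sum>s' | s' \<in> {l, r} \<and> xi s' < xi s. g s'))) =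
        eps l * c + eps r * (c + g l)" using sets(3) by simp
    also have "\<dots> = c * (eps l + eps r) + eps r * g l" by (simp add: algebra_simps)
    also have "eps r * g l = (if eps r = - e then - e else 0)"
      using gC[OF that(3)] eps[OF that(4)] e unfolding that(2) by (elim disjE) simp_all
    finally show ?thesis using sets(3) by simp
  qed
  have single: "{s'. s' = x \<and> xi s' < xi x} = {}" for x by auto
  have inp: "(\<Sum>s\<in>into p. eps s * W s) = G p * sum eps (into p) + (if p \<in> maxima (-e) then - e else 0)"
    if "p \<in> points" for p
  proof -
    have "(\<Sum>s\<in>into p. eps s * W s) = (\<Sum>s\<in>into p. eps s * (G p + (\<Sum>s' | s' \<in> into p \<and> xi s' < xi s. g s')))"
      by (rule sum.cong) (use W_in in auto)
    also have "\<dots> = G p * sum eps (into p) + (if p \<in> maxima (-e) then - e else 0)"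
      using that
    proof (cases rule: point_cases)
      case (max l r e')
      have "p \<in> maxima (-e) \<longleftrightarrow> eps r = - e"
        using max by (intro maxima_iff[of p l r]) auto
      moreover have "l \<in> C" "r \<in> C" using max by (auto simp: into_def)
      ultimately show ?thesis using pair[of l r "G p"] max by simp
    qed (auto simp: maxima_def single)
    finally show ?thesis .
  qed
  have outp: "(\<Sum>s\<in>out p. eps s * W s) = G p * sum eps (out p) + (if p \<in> minima (-e) then - e else 0)"
    if "p \<in> points" for p
  proof -
    have "(\<Sum>s\<in>out p. eps s * W s) = (\<Sum>s\<in>out p. eps s * (G p + (\<Sum>s' | s' \<in> out p \<and> xi s' < xi s. g s')))"
      by (rule sum.cong) (use W_out in auto)
    also have "\<dots> = G p * sum eps (out p) + (if p \<in> minima (-e) then - e else 0)"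
      using that
    proof (cases rule: point_cases)
      case (min l r e')
      have "p \<in> minima (-e) \<longleftrightarrow> eps r = - e"
        using min by (intro minima_iff[of p l r]) auto
      moreover have "l \<in> C" "r \<in> C" using min by (auto simp: out_def)
      ultimately show ?thesis using pair[of l r "G p"] min by simp
    qed (auto simp: minima_def single)
    finally show ?thesis .
  qed
  have sub: "maxima e \<subseteq> points" "minima e \<subseteq> points" for e
    by (auto simp: maxima_def minima_def points_iff)
  have "(\<Sum>p\<in>points. \<Sum>s\<in>into p. eps s * W s) = (\<Sum>p\<in>points. \<Sum>s\<in>out p. eps s * W s)"
    using sum_by_tgt[where Q = "\<lambda>_. True" and h = "\<lambda>s. eps s * W s"]
      sum_by_src[where Q = "\<lambda>_. True" and h = "\<lambda>s. eps s * W s"] by simp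
  moreover have "(\<Sum>p\<in>points. \<Sum>s\<in>into p. eps s * W s) =
      (\<Sum>p\<in>points. G p * sum eps (into p)) - e * int (card (maxima (-e)))"
  proof -
    have "(\<Sum>p\<in>points. if p \<in> maxima (-e) then - e else 0) = (\<Sum>p\<in>maxima (-e). - e)"
      by (rule sum.mono_neutral_cong_right) (use finite_points sub in auto)
    then show ?thesis using inp by (simp add: sum.distrib)
  qed
  moreover have "(\<Sum>p\<in>points. \<Sum>s\<in>out p. eps s * W s) =
      (\<Sum>p\<in>points. G p * sum eps (out p)) - e * int (card (minima (-e)))"
  proof -
    have "(\<Sum>p\<in>points. if p \<in> minima (-e) then - e else 0) = (\<Sum>p\<in>minima (-e). - e)"
      by (rule sum.mono_neutral_cong_right) (use finite_points sub in auto)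
    then show ?thesis using outp by (simp add: sum.distrib)
  qed
  moreover have "(\<Sum>p\<in>points. G p * sum eps (into p)) = (\<Sum>p\<in>points. G p * sum eps (out p))"
    by (rule sum.cong) (use into_out_sum in auto)
  ultimately show ?thesis using e by auto
qed

end

section \<open>Reflection and reversal of a closed curve\<close>

definition mirror :: "real \<times> complex \<Rightarrow> real \<times> complex" where
  "mirror p = (- fst p, snd p)"

lemma mirror_mirror [simp]: "mirror (mirror p) = p"
  by (simp add: mirror_def)

lemma mirror_eq_iff: "mirror p = q \<longleftrightarrow> p = mirror q"
  by (metis mirror_mirror)

lemma mirror_vimage: "{p. mirror p \<in> X} = mirror ` X"
proof (intro set_eqI iffI)
  fix p assume "p \<in> {p. mirror p \<in> X}"
  then show "p \<in> mirror ` X" by (intro image_eqI[of _ _ "mirror p"]) auto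
qed auto

context strand_curve
begin

text \<open>Reflection keeps the direction of every strand, hence the winding number, but exchanges
  left turns and right turns.\<close>

lemma mirror_strand_curve:
  "strand_curve S (\<lambda>s. mirror (src s)) (\<lambda>s. mirror (tgt s)) (\<lambda>s. - xi s) C eps"
proof unfold_locales
  show "finite S" by (rule finite_S)
  show "C \<subseteq> S" by (rule C_sub)
next
  fix s s' assume "s \<in> S" "s' \<in> S"
  then show "(snd (mirror (src s)) = snd (mirror (src s'))) = (snd (mirror (tgt s)) = snd (mirror (tgt s')))"
    using same_slab by (simp add: mirror_def)
next
  fix s s' assume "s \<in> S" "s' \<in> S" "snd (mirror (src s)) = snd (mirror (src s'))" "- xi s = - xi s'"
  then show "s = s'" using xi_inj by (simp add: mirror_def)
next
  fix s s' assume "s \<in> S" "s' \<in> S" "snd (mirror (src s)) = snd (mirror (src s'))" "- xi s < - xi s'"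
  then show "fst (mirror (src s)) \<le> fst (mirror (src s')) \<and> fst (mirror (tgt s)) \<le> fst (mirror (tgt s'))"
    using xi_mono[of s' s] by (simp add: mirror_def)
next
  fix s assume "s \<in> C" then show "eps s = 1 \<or> eps s = -1" by (rule eps)
next
  fix p assume "p \<in> (\<lambda>s. mirror (src s)) ` C \<union> (\<lambda>s. mirror (tgt s)) ` C"
  then have mp: "mirror p \<in> points" by (auto simp: points_def)
  have eq: "{s \<in> C. mirror (tgt s) = p} = into (mirror p)" "{s \<in> C. mirror (src s) = p} = out (mirror p)"
    by (auto simp: into_def out_def mirror_eq_iff)
  have "(\<exists>s s'. into (mirror p) = {s} \<and> out (mirror p) = {s'} \<and> eps s = eps s') \<or>
      (\<exists>l r. into (mirror p) = {l, r} \<and> out (mirror p) = {} \<and> - xi l < - xi r \<and> eps l = - eps r) \<or>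
      (\<exists>l r. out (mirror p) = {l, r} \<and> into (mirror p) = {} \<and> - xi l < - xi r \<and> eps l = - eps r)"
    using mp
  proof (cases rule: point_cases)
    case (through s s' e)
    then have "into (mirror p) = {s} \<and> out (mirror p) = {s'} \<and> eps s = eps s'" by simp
    then show ?thesis by blast
  next
    case (max l r e)
    then have "into (mirror p) = {r, l} \<and> out (mirror p) = {} \<and> - xi r < - xi l \<and> eps r = - eps l"
      by (simp add: insert_commute)
    then show ?thesis by blast
  next
    case (min l r e)
    then have "out (mirror p) = {r, l} \<and> into (mirror p) = {} \<and> - xi r < - xi l \<and> eps r = - eps l"
      by (simp add: insert_commute)
    then show ?thesis by blast
  qed
  then show "(\<exists>s s'. {s \<in> C. mirror (tgt s) = p} = {s} \<and> {s \<in> C. mirror (src s) = p} = {s'} \<and> eps s = eps s') \<or>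
      (\<exists>l r. {s \<in> C. mirror (tgt s) = p} = {l, r} \<and> {s \<in> C. mirror (src s) = p} = {} \<and> - xi l < - xi r \<and> eps l = - eps r) \<or>
      (\<exists>l r. {s \<in> C. mirror (src s) = p} = {l, r} \<and> {s \<in> C. mirror (tgt s) = p} = {} \<and> - xi l < - xi r \<and> eps l = - eps r)"
    unfolding eq .
next
  fix D assume D: "D \<subseteq> C" "D \<noteq> {}" "\<And>p s s'. s \<in> D \<Longrightarrow> s' \<in> C \<Longrightarrow> p \<in> {mirror (src s), mirror (tgt s)} \<Longrightarrow>
    p \<in> {mirror (src s'), mirror (tgt s')} \<Longrightarrow> s' \<in> D"
  show "D = C"
  proof (rule connected_C[OF D(1,2)])
    fix p s s' assume "s \<in> D" "s' \<in> C" "p \<in> {src s, tgt s}" "p \<in> {src s', tgt s'}"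
    then show "s' \<in> D" by (intro D(3)[of s s' "mirror p"]) auto
  qed
qed

lemma uminus_strand_curve: "strand_curve S src tgt xi C (\<lambda>s. - eps s)"
proof unfold_locales
  fix s assume "s \<in> C" then show "- eps s = 1 \<or> - eps s = -1" using eps by fastforce
next
  fix p assume "p \<in> src ` C \<union> tgt ` C"
  from local_type[OF this] show "(\<exists>s s'. {s \<in> C. tgt s = p} = {s} \<and> {s \<in> C. src s = p} = {s'} \<and> - eps s = - eps s') \<or>
      (\<exists>l r. {s \<in> C. tgt s = p} = {l, r} \<and> {s \<in> C. src s = p} = {} \<and> xi l < xi r \<and> - eps l = - (- eps r)) \<or>
      (\<exists>l r. {s \<in> C. src s = p} = {l, r} \<and> {s \<in> C. tgt s = p} = {} \<and> xi l < xi r \<and> - eps l = - (- eps r))"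
    by (simp only: neg_equal_iff_equal)
qed (use C_sub connected_C in auto)

text \<open>\<open>card_maxima_le\<close> for the curve and for its mirror image bounds the maxima
  of each kind by the minima of the other kind, and \<open>card_maxima_eq_minima\<close> turns these
  minima back into maxima. The two resulting inequalities are opposite.\<close>

lemma card_maxima_eq_aux:
  fixes g :: "int \<Rightarrow> 'a \<Rightarrow> int"
  assumes winding: "0 < (\<Sum>s | s \<in> C \<and> snd (src s) = z. eps s)"
    and flow: "\<And>e p. e = 1 \<or> e = -1 \<Longrightarrow> (\<Sum>s | s \<in> S \<and> tgt s = p. g e s) = (\<Sum>s | s \<in> S \<and> src s = p. g e s)"
    and gC: "\<And>e s. e = 1 \<or> e = -1 \<Longrightarrow> s \<in> C \<Longrightarrow> g e s = (if eps s = e then 1 else 0)"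
    and g_tgt: "\<And>e s s'. e = 1 \<or> e = -1 \<Longrightarrow> s \<in> S - C \<Longrightarrow> s' \<in> C \<Longrightarrow> tgt s = tgt s' \<Longrightarrow> g e s = 0"
    and g_src: "\<And>e s s'. e = 1 \<or> e = -1 \<Longrightarrow> s \<in> S - C \<Longrightarrow> s' \<in> C \<Longrightarrow> src s = src s' \<Longrightarrow> g e s = 0"
  shows "card (maxima 1) = card (maxima (-1))"
proof -
  interpret M: strand_curve S "\<lambda>s. mirror (src s)" "\<lambda>s. mirror (tgt s)" "\<lambda>s. - xi s" C eps
    by (rule mirror_strand_curve)
  have inj: "inj_on mirror X" for X by (rule inj_on_inverseI[of _ mirror]) simp
  have io: "M.into p = into (mirror p)" "M.out p = out (mirror p)" for p
    by (auto simp: M.into_def M.out_def into_def out_def mirror_eq_iff)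
  have "M.maxima 1 = {p. mirror p \<in> maxima (-1)}"
  proof (intro set_eqI iffI)
    fix p assume "p \<in> M.maxima 1"
    then obtain l r where "into (mirror p) = {r, l}" "out (mirror p) = {}" "xi r < xi l" "eps l = -1" "eps r = 1"
      by (auto simp: M.maxima_def io insert_commute)
    then show "p \<in> {p. mirror p \<in> maxima (-1)}" by (auto simp: maxima_def)
  next
    fix p assume "p \<in> {p. mirror p \<in> maxima (-1)}"
    then obtain l r where "into (mirror p) = {r, l}" "out (mirror p) = {}" "xi l < xi r" "eps l = 1" "eps r = -1"
      by (auto simp: maxima_def insert_commute)
    then have "M.into p = {r, l}" "M.out p = {}" "- xi r < - xi l" "eps r = -1" "eps l = 1" by (simp_all add: io)
    then show "p \<in> M.maxima 1" unfolding M.maxima_def by blast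
  qed
  moreover have "M.minima (-1) = {p. mirror p \<in> minima 1}"
  proof (intro set_eqI iffI)
    fix p assume "p \<in> M.minima (-1)"
    then obtain l r where "out (mirror p) = {r, l}" "into (mirror p) = {}" "xi r < xi l" "eps l = 1" "eps r = -1"
      by (auto simp: M.minima_def io insert_commute)
    then show "p \<in> {p. mirror p \<in> minima 1}" by (auto simp: minima_def)
  next
    fix p assume "p \<in> {p. mirror p \<in> minima 1}"
    then obtain l r where "out (mirror p) = {r, l}" "into (mirror p) = {}" "xi l < xi r" "eps l = -1" "eps r = 1"
      by (auto simp: minima_def insert_commute)
    then have "M.out p = {r, l}" "M.into p = {}" "- xi r < - xi l" "eps r = - (-1)" "eps l = -1" by (simp_all add: io)
    then show "p \<in> M.minima (-1)" unfolding M.minima_def by blast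
  qed
  ultimately have "M.maxima 1 = mirror ` maxima (-1)" "M.minima (-1) = mirror ` minima 1"
    by (simp_all only: mirror_vimage)
  then have cards: "card (M.maxima 1) = card (maxima (-1))" "card (M.minima (-1)) = card (minima 1)"
    by (simp_all add: card_image inj)
  have "0 < (\<Sum>s | s \<in> C \<and> snd (mirror (src s)) = z. eps s)" using winding by (simp add: mirror_def)
  then have "card (maxima (-1)) \<le> card (minima 1)"
    using M.card_maxima_le[of z] cards by simp
  moreover have "card (maxima 1) \<le> card (minima (-1))" using card_maxima_le[OF winding] .
  moreover have "card (maxima (-e)) = card (minima (-e))" if "e = 1 \<or> e = -1" for e
    by (rule card_maxima_eq_minima[OF that flow[OF that] gC[OF that] g_tgt[OF that] g_src[OF that]])
  from this[of 1] this[of "-1"] have "card (maxima (-1)) = card (minima (-1))" "card (maxima 1) = card (minima 1)"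
    by simp_all
  ultimately show ?thesis by simp
qed

text \<open>A curve of negative winding is reversed first. Reversal exchanges the two directions, so
  the flows are reindexed by \<open>-e\<close>.\<close>

lemma card_maxima_eq:
  fixes g :: "int \<Rightarrow> 'a \<Rightarrow> int"
  assumes winding: "(\<Sum>s | s \<in> C \<and> snd (src s) = z. eps s) \<noteq> 0"
    and flow: "\<And>e p. e = 1 \<or> e = -1 \<Longrightarrow> (\<Sum>s | s \<in> S \<and> tgt s = p. g e s) = (\<Sum>s | s \<in> S \<and> src s = p. g e s)"
    and gC: "\<And>e s. e = 1 \<or> e = -1 \<Longrightarrow> s \<in> C \<Longrightarrow> g e s = (if eps s = e then 1 else 0)"
    and g_tgt: "\<And>e s s'. e = 1 \<or> e = -1 \<Longrightarrow> s \<in> S - C \<Longrightarrow> s' \<in> C \<Longrightarrow> tgt s = tgt s' \<Longrightarrow> g e s = 0"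
    and g_src: "\<And>e s s'. e = 1 \<or> e = -1 \<Longrightarrow> s \<in> S - C \<Longrightarrow> s' \<in> C \<Longrightarrow> src s = src s' \<Longrightarrow> g e s = 0"
  shows "card (maxima 1) = card (maxima (-1))"
proof (cases "0 < (\<Sum>s | s \<in> C \<and> snd (src s) = z. eps s)")
  case True
  show ?thesis
  proof (rule card_maxima_eq_aux[where g = g and z = z])
    show "0 < (\<Sum>s | s \<in> C \<and> snd (src s) = z. eps s)" by (rule True)
  qed (fact flow gC g_tgt g_src)+
next
  case False
  interpret N: strand_curve S src tgt xi C "\<lambda>s. - eps s" by (rule uminus_strand_curve)
  have eq: "N.maxima e = maxima (-e)" for e
  proof -
    have "- eps s = e \<longleftrightarrow> eps s = - e" for s by auto
    then show ?thesis unfolding N.maxima_def maxima_def by simp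
  qed
  have "card (N.maxima 1) = card (N.maxima (-1))"
  proof (rule N.card_maxima_eq_aux[of z "\<lambda>e. g (-e)"])
    show "0 < (\<Sum>s | s \<in> C \<and> snd (src s) = z. - eps s)"
      using False winding by (simp add: sum_negf)
    fix e :: int assume e: "e = 1 \<or> e = -1"
    then have e': "- e = 1 \<or> - e = -1" by auto
    show "(\<Sum>s | s \<in> S \<and> tgt s = p. g (- e) s) = (\<Sum>s | s \<in> S \<and> src s = p. g (- e) s)" for p
      by (rule flow[OF e'])
    show "g (- e) s = (if - eps s = e then 1 else 0)" if "s \<in> C" for s
      using gC[OF e' that] by auto
    show "g (- e) s = 0" if "s \<in> S - C" "s' \<in> C" "tgt s = tgt s'" for s s' using g_tgt[OF e' that] .
    show "g (- e) s = 0" if "s \<in> S - C" "s' \<in> C" "src s = src s'" for s s' using g_src[OF e' that] .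
  qed
  then show ?thesis by (simp add: eq)
qed

end

section \<open>Levels and strands\<close>

lemma cis_eq_iff: "cis (2 * pi * s) = cis (2 * pi * t) \<longleftrightarrow> s - t \<in> \<int>"
proof
  assume "cis (2 * pi * s) = cis (2 * pi * t)"
  then have "sin (2 * pi * s) = sin (2 * pi * t) \<and> cos (2 * pi * s) = cos (2 * pi * t)"
    by (simp add: complex_eq_iff)
  then obtain n :: int where "2 * pi * s = 2 * pi * t + 2 * pi * n"
    unfolding sin_cos_eq_iff by blast
  then have "2 * pi * (s - t) = 2 * pi * n" by (simp add: algebra_simps)
  then have "s - t = n" by simp
  then show "s - t \<in> \<int>" by simp
next
  assume "s - t \<in> \<int>"
  then obtain n where "s - t = of_int n" by (elim Ints_cases)
  then have "s = t + of_int n" by simp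
  then have "2 * pi * s = 2 * pi * t + 2 * pi * of_int n" by (simp add: distrib_left)
  then have "sin (2 * pi * s) = sin (2 * pi * t) \<and> cos (2 * pi * s) = cos (2 * pi * t)"
    unfolding sin_cos_eq_iff by blast
  then show "cis (2 * pi * s) = cis (2 * pi * t)" by (simp add: complex_eq_iff)
qed

locale web_context =
  fixes w :: "'e web"
  assumes web: "annular_web w"
begin

lemma finite_verts: "finite (verts w)" and finite_edges: "finite (edges w)"
  and verts_eq: "verts w = merges w \<union> splits w"
  using web unfolding annular_web_def by - ((elim conjE), assumption)+

lemma thick_conservation:
  assumes "v \<in> verts w"
  shows "(\<Sum>e\<in>in_edges w v. thick w e) = (\<Sum>e\<in>out_edges w v. thick w e)"
proof -
  have "\<forall>v\<in>verts w. (\<Sum>e\<in>in_edges w v. thick w e) = (\<Sum>e\<in>out_edges w v. thick w e)"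
    using web unfolding annular_web_def by (elim conjE) assumption
  then show ?thesis using assms by (rule bspec)
qed

lemma edge_props:
  assumes "e \<in> edges w"
  shows "simple_path (curve w e)" "path_image (curve w e) \<subseteq> annulus" "upward (curve w e)" "0 < thick w e"
    "pathstart (curve w e) \<in> verts w \<and> pathfinish (curve w e) \<in> verts w \<and> curve w e ` {0<..<1} \<inter> verts w = {}
     \<or> pathstart (curve w e) = pathfinish (curve w e) \<and> path_image (curve w e) \<inter> verts w = {}"
proof -
  have "\<forall>e\<in>edges w. simple_path (curve w e) \<and> path_image (curve w e) \<subseteq> annulus \<and> upward (curve w e) \<and>
        0 < thick w e \<and>
        (pathstart (curve w e) \<in> verts w \<and> pathfinish (curve w e) \<in> verts w \<and>
           curve w e ` {0<..<1} \<inter> verts w = {}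
         \<or> pathstart (curve w e) = pathfinish (curve w e) \<and>
           path_image (curve w e) \<inter> verts w = {})"
    using web unfolding annular_web_def by (elim conjE) assumption
  from bspec[OF this assms] show "simple_path (curve w e)" "path_image (curve w e) \<subseteq> annulus"
    "upward (curve w e)" "0 < thick w e"
    "pathstart (curve w e) \<in> verts w \<and> pathfinish (curve w e) \<in> verts w \<and> curve w e ` {0<..<1} \<inter> verts w = {}
     \<or> pathstart (curve w e) = pathfinish (curve w e) \<and> path_image (curve w e) \<inter> verts w = {}"
    by - ((elim conjE), assumption)+
qed

lemma edges_disjoint:
  assumes "e \<in> edges w" "e' \<in> edges w" "e \<noteq> e'"
  shows "path_image (curve w e) \<inter> path_image (curve w e') \<subseteq> verts w"
proof -
  have "\<forall>e\<in>edges w. \<forall>e'\<in>edges w. e \<noteq> e' \<longrightarrow>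
        path_image (curve w e) \<inter> path_image (curve w e') \<subseteq> verts w"
    using web unfolding annular_web_def by (elim conjE) assumption
  from bspec[OF bspec[OF this assms(1)] assms(2)] assms(3) show ?thesis by (rule mp)
qed

text \<open>A lift is determined only up to an integer. Fixing one makes each edge a graph over an
  interval of heights, with \<open>pos\<close> as horizontal coordinate.\<close>

definition height :: "'e \<Rightarrow> real \<Rightarrow> real" where
  "height e = (SOME h. continuous_on {0..1} h \<and> strict_mono_on {0..1} h \<and>
      (\<forall>s\<in>{0..1}. snd (curve w e s) = cis (2 * pi * h s)))"

definition low where "low e = height e 0"
definition high where "high e = height e 1"
definition pos where "pos e t = fst (curve w e (the_inv_into {0..1} (height e) t))"
definition pt where "pt e t = (pos e t, cis (2 * pi * t))"

lemma snd_pt [simp]: "snd (pt e t) = cis (2 * pi * t)" and fst_pt [simp]: "fst (pt e t) = pos e t"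
  by (simp_all add: pt_def)

context
  fixes e assumes e: "e \<in> edges w"
begin

lemma height_props:
  "continuous_on {0..1} (height e)" "strict_mono_on {0..1} (height e)"
  "s \<in> {0..1} \<Longrightarrow> snd (curve w e s) = cis (2 * pi * height e s)"
proof -
  have "\<exists>h. continuous_on {0..1} h \<and> strict_mono_on {0..1} h \<and>
      (\<forall>s\<in>{0..1}. snd (curve w e s) = cis (2 * pi * h s))"
    using edge_props(3)[OF e] by (simp add: upward_def)
  from someI_ex[OF this] show "continuous_on {0..1} (height e)" "strict_mono_on {0..1} (height e)"
    "s \<in> {0..1} \<Longrightarrow> snd (curve w e s) = cis (2 * pi * height e s)"
    unfolding height_def[symmetric] by blast+
qed

lemma height_inj: "inj_on (height e) {0..1}"
  using height_props(2) by (rule strict_mono_on_imp_inj_on)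

lemma low_less_high: "low e < high e"
  unfolding low_def high_def using strict_mono_onD[OF height_props(2), of 0 1] by simp

lemma height_image: "height e ` {0..1} = {low e..high e}"
proof
  have mono: "height e s \<le> height e t" if "0 \<le> s" "s \<le> t" "t \<le> 1" for s t
    using strict_mono_onD[OF height_props(2), of s t] that by (cases "s = t") auto
  show "height e ` {0..1} \<subseteq> {low e..high e}" using mono by (auto simp: low_def high_def)
  show "{low e..high e} \<subseteq> height e ` {0..1}"
  proof
    fix y assume "y \<in> {low e..high e}"
    then show "y \<in> height e ` {0..1}"
      using IVT'[of "height e" 0 y 1] height_props(1) by (auto simp: low_def high_def)
  qed
qed

lemma curve_eq_pt: "s \<in> {0..1} \<Longrightarrow> curve w e s = pt e (height e s)"
  using height_props(3)[of s] the_inv_into_f_f[OF height_inj] by (simp add: pt_def pos_def prod_eq_iff)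

lemma path_image_eq: "path_image (curve w e) = pt e ` {low e..high e}"
  unfolding path_image_def height_image[symmetric] image_image
  by (rule image_cong) (simp_all add: curve_eq_pt)

lemma continuous_pos: "continuous_on {low e..high e} (pos e)"
proof -
  have inv: "continuous_on {low e..high e} (the_inv_into {0..1} (height e))"
    using continuous_on_inv_into[OF height_props(1) _ height_inj] height_image by simp
  have img: "the_inv_into {0..1} (height e) ` {low e..high e} \<subseteq> {0..1}"
    using the_inv_into_into[OF height_inj _ subset_refl] height_image by blast
  have "path (curve w e)" using edge_props(1)[OF e] by (rule simple_path_imp_path)
  then have "continuous_on {0..1} (\<lambda>s. fst (curve w e s))"
    unfolding path_def by (rule continuous_on_fst)
  from continuous_on_compose2[OF this inv img] show ?thesis by (simp add: pos_def[abs_def])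
qed

lemma pathstart_eq: "pathstart (curve w e) = pt e (low e)"
  and pathfinish_eq: "pathfinish (curve w e) = pt e (high e)"
  using curve_eq_pt[of 0] curve_eq_pt[of 1] by (simp_all add: pathstart_def pathfinish_def low_def high_def)

lemma pt_in_image: "t \<in> {low e..high e} \<Longrightarrow> pt e t \<in> path_image (curve w e)"
  by (simp add: path_image_eq)

lemma pt_inj:
  assumes "t \<in> {low e..high e}" "t' \<in> {low e..high e}" "pt e t = pt e t'"
  shows "t = t' \<or> t = low e \<and> t' = high e \<or> t = high e \<and> t' = low e"
proof -
  obtain s where s: "s \<in> {0..1}" "t = height e s" using assms(1) height_image by blast
  obtain s' where s': "s' \<in> {0..1}" "t' = height e s'" using assms(2) height_image by blast
  have "curve w e s = curve w e s'" using assms(3) s s' by (simp add: curve_eq_pt)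
  moreover have "loop_free (curve w e)" using edge_props(1)[OF e] by (simp add: simple_path_def)
  ultimately have "s = s' \<or> s = 0 \<and> s' = 1 \<or> s = 1 \<and> s' = 0"
    using s(1) s'(1) by (auto simp: loop_free_def)
  then show ?thesis using s s' by (auto simp: low_def high_def)
qed

lemma pt_interior_not_vertex:
  assumes "low e < t" "t < high e" shows "pt e t \<notin> verts w"
proof -
  have "t \<in> {low e..high e}" using assms by simp
  then obtain s where s: "s \<in> {0..1}" "t = height e s" using height_image by blast
  then have "s \<noteq> 0" "s \<noteq> 1" using assms by (auto simp: low_def high_def)
  then have "s \<in> {0<..<1}" using s(1) by auto
  then have "pt e t \<in> curve w e ` {0<..<1}" "pt e t \<in> path_image (curve w e)"
    using s curve_eq_pt by (auto simp: path_image_def)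
  then show ?thesis using edge_props(5)[OF e] by blast
qed

lemma ends_cases:
  obtains (arc) "pt e (low e) \<in> verts w" "pt e (high e) \<in> verts w"
  | (circle) "pt e (low e) = pt e (high e)" "\<And>t. t \<in> {low e..high e} \<Longrightarrow> pt e t \<notin> verts w"
  using edge_props(5)[OF e] pathstart_eq pathfinish_eq pt_in_image by (metis disjoint_iff)

lemma pt_annulus: "t \<in> {low e..high e} \<Longrightarrow> pt e t \<in> annulus"
  using pt_in_image edge_props(2)[OF e] by blast

end

lemma pt_eq_vertex:
  assumes "e \<in> edges w" "e' \<in> edges w" "e \<noteq> e'" "t \<in> {low e..high e}" "t' \<in> {low e'..high e'}" "pt e t = pt e' t'"
  shows "pt e t \<in> verts w"
  using edges_disjoint[OF assms(1-3)] pt_in_image[OF assms(1,4)] pt_in_image[OF assms(2,5)] assms(6) by auto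

text \<open>The same choice as in \<open>web_degree\<close>, so that the degree is a count of
  crossings at this very angle.\<close>

definition base_point :: complex where
  "base_point = (SOME z. z \<in> sphere 0 1 \<and> z \<notin> snd ` verts w)"

lemma base_point: "base_point \<in> sphere 0 1" "base_point \<notin> snd ` verts w"
proof -
  have inj: "inj_on (\<lambda>t. cis (2 * pi * t)) {0<..<1::real}"
  proof (rule inj_onI)
    fix s t :: real assume st: "s \<in> {0<..<1}" "t \<in> {0<..<1}" "cis (2 * pi * s) = cis (2 * pi * t)"
    then obtain n where "s - t = of_int n" unfolding cis_eq_iff by (elim Ints_cases)
    moreover have "\<bar>s - t\<bar> < 1" using st by auto
    ultimately have "n = 0" by linarith
    then show "s = t" using \<open>s - t = of_int n\<close> by simp
  qed
  have "infinite ((\<lambda>t. cis (2 * pi * t)) ` {0<..<1::real})"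
    using finite_imageD[OF _ inj] infinite_Ioo[of 0 "1::real"] by auto
  moreover have "finite (snd ` verts w)" using finite_verts by simp
  ultimately obtain z where "z \<in> (\<lambda>t. cis (2 * pi * t)) ` {0<..<1::real}" "z \<notin> snd ` verts w"
    by (metis finite_subset subsetI)
  moreover from this have "z \<in> sphere 0 1" by auto
  ultimately have "\<exists>z. z \<in> sphere 0 1 \<and> z \<notin> snd ` verts w" by blast
  from someI_ex[OF this] show "base_point \<in> sphere 0 1" "base_point \<notin> snd ` verts w"
    unfolding base_point_def by blast+
qed

definition base_angle :: real where "base_angle = Arg base_point / (2 * pi)"

lemma cis_base_angle: "cis (2 * pi * base_angle) = base_point"
proof -
  have "base_point \<noteq> 0" "norm base_point = 1" using base_point(1) by auto
  then have "base_point = cis (Arg base_point)" by (simp add: cis_Arg sgn_div_norm)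
  then show ?thesis by (simp add: base_angle_def)
qed

text \<open>\<open>lev\<close> enumerates increasingly all heights that agree modulo \<open>1\<close> with the base angle or with an
  end of an edge, and \<open>nlev\<close> of them make up one turn.\<close>

definition residues :: "real set" where
  "residues = (\<lambda>u. frac (u - base_angle)) ` insert base_angle (low ` edges w \<union> high ` edges w)"

definition nlev :: nat where "nlev = card residues"

definition lev :: "int \<Rightarrow> real" where
  "lev N = base_angle + sorted_list_of_set residues ! nat (N mod int nlev) + of_int (N div int nlev)"

lemma finite_residues: "finite residues" by (simp add: residues_def finite_edges)

lemma nlev_pos: "0 < nlev"
  unfolding nlev_def using finite_residues by (simp add: card_gt_0_iff residues_def)

lemma residues_range: "r \<in> residues \<Longrightarrow> 0 \<le> r \<and> r < 1"
  by (auto simp: residues_def frac_lt_1)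

lemma nth_residues:
  assumes "i < nlev"
  shows "sorted_list_of_set residues ! i \<in> residues"
    "j < i \<Longrightarrow> sorted_list_of_set residues ! j < sorted_list_of_set residues ! i"
proof -
  have len: "length (sorted_list_of_set residues) = nlev" by (simp add: nlev_def)
  show "sorted_list_of_set residues ! i \<in> residues"
    using nth_mem[of i "sorted_list_of_set residues"] assms len finite_residues by simp
  show "j < i \<Longrightarrow> sorted_list_of_set residues ! j < sorted_list_of_set residues ! i"
    using strict_sorted_list_of_set[of residues] assms len by (simp add: sorted_wrt_iff_nth_less)
qed

lemma residues_index:
  assumes "r \<in> residues" obtains i where "i < nlev" "sorted_list_of_set residues ! i = r"
  using assms finite_residues by (metis in_set_conv_nth length_sorted_list_of_set nlev_def set_sorted_list_of_set)

lemma lev_add_period: "lev (N + m * int nlev) = lev N + of_int m"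
  using nlev_pos by (simp add: lev_def)

lemma lev_step: "lev N < lev (N + 1)"
proof (cases "N mod int nlev = int nlev - 1")
  case True
  have "N + 1 = (N div int nlev + 1) * int nlev"
    using div_mult_mod_eq[of N "int nlev"] unfolding True by (simp add: algebra_simps)
  then have "(N + 1) mod int nlev = 0" "(N + 1) div int nlev = N div int nlev + 1"
    using nlev_pos by simp_all
  moreover have "nat (N mod int nlev) < nlev" using nlev_pos by (simp add: nat_less_iff)
  then have "sorted_list_of_set residues ! nat (N mod int nlev) < 1" "0 \<le> sorted_list_of_set residues ! 0"
    using nth_residues(1) residues_range nlev_pos by blast+
  ultimately show ?thesis by (simp add: lev_def)
next
  case False
  have r: "0 \<le> N mod int nlev" "N mod int nlev < int nlev" using nlev_pos by simp_all
  then have lt: "N mod int nlev + 1 < int nlev" using False by simp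
  have N: "N + 1 = int nlev * (N div int nlev) + (N mod int nlev + 1)" by simp
  have "(N + 1) mod int nlev = N mod int nlev + 1"
    by (rule int_mod_pos_eq[OF N]) (use lt r in simp_all)
  moreover have "(N + 1) div int nlev = N div int nlev"
    by (rule int_div_pos_eq[OF N]) (use lt r in simp_all)
  ultimately show ?thesis
    using nth_residues(2)[of "nat (N mod int nlev + 1)" "nat (N mod int nlev)"] lt r
    by (simp add: lev_def nat_less_iff)
qed

lemma lev_strict_mono: "M < N \<Longrightarrow> lev M < lev N"
proof (induction N rule: int_gr_induct)
  case base then show ?case by (rule lev_step)
next
  case (step N) then show ?case using lev_step[of N] by simp
qed

lemma lev_less_iff [simp]: "lev M < lev N \<longleftrightarrow> M < N"
  using lev_strict_mono[of M N] lev_strict_mono[of N M] by (cases M N rule: linorder_cases) auto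

lemma lev_le_iff [simp]: "lev M \<le> lev N \<longleftrightarrow> M \<le> N"
  using lev_less_iff[of N M] by (simp only: linorder_not_less[symmetric])

lemma lev_eq_iff [simp]: "lev M = lev N \<longleftrightarrow> M = N"
  using lev_le_iff[of M N] lev_le_iff[of N M] by (metis order_antisym order_refl)

lemma residue_lev:
  assumes "frac (u - base_angle) \<in> residues"
  obtains N where "lev N = u"
proof -
  obtain i where i: "i < nlev" "sorted_list_of_set residues ! i = frac (u - base_angle)"
    using residues_index[OF assms] .
  have "lev (int i + \<lfloor>u - base_angle\<rfloor> * int nlev) = lev (int i) + of_int \<lfloor>u - base_angle\<rfloor>"
    by (rule lev_add_period)
  also have "lev (int i) = base_angle + frac (u - base_angle)" using i by (simp add: lev_def)
  finally show ?thesis using that by (simp add: frac_def)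
qed

lemma low_lev: "e \<in> edges w \<Longrightarrow> \<exists>N. lev N = low e" and high_lev: "e \<in> edges w \<Longrightarrow> \<exists>N. lev N = high e"
  by (metis residue_lev residues_def UnCI image_eqI insertI2)+

text \<open>\<open>0\<close>, the residue of the base angle, is the smallest one. Hence the slabs
  whose index is divisible by \<open>nlev\<close> are those starting at the base angle.\<close>

lemma lev_0: "lev 0 = base_angle"
proof -
  have "(0::real) \<in> residues" by (auto simp: residues_def image_iff)
  then obtain i where i: "i < nlev" "sorted_list_of_set residues ! i = 0" using residues_index by blast
  have "i = 0"
  proof (rule ccontr)
    assume "i \<noteq> 0"
    then have "sorted_list_of_set residues ! 0 < 0" using nth_residues(2)[of i 0] i by simp
    moreover have "0 \<le> sorted_list_of_set residues ! 0" using nth_residues(1)[of 0] residues_range nlev_pos by blast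
    ultimately show False by simp
  qed
  then show ?thesis using i by (simp add: lev_def)
qed

lemma lev_diff_int: "lev M - lev N \<in> \<int> \<longleftrightarrow> int nlev dvd M - N"
proof
  assume "lev M - lev N \<in> \<int>"
  then obtain m where "lev M - lev N = of_int m" by (elim Ints_cases)
  then have "lev M = lev (N + m * int nlev)" by (simp add: lev_add_period)
  then show "int nlev dvd M - N" by simp
next
  assume "int nlev dvd M - N"
  then obtain m where "M - N = int nlev * m" by (elim dvdE)
  then have "M = N + m * int nlev" by (simp add: algebra_simps)
  then show "lev M - lev N \<in> \<int>" by (simp add: lev_add_period)
qed

lemma lev_cover:
  obtains N where "lev N \<le> t" "t < lev (N + 1)"
proof -
  define m where "m = \<lfloor>t - base_angle\<rfloor>"
  have lo: "lev (m * int nlev) \<le> t"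
    using lev_add_period[of 0 m] by (simp add: lev_0 m_def) linarith
  have hi: "t < lev ((m + 1) * int nlev)"
    using lev_add_period[of 0 "m + 1"] by (simp add: lev_0 m_def) linarith
  define A where "A = {N \<in> {m * int nlev..(m + 1) * int nlev}. lev N \<le> t}"
  have A: "finite A" by (rule finite_subset[of _ "{m * int nlev..(m + 1) * int nlev}"]) (auto simp: A_def)
  have mA: "m * int nlev \<in> A" using lo by (auto simp: A_def algebra_simps)
  have "Max A \<in> A" using A mA by (intro Max_in) auto
  then have N: "lev (Max A) \<le> t" "m * int nlev \<le> Max A" "Max A \<le> (m + 1) * int nlev" by (auto simp: A_def)
  have "t < lev (Max A + 1)"
  proof (rule ccontr)
    assume "\<not> t < lev (Max A + 1)"
    then have le: "lev (Max A + 1) \<le> t" by simp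
    then have "lev (Max A + 1) < lev ((m + 1) * int nlev)" using hi by (rule le_less_trans)
    then have "Max A + 1 < (m + 1) * int nlev" by (simp only: lev_less_iff)
    then have "Max A + 1 \<in> A" using le N by (auto simp: A_def)
    then have "Max A + 1 \<le> Max A" using A by (rule Max_ge[rotated])
    then show False by simp
  qed
  then show ?thesis using that N(1) by blast
qed

section \<open>Strands and their order inside a slab\<close>

definition start :: "'e \<Rightarrow> int" where "start e = (SOME N. lev N = low e)"
definition stop :: "'e \<Rightarrow> int" where "stop e = (SOME N. lev N = high e)"

lemma lev_start: "e \<in> edges w \<Longrightarrow> lev (start e) = low e"
  unfolding start_def using low_lev by (rule someI_ex)

lemma lev_stop: "e \<in> edges w \<Longrightarrow> lev (stop e) = high e"
  unfolding stop_def using high_lev by (rule someI_ex)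

lemma start_less_stop: "e \<in> edges w \<Longrightarrow> start e < stop e"
  using low_less_high[of e] lev_start[of e] lev_stop[of e] by (metis lev_less_iff)

text \<open>\<open>(e, N)\<close> stands for the part of \<open>e\<close> between the heights
  \<open>lev N\<close> and \<open>lev (N + 1)\<close>. An edge that winds several times has several
  strands in one slab, whose indices are congruent modulo \<open>nlev\<close>.\<close>

definition strand_set :: "('e \<times> int) set" where
  "strand_set = (SIGMA e:edges w. {start e..<stop e})"

definition src :: "'e \<times> int \<Rightarrow> real \<times> complex" where "src s = pt (fst s) (lev (snd s))"
definition tgt :: "'e \<times> int \<Rightarrow> real \<times> complex" where "tgt s = pt (fst s) (lev (snd s + 1))"
definition mid :: "int \<Rightarrow> real" where "mid N = (lev N + lev (N + 1)) / 2"
text \<open>Strands may meet in a vertex at the boundary of a slab, so their order is read off at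
  the middle height. By \<open>pos_less\<close> it is the same at every interior height.\<close>

definition xi :: "'e \<times> int \<Rightarrow> real" where "xi s = pos (fst s) (mid (snd s))"

lemma finite_strand_set: "finite strand_set"
  by (simp add: strand_set_def finite_edges)

lemma strandD:
  assumes "(e, N) \<in> strand_set"
  shows "e \<in> edges w" "low e \<le> lev N" "lev (N + 1) \<le> high e"
  using assms lev_start[of e] lev_stop[of e] lev_le_iff[of "start e" N] lev_le_iff[of "N + 1" "stop e"]
  by (auto simp: strand_set_def)

lemma mid_between: "lev N < mid N" "mid N < lev (N + 1)"
  using lev_step[of N] by (auto simp: mid_def)

lemma slab_src: "snd (src (e, N)) = snd (src (e', N')) \<longleftrightarrow> int nlev dvd N - N'"
  by (simp add: src_def cis_eq_iff lev_diff_int)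

lemma slab_tgt: "snd (tgt (e, N)) = snd (tgt (e', N')) \<longleftrightarrow> int nlev dvd N - N'"
  by (simp add: tgt_def cis_eq_iff lev_diff_int)

lemma lev_shift: "lev (N + m * int nlev) = lev N + of_int m" "lev (N + m * int nlev + 1) = lev (N + 1) + of_int m"
proof -
  show "lev (N + m * int nlev) = lev N + of_int m" by (rule lev_add_period)
  have "N + m * int nlev + 1 = (N + 1) + m * int nlev" by simp
  then show "lev (N + m * int nlev + 1) = lev (N + 1) + of_int m" by (simp only: lev_add_period)
qed

lemma mid_shift: "mid (N + m * int nlev) = mid N + of_int m"
  unfolding mid_def lev_shift by (simp add: field_simps)

text \<open>\<open>m\<close> is the number of turns between the two lifts. An interior height of the
  slab is interior to both edges, so a common point would not be a vertex, while distinct edges meet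
  only in vertices and an edge does not cross itself.\<close>

lemma pos_distinct:
  assumes s: "(e, N) \<in> strand_set" and s': "(e', N + m * int nlev) \<in> strand_set"
    and t: "lev N < t" "t < lev (N + 1)" and eq: "pos e t = pos e' (t + of_int m)"
  shows "e = e' \<and> m = 0"
proof -
  note d = strandD[OF s] and d' = strandD[OF s', unfolded lev_shift]
  have "pt e t = pt e' (t + of_int m)" using eq by (simp add: pt_def cis_eq_iff)
  have in1: "t \<in> {low e..high e}" and in2: "t + of_int m \<in> {low e'..high e'}" using t d d' by auto
  have "pt e t \<notin> verts w" using pt_interior_not_vertex[OF d(1)] t d by auto
  then have "e = e'" using pt_eq_vertex[OF d(1) d'(1) _ in1 in2] \<open>pt e t = pt e' (t + of_int m)\<close> by blast
  then show ?thesis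
    using pt_inj[OF d(1) in1, of "t + of_int m"] in2 \<open>pt e t = pt e' (t + of_int m)\<close> t d by auto
qed

text \<open>By the intermediate value theorem a change of order would produce a common interior
  point, against \<open>pos_distinct\<close>.\<close>

lemma pos_less:
  assumes s: "(e, N) \<in> strand_set" and s': "(e', N + m * int nlev) \<in> strand_set"
    and less: "xi (e, N) < xi (e', N + m * int nlev)" and t: "lev N < t" "t < lev (N + 1)"
  shows "pos e t < pos e' (t + of_int m)"
proof (rule ccontr)
  note d = strandD[OF s] and d' = strandD[OF s', unfolded lev_shift]
  define f where "f u = pos e' (u + of_int m) - pos e u" for u
  assume "\<not> pos e t < pos e' (t + of_int m)"
  then have "f t \<le> 0" by (simp add: f_def)
  have fm: "f (mid N) > 0" using less by (simp add: f_def xi_def mid_shift)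
  have cont: "continuous_on {lev N..lev (N + 1)} f"
  proof -
    have "continuous_on {lev N..lev (N + 1)} (pos e)"
      using continuous_pos[OF d(1)] by (rule continuous_on_subset) (use d in auto)
    moreover have "continuous_on {lev N..lev (N + 1)} (\<lambda>u. pos e' (u + of_int m))"
      by (rule continuous_on_compose2[OF continuous_pos[OF d'(1)]])
        (use d' in \<open>auto intro!: continuous_intros\<close>)
    ultimately show ?thesis unfolding f_def[abs_def] by (intro continuous_on_diff)
  qed
  have mb: "lev N < mid N" "mid N < lev (N + 1)" by (rule mid_between)+
  have "\<exists>u. lev N < u \<and> u < lev (N + 1) \<and> f u = 0"
  proof (cases "t \<le> mid N")
    case True
    have "continuous_on {t..mid N} f" by (rule continuous_on_subset[OF cont]) (use t mb in auto)
    from IVT'[OF _ _ True this, of 0] obtain u where "t \<le> u" "u \<le> mid N" "f u = 0"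
      using \<open>f t \<le> 0\<close> fm by auto
    then show ?thesis using t mb by (intro exI[of _ u]) auto
  next
    case False
    then have le: "mid N \<le> t" by simp
    have "continuous_on {mid N..t} f" by (rule continuous_on_subset[OF cont]) (use t mb in auto)
    from IVT2'[OF _ _ le this, of 0] obtain u where "mid N \<le> u" "u \<le> t" "f u = 0"
      using \<open>f t \<le> 0\<close> fm by auto
    then show ?thesis using t mb by (intro exI[of _ u]) auto
  qed
  then obtain u where u: "lev N < u" "u < lev (N + 1)" "pos e u = pos e' (u + of_int m)"
    by (auto simp: f_def)
  from pos_distinct[OF s s' u] less show False by simp
qed

text \<open>The limit of \<open>pos_less\<close>. Only \<open>\<le>\<close> survives, because
  strands may meet at the ends of the slab.\<close>

lemma pos_le_ends:
  assumes s: "(e, N) \<in> strand_set" and s': "(e', N + m * int nlev) \<in> strand_set"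
    and less: "xi (e, N) < xi (e', N + m * int nlev)" and t: "lev N \<le> t" "t \<le> lev (N + 1)"
  shows "pos e t \<le> pos e' (t + of_int m)"
proof -
  note d = strandD[OF s] and d' = strandD[OF s', unfolded lev_shift]
  have cl: "closure {lev N<..<lev (N + 1)} = {lev N..lev (N + 1)}"
    using closure_greaterThanLessThan[of "lev N" "lev (N + 1)"] lev_step[of N] by simp
  have c1: "continuous_on {lev N..lev (N + 1)} (pos e)"
    using continuous_pos[OF d(1)] by (rule continuous_on_subset) (use d in auto)
  have c2: "continuous_on {lev N..lev (N + 1)} (\<lambda>u. pos e' (u + of_int m))"
    by (rule continuous_on_compose2[OF continuous_pos[OF d'(1)]])
      (use d' in \<open>auto intro!: continuous_intros\<close>)
  have "t \<in> closure {lev N<..<lev (N + 1)}" using t cl by simp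
  then have "0 \<le> pos e' (t + of_int m) - pos e t"
  proof (rule continuous_ge_on_closure[rotated])
    show "continuous_on (closure {lev N<..<lev (N + 1)}) (\<lambda>u. pos e' (u + of_int m) - pos e u)"
      unfolding cl using c1 c2 by (intro continuous_on_diff)
    fix u assume "u \<in> {lev N<..<lev (N + 1)}"
    then show "0 \<le> pos e' (u + of_int m) - pos e u" using pos_less[OF s s' less, of u] by simp
  qed
  then show ?thesis by simp
qed

lemma slab_shift:
  assumes "int nlev dvd N - N'"
  obtains m where "N' = N + m * int nlev"
proof -
  obtain k where "N - N' = int nlev * k" using assms by (elim dvdE)
  then have "N' = N + (- k) * int nlev" by (simp add: algebra_simps)
  then show ?thesis using that by blast
qed

sublocale strands strand_set src tgt xi
proof
  show "finite strand_set" by (rule finite_strand_set)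
next
  fix s s' assume "s \<in> strand_set" "s' \<in> strand_set"
  show "(snd (src s) = snd (src s')) = (snd (tgt s) = snd (tgt s'))"
    by (cases s; cases s') (simp add: slab_src slab_tgt)
next
  fix s s' assume s: "s \<in> strand_set" "s' \<in> strand_set" "snd (src s) = snd (src s')" "xi s = xi s'"
  obtain e N e' N' where [simp]: "s = (e, N)" "s' = (e', N')" by (cases s, cases s')
  obtain m where [simp]: "N' = N + m * int nlev" using s(3) slab_src slab_shift by (metis \<open>s = (e, N)\<close> \<open>s' = (e', N')\<close>)
  have "e = e' \<and> m = 0"
    using s mid_between[of N] by (intro pos_distinct[of e N e' m "mid N"]) (auto simp: xi_def mid_shift)
  then show "s = s'" by simp
next
  fix s s' assume s: "s \<in> strand_set" "s' \<in> strand_set" "snd (src s) = snd (src s')" "xi s < xi s'"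
  obtain e N e' N' where [simp]: "s = (e, N)" "s' = (e', N')" by (cases s, cases s')
  obtain m where [simp]: "N' = N + m * int nlev" using s(3) slab_src slab_shift by (metis \<open>s = (e, N)\<close> \<open>s' = (e', N')\<close>)
  have "pos e t \<le> pos e' (t + of_int m)" if "lev N \<le> t" "t \<le> lev (N + 1)" for t
    using pos_le_ends[of e N e' m t] s that by simp
  from this[of "lev N"] this[of "lev (N + 1)"] lev_step[of N]
  show "fst (src s) \<le> fst (src s') \<and> fst (tgt s) \<le> fst (tgt s')"
    by (simp add: src_def tgt_def lev_shift)
qed

end

text \<open>Consider the least point \<open>y\<close> that is moved. If \<open>f y\<close> lies
  below \<open>y\<close>, it is fixed, against monotonicity at \<open>f y\<close> and
  \<open>y\<close>. Otherwise the preimage of \<open>y\<close> lies above \<open>y\<close>, and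
  monotonicity puts \<open>f y\<close> below \<open>y\<close> after all. The lemma will be applied
  to the return map of a flow after one turn.\<close>

lemma strict_mono_finite_id:
  fixes key :: "'b \<Rightarrow> real"
  assumes "finite X" "\<And>x. x \<in> X \<Longrightarrow> f x \<in> X" "inj_on key X"
    and mono: "\<And>x y. x \<in> X \<Longrightarrow> y \<in> X \<Longrightarrow> key x < key y \<Longrightarrow> key (f x) < key (f y)"
    and "x \<in> X"
  shows "f x = x"
proof (rule ccontr)
  assume "f x \<noteq> x"
  define Y where "Y = {x \<in> X. f x \<noteq> x}"
  have "finite Y" "Y \<noteq> {}" using assms(1,5) \<open>f x \<noteq> x\<close> by (auto simp: Y_def)
  then obtain y where y: "y \<in> Y" "\<And>z. z \<in> Y \<Longrightarrow> key y \<le> key z"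
    by (metis arg_min_if_finite(1) arg_min_least)
  have yX: "y \<in> X" "f y \<noteq> y" using y(1) by (auto simp: Y_def)
  have inj: "inj_on f X"
  proof (rule inj_onI)
    fix a b assume "a \<in> X" "b \<in> X" "f a = f b"
    then show "a = b" using mono[of a b] mono[of b a] assms(3) by (metis inj_onD less_irrefl linorder_neqE)
  qed
  have surj: "f ` X = X" using assms(1,2) inj by (intro endo_inj_surj) auto
  have ne: "key (f y) \<noteq> key y" using yX assms(2,3) by (metis inj_onD)
  show False
  proof (cases "key (f y) < key y")
    case True
    then have "f y \<notin> Y" using y(2) by force
    then have "f (f y) = f y" using assms(2) yX by (simp add: Y_def)
    then show False using mono[of "f y" y] True assms(2) yX by simp
  next
    case False
    obtain u where u: "u \<in> X" "f u = y" using surj yX by (metis imageE)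
    have "u \<noteq> y" using u yX by auto
    then have "key u \<noteq> key y" using u yX assms(3) by (metis inj_onD)
    moreover have "\<not> key u < key y"
    proof
      assume "key u < key y"
      then have "u \<notin> Y" using y(2) by force
      then show False using u \<open>u \<noteq> y\<close> by (simp add: Y_def)
    qed
    ultimately have "key y < key u" by simp
    then have "key (f y) < key y" using mono[of y u] u yX by simp
    then show False using False by simp
  qed
qed

context web_context
begin

section \<open>Strands meeting at a point, and flows\<close>

lemma src_start: "e \<in> edges w \<Longrightarrow> src (e, start e) = pathstart (curve w e)"
  by (simp add: src_def lev_start pathstart_eq)

lemma tgt_stop: "e \<in> edges w \<Longrightarrow> tgt (e, stop e - 1) = pathfinish (curve w e)"
  by (simp add: tgt_def lev_stop pathfinish_eq)

lemma start_strand: "e \<in> edges w \<Longrightarrow> (e, start e) \<in> strand_set"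
  and stop_strand: "e \<in> edges w \<Longrightarrow> (e, stop e - 1) \<in> strand_set"
  using start_less_stop[of e] by (auto simp: strand_set_def)

lemma into_vertex:
  assumes "v \<in> verts w"
  shows "{s \<in> strand_set. tgt s = v} = (\<lambda>e. (e, stop e - 1)) ` in_edges w v"
proof (intro set_eqI iffI)
  fix s assume s: "s \<in> {s \<in> strand_set. tgt s = v}"
  obtain e N where [simp]: "s = (e, N)" by (cases s)
  have d: "e \<in> edges w" "low e \<le> lev N" "lev (N + 1) \<le> high e" using strandD[of e N] s by auto
  have "\<not> lev (N + 1) < high e"
    using pt_interior_not_vertex[OF d(1), of "lev (N + 1)"] d(2) lev_step[of N] s assms by (auto simp: tgt_def)
  then have "lev (N + 1) = lev (stop e)" using d lev_stop by simp
  then have "N = stop e - 1" by (simp only: lev_eq_iff)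
  then show "s \<in> (\<lambda>e. (e, stop e - 1)) ` in_edges w v"
    using s d tgt_stop by (auto simp: in_edges_def)
next
  fix s assume "s \<in> (\<lambda>e. (e, stop e - 1)) ` in_edges w v"
  then show "s \<in> {s \<in> strand_set. tgt s = v}" using stop_strand tgt_stop by (auto simp: in_edges_def)
qed

lemma out_vertex:
  assumes "v \<in> verts w"
  shows "{s \<in> strand_set. src s = v} = (\<lambda>e. (e, start e)) ` out_edges w v"
proof (intro set_eqI iffI)
  fix s assume s: "s \<in> {s \<in> strand_set. src s = v}"
  obtain e N where [simp]: "s = (e, N)" by (cases s)
  have d: "e \<in> edges w" "low e \<le> lev N" "lev (N + 1) \<le> high e" using strandD[of e N] s by auto
  have "\<not> low e < lev N"
    using pt_interior_not_vertex[OF d(1), of "lev N"] d(3) lev_step[of N] s assms by (auto simp: src_def)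
  then have "lev N = lev (start e)" using d lev_start by simp
  then have "N = start e" by (simp only: lev_eq_iff)
  then show "s \<in> (\<lambda>e. (e, start e)) ` out_edges w v"
    using s d src_start by (auto simp: out_edges_def)
next
  fix s assume "s \<in> (\<lambda>e. (e, start e)) ` out_edges w v"
  then show "s \<in> {s \<in> strand_set. src s = v}" using start_strand src_start by (auto simp: out_edges_def)
qed

lemma strand_level:
  assumes "s \<in> strand_set" "src s = p \<or> tgt s = p"
  obtains M where "start (fst s) \<le> M" "M \<le> stop (fst s)" "p = pt (fst s) (lev M)" "fst s \<in> edges w"
proof -
  have s: "fst s \<in> edges w" "start (fst s) \<le> snd s" "snd s < stop (fst s)"
    using assms(1) by (auto simp: strand_set_def)
  from assms(2) show ?thesis
  proof
    assume "src s = p" then show ?thesis using s by (intro that[of "snd s"]) (simp_all add: src_def)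
  next
    assume "tgt s = p" then show ?thesis using s by (intro that[of "snd s + 1"]) (simp_all add: tgt_def)
  qed
qed

text \<open>Besides interior points of edges this covers the base point of a vertex-free circle,
  where the last strand of the edge is followed by its first.\<close>

lemma nonvertex_point:
  assumes p: "p \<notin> verts w" and s: "s \<in> strand_set" "src s = p \<or> tgt s = p"
  shows "\<exists>N N'. {s \<in> strand_set. tgt s = p} = {(fst s, N)} \<and> {s \<in> strand_set. src s = p} = {(fst s, N')}"
proof -
  define e where "e = fst s"
  have e: "e \<in> edges w" using s(1) by (auto simp: e_def strand_set_def)
  note ss = start_less_stop[OF e]
  obtain M where M: "start e \<le> M" "M \<le> stop e" "p = pt e (lev M)"
    using strand_level[OF s] unfolding e_def by blast
  have in_range: "lev M' \<in> {low e..high e}" if "start e \<le> M'" "M' \<le> stop e" for M'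
    using that lev_le_iff[of "start e" M'] lev_le_iff[of M' "stop e"] lev_start[OF e] lev_stop[OF e] by simp
  have sameedge: "fst t = e" if "t \<in> strand_set" "tgt t = p \<or> src t = p" for t
  proof (rule ccontr)
    assume ne: "fst t \<noteq> e"
    define e' where "e' = fst t"
    have t: "t \<in> strand_set" "src t = p \<or> tgt t = p" using that by blast+
    obtain M' where M': "start e' \<le> M'" "M' \<le> stop e'" "p = pt e' (lev M')" "e' \<in> edges w"
      using strand_level[OF t] unfolding e'_def by blast
    have "lev M' \<in> {low e'..high e'}"
      using M' lev_le_iff[of "start e'" M'] lev_le_iff[of M' "stop e'"] lev_start[of e'] lev_stop[of e'] by simp
    from pt_eq_vertex[OF e M'(4) _ in_range[OF M(1,2)] this] show False using ne M M' p e'_def by simp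
  qed
  have inj: "M1 = M2 \<or> M1 = start e \<and> M2 = stop e \<or> M1 = stop e \<and> M2 = start e"
    if "start e \<le> M1" "M1 \<le> stop e" "start e \<le> M2" "M2 \<le> stop e" "pt e (lev M1) = pt e (lev M2)" for M1 M2
    using pt_inj[OF e in_range[OF that(1,2)] in_range[OF that(3,4)] that(5)]
    unfolding lev_start[OF e, symmetric] lev_stop[OF e, symmetric] lev_eq_iff .
  \<comment> \<open>The indices wrap around at the ends of \<open>e\<close>: a point there that is
    no vertex forces \<open>e\<close> to be a circle.\<close>
  define N where "N = (if M = start e then stop e - 1 else M - 1)"
  define N' where "N' = (if M = stop e then start e else M)"
  have closed: "pt e (lev (start e)) = pt e (lev (stop e))" if "M = start e \<or> M = stop e"
    using e
  proof (cases rule: ends_cases)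
    case arc
    then have "p \<in> verts w" using that M lev_start[OF e] lev_stop[OF e] by auto
    then show ?thesis using p by simp
  next
    case circle then show ?thesis by (simp add: lev_start[OF e] lev_stop[OF e])
  qed
  have "{s \<in> strand_set. tgt s = p} = {(e, N)}"
  proof (intro set_eqI iffI)
    fix t assume t: "t \<in> {s \<in> strand_set. tgt s = p}"
    obtain N1 where [simp]: "t = (e, N1)" using sameedge[of t] t by (cases t) auto
    have "start e \<le> N1" "N1 < stop e" "pt e (lev (N1 + 1)) = pt e (lev M)"
      using t M by (auto simp: strand_set_def tgt_def)
    then show "t \<in> {(e, N)}" using inj[of "N1 + 1" M] M ss by (auto simp: N_def)
  next
    fix t assume "t \<in> {(e, N)}"
    then show "t \<in> {s \<in> strand_set. tgt s = p}"
      using M ss closed e by (auto simp: N_def strand_set_def tgt_def)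
  qed
  moreover have "{s \<in> strand_set. src s = p} = {(e, N')}"
  proof (intro set_eqI iffI)
    fix t assume t: "t \<in> {s \<in> strand_set. src s = p}"
    obtain N1 where [simp]: "t = (e, N1)" using sameedge[of t] t by (cases t) auto
    have "start e \<le> N1" "N1 < stop e" "pt e (lev N1) = pt e (lev M)"
      using t M by (auto simp: strand_set_def src_def)
    then show "t \<in> {(e, N')}" using inj[of N1 M] M ss by (auto simp: N'_def)
  next
    fix t assume "t \<in> {(e, N')}"
    then show "t \<in> {s \<in> strand_set. src s = p}"
      using M ss closed e by (auto simp: N'_def strand_set_def src_def)
  qed
  ultimately show ?thesis unfolding e_def by blast
qed

text \<open>Away from the vertices the only incoming and the only outgoing strand belong to the same
  edge.\<close>

lemma flow_conservation:
  fixes g :: "'e \<Rightarrow> 'c::comm_monoid_add"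
  assumes "\<And>v. v \<in> verts w \<Longrightarrow> (\<Sum>e\<in>in_edges w v. g e) = (\<Sum>e\<in>out_edges w v. g e)"
  shows "(\<Sum>s | s \<in> strand_set \<and> tgt s = p. g (fst s)) = (\<Sum>s | s \<in> strand_set \<and> src s = p. g (fst s))"
proof (cases "p \<in> verts w")
  case True
  have "(\<Sum>s | s \<in> strand_set \<and> tgt s = p. g (fst s)) = (\<Sum>e\<in>in_edges w p. g e)"
    unfolding into_vertex[OF True] by (subst sum.reindex) (auto simp: inj_on_def)
  moreover have "(\<Sum>s | s \<in> strand_set \<and> src s = p. g (fst s)) = (\<Sum>e\<in>out_edges w p. g e)"
    unfolding out_vertex[OF True] by (subst sum.reindex) (auto simp: inj_on_def)
  ultimately show ?thesis using assms[OF True] by simp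
next
  case False
  show ?thesis
  proof (cases "\<exists>s\<in>strand_set. src s = p \<or> tgt s = p")
    case True
    then obtain s where "s \<in> strand_set" "src s = p \<or> tgt s = p" by blast
    then obtain N N' where "{s \<in> strand_set. tgt s = p} = {(fst s, N)}" "{s \<in> strand_set. src s = p} = {(fst s, N')}"
      using nonvertex_point[OF False, of s] by meson
    then show ?thesis by simp
  next
    case none: False
    then have "{s \<in> strand_set. tgt s = p} = {}" "{s \<in> strand_set. src s = p} = {}" by auto
    then show ?thesis by (simp only: sum.empty)
  qed
qed

abbreviation "st e \<equiv> pathstart (curve w e)"
abbreviation "fi e \<equiv> pathfinish (curve w e)"

text \<open>The vertex-disjoint unions of loops.\<close>

definition flow :: "'e set \<Rightarrow> bool" where
  "flow F \<longleftrightarrow> F \<subseteq> edges w \<and> inj_on st F \<and> inj_on fi F \<and> fi ` F = st ` F"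

lemma flowD:
  assumes "flow F"
  shows "F \<subseteq> edges w" "inj_on st F" "inj_on fi F" "fi ` F = st ` F" "finite F"
  using assms finite_edges finite_subset by (auto simp: flow_def)

definition strands_of :: "'e set \<Rightarrow> ('e \<times> int) set" where
  "strands_of F = {s \<in> strand_set. fst s \<in> F}"

lemma flow_point:
  assumes F: "flow F" and s: "s \<in> strands_of F"
  shows "\<exists>!s'. s' \<in> strands_of F \<and> src s' = tgt s"
    "s' \<in> strands_of F \<Longrightarrow> tgt s' = tgt s \<Longrightarrow> s' = s"
proof -
  have s': "s \<in> strand_set" "fst s \<in> F" using s by (auto simp: strands_of_def)
  note d = flowD[OF F]
  have "(\<exists>!s'. s' \<in> strands_of F \<and> src s' = tgt s) \<and> (\<forall>s'\<in>strands_of F. tgt s' = tgt s \<longrightarrow> s' = s)"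
  proof (cases "tgt s \<in> verts w")
    case False
    then obtain N N' where N: "{t \<in> strand_set. tgt t = tgt s} = {(fst s, N)}" "{t \<in> strand_set. src t = tgt s} = {(fst s, N')}"
      using nonvertex_point[OF False s'(1)] by meson
    have 1: "t \<in> strands_of F \<and> src t = tgt s \<longleftrightarrow> t = (fst s, N')" for t
      using N(2) s'(2) by (auto simp: strands_of_def)
    have 2: "t \<in> strands_of F \<and> tgt t = tgt s \<longleftrightarrow> t = (fst s, N)" for t
      using N(1) s'(2) by (auto simp: strands_of_def)
    have "t = s" if "t \<in> strands_of F" "tgt t = tgt s" for t using 2[of s] 2[of t] s that by simp
    then show ?thesis unfolding 1 by simp
  next
    case True
    have in_s: "s \<in> (\<lambda>e. (e, stop e - 1)) ` in_edges w (tgt s)" using into_vertex[OF True] s'(1) by blast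
    then have fs: "fi (fst s) = tgt s" "s = (fst s, stop (fst s) - 1)" by (auto simp: in_edges_def)
    have "fi (fst s) \<in> st ` F" using d(4) s'(2) by blast
    then obtain e where e': "e \<in> F" "fi (fst s) = st e" by blast
    have e: "e \<in> F" "st e = tgt s" using e' fs(1) by simp_all
    have eE: "e \<in> edges w" using e d by auto
    have a: "t = (e, start e)" if "t \<in> strands_of F" "src t = tgt s" for t
    proof -
      have "t \<in> (\<lambda>e. (e, start e)) ` out_edges w (tgt s)" using out_vertex[OF True] that by (auto simp: strands_of_def)
      then have t: "st (fst t) = st e" "t = (fst t, start (fst t))" using e(2) by (auto simp: out_edges_def)
      have "fst t \<in> F" using that(1) by (simp add: strands_of_def)
      from inj_onD[OF d(2) t(1) this e(1)] t(2) show ?thesis by simp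
    qed
    have b: "(e, start e) \<in> strands_of F" "src (e, start e) = tgt s"
      using e eE start_strand src_start by (auto simp: strands_of_def)
    have c: "t = s" if "t \<in> strands_of F" "tgt t = tgt s" for t
    proof -
      have "t \<in> (\<lambda>e. (e, stop e - 1)) ` in_edges w (tgt s)" using into_vertex[OF True] that by (auto simp: strands_of_def)
      then have t: "fi (fst t) = fi (fst s)" "t = (fst t, stop (fst t) - 1)" using fs(1) by (auto simp: in_edges_def)
      have "fst t \<in> F" using that(1) by (simp add: strands_of_def)
      from inj_onD[OF d(3) t(1) this s'(2)] show ?thesis by (subst t(2), subst fs(2)) simp
    qed
    have "\<exists>!s'. s' \<in> strands_of F \<and> src s' = tgt s"
    proof (rule ex1I[of _ "(e, start e)"])
      show "(e, start e) \<in> strands_of F \<and> src (e, start e) = tgt s" using b by (rule conjI)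
    qed (use a in blast)
    moreover have "\<forall>s'\<in>strands_of F. tgt s' = tgt s \<longrightarrow> s' = s" using c by blast
    ultimately show ?thesis by (rule conjI)
  qed
  then show "\<exists>!s'. s' \<in> strands_of F \<and> src s' = tgt s"
    "s' \<in> strands_of F \<Longrightarrow> tgt s' = tgt s \<Longrightarrow> s' = s" by blast+
qed

definition nxt :: "'e set \<Rightarrow> 'e \<times> int \<Rightarrow> 'e \<times> int" where
  "nxt F s = (THE s'. s' \<in> strands_of F \<and> src s' = tgt s)"

context
  fixes F assumes F: "flow F"
begin

lemma nxt: "s \<in> strands_of F \<Longrightarrow> nxt F s \<in> strands_of F" "s \<in> strands_of F \<Longrightarrow> src (nxt F s) = tgt s"
  unfolding nxt_def using theI'[OF flow_point(1)[OF F]] by blast+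

lemma nxt_eqI: "s \<in> strands_of F \<Longrightarrow> s' \<in> strands_of F \<Longrightarrow> src s' = tgt s \<Longrightarrow> nxt F s = s'"
  using flow_point(1)[OF F, of s] nxt[of s] by blast

lemma nxt_inj: "s \<in> strands_of F \<Longrightarrow> s' \<in> strands_of F \<Longrightarrow> nxt F s = nxt F s' \<Longrightarrow> s = s'"
  using flow_point(2)[OF F, of s' s] nxt(2)[of s] nxt(2)[of s'] by simp

lemma nxt_slab:
  assumes "s \<in> strands_of F"
  shows "int nlev dvd snd (nxt F s) - (snd s + 1)"
proof -
  have "snd (src (nxt F s)) = snd (tgt s)" using nxt(2)[OF assms] by simp
  then show ?thesis by (simp add: src_def tgt_def cis_eq_iff lev_diff_int)
qed

lemma funpow_nxt:
  assumes "s \<in> strands_of F"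
  shows "(nxt F ^^ j) s \<in> strands_of F" "int nlev dvd snd ((nxt F ^^ j) s) - (snd s + int j)"
proof -
  have "(nxt F ^^ j) s \<in> strands_of F \<and> int nlev dvd snd ((nxt F ^^ j) s) - (snd s + int j)"
  proof (induction j)
    case (Suc j)
    have "snd ((nxt F ^^ Suc j) s) - (snd s + int (Suc j)) =
        (snd (nxt F ((nxt F ^^ j) s)) - (snd ((nxt F ^^ j) s) + 1)) + (snd ((nxt F ^^ j) s) - (snd s + int j))"
      by simp
    then show ?case using Suc nxt(1) nxt_slab by (simp only: dvd_add funpow.simps o_apply simp_thms)
  qed (use assms in auto)
  then show "(nxt F ^^ j) s \<in> strands_of F" "int nlev dvd snd ((nxt F ^^ j) s) - (snd s + int j)" by blast+
qed

lemma same_slab_iff: "snd (src s) = snd (src s') \<longleftrightarrow> int nlev dvd snd s - snd s'"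
  by (simp add: src_def cis_eq_iff lev_diff_int)

lemma strands_of_sub: "s \<in> strands_of F \<Longrightarrow> s \<in> strand_set"
  by (simp add: strands_of_def)

text \<open>Two strands of a flow never end in the same point, so the weak inequality of
  \<open>xi_mono\<close> becomes strict at the upper ends, and the continuations start in this
  order.\<close>

lemma nxt_mono:
  assumes "s \<in> strands_of F" "s' \<in> strands_of F" "snd (src s) = snd (src s')" "xi s < xi s'"
  shows "snd (src (nxt F s)) = snd (src (nxt F s'))" "xi (nxt F s) < xi (nxt F s')"
proof -
  have le: "fst (tgt s) \<le> fst (tgt s')" and t: "snd (tgt s) = snd (tgt s')"
    using xi_mono[of s s'] same_slab[of s s'] assms strands_of_sub by blast+
  have "tgt s \<noteq> tgt s'" using flow_point(2)[OF F, of s' s] assms by auto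
  then have lt: "fst (tgt s) < fst (tgt s')" using le t by (auto simp: prod_eq_iff)
  show eq: "snd (src (nxt F s)) = snd (src (nxt F s'))" using t nxt assms by simp
  show "xi (nxt F s) < xi (nxt F s')"
    using src_less_imp_xi_less[of "nxt F s" "nxt F s'"] eq lt nxt assms strands_of_sub by simp
qed

lemma funpow_nxt_mono:
  assumes "s \<in> strands_of F" "s' \<in> strands_of F" "snd (src s) = snd (src s')" "xi s < xi s'"
  shows "xi ((nxt F ^^ j) s) < xi ((nxt F ^^ j) s')"
proof -
  have "snd (src ((nxt F ^^ j) s)) = snd (src ((nxt F ^^ j) s')) \<and> xi ((nxt F ^^ j) s) < xi ((nxt F ^^ j) s')"
    by (induction j) (use assms nxt_mono funpow_nxt(1) in auto)
  then show ?thesis by blast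
qed

text \<open>After \<open>nlev\<close> steps a strand is back in its slab. The return map preserves
  the order of the finitely many strands of \<open>F\<close> there, so it is the identity. This
  stands for the topological fact that a simple closed upward curve winds exactly once.\<close>

lemma funpow_nxt_period:
  assumes "s \<in> strands_of F"
  shows "(nxt F ^^ nlev) s = s"
proof -
  define X where "X = {s' \<in> strands_of F. snd (src s') = snd (src s)}"
  show ?thesis
  proof (rule strict_mono_finite_id[where X = X and key = xi])
    show "finite X" using finite_strand_set by (simp add: X_def strands_of_def)
    show "s \<in> X" using assms by (simp add: X_def)
    show "inj_on xi X" using xi_inj strands_of_sub by (auto simp: X_def inj_on_def)
    show "(nxt F ^^ nlev) t \<in> X" if "t \<in> X" for t
    proof -
      have t: "t \<in> strands_of F" "int nlev dvd snd t - snd s" using that by (auto simp: X_def same_slab_iff)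
      have "snd ((nxt F ^^ nlev) t) - snd s = (snd ((nxt F ^^ nlev) t) - (snd t + int nlev)) + (snd t - snd s) + int nlev"
        by simp
      then have "int nlev dvd snd ((nxt F ^^ nlev) t) - snd s"
        using funpow_nxt(2)[OF t(1), of nlev] t(2) by (simp only: dvd_add dvd_refl)
      then show ?thesis using funpow_nxt(1)[OF t(1)] by (simp add: X_def same_slab_iff)
    qed
    show "xi ((nxt F ^^ nlev) t) < xi ((nxt F ^^ nlev) t')" if "t \<in> X" "t' \<in> X" "xi t < xi t'" for t t'
      using funpow_nxt_mono[of t t'] that by (simp add: X_def)
  qed
qed

lemma funpow_nxt_mod:
  assumes "s \<in> strands_of F"
  shows "(nxt F ^^ (j + m * nlev)) s = (nxt F ^^ j) s"
proof (induction m)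
  case (Suc m)
  have "j + Suc m * nlev = (j + m * nlev) + nlev" by simp
  then have "(nxt F ^^ (j + Suc m * nlev)) s = (nxt F ^^ (j + m * nlev)) ((nxt F ^^ nlev) s)"
    by (simp only: funpow_add o_apply)
  then show ?case using Suc by (simp only: funpow_nxt_period[OF assms])
qed simp

end

end

section \<open>Loops\<close>

lemma funpow_cancel:
  assumes "inj_on f F" "f ` F \<subseteq> F" "x \<in> F" "y \<in> F" "(f ^^ i) x = (f ^^ i) y"
  shows "x = y"
  using assms(5)
proof (induction i)
  case (Suc i)
  have mem: "(f ^^ i) z \<in> F" if "z \<in> F" for z using that assms(2) by (induction i) auto
  have "f ((f ^^ i) x) = f ((f ^^ i) y)" using Suc.prems by simp
  from inj_onD[OF assms(1) this mem[OF assms(3)] mem[OF assms(4)]] show ?case by (rule Suc.IH)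
qed simp

lemma finite_inj_funpow_period:
  assumes "finite F" "inj_on f F" "f ` F \<subseteq> F" "x \<in> F"
  obtains m where "0 < m" "(f ^^ m) x = x" "\<And>i j. i < j \<Longrightarrow> j < m \<Longrightarrow> (f ^^ i) x \<noteq> (f ^^ j) x"
proof -
  have mem: "(f ^^ i) x \<in> F" for i using assms(3,4) by (induction i) auto
  have shift: "(f ^^ (j - i)) x = x" if "i < j" "(f ^^ i) x = (f ^^ j) x" for i j
  proof (rule funpow_cancel[OF assms(2,3) mem assms(4)])
    have "j = i + (j - i)" using that(1) by simp
    then have "(f ^^ j) x = (f ^^ i) ((f ^^ (j - i)) x)" by (metis funpow_add o_apply)
    then show "(f ^^ i) ((f ^^ (j - i)) x) = (f ^^ i) x" using that(2) by simp
  qed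
  have "\<not> inj (\<lambda>i. (f ^^ i) x)"
  proof
    assume "inj (\<lambda>i. (f ^^ i) x)"
    then have "infinite (range (\<lambda>i. (f ^^ i) x))" using finite_imageD infinite_UNIV_nat by blast
    moreover have "range (\<lambda>i. (f ^^ i) x) \<subseteq> F" using mem by blast
    ultimately show False using assms(1) finite_subset by blast
  qed
  then obtain i j where "(f ^^ i) x = (f ^^ j) x" "i < j" unfolding inj_def by (metis linorder_neqE_nat)
  then have ex: "\<exists>m. 0 < m \<and> (f ^^ m) x = x" using shift by (intro exI[of _ "j - i"]) simp
  define m where "m = (LEAST m. 0 < m \<and> (f ^^ m) x = x)"
  have m: "0 < m" "(f ^^ m) x = x" unfolding m_def using LeastI_ex[OF ex] by blast+
  moreover have "(f ^^ i) x \<noteq> (f ^^ j) x" if "i < j" "j < m" for i j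
  proof
    assume "(f ^^ i) x = (f ^^ j) x"
    then have "(f ^^ (j - i)) x = x" using shift that by blast
    then have "m \<le> j - i" unfolding m_def using that by (intro Least_le) simp
    then show False using that by simp
  qed
  ultimately show ?thesis using that by blast
qed

context web_context
begin

text \<open>The last clause is the induction principle for loops: a nonempty set of edges that is
  closed under successors runs once around the whole list.\<close>

lemma loopD:
  assumes "is_loop w L"
  shows "L \<subseteq> edges w" "L \<noteq> {}" "flow L"
    "\<And>D. D \<subseteq> L \<Longrightarrow> D \<noteq> {} \<Longrightarrow> (\<And>e e'. e \<in> D \<Longrightarrow> e' \<in> L \<Longrightarrow> fi e = st e' \<Longrightarrow> e' \<in> D) \<Longrightarrow> D = L"
proof -
  from assms obtain es where sub: "L \<subseteq> edges w" and es: "es \<noteq> []" "set es = L" "distinct (map st es)"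
    and next_es: "\<And>k. k < length es \<Longrightarrow> fi (es ! k) = st (es ! (Suc k mod length es))"
    unfolding is_loop_def by blast
  let ?n = "length es"
  show "L \<subseteq> edges w" by (rule sub)
  show "L \<noteq> {}" using es by auto
  have mod: "Suc k mod ?n < ?n" for k using es(1) by simp
  have inj: "inj_on st L" using es(2,3) by (simp add: distinct_map)
  have sub_im: "fi ` L \<subseteq> st ` L"
  proof
    fix p assume "p \<in> fi ` L"
    then obtain k where "k < ?n" "p = fi (es ! k)" using es(2) by (auto simp: in_set_conv_nth)
    then have "p = st (es ! (Suc k mod ?n))" "es ! (Suc k mod ?n) \<in> L"
      using next_es mod es(2) by auto
    then show "p \<in> st ` L" by blast
  qed
  have sup_im: "st ` L \<subseteq> fi ` L"
  proof
    fix p assume "p \<in> st ` L"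
    then obtain k where k: "k < ?n" "p = st (es ! k)" using es(2) by (auto simp: in_set_conv_nth)
    define k' where "k' = (if k = 0 then ?n - 1 else k - 1)"
    have k': "k' < ?n" "Suc k' mod ?n = k" using k(1) es(1) by (auto simp: k'_def)
    then have "p = fi (es ! k')" using next_es[OF k'(1)] k by simp
    then show "p \<in> fi ` L" using k'(1) es(2) by auto
  qed
  have im: "fi ` L = st ` L" using sub_im sup_im by (rule equalityI)
  have fin: "finite L" using es(2) by auto
  have "inj_on fi L" using im card_image[OF inj] fin by (intro eq_card_imp_inj_on) simp_all
  then show "flow L" using sub inj im by (simp add: flow_def)
  fix D assume D: "D \<subseteq> L" "D \<noteq> {}" and closed: "\<And>e e'. e \<in> D \<Longrightarrow> e' \<in> L \<Longrightarrow> fi e = st e' \<Longrightarrow> e' \<in> D"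
  obtain k where k: "k < ?n" "es ! k \<in> D" using D es(2) by (metis equals0I in_set_conv_nth subsetD)
  have all: "es ! ((k + j) mod ?n) \<in> D" for j
  proof (induction j)
    case 0 then show ?case using k by simp
  next
    case (Suc j)
    have lt: "(k + j) mod ?n < ?n" using es(1) by simp
    have "Suc ((k + j) mod ?n) mod ?n = (k + Suc j) mod ?n" by (simp add: mod_Suc_eq)
    then have "fi (es ! ((k + j) mod ?n)) = st (es ! ((k + Suc j) mod ?n))" using next_es[OF lt] by simp
    moreover have "es ! ((k + Suc j) mod ?n) \<in> L" using es(1,2) by (metis length_greater_0_conv mod_less_divisor nth_mem)
    ultimately show ?case using closed[OF Suc] by blast
  qed
  have "es ! i \<in> D" if "i < ?n" for i
  proof -
    have "(k + (?n - k + i)) mod ?n = i" using that k(1) by simp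
    then show ?thesis using all[of "?n - k + i"] by simp
  qed
  then have "L \<subseteq> D" using es(2) by (auto simp: in_set_conv_nth)
  then show "D = L" using D(1) by blast
qed

text \<open>Loops are the orbits of the successor permutation of a flow; the least period keeps the
  list free of repetitions.\<close>

lemma loop_in_flow:
  assumes F: "flow F" and e: "e \<in> F"
  obtains L where "is_loop w L" "L \<subseteq> F" "e \<in> L"
proof -
  note d = flowD[OF F]
  define f where "f x = inv_into F st (fi x)" for x
  have fim: "fi x \<in> st ` F" if "x \<in> F" for x using that d(4) by blast
  have f: "f x \<in> F" "st (f x) = fi x" if "x \<in> F" for x
    unfolding f_def using inv_into_into[OF fim[OF that]] f_inv_into_f[OF fim[OF that]] by blast+
  have inj: "inj_on f F"
  proof (rule inj_onI)
    fix x y assume "x \<in> F" "y \<in> F" "f x = f y"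
    then show "x = y" using f(2)[of x] f(2)[of y] inj_onD[OF d(3)] by metis
  qed
  have im: "f ` F \<subseteq> F" using f(1) by blast
  obtain m where m: "0 < m" "(f ^^ m) e = e" "\<And>i j. i < j \<Longrightarrow> j < m \<Longrightarrow> (f ^^ i) e \<noteq> (f ^^ j) e"
    using finite_inj_funpow_period[OF d(5) inj im e] by blast
  have mem: "(f ^^ i) e \<in> F" for i using im e by (induction i) auto
  define es where "es = map (\<lambda>i. (f ^^ i) e) [0..<m]"
  have len: "length es = m" and nth: "\<And>i. i < m \<Longrightarrow> es ! i = (f ^^ i) e" by (simp_all add: es_def)
  have sub: "set es \<subseteq> F" using mem by (auto simp: es_def)
  have "is_loop w (set es)"
    unfolding is_loop_def
  proof (intro conjI exI[of _ es])
    show "set es \<subseteq> edges w" using sub d(1) by blast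
    show "es \<noteq> []" using m(1) len by auto
    have "distinct es"
      unfolding distinct_conv_nth len
    proof (intro allI impI)
      fix i j assume ij: "i < m" "j < m" "i \<noteq> j"
      then show "es ! i \<noteq> es ! j" using m(3)[of i j] m(3)[of j i] nth[OF ij(1)] nth[OF ij(2)]
        by (metis linorder_neqE_nat)
    qed
    moreover have "inj_on st (set es)" using d(2) sub by (rule inj_on_subset)
    ultimately show "distinct (map st es)" by (simp add: distinct_map)
    show "\<forall>k<length es. fi (es ! k) = st (es ! (Suc k mod length es))"
      unfolding len
    proof (intro allI impI)
      fix k assume k: "k < m"
      have "es ! (Suc k mod m) = f (es ! k)"
      proof (cases "Suc k = m")
        case True
        then have "f ((f ^^ k) e) = e" using m(2) by (metis funpow.simps(2) o_apply)
        then show ?thesis using nth[OF k] nth[OF m(1)] True by simp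
      next
        case False
        then have "Suc k < m" using k by simp
        then show ?thesis using nth[OF k] nth[of "Suc k"] by simp
      qed
      then show "fi (es ! k) = st (es ! (Suc k mod m))" using f(2)[of "es ! k"] mem nth[OF k] by simp
    qed
  qed simp
  moreover have "e \<in> set es" using nth[OF m(1)] m(1) len nth_mem[of 0 es] by simp
  ultimately show ?thesis using that sub by blast
qed

lemma flow_start_unique: "flow F \<Longrightarrow> e \<in> F \<Longrightarrow> e' \<in> F \<Longrightarrow> st e = st e' \<Longrightarrow> e = e'"
  using flowD(2)[of F] by (auto dest: inj_onD)

lemma loops_in_flow_eq:
  assumes F: "flow F" and L: "is_loop w L" "L \<subseteq> F" and L': "is_loop w L'" "L' \<subseteq> F" and e: "e \<in> L" "e \<in> L'"
  shows "L = L'"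
proof -
  have "L \<inter> L' = L" if L: "is_loop w L" "L \<subseteq> F" and L': "is_loop w L'" "L' \<subseteq> F" and e: "e \<in> L" "e \<in> L'" for L L'
  proof (rule loopD(4)[OF L(1)])
    fix a b assume a: "a \<in> L \<inter> L'" and b: "b \<in> L" "fi a = st b"
    have "fi a \<in> st ` L'" using a flowD(4)[OF loopD(3)[OF L'(1)]] by blast
    then obtain c where "c \<in> L'" "fi a = st c" by blast
    then have "b = c" using flow_start_unique[OF F] b L(2) L'(2) by (metis subsetD)
    then show "b \<in> L \<inter> L'" using b \<open>c \<in> L'\<close> by blast
  qed (use e in auto)
  from this[OF L L' e] this[OF L' L e(2,1)] show ?thesis by blast
qed

lemma carrier_point:
  assumes F: "flow F" and p: "p \<in> carrier_of w F"
  obtains e N u where "(e, N) \<in> strands_of F" "lev N \<le> u" "u < lev (N + 1)" "p = pt e u"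
proof -
  obtain e where e: "e \<in> F" "p \<in> path_image (curve w e)" using p by (auto simp: carrier_of_def)
  have eE: "e \<in> edges w" using e flowD(1)[OF F] by blast
  obtain u where u: "low e \<le> u" "u \<le> high e" "p = pt e u" using e(2) path_image_eq[OF eE] by auto
  show ?thesis
  proof (cases "u = high e")
    case True
    have "fi e \<in> st ` F" using e(1) flowD(4)[OF F] by blast
    then obtain e' where e': "e' \<in> F" "fi e = st e'" by blast
    have e'E: "e' \<in> edges w" using e' flowD(1)[OF F] by blast
    have "p = pt e' (lev (start e'))"
      using u True e'(2) by (simp add: pathfinish_eq[OF eE] pathstart_eq[OF e'E] lev_start[OF e'E])
    moreover have "(e', start e') \<in> strands_of F" using start_strand[OF e'E] e'(1) by (simp add: strands_of_def)
    ultimately show ?thesis using that[of e' "start e'" "lev (start e')"] lev_step by simp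
  next
    case False
    then have "u < high e" using u by simp
    obtain N where N: "lev N \<le> u" "u < lev (N + 1)" using lev_cover .
    have "lev (start e) < lev (N + 1)" using N u lev_start[OF eE] by simp
    moreover have "lev N < lev (stop e)" using N \<open>u < high e\<close> lev_stop[OF eE] by simp
    ultimately have "(e, N) \<in> strands_of F" using e(1) eE by (simp add: strands_of_def strand_set_def)
    then show ?thesis using that N u by blast
  qed
qed

lemma strand_carrier:
  assumes "(e, N) \<in> strands_of F" "lev N \<le> u" "u \<le> lev (N + 1)"
  shows "pt e u \<in> carrier_of w F"
proof -
  have s: "(e, N) \<in> strand_set" "e \<in> F" using assms(1) by (auto simp: strands_of_def)
  note d = strandD[OF s(1)]
  have "pt e u \<in> path_image (curve w e)" using d assms by (intro pt_in_image) auto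
  then show ?thesis using s(2) by (auto simp: carrier_of_def)
qed

text \<open>A common point would be a vertex in which each of the two loops has a starting edge.
  Starting points in a flow are distinct, so the loops would share an edge and coincide.\<close>

lemma carrier_disjoint:
  assumes F: "flow F" and L: "is_loop w L" "L \<subseteq> F" and L': "is_loop w L'" "L' \<subseteq> F" and ne: "L \<noteq> L'"
  shows "carrier_of w L \<inter> carrier_of w L' = {}"
proof (rule ccontr)
  assume "carrier_of w L \<inter> carrier_of w L' \<noteq> {}"
  then obtain p e e' where e: "e \<in> L" "p \<in> path_image (curve w e)" and e': "e' \<in> L'" "p \<in> path_image (curve w e')"
    by (auto simp: carrier_of_def)
  have "e \<noteq> e'" using loops_in_flow_eq[OF F L L'] ne e(1) e'(1) by blast
  have E: "e \<in> edges w" "e' \<in> edges w" using loopD(1)[OF L(1)] loopD(1)[OF L'(1)] e(1) e'(1) by blast+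
  then have pv: "p \<in> verts w" using edges_disjoint[OF E \<open>e \<noteq> e'\<close>] e(2) e'(2) by blast
  have start: "p \<in> st ` M" if M: "is_loop w M" "a \<in> M" "p \<in> path_image (curve w a)" for M a
  proof -
    have aE: "a \<in> edges w" using loopD(1)[OF M(1)] M(2) by blast
    obtain t where t: "low a \<le> t" "t \<le> high a" "p = pt a t" using M(3) path_image_eq[OF aE] by auto
    have "\<not> (low a < t \<and> t < high a)" using pt_interior_not_vertex[OF aE] t(3) pv by blast
    then have "p = st a \<or> p = fi a" using t by (auto simp: pathstart_eq[OF aE] pathfinish_eq[OF aE])
    then show ?thesis using M(2) flowD(4)[OF loopD(3)[OF M(1)]] by blast
  qed
  obtain a where a: "a \<in> L" "p = st a" using start[OF L(1) e] by blast
  obtain b where b: "b \<in> L'" "p = st b" using start[OF L'(1) e'] by blast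
  have "a = b" using flow_start_unique[OF F, of a b] a b L(2) L'(2) by auto
  then show False using loops_in_flow_eq[OF F L L'] a(1) b(1) ne by blast
qed

text \<open>The iterates of \<open>nxt\<close> contain with one strand of an edge all of them, and
  then those of the next edge. By periodicity the predecessor of an iterate is again an iterate, and
  \<open>nlev\<close> of them suffice.\<close>

lemma loop_strands:
  assumes L: "is_loop w L" and s: "s \<in> strands_of L"
  shows "strands_of L = (\<lambda>j. (nxt L ^^ j) s) ` {..<nlev}"
proof -
  note F = loopD(3)[OF L]
  define R where "R = range (\<lambda>j. (nxt L ^^ j) s)"
  have Rsub: "R \<subseteq> strands_of L" using funpow_nxt(1)[OF F s] by (auto simp: R_def)
  have R_nxt: "nxt L t \<in> R" if t: "t \<in> R" for t
  proof -
    obtain j where "t = (nxt L ^^ j) s" using t by (auto simp: R_def)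
    then have "nxt L t = (nxt L ^^ Suc j) s" by simp
    then show ?thesis unfolding R_def by blast
  qed
  have R_prev: "t' \<in> R" if t': "t' \<in> strands_of L" "nxt L t' \<in> R" for t'
  proof -
    obtain j where j: "nxt L t' = (nxt L ^^ j) s" using t' by (auto simp: R_def)
    obtain n where n: "nlev = Suc n" using nlev_pos by (cases nlev) auto
    have "(nxt L ^^ (j + 1 * nlev)) s = (nxt L ^^ j) s" by (rule funpow_nxt_mod[OF F s])
    moreover have "j + 1 * nlev = Suc (j + n)" using n by simp
    ultimately have "nxt L t' = nxt L ((nxt L ^^ (j + n)) s)" using j by simp
    then have "t' = (nxt L ^^ (j + n)) s" using nxt_inj[OF F t'(1) funpow_nxt(1)[OF F s]] by blast
    then show ?thesis unfolding R_def by blast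
  qed
  have step: "nxt L (e, N) = (e, N + 1)" if "(e, N) \<in> strands_of L" "(e, N + 1) \<in> strands_of L" for e N
    by (rule nxt_eqI[OF F that]) (simp add: src_def tgt_def)
  have edge: "(e, M) \<in> R" if e: "(e, N) \<in> R" "e \<in> L" "start e \<le> M" "M < stop e" for e N M
  proof -
    have mem: "(e, K) \<in> strands_of L" if "start e \<le> K" "K < stop e" for K
      using that e(2) loopD(1)[OF L] by (auto simp: strands_of_def strand_set_def)
    have N: "start e \<le> N" "N < stop e" using e(1) Rsub by (auto simp: strands_of_def strand_set_def)
    have up: "(e, N + int k) \<in> R" if "N + int k < stop e" for k
      using that
    proof (induction k)
      case (Suc k)
      then have "(e, N + int k) \<in> R" by simp
      from R_nxt[OF this] show ?case
        using step[OF mem mem, of "N + int k"] N Suc.prems by (simp add: add.commute add.left_commute)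
    qed (use e in simp)
    have down: "(e, N - int k) \<in> R" if "start e \<le> N - int k" for k
      using that
    proof (induction k)
      case (Suc k)
      have m: "(e, N - int (Suc k)) \<in> strands_of L" "(e, N - int (Suc k) + 1) \<in> strands_of L"
        using Suc.prems N by (auto intro!: mem)
      have "(e, N - int (Suc k) + 1) \<in> R" using Suc by simp
      then show ?case using R_prev[OF m(1)] step[OF m] by simp
    qed (use e in simp)
    show ?thesis
    proof (cases "N \<le> M")
      case True then show ?thesis using up[of "nat (M - N)"] e(4) by simp
    next
      case False then show ?thesis using down[of "nat (N - M)"] e(3) by simp
    qed
  qed
  define D where "D = {e \<in> L. \<exists>N. (e, N) \<in> R}"
  have "D = L"
  proof (rule loopD(4)[OF L])
    have "s \<in> R" unfolding R_def by (rule range_eqI[of _ _ 0]) simp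
    moreover have "fst s \<in> L" using s by (simp add: strands_of_def)
    ultimately show "D \<noteq> {}" unfolding D_def by (metis (mono_tags, lifting) empty_iff mem_Collect_eq prod.collapse)
    fix a b assume a: "a \<in> D" and b: "b \<in> L" "fi a = st b"
    then obtain N where N: "(a, N) \<in> R" "a \<in> L" by (auto simp: D_def)
    have E: "a \<in> edges w" "b \<in> edges w" using N(2) b(1) loopD(1)[OF L] by blast+
    have "(a, stop a - 1) \<in> R" using edge[OF N] start_less_stop[OF E(1)] by simp
    moreover have "nxt L (a, stop a - 1) = (b, start b)"
      by (rule nxt_eqI[OF F])
        (use start_strand[OF E(2)] stop_strand[OF E(1)] N b in \<open>simp_all add: strands_of_def src_start[OF E(2)] tgt_stop[OF E(1)]\<close>)
    ultimately have "(b, start b) \<in> R" using R_nxt by metis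
    then show "b \<in> D" using b(1) by (auto simp: D_def)
  qed (auto simp: D_def)
  have "strands_of L \<subseteq> R"
  proof
    fix t assume t: "t \<in> strands_of L"
    obtain e M where [simp]: "t = (e, M)" by (cases t)
    have e: "e \<in> L" "start e \<le> M" "M < stop e" using t by (auto simp: strands_of_def strand_set_def)
    then obtain N where "(e, N) \<in> R" using \<open>D = L\<close> unfolding D_def by blast
    then show "t \<in> R" using edge e by simp
  qed
  then have "strands_of L = R" using Rsub by (rule equalityI)
  also have "R = (\<lambda>j. (nxt L ^^ j) s) ` {..<nlev}"
  proof (intro equalityI subsetI)
    fix t assume "t \<in> R"
    then obtain j where "t = (nxt L ^^ j) s" by (auto simp: R_def)
    also have "\<dots> = (nxt L ^^ (j mod nlev)) s"
      using funpow_nxt_mod[OF F s, of "j mod nlev" "j div nlev"] by simp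
    finally show "t \<in> (\<lambda>j. (nxt L ^^ j) s) ` {..<nlev}" using nlev_pos by (intro image_eqI[of _ _ "j mod nlev"]) simp_all
  qed (auto simp: R_def)
  finally show ?thesis .
qed

text \<open>The \<open>nlev\<close> iterates run through all classes modulo \<open>nlev\<close>, one
  slab each. This is the combinatorial form of crossing every radial segment exactly once.\<close>

lemma loop_slab_unique:
  assumes L: "is_loop w L"
  shows "\<exists>!s. s \<in> strands_of L \<and> int nlev dvd snd s - N"
proof -
  note F = loopD(3)[OF L]
  obtain e where e: "e \<in> L" "e \<in> edges w" using loopD(1,2)[OF L] by blast
  define s where "s = (e, start e)"
  have s: "s \<in> strands_of L" using start_strand[OF e(2)] e(1) by (simp add: s_def strands_of_def)
  note S = loop_strands[OF L s]
  have dv: "int nlev dvd snd ((nxt L ^^ j) s) - N \<longleftrightarrow> int nlev dvd (snd s + int j) - N" for j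
  proof -
    have "snd ((nxt L ^^ j) s) - N = (snd ((nxt L ^^ j) s) - (snd s + int j)) + ((snd s + int j) - N)" by simp
    then show ?thesis using funpow_nxt(2)[OF F s, of j] by (metis dvd_add_right_iff)
  qed
  define j where "j = nat ((N - snd s) mod int nlev)"
  have jl: "j < nlev" using nlev_pos by (simp add: j_def nat_less_iff)
  have ij: "int j = (N - snd s) mod int nlev" using nlev_pos by (simp add: j_def)
  have dj: "int nlev dvd (snd s + int j) - N"
  proof -
    have "(snd s + int j) - N = - ((N - snd s) - (N - snd s) mod int nlev)" using ij by simp
    then show ?thesis by (metis dvd_minus_iff dvd_minus_mod)
  qed
  show ?thesis
  proof (rule ex1I[of _ "(nxt L ^^ j) s"])
    show "(nxt L ^^ j) s \<in> strands_of L \<and> int nlev dvd snd ((nxt L ^^ j) s) - N"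
      using funpow_nxt(1)[OF F s] dv dj by blast
    fix t assume t: "t \<in> strands_of L \<and> int nlev dvd snd t - N"
    then obtain i where i: "i < nlev" "t = (nxt L ^^ i) s" using S by auto
    then have "int nlev dvd (snd s + int i) - N" using t dv by blast
    then have "int nlev dvd (int i - int j)" using dvd_diff[OF _ dj] by force
    moreover have "\<bar>int i - int j\<bar> < int nlev" using i(1) jl by linarith
    ultimately have "int i - int j = 0" by (metis abs_of_nat dvd_imp_le_int not_le)
    then show "t = (nxt L ^^ j) s" using i(2) by simp
  qed
qed

lemma loop_meets:
  assumes L: "is_loop w L"
  obtains p where "p \<in> carrier_of w L" "snd p = cis (2 * pi * t)"
proof -
  obtain N where N: "lev N \<le> t" "t < lev (N + 1)" using lev_cover .
  obtain s where s: "s \<in> strands_of L" "int nlev dvd snd s - N" using loop_slab_unique[OF L, of N] by blast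
  obtain m where m: "N = snd s + m * int nlev" using slab_shift[OF s(2)] .
  define u where "u = t - of_int m"
  have u: "lev (snd s) \<le> u" "u \<le> lev (snd s + 1)"
    using N unfolding m lev_shift by (auto simp: u_def)
  have "pt (fst s) u \<in> carrier_of w L" by (rule strand_carrier[OF _ u]) (use s in simp)
  moreover have "cis (2 * pi * u) = cis (2 * pi * t)" by (simp add: cis_eq_iff u_def)
  ultimately show ?thesis using that[of "pt (fst s) u"] by simp
qed

end

text \<open>The other members form a closed set disjoint from \<open>A\<close>, so no connected
  subset of the union is properly larger than \<open>A\<close>.\<close>

lemma components_disjoint_Union:
  fixes K :: "'b::topological_space set set"
  assumes fin: "finite K" and closed: "\<And>A. A \<in> K \<Longrightarrow> closed A" and conn: "\<And>A. A \<in> K \<Longrightarrow> connected A"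
    and ne: "\<And>A. A \<in> K \<Longrightarrow> A \<noteq> {}" and disj: "\<And>A B. A \<in> K \<Longrightarrow> B \<in> K \<Longrightarrow> A \<noteq> B \<Longrightarrow> A \<inter> B = {}"
  shows "components (\<Union>K) = K"
proof -
  have comp: "connected_component_set (\<Union>K) x = A" if A: "A \<in> K" "x \<in> A" for A x
  proof
    show "A \<subseteq> connected_component_set (\<Union>K) x"
      by (rule connected_component_maximal[OF A(2) conn[OF A(1)]]) (use A in blast)
    let ?C = "connected_component_set (\<Union>K) x" and ?B = "\<Union>(K - {A})"
    have "connected ?C" by (rule connected_connected_component)
    moreover have "closed A" "closed ?B" using closed[OF A(1)] closed fin by (auto intro: closed_Union)
    moreover have "?C \<subseteq> A \<union> ?B" using connected_component_subset[of "\<Union>K" x] by blast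
    moreover have "A \<inter> ?B \<inter> ?C = {}" using disj[OF A(1)] by blast
    moreover have "A \<inter> ?C \<noteq> {}"
    proof -
      have "x \<in> ?C" using A by (auto simp: connected_component_refl_eq)
      then show ?thesis using A(2) by blast
    qed
    ultimately have "?B \<inter> ?C = {}" unfolding connected_closed by blast
    then show "?C \<subseteq> A" using \<open>?C \<subseteq> A \<union> ?B\<close> by blast
  qed
  show ?thesis
  proof (intro set_eqI iffI)
    fix C assume "C \<in> components (\<Union>K)"
    then obtain x where x: "x \<in> \<Union>K" "C = connected_component_set (\<Union>K) x" by (auto simp: components_iff)
    then obtain A where "A \<in> K" "x \<in> A" by blast
    then show "C \<in> K" using comp x(2) by simp
  next
    fix A assume A: "A \<in> K"
    then obtain x where x: "x \<in> A" using ne by blast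
    then have "A = connected_component_set (\<Union>K) x" using comp[OF A] by simp
    then show "A \<in> components (\<Union>K)" using A x by (auto simp: components_iff)
  qed
qed

context web_context
begin

section \<open>Horizontal order of the loops in a flow\<close>

definition loops_of :: "'e set \<Rightarrow> 'e set set" where
  "loops_of F = {L. is_loop w L \<and> L \<subseteq> F}"

definition base_strand :: "'e set \<Rightarrow> 'e \<times> int" where
  "base_strand L = (THE s. s \<in> strands_of L \<and> int nlev dvd snd s)"

text \<open>Inside one flow \<open>loop_prec\<close> is a total order, and \<open>key\<close> embeds
  it into the real numbers.\<close>

definition key :: "'e set \<Rightarrow> real" where "key L = xi (base_strand L)"

lemma base_strand:
  assumes "is_loop w L"
  shows "base_strand L \<in> strands_of L" "int nlev dvd snd (base_strand L)"
    "s \<in> strands_of L \<Longrightarrow> int nlev dvd snd s \<Longrightarrow> s = base_strand L"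
proof -
  have ex: "\<exists>!s. s \<in> strands_of L \<and> int nlev dvd snd s" using loop_slab_unique[OF assms, of 0] by simp
  from theI'[OF ex] show a: "base_strand L \<in> strands_of L" "int nlev dvd snd (base_strand L)"
    unfolding base_strand_def by blast+
  show "s \<in> strands_of L \<Longrightarrow> int nlev dvd snd s \<Longrightarrow> s = base_strand L" using ex a by blast
qed

lemma strands_of_mono: "L \<subseteq> F \<Longrightarrow> strands_of L \<subseteq> strands_of F"
  by (auto simp: strands_of_def)

lemma Union_loops_of: "flow F \<Longrightarrow> \<Union>(loops_of F) = F"
  using loop_in_flow unfolding loops_of_def by blast

lemma finite_loops_of: "flow F \<Longrightarrow> finite (loops_of F)"
  using flowD(5) by (auto simp: loops_of_def intro: finite_subset[of _ "Pow F"])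

lemma card_loops_of:
  assumes F: "flow F"
  shows "card (loops_of F) = card {s \<in> strands_of F. int nlev dvd snd s}"
proof -
  have "bij_betw base_strand (loops_of F) {s \<in> strands_of F. int nlev dvd snd s}"
    unfolding bij_betw_def
  proof
    show "inj_on base_strand (loops_of F)"
    proof (rule inj_onI)
      fix L L' assume L: "L \<in> loops_of F" "L' \<in> loops_of F" "base_strand L = base_strand L'"
      then have "fst (base_strand L) \<in> L" "fst (base_strand L) \<in> L'"
        using base_strand(1)[of L] base_strand(1)[of L'] by (auto simp: loops_of_def strands_of_def)
      then show "L = L'" using loops_in_flow_eq[OF F] L by (simp add: loops_of_def)
    qed
    show "base_strand ` loops_of F = {s \<in> strands_of F. int nlev dvd snd s}"
    proof (intro equalityI subsetI)
      fix s assume "s \<in> base_strand ` loops_of F"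
      then obtain L where L: "s = base_strand L" "is_loop w L" "L \<subseteq> F" by (auto simp: loops_of_def)
      have "s \<in> strands_of F" using base_strand(1)[OF L(2)] strands_of_mono[OF L(3)] L(1) by blast
      then show "s \<in> {s \<in> strands_of F. int nlev dvd snd s}"
        using base_strand(2)[OF L(2)] L(1) by simp
    next
      fix s assume s: "s \<in> {s \<in> strands_of F. int nlev dvd snd s}"
      then have "fst s \<in> F" by (simp add: strands_of_def)
      then obtain L where L: "is_loop w L" "L \<subseteq> F" "fst s \<in> L" using loop_in_flow[OF F] by blast
      then have "s \<in> strands_of L" using s by (simp add: strands_of_def)
      then have "s = base_strand L" using base_strand(3)[OF L(1)] s by simp
      then show "s \<in> base_strand ` loops_of F" using L by (auto simp: loops_of_def)
    qed
  qed
  then show ?thesis by (rule bij_betw_same_card)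
qed

lemma key_inj:
  assumes F: "flow F" and L: "L \<in> loops_of F" "L' \<in> loops_of F" and eq: "key L = key L'"
  shows "L = L'"
proof -
  have l: "is_loop w L" "is_loop w L'" "L \<subseteq> F" "L' \<subseteq> F" using L by (auto simp: loops_of_def)
  have "int nlev dvd snd (base_strand L) - snd (base_strand L')"
    using base_strand(2)[OF l(1)] base_strand(2)[OF l(2)] by (rule dvd_diff)
  then have "snd (src (base_strand L)) = snd (src (base_strand L'))"
    by (simp add: src_def cis_eq_iff lev_diff_int)
  then have "base_strand L = base_strand L'"
    using xi_inj[of "base_strand L" "base_strand L'"] base_strand(1)[OF l(1)] base_strand(1)[OF l(2)] eq
    by (simp add: key_def strands_of_def)
  then have "fst (base_strand L) \<in> L" "fst (base_strand L) \<in> L'"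
    using base_strand(1)[OF l(1)] base_strand(1)[OF l(2)] by (auto simp: strands_of_def)
  then show ?thesis using loops_in_flow_eq[OF F] l by blast
qed

lemma nxt_subflow:
  assumes F: "flow F" and L: "is_loop w L" "L \<subseteq> F" and s: "s \<in> strands_of L"
  shows "(nxt F ^^ j) s = (nxt L ^^ j) s"
proof (induction j)
  case (Suc j)
  have t: "(nxt L ^^ j) s \<in> strands_of L" by (rule funpow_nxt(1)[OF loopD(3)[OF L(1)] s])
  have "nxt F ((nxt L ^^ j) s) = nxt L ((nxt L ^^ j) s)"
    using nxt_eqI[OF F, of "(nxt L ^^ j) s" "nxt L ((nxt L ^^ j) s)"] nxt[OF loopD(3)[OF L(1)] t]
      t strands_of_mono[OF L(2)] by blast
  then show ?case using Suc by simp
qed simp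

text \<open>\<open>nxt\<close> carries the order in the base slab to every other slab, and
  \<open>pos_le_ends\<close> carries it to all heights inside a slab. Strictness, also at the
  levels, comes from the disjointness of the two loops.\<close>

lemma key_less_imp_prec:
  assumes F: "flow F" and L: "L \<in> loops_of F" "L' \<in> loops_of F" and less: "key L < key L'"
  shows "loop_prec w L L'"
proof -
  have l: "is_loop w L" "is_loop w L'" "L \<subseteq> F" "L' \<subseteq> F" using L by (auto simp: loops_of_def)
  have disj: "carrier_of w L \<inter> carrier_of w L' = {}"
    using carrier_disjoint[OF F l(1,3) l(2,4)] less by auto
  let ?s = "base_strand L" and ?s' = "base_strand L'"
  have sL: "?s \<in> strands_of L" "?s' \<in> strands_of L'" using base_strand(1) l by blast+
  have sF: "?s \<in> strands_of F" "?s' \<in> strands_of F" using sL strands_of_mono l by blast+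
  have slab0: "snd (src ?s) = snd (src ?s')"
    using base_strand(2)[OF l(1)] base_strand(2)[OF l(2)] by (simp add: src_def cis_eq_iff lev_diff_int dvd_diff)
  have all: "xi s < xi s'" if s: "s \<in> strands_of L" "s' \<in> strands_of L'" "int nlev dvd snd s - snd s'" for s s'
  proof -
    obtain j where j: "s = (nxt F ^^ j) ?s"
      using loop_strands[OF l(1) sL(1)] s(1) nxt_subflow[OF F l(1,3) sL(1)] by auto
    define t where "t = (nxt F ^^ j) ?s'"
    have t: "t \<in> strands_of L'" unfolding t_def nxt_subflow[OF F l(2,4) sL(2)]
      by (rule funpow_nxt(1)[OF loopD(3)[OF l(2)] sL(2)])
    have d1: "int nlev dvd snd s - (snd ?s + int j)" unfolding j by (rule funpow_nxt(2)[OF F sF(1)])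
    have d2: "int nlev dvd snd t - (snd ?s' + int j)" unfolding t_def by (rule funpow_nxt(2)[OF F sF(2)])
    have d3: "int nlev dvd snd t - snd s'"
    proof -
      have eq: "snd t - snd s' = (snd t - (snd ?s' + int j)) - (snd s - (snd ?s + int j)) + snd ?s' - snd ?s + (snd s - snd s')"
        by simp
      show ?thesis unfolding eq
        by (intro dvd_add dvd_diff d1 d2 s(3) base_strand(2)[OF l(1)] base_strand(2)[OF l(2)])
    qed
    have "t = s'" using loop_slab_unique[OF l(2), of "snd s'"] t s(2) d3 by (metis diff_self dvd_0_right)
    moreover have "xi s < xi t" unfolding j t_def
      using funpow_nxt_mono[OF F sF slab0] less by (simp add: key_def)
    ultimately show ?thesis by simp
  qed
  show ?thesis
    unfolding loop_prec_def right_region_def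
  proof (intro subsetI CollectI conjI ballI impI)
    fix p assume p: "p \<in> carrier_of w L'"
    obtain e N u where e: "(e, N) \<in> strands_of L'" "lev N \<le> u" "u < lev (N + 1)" "p = pt e u"
      using carrier_point[OF loopD(3)[OF l(2)] p] .
    have e_s: "(e, N) \<in> strand_set" using e(1) by (simp add: strands_of_def)
    note d = strandD[OF e_s]
    show "p \<in> annulus" unfolding e(4) by (rule pt_annulus[OF d(1)]) (use d e in auto)
    fix q assume q: "q \<in> carrier_of w L" "snd q = snd p"
    obtain e' N' u' where e': "(e', N') \<in> strands_of L" "lev N' \<le> u'" "u' < lev (N' + 1)" "q = pt e' u'"
      using carrier_point[OF loopD(3)[OF l(1)] q(1)] .
    have e'_s: "(e', N') \<in> strand_set" using e'(1) by (simp add: strands_of_def)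
    have "u - u' \<in> \<int>" using q(2) e(4) e'(4) by (simp add: cis_eq_iff[symmetric])
    then obtain m where "u - u' = of_int m" by (elim Ints_cases)
    then have m: "u = u' + of_int m" by simp
    have "lev (N' + m * int nlev) < lev (N + 1)" "lev N < lev (N' + m * int nlev + 1)"
      unfolding lev_shift using e e' m by auto
    then have N: "N = N' + m * int nlev" unfolding lev_less_iff by simp
    have "xi (e', N') < xi (e, N)" by (rule all[OF e'(1) e(1)]) (simp add: N)
    then have "pos e' u' \<le> pos e (u' + of_int m)"
      using pos_le_ends[OF e'_s e_s[unfolded N], of u'] e'(2,3) N by simp
    moreover have "pos e' u' \<noteq> pos e u"
    proof
      assume "pos e' u' = pos e u"
      then have "p = q" using q(2) e(4) e'(4) by (simp add: prod_eq_iff)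
      then show False using disj p q(1) by blast
    qed
    ultimately show "fst q < fst p" using e(4) e'(4) m by simp
  qed
qed

lemma prec_less:
  assumes "loop_prec w L L'" "p \<in> carrier_of w L" "q \<in> carrier_of w L'" "snd p = snd q"
  shows "fst p < fst q"
  using assms by (auto simp: loop_prec_def right_region_def)

lemma prec_carrier_disjoint:
  assumes "loop_prec w L L'" shows "carrier_of w L \<inter> carrier_of w L' = {}"
  using prec_less[OF assms] by blast

lemma loop_carrier_nonempty: "is_loop w L \<Longrightarrow> e \<in> L \<Longrightarrow> st e \<in> carrier_of w L"
  by (auto simp: carrier_of_def)

lemma prec_disjoint:
  assumes "loop_prec w L L'" "is_loop w L" "is_loop w L'" shows "L \<inter> L' = {}"
  using prec_carrier_disjoint[OF assms(1)] loop_carrier_nonempty[OF assms(2)] loop_carrier_nonempty[OF assms(3)] by blast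

lemma prec_imp_key_less:
  assumes "loop_prec w L L'" "is_loop w L" "is_loop w L'"
  shows "key L < key L'"
proof -
  let ?s = "base_strand L" and ?s' = "base_strand L'"
  have s: "?s \<in> strands_of L" "?s' \<in> strands_of L'" using base_strand(1) assms by blast+
  have slab0: "snd (src ?s) = snd (src ?s')"
    using base_strand(2)[OF assms(2)] base_strand(2)[OF assms(3)] by (simp add: src_def cis_eq_iff lev_diff_int dvd_diff)
  have "src ?s \<in> carrier_of w L" "src ?s' \<in> carrier_of w L'"
    unfolding src_def using strand_carrier[of "fst ?s" "snd ?s" L "lev (snd ?s)"]
      strand_carrier[of "fst ?s'" "snd ?s'" L' "lev (snd ?s')"] s by simp_all
  then have "fst (src ?s) < fst (src ?s')" using prec_less[OF assms(1)] slab0 by blast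
  then show ?thesis
    unfolding key_def using src_less_imp_xi_less[of ?s ?s'] slab0 s by (simp add: strands_of_def)
qed

text \<open>Every radial segment contains a point of the middle loop, by \<open>loop_meets\<close>;
  without it the two comparisons could not be chained.\<close>

lemma prec_trans:
  assumes "loop_prec w L L'" "loop_prec w L' L''" "is_loop w L'"
  shows "loop_prec w L L''"
  unfolding loop_prec_def right_region_def
proof (intro subsetI CollectI conjI ballI impI)
  fix p assume p: "p \<in> carrier_of w L''"
  then show ann: "p \<in> annulus" using assms(2) by (auto simp: loop_prec_def right_region_def)
  fix q assume q: "q \<in> carrier_of w L" "snd q = snd p"
  have "norm (snd p) = 1" using ann by (auto simp: annulus_def)
  then have "snd p = cis (Arg (snd p))" by (subst cis_Arg) (auto simp: sgn_div_norm)
  then have "snd p = cis (2 * pi * (Arg (snd p) / (2 * pi)))" by simp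
  then obtain r where r: "r \<in> carrier_of w L'" "snd r = snd p"
    using loop_meets[OF assms(3), of "Arg (snd p) / (2 * pi)"] by metis
  have "fst q < fst r" "fst r < fst p"
    using prec_less[OF assms(1) q(1) r(1)] prec_less[OF assms(2) r(1) p] q(2) r(2) by auto
  then show "fst q < fst p" by simp
qed

lemma prec_iff_key:
  assumes "flow F" "L \<in> loops_of F" "L' \<in> loops_of F"
  shows "loop_prec w L L' \<longleftrightarrow> key L < key L'"
  using key_less_imp_prec[OF assms] prec_imp_key_less[of L L'] assms by (auto simp: loops_of_def)

text \<open>Makes rows of an array and flows determine each other: a loop inside the union shares an
  edge with one of the given loops and therefore equals it.\<close>

lemma flow_Union_loops:
  assumes loops: "\<And>L. L \<in> K \<Longrightarrow> is_loop w L"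
    and disj: "\<And>L L'. L \<in> K \<Longrightarrow> L' \<in> K \<Longrightarrow> L \<noteq> L' \<Longrightarrow> carrier_of w L \<inter> carrier_of w L' = {}"
  shows "flow (\<Union>K)" "loops_of (\<Union>K) = K"
proof -
  have st: "st e \<in> carrier_of w L" and fi: "fi e \<in> carrier_of w L" if "e \<in> L" for e L
    using that by (auto simp: carrier_of_def)
  have f: "flow L" if "L \<in> K" for L using loopD(3)[OF loops[OF that]] .
  have "inj_on st (\<Union>K)"
  proof (rule inj_onI)
    fix a b assume ab: "a \<in> \<Union>K" "b \<in> \<Union>K" "st a = st b"
    then obtain L L' where L: "a \<in> L" "L \<in> K" "b \<in> L'" "L' \<in> K" by blast
    have "st a \<in> carrier_of w L \<inter> carrier_of w L'" using st[OF L(1)] st[OF L(3)] ab(3) by simp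
    then have "L = L'" using disj[OF L(2,4)] by blast
    then show "a = b" using flow_start_unique[OF f[OF L(2)] L(1)] L(3) ab(3) by blast
  qed
  moreover have "inj_on fi (\<Union>K)"
  proof (rule inj_onI)
    fix a b assume ab: "a \<in> \<Union>K" "b \<in> \<Union>K" "fi a = fi b"
    then obtain L L' where L: "a \<in> L" "L \<in> K" "b \<in> L'" "L' \<in> K" by blast
    have "fi a \<in> carrier_of w L \<inter> carrier_of w L'" using fi[OF L(1)] fi[OF L(3)] ab(3) by simp
    then have "L = L'" using disj[OF L(2,4)] by blast
    then show "a = b" using inj_onD[OF flowD(3)[OF f[OF L(2)]] ab(3) L(1)] L(3) by blast
  qed
  moreover have "fi ` \<Union>K = st ` \<Union>K"
  proof -
    have "fi ` \<Union>K = (\<Union>L\<in>K. fi ` L)" "st ` \<Union>K = (\<Union>L\<in>K. st ` L)" by blast+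
    then show ?thesis using flowD(4)[OF f] by simp
  qed
  moreover have "\<Union>K \<subseteq> edges w" using loopD(1)[OF loops] by blast
  ultimately show F: "flow (\<Union>K)" by (simp add: flow_def)
  show "loops_of (\<Union>K) = K"
  proof (intro equalityI subsetI)
    fix L assume "L \<in> loops_of (\<Union>K)"
    then have L: "is_loop w L" "L \<subseteq> \<Union>K" by (auto simp: loops_of_def)
    obtain e where "e \<in> L" using loopD(2)[OF L(1)] by blast
    then obtain L' where L': "e \<in> L'" "L' \<in> K" using L(2) by blast
    have "L = L'" using loops_in_flow_eq[OF F L loops[OF L'(2)] _ \<open>e \<in> L\<close> L'(1)] L'(2) by blast
    then show "L \<in> K" using L'(2) by simp
  qed (use loops in \<open>auto simp: loops_of_def\<close>)
qed

lemma closed_carrier: "F \<subseteq> edges w \<Longrightarrow> closed (carrier_of w F)"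
  unfolding carrier_of_def
proof (rule closed_UN)
  assume F: "F \<subseteq> edges w"
  show "finite F" using F finite_edges by (rule finite_subset)
  show "\<forall>e\<in>F. closed (path_image (curve w e))"
    using F edge_props(1) by (auto intro!: closed_path_image simple_path_imp_path)
qed

lemma connected_carrier:
  assumes "is_loop w L" shows "connected (carrier_of w L)"
proof -
  from assms obtain es where sub: "L \<subseteq> edges w" and es: "es \<noteq> []" "set es = L"
    and next_es: "\<And>k. k < length es \<Longrightarrow> fi (es ! k) = st (es ! (Suc k mod length es))"
    unfolding is_loop_def by blast
  have E: "connected (path_image (curve w (es ! k)))" if "k < length es" for k
  proof -
    have "es ! k \<in> edges w" using that es(2) sub nth_mem by blast
    then show ?thesis by (intro connected_path_image simple_path_imp_path edge_props(1))
  qed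
  have "connected (\<Union>k<j. path_image (curve w (es ! k)))" if "j \<le> length es" for j
    using that
  proof (induction j)
    case (Suc j)
    have *: "(\<Union>k<Suc j. path_image (curve w (es ! k))) =
        (\<Union>k<j. path_image (curve w (es ! k))) \<union> path_image (curve w (es ! j))"
      by (auto simp: less_Suc_eq)
    show ?case
    proof (cases j)
      case 0 then show ?thesis using E[of 0] es(1) by (simp add: lessThan_Suc)
    next
      case (Suc i)
      have "Suc i mod length es = j" using Suc Suc.prems \<open>Suc j \<le> length es\<close> by simp
      then have "fi (es ! i) = st (es ! j)" using next_es[of i] Suc \<open>Suc j \<le> length es\<close> by simp
      then have "st (es ! j) \<in> (\<Union>k<j. path_image (curve w (es ! k))) \<inter> path_image (curve w (es ! j))"
        using Suc pathfinish_in_path_image[of "curve w (es ! i)"] pathstart_in_path_image[of "curve w (es ! j)"] by auto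
      then have ne: "(\<Union>k<j. path_image (curve w (es ! k))) \<inter> path_image (curve w (es ! j)) \<noteq> {}" by blast
      show ?thesis unfolding *
        by (rule connected_Un[OF Suc.IH E ne]) (use \<open>Suc j \<le> length es\<close> in simp_all)
    qed
  qed simp
  from this[of "length es"] have "connected (\<Union>k<length es. path_image (curve w (es ! k)))" by simp
  moreover have "(\<Union>k<length es. path_image (curve w (es ! k))) = carrier_of w L"
    unfolding carrier_of_def es(2)[symmetric] set_conv_nth by auto
  ultimately show ?thesis by simp
qed

text \<open>The loops of a flow are finitely many closed, connected and pairwise disjoint sets, so
  the topological components are exactly these loops.\<close>

lemma comps_eq_loops_of:
  assumes F: "flow F" shows "comps w F = loops_of F"
proof -
  have inj: "L = L'" if "L \<in> loops_of F" "L' \<in> loops_of F" "carrier_of w L \<inter> carrier_of w L' \<noteq> {}" for L L'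
    using carrier_disjoint[OF F, of L L'] that by (auto simp: loops_of_def)
  have "components (\<Union>(carrier_of w ` loops_of F)) = carrier_of w ` loops_of F"
  proof (rule components_disjoint_Union)
    show "finite (carrier_of w ` loops_of F)" using finite_loops_of[OF F] by simp
    fix A assume "A \<in> carrier_of w ` loops_of F"
    then obtain L where L: "A = carrier_of w L" "is_loop w L" by (auto simp: loops_of_def)
    show "closed A" unfolding L(1) by (rule closed_carrier[OF loopD(1)[OF L(2)]])
    show "connected A" unfolding L(1) by (rule connected_carrier[OF L(2)])
    show "A \<noteq> {}" unfolding L(1) using loopD(2)[OF L(2)] loop_carrier_nonempty[OF L(2)] by blast
  next
    fix A B assume "A \<in> carrier_of w ` loops_of F" "B \<in> carrier_of w ` loops_of F" "A \<noteq> B"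
    then show "A \<inter> B = {}" using inj by blast
  qed
  moreover have "\<Union>(carrier_of w ` loops_of F) = carrier_of w F"
    unfolding carrier_of_def using Union_loops_of[OF F] by blast
  moreover have "{e \<in> F. path_image (curve w e) \<subseteq> carrier_of w L} = L" if L: "L \<in> loops_of F" for L
  proof (intro equalityI subsetI)
    fix e assume e: "e \<in> {e \<in> F. path_image (curve w e) \<subseteq> carrier_of w L}"
    then obtain L' where L': "L' \<in> loops_of F" "e \<in> L'" using Union_loops_of[OF F] by blast
    have "st e \<in> carrier_of w L" using e by auto
    moreover have "st e \<in> carrier_of w L'" using L'(2) by (auto simp: carrier_of_def)
    ultimately have "L = L'" using inj[OF L L'(1)] by blast
    then show "e \<in> L" using L'(2) by simp
  next
    fix e assume "e \<in> L" then show "e \<in> {e \<in> F. path_image (curve w e) \<subseteq> carrier_of w L}"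
      using L by (auto simp: loops_of_def carrier_of_def)
  qed
  ultimately show ?thesis unfolding comps_def by (simp add: image_image)
qed

lemma sorted_loops_unique:
  assumes F: "flow F" and xs: "set xs \<subseteq> loops_of F" "sorted_wrt (loop_prec w) xs"
    and ys: "sorted_wrt (loop_prec w) ys" "set ys = set xs"
  shows "ys = xs"
proof -
  have s: "sorted_wrt (<) (map key zs)" if "set zs \<subseteq> loops_of F" "sorted_wrt (loop_prec w) zs" for zs
    unfolding sorted_wrt_map
    by (rule sorted_wrt_mono_rel[OF _ that(2)]) (use prec_iff_key[OF F] that(1) in blast)
  have "map key ys = map key xs"
    by (rule strict_sorted_equal[OF s[OF xs] s]) (use xs ys in auto)
  moreover have "inj_on key (set xs \<union> set ys)"
    using key_inj[OF F] xs(1) ys(2) by (auto simp: inj_on_def)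
  ultimately show ?thesis by (metis map_inj_on sup_commute)
qed

lemma sorted_loops_distinct:
  assumes "\<And>L. L \<in> set xs \<Longrightarrow> is_loop w L" "sorted_wrt (loop_prec w) xs"
  shows "distinct xs"
proof -
  have "sorted_wrt (\<lambda>L L'. key L < key L') xs"
    by (rule sorted_wrt_mono_rel[OF _ assms(2)]) (use prec_imp_key_less assms(1) in blast)
  then have "sorted_wrt (<) (map key xs)" by (simp add: sorted_wrt_map)
  then show ?thesis by (metis distinct_map strict_sorted_iff)
qed

text \<open>Justifies the definite description in \<open>ordered_loops\<close>: sorting by
  \<open>key\<close> gives existence, injectivity of \<open>key\<close> gives uniqueness.\<close>

lemma ordered_loops:
  assumes F: "flow F"
  shows "set (ordered_loops w F) = loops_of F" "sorted_wrt (loop_prec w) (ordered_loops w F)"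
    "set xs = loops_of F \<Longrightarrow> sorted_wrt (loop_prec w) xs \<Longrightarrow> ordered_loops w F = xs"
proof -
  define xs where "xs = map (inv_into (loops_of F) key) (sorted_list_of_set (key ` loops_of F))"
  have fin: "finite (key ` loops_of F)" using finite_loops_of[OF F] by simp
  have inj: "inj_on key (loops_of F)" using key_inj[OF F] by (auto simp: inj_on_def)
  have setxs: "set xs = loops_of F"
    unfolding xs_def using fin inv_into_image_cancel[OF inj subset_refl] by simp
  have srt: "sorted_wrt (loop_prec w) xs"
    unfolding xs_def sorted_wrt_map
  proof (rule sorted_wrt_mono_rel[OF _ strict_sorted_list_of_set])
    fix a b assume ab: "a \<in> set (sorted_list_of_set (key ` loops_of F))" "b \<in> set (sorted_list_of_set (key ` loops_of F))" "a < b"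
    then have m: "a \<in> key ` loops_of F" "b \<in> key ` loops_of F" using fin by auto
    show "loop_prec w (inv_into (loops_of F) key a) (inv_into (loops_of F) key b)"
      using prec_iff_key[OF F inv_into_into[OF m(1)] inv_into_into[OF m(2)]]
        f_inv_into_f[OF m(1)] f_inv_into_f[OF m(2)] ab(3) by simp
  qed
  have ex: "\<exists>!Ls. set Ls = comps w F \<and> sorted_wrt (loop_prec w) Ls"
    unfolding comps_eq_loops_of[OF F]
    by (rule ex1I[of _ xs]) (use setxs srt sorted_loops_unique[OF F] in auto)
  from theI'[OF ex] show o: "set (ordered_loops w F) = loops_of F" "sorted_wrt (loop_prec w) (ordered_loops w F)"
    unfolding ordered_loops_def comps_eq_loops_of[OF F] by blast+
  show "set ys = loops_of F \<Longrightarrow> sorted_wrt (loop_prec w) ys \<Longrightarrow> ordered_loops w F = ys" for ys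
    using sorted_loops_unique[OF F, of ys "ordered_loops w F"] o by simp
qed

lemma strand_src_range: "(e, N) \<in> strand_set \<Longrightarrow> lev N \<in> {low e..high e}"
  using strandD(2)[of e N] order.trans[OF less_imp_le[OF lev_step[of N]] strandD(3)[of e N]] by simp

text \<open>A crossing of an edge with the base segment is the lower end of exactly one of its
  strands. Using lower ends only avoids counting the base point of a closed edge twice.\<close>

lemma web_degree_eq: "web_degree w = (\<Sum>s | s \<in> strand_set \<and> int nlev dvd snd s. thick w (fst s))"
proof -
  have base: "base_point = cis (2 * pi * lev 0)" by (simp add: lev_0 cis_base_angle)
  have card_eq: "card {p \<in> path_image (curve w e). snd p = base_point} = card {s \<in> strand_set. fst s = e \<and> int nlev dvd snd s}"
    if e: "e \<in> edges w" for e
  proof -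
    let ?S = "{s \<in> strand_set. fst s = e \<and> int nlev dvd snd s}"
    have "bij_betw src ?S {p \<in> path_image (curve w e). snd p = base_point}"
      unfolding bij_betw_def
    proof
      show "inj_on src ?S"
      proof (rule inj_onI)
        fix s s' assume s: "s \<in> ?S" "s' \<in> ?S" "src s = src s'"
        then obtain N N' where [simp]: "s = (e, N)" "s' = (e, N')" by (cases s, cases s') auto
        have d: "start e \<le> N" "N < stop e" "start e \<le> N'" "N' < stop e" using s by (auto simp: strand_set_def)
        have r: "lev N \<in> {low e..high e}" "lev N' \<in> {low e..high e}"
          using strand_src_range[of e N] strand_src_range[of e N'] s by auto
        from pt_inj[OF e r] s(3) have "lev N = lev N' \<or> lev N = high e \<or> lev N' = high e" by (auto simp: src_def)
        then show "s = s'" using d unfolding lev_stop[OF e, symmetric] lev_eq_iff by auto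
      qed
      show "src ` ?S = {p \<in> path_image (curve w e). snd p = base_point}"
      proof (intro equalityI subsetI)
        fix p assume "p \<in> src ` ?S"
        then obtain N where N: "(e, N) \<in> strand_set" "int nlev dvd N" "p = pt e (lev N)" by (auto simp: src_def)
        have "p \<in> path_image (curve w e)" unfolding N(3) by (rule pt_in_image[OF e strand_src_range[OF N(1)]])
        moreover have "snd p = base_point" using N(2,3) by (simp add: base cis_eq_iff lev_diff_int)
        ultimately show "p \<in> {p \<in> path_image (curve w e). snd p = base_point}" by simp
      next
        fix p assume "p \<in> {p \<in> path_image (curve w e). snd p = base_point}"
        then obtain u where u: "low e \<le> u" "u \<le> high e" "p = pt e u" "snd p = base_point"
          using path_image_eq[OF e] by auto
        have pv: "p \<notin> verts w" using base_point(2) u(4) by (metis imageI)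
        have "cis (2 * pi * u) = cis (2 * pi * lev 0)" using u(3,4) base by simp
        then have "u - lev 0 \<in> \<int>" unfolding cis_eq_iff .
        then obtain m where "u - lev 0 = of_int m" by (elim Ints_cases)
        then have um: "u = lev (0 + m * int nlev)" unfolding lev_shift by simp
        define M where "M = m * int nlev"
        have uM: "u = lev M" using um by (simp add: M_def)
        have M: "start e \<le> M" "M \<le> stop e"
          using u(1,2) unfolding uM lev_start[OF e, symmetric] lev_stop[OF e, symmetric] lev_le_iff by blast+
        show "p \<in> src ` ?S"
        proof (cases "M = stop e")
          case False
          then have "(e, M) \<in> ?S" using M e by (simp add: strand_set_def M_def)
          moreover have "p = src (e, M)" using u(3) uM by (simp add: src_def)
          ultimately show ?thesis by blast
        next
          \<comment> \<open>The edge ends at the base angle, hence not in a vertex. So it is a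
            vertex-free circle, and the point is also the lower end of its first strand.\<close>
          case True
          have uh: "u = high e" using True uM lev_stop[OF e] by simp
          have "pt e (low e) = pt e (high e)"
            using e
          proof (cases rule: ends_cases)
            case arc then show ?thesis using pv u(3) uh by simp
          qed
          then have p: "p = src (e, start e)" using u(3) uh by (simp add: src_def lev_start[OF e])
          then have "cis (2 * pi * lev (start e)) = cis (2 * pi * lev 0)" using u(4) base by (simp add: src_def)
          then have "int nlev dvd start e" unfolding cis_eq_iff lev_diff_int by simp
          then have "(e, start e) \<in> ?S" using start_strand[OF e] by simp
          then show ?thesis using p by blast
        qed
      qed
    qed
    then show ?thesis by (rule bij_betw_same_card[symmetric])
  qed
  have "web_degree w = (\<Sum>e\<in>edges w. thick w e * card {p \<in> path_image (curve w e). snd p = base_point})"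
    by (simp add: web_degree_def crossing_thickness_def base_point_def)
  also have "\<dots> = (\<Sum>e\<in>edges w. \<Sum>s | s \<in> strand_set \<and> fst s = e \<and> int nlev dvd snd s. thick w (fst s))"
    by (rule sum.cong) (simp_all add: card_eq)
  also have "\<dots> = sum (\<lambda>s. thick w (fst s)) (\<Union>e\<in>edges w. {s \<in> strand_set. fst s = e \<and> int nlev dvd snd s})"
    by (rule sum.UNION_disjoint[symmetric]) (use finite_edges finite_strand_set in auto)
  also have "(\<Union>e\<in>edges w. {s \<in> strand_set. fst s = e \<and> int nlev dvd snd s}) = {s \<in> strand_set. int nlev dvd snd s}"
    by (auto simp: strand_set_def)
  finally show ?thesis .
qed

end

section \<open>Colorings and arrays\<close>

lemma card_doubleton_Un_disjoint:
  assumes "finite A" "finite B" "card (A \<union> B) = card A + card B"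
  shows "A \<inter> B = {}"
  using card_Un_Int[OF assms(1,2)] assms by simp

lemma sorted_wrt_cases:
  assumes "sorted_wrt R xs" "x \<in> set xs" "y \<in> set xs" "x \<noteq> y"
  shows "R x y \<or> R y x"
proof -
  obtain i j where ij: "i < length xs" "x = xs ! i" "j < length xs" "y = xs ! j"
    using assms(2,3) by (auto simp: in_set_conv_nth)
  then have "i < j \<or> j < i" using assms(4) by (metis linorder_neqE_nat)
  then show ?thesis using assms(1) ij by (auto simp: sorted_wrt_iff_nth_less)
qed

context web_context
begin

lemma vertex_cases:
  assumes "v \<in> verts w"
  obtains (merge) a b c where "v \<in> merges w" "in_edges w v = {a, b}" "a \<noteq> b" "out_edges w v = {c}"
  | (split) a b c where "v \<in> splits w" "in_edges w v = {c}" "out_edges w v = {a, b}" "a \<noteq> b"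
proof -
  from assms verts_eq have "v \<in> merges w \<or> v \<in> splits w" by blast
  then show ?thesis
  proof
    assume v: "v \<in> merges w"
    then have "card (in_edges w v) = 2" "card (out_edges w v) = 1" by (auto simp: merges_def)
    then show ?thesis using merge[OF v] by (auto simp: card_2_iff card_1_singleton_iff)
  next
    assume v: "v \<in> splits w"
    then have "card (in_edges w v) = 1" "card (out_edges w v) = 2" by (auto simp: splits_def)
    then show ?thesis using split[OF v] by (auto simp: card_2_iff card_1_singleton_iff)
  qed
qed

lemma in_edges_sub: "in_edges w v \<subseteq> edges w" and out_edges_sub: "out_edges w v \<subseteq> edges w"
  by (auto simp: in_edges_def out_edges_def)

lemma coloringD:
  assumes "c \<in> colorings w"
  shows "e \<in> edges w \<Longrightarrow> finite (c e)" "e \<in> edges w \<Longrightarrow> 0 \<notin> c e" "e \<in> edges w \<Longrightarrow> card (c e) = thick w e"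
    "v \<in> verts w \<Longrightarrow> (\<Union>e\<in>in_edges w v. c e) = (\<Union>e\<in>out_edges w v. c e)"
    "e \<notin> edges w \<Longrightarrow> c e = undefined"
  using assms by (auto simp: colorings_def PiE_iff extensional_def)

text \<open>Equal unions and conserved thickness give
  \<open>|c a \<union> c b| = |c a| + |c b|\<close> for two edges on the same side of a
  vertex.\<close>

lemma coloring_disjoint:
  assumes c: "c \<in> colorings w" and v: "v \<in> verts w"
  shows "a \<in> in_edges w v \<Longrightarrow> b \<in> in_edges w v \<Longrightarrow> a \<noteq> b \<Longrightarrow> c a \<inter> c b = {}"
    "a \<in> out_edges w v \<Longrightarrow> b \<in> out_edges w v \<Longrightarrow> a \<noteq> b \<Longrightarrow> c a \<inter> c b = {}"
proof -
  have main: "c a \<inter> c b = {}"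
    if "a \<noteq> b" "a \<in> edges w" "b \<in> edges w" "o' \<in> edges w" "c a \<union> c b = c o'" "thick w a + thick w b = thick w o'" for a b o'
    using coloringD(1,3)[OF c] that by (intro card_doubleton_Un_disjoint) simp_all
  have E: "e \<in> edges w" if "e \<in> in_edges w v \<or> e \<in> out_edges w v" for e
    using that in_edges_sub out_edges_sub by blast
  note u = coloringD(4)[OF c v] and t = thick_conservation[OF v]
  have "(\<forall>a\<in>in_edges w v. \<forall>b\<in>in_edges w v. a \<noteq> b \<longrightarrow> c a \<inter> c b = {}) \<and>
      (\<forall>a\<in>out_edges w v. \<forall>b\<in>out_edges w v. a \<noteq> b \<longrightarrow> c a \<inter> c b = {})"
    using v
  proof (cases rule: vertex_cases)
    case (merge a b d)
    have "c a \<inter> c b = {}" using main[of a b d] E[of a] E[of b] E[of d] u t merge by simp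
    then show ?thesis using merge by auto
  next
    case (split a b d)
    have "c a \<inter> c b = {}" using main[of a b d] E[of a] E[of b] E[of d] u t split by simp
    then show ?thesis using split by auto
  qed
  then show "a \<in> in_edges w v \<Longrightarrow> b \<in> in_edges w v \<Longrightarrow> a \<noteq> b \<Longrightarrow> c a \<inter> c b = {}"
    "a \<in> out_edges w v \<Longrightarrow> b \<in> out_edges w v \<Longrightarrow> a \<noteq> b \<Longrightarrow> c a \<inter> c b = {}" by blast+
qed

lemma nonvertex_ends:
  assumes "e \<in> edges w" "st e \<notin> verts w \<or> fi e \<notin> verts w" shows "st e = fi e"
  using edge_props(5)[OF assms(1)] assms(2) by blast

lemma nonvertex_edge_unique:
  assumes "e \<in> edges w" "e' \<in> edges w" "p \<notin> verts w" "p = st e \<or> p = fi e" "p = st e' \<or> p = fi e'"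
  shows "e = e'"
proof (rule ccontr)
  assume "e \<noteq> e'"
  moreover have "p \<in> path_image (curve w e)" "p \<in> path_image (curve w e')" using assms(4,5) by auto
  ultimately show False using edges_disjoint[OF assms(1,2)] assms(3) by blast
qed

text \<open>By disjointness a color enters and leaves a vertex along at most one edge, and it enters
  if and only if it leaves. The base points of vertex-free circles are no vertices and are treated
  separately.\<close>

lemma flow_color_edges:
  assumes c: "c \<in> colorings w" shows "flow (color_edges w c i)"
proof -
  let ?F = "color_edges w c i"
  have F: "e \<in> ?F \<longleftrightarrow> e \<in> edges w \<and> i \<in> c e" for e by (simp add: color_edges_def)
  have "inj_on st ?F"
  proof (rule inj_onI)
    fix a b assume ab: "a \<in> ?F" "b \<in> ?F" "st a = st b"
    show "a = b"
    proof (cases "st a \<in> verts w")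
      case True
      then show ?thesis using coloring_disjoint(2)[OF c True, of a b] ab F by (auto simp: out_edges_def)
    next
      case False then show ?thesis using nonvertex_edge_unique[of a b "st a"] ab F by auto
    qed
  qed
  moreover have "inj_on fi ?F"
  proof (rule inj_onI)
    fix a b assume ab: "a \<in> ?F" "b \<in> ?F" "fi a = fi b"
    show "a = b"
    proof (cases "fi a \<in> verts w")
      case True
      then show ?thesis using coloring_disjoint(1)[OF c True, of a b] ab F by (auto simp: in_edges_def)
    next
      case False then show ?thesis using nonvertex_edge_unique[of a b "fi a"] ab F by auto
    qed
  qed
  moreover have "fi ` ?F = st ` ?F"
  proof (intro equalityI subsetI)
    fix p assume "p \<in> fi ` ?F"
    then obtain e where e: "e \<in> ?F" "p = fi e" by blast
    show "p \<in> st ` ?F"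
    proof (cases "p \<in> verts w")
      case True
      have "i \<in> (\<Union>e\<in>in_edges w p. c e)" using e F by (auto simp: in_edges_def)
      then obtain e' where "e' \<in> out_edges w p" "i \<in> c e'" using coloringD(4)[OF c True] by blast
      then show ?thesis using F by (auto simp: out_edges_def)
    next
      case False
      then have "st e = fi e" using nonvertex_ends[of e] e F by blast
      then show ?thesis using e by (metis image_eqI)
    qed
  next
    fix p assume "p \<in> st ` ?F"
    then obtain e where e: "e \<in> ?F" "p = st e" by blast
    show "p \<in> fi ` ?F"
    proof (cases "p \<in> verts w")
      case True
      have "i \<in> (\<Union>e\<in>out_edges w p. c e)" using e F by (auto simp: out_edges_def)
      then obtain e' where "e' \<in> in_edges w p" "i \<in> c e'" using coloringD(4)[OF c True] by blast
      then show ?thesis using F by (auto simp: in_edges_def)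
    next
      case False
      then have "st e = fi e" using nonvertex_ends[of e] e F by blast
      then show ?thesis using e by (metis image_eqI)
    qed
  qed
  ultimately show ?thesis using F by (auto simp: flow_def)
qed

text \<open>Each loop is counted by its crossing with the base segment. The second form is additive
  over strands, as double counting and the exchange of colors require.\<close>

lemma coloring_monomial_eq:
  assumes "c \<in> colorings w"
  shows "coloring_monomial w c i = card (loops_of (color_edges w c i))"
    "coloring_monomial w c i = card {s \<in> strand_set. int nlev dvd snd s \<and> i \<in> c (fst s)}"
proof -
  show a: "coloring_monomial w c i = card (loops_of (color_edges w c i))"
    unfolding coloring_monomial_def comps_eq_loops_of[OF flow_color_edges[OF assms]] ..
  have "{s \<in> strands_of (color_edges w c i). int nlev dvd snd s} = {s \<in> strand_set. int nlev dvd snd s \<and> i \<in> c (fst s)}"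
    by (auto simp: strands_of_def color_edges_def strand_set_def)
  then show "coloring_monomial w c i = card {s \<in> strand_set. int nlev dvd snd s \<and> i \<in> c (fst s)}"
    unfolding a card_loops_of[OF flow_color_edges[OF assms]] by simp
qed

lemma coloring_monomial_zero:
  assumes c: "c \<in> colorings w" and "coloring_monomial w c i = 0" and e: "e \<in> edges w"
  shows "i \<notin> c e"
proof
  assume i: "i \<in> c e"
  note F = flow_color_edges[OF c, of i]
  have "loops_of (color_edges w c i) = {}"
    using assms(2) coloring_monomial_eq(1)[OF c] finite_loops_of[OF F] by simp
  then have "color_edges w c i = {}" using Union_loops_of[OF F] by simp
  then show False using i e by (auto simp: color_edges_def)
qed

text \<open>Double counting of the pairs of a strand over the base angle and a color on it.\<close>

lemma coloring_monomial_homogeneous: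
  assumes c: "c \<in> colorings w"
  shows "coloring_monomial w c 0 = 0" "finite {i. coloring_monomial w c i \<noteq> 0}"
    "(\<Sum>i | coloring_monomial w c i \<noteq> 0. coloring_monomial w c i) = web_degree w"
proof -
  define I where "I = (\<Union>e\<in>edges w. c e)"
  have finI: "finite I" using coloringD(1)[OF c] finite_edges by (simp add: I_def)
  let ?S = "{s \<in> strand_set. int nlev dvd snd s}"
  have E: "fst s \<in> edges w" if "s \<in> strand_set" for s using that by (auto simp: strand_set_def)
  have m: "coloring_monomial w c i = card {s \<in> ?S. i \<in> c (fst s)}" for i
    unfolding coloring_monomial_eq(2)[OF c] by (rule arg_cong[of _ _ card]) blast
  have "{s \<in> ?S. 0 \<in> c (fst s)} = {}" using coloringD(2)[OF c] E by blast
  then show "coloring_monomial w c 0 = 0" unfolding m by (simp only: card.empty)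
  have sub: "{i. coloring_monomial w c i \<noteq> 0} \<subseteq> I"
  proof
    fix i assume "i \<in> {i. coloring_monomial w c i \<noteq> 0}"
    then have "card {s \<in> ?S. i \<in> c (fst s)} \<noteq> 0" unfolding m by blast
    then have "{s \<in> ?S. i \<in> c (fst s)} \<noteq> {}" by (intro notI) (simp only: card.empty)
    then obtain s where s: "s \<in> strand_set" "i \<in> c (fst s)" by blast
    then show "i \<in> I" using E[OF s(1)] unfolding I_def by blast
  qed
  then show "finite {i. coloring_monomial w c i \<noteq> 0}" using finI finite_subset by blast
  have "(\<Sum>i | coloring_monomial w c i \<noteq> 0. coloring_monomial w c i) = (\<Sum>i\<in>I. coloring_monomial w c i)"
    by (rule sum.mono_neutral_left) (use finI sub in auto)
  also have "\<dots> = (\<Sum>i\<in>I. \<Sum>s\<in>?S. if i \<in> c (fst s) then 1 else 0)"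
    unfolding m by (rule sum.cong) (simp_all add: finite_strand_set sum.If_cases Int_def)
  also have "\<dots> = (\<Sum>s\<in>?S. \<Sum>i\<in>I. if i \<in> c (fst s) then 1 else 0)" by (rule sum.swap)
  also have "\<dots> = (\<Sum>s\<in>?S. thick w (fst s))"
  proof (rule sum.cong)
    fix s assume s: "s \<in> ?S"
    have "fst s \<in> edges w" using E s by blast
    then have "I \<inter> {i. i \<in> c (fst s)} = c (fst s)" by (auto simp: I_def)
    then show "(\<Sum>i\<in>I. if i \<in> c (fst s) then 1 else 0) = thick w (fst s)"
      using finI coloringD(3)[OF c, of "fst s"] E s by (simp add: sum.If_cases)
  qed simp
  also have "\<dots> = web_degree w" by (simp add: web_degree_eq)
  finally show "(\<Sum>i | coloring_monomial w c i \<noteq> 0. coloring_monomial w c i) = web_degree w" .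
qed

lemma homogeneous_chromatic_function: "homogeneous (web_degree w) (chromatic_function w)"
  unfolding homogeneous_def
proof (intro allI impI)
  fix \<mu> assume "chromatic_function w \<mu> \<noteq> 0"
  then have "(\<Sum>c | c \<in> colorings w \<and> coloring_monomial w c = \<mu>. q_power (inv_coloring w c)) \<noteq> 0"
    by (simp only: chromatic_function_def not_False_eq_True)
  then obtain c where "c \<in> {c. c \<in> colorings w \<and> coloring_monomial w c = \<mu>}"
    by (rule sum.not_neutral_contains_not_neutral)
  then have c: "c \<in> colorings w" "coloring_monomial w c = \<mu>" by blast+
  show "\<mu> 0 = 0 \<and> finite {i. \<mu> i \<noteq> 0} \<and> (\<Sum>i | \<mu> i \<noteq> 0. \<mu> i) = web_degree w"
    using coloring_monomial_homogeneous[OF c(1)] unfolding c(2) by blast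
qed

lemma array_row:
  assumes T: "web_array w T" and r: "r \<in> set T"
  shows "\<And>L. L \<in> set r \<Longrightarrow> is_loop w L" "sorted_wrt (loop_prec w) r" "distinct r"
    "flow (\<Union>(set r))" "loops_of (\<Union>(set r)) = set r" "ordered_loops w (\<Union>(set r)) = r"
proof -
  show loop: "is_loop w L" if "L \<in> set r" for L
    using T r that by (auto simp: web_array_def loop_decomposition_def)
  show srt: "sorted_wrt (loop_prec w) r" using T r by (simp add: web_array_def)
  show "distinct r" using sorted_loops_distinct loop srt by blast
  have disj: "carrier_of w L \<inter> carrier_of w L' = {}" if "L \<in> set r" "L' \<in> set r" "L \<noteq> L'" for L L'
    using sorted_wrt_cases[OF srt that] prec_carrier_disjoint[of L L'] prec_carrier_disjoint[of L' L] by blast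
  show F: "flow (\<Union>(set r))" and l: "loops_of (\<Union>(set r)) = set r"
    using flow_Union_loops[of "set r"] loop disj by blast+
  show "ordered_loops w (\<Union>(set r)) = r" using ordered_loops(3)[OF F] l srt by simp
qed

lemma color_edges_array_coloring:
  assumes "web_array w T"
  shows "color_edges w (array_coloring w T) i = (if 1 \<le> i \<and> i \<le> length T then \<Union>(set (T ! (i - 1))) else {})"
proof -
  have "\<Union>(set (T ! (i - 1))) \<subseteq> edges w" if "1 \<le> i" "i \<le> length T"
  proof -
    have "T ! (i - 1) \<in> set T" using that by (intro nth_mem) simp
    then show ?thesis using array_row(1)[OF assms] loopD(1) by blast
  qed
  then show ?thesis by (auto simp: color_edges_def array_coloring_def)
qed

lemma count_row:
  assumes loops: "\<And>L. L \<in> set r \<Longrightarrow> is_loop w L" and dist: "distinct r"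
    and l: "flow (\<Union>(set r))"
  shows "length (filter (\<lambda>L. e \<in> L) r) = (if e \<in> \<Union>(set r) then 1 else 0)"
proof -
  have "length (filter (\<lambda>L. e \<in> L) r) = card ({L. e \<in> L} \<inter> set r)"
    using dist by (rule distinct_length_filter)
  also have "\<dots> = (if e \<in> \<Union>(set r) then 1 else 0)"
  proof (cases "e \<in> \<Union>(set r)")
    case True
    then obtain L where L: "L \<in> set r" "e \<in> L" by blast
    have "{L. e \<in> L} \<inter> set r = {L}"
      using loops_in_flow_eq[OF l] loops L by blast
    then show ?thesis using True by simp
  next
    case False
    then have "{L. e \<in> L} \<inter> set r = {}" by blast
    then show ?thesis using False by (simp only: card.empty if_False)
  qed
  finally show ?thesis .
qed

lemma size_filter_concat:
  "size {#L \<in># mset (concat T). P L#} = (\<Sum>i<length T. length (filter P (T ! i)))"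
proof -
  have "size {#L \<in># mset (concat T). P L#} = length (filter P (concat T))"
    by (metis mset_filter size_mset)
  also have "\<dots> = sum_list (map (\<lambda>r. length (filter P r)) T)"
    by (induction T) auto
  also have "\<dots> = (\<Sum>i<length T. length (filter P (T ! i)))"
    by (simp add: sum_list_sum_nth atLeast0LessThan)
  finally show ?thesis .
qed

lemma card_color_shift:
  fixes P :: "nat \<Rightarrow> bool"
  shows "card {i \<in> {1..n}. P (i - 1)} = (\<Sum>i<n. if P i then 1 else (0::nat))"
proof -
  have "{i \<in> {1..n}. P (i - 1)} = Suc ` {i. i < n \<and> P i}"
  proof (intro equalityI subsetI)
    fix i assume "i \<in> {i \<in> {1..n}. P (i - 1)}"
    then show "i \<in> Suc ` {i. i < n \<and> P i}" by (cases i) auto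
  qed auto
  then have "card {i \<in> {1..n}. P (i - 1)} = card {i. i < n \<and> P i}" by (simp add: card_image)
  also have "\<dots> = (\<Sum>i<n. if P i then 1 else (0::nat))"
    by (simp add: sum.If_cases Int_def)
  finally show ?thesis .
qed

text \<open>Each color class is the flow of one row, so the unions at a vertex agree color by color;
  the sizes of the color sets come from the loop decomposition.\<close>

lemma array_coloring_in_colorings:
  assumes T: "web_array w T"
  shows "array_coloring w T \<in> colorings w"
proof -
  let ?c = "array_coloring w T"
  have row: "T ! i \<in> set T" if "i < length T" for i using that by simp
  have c: "?c e = {i \<in> {1..length T}. e \<in> \<Union>(set (T ! (i - 1)))}" if "e \<in> edges w" for e
    using that by (auto simp: array_coloring_def)
  have card: "card (?c e) = thick w e" if e: "e \<in> edges w" for e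
  proof -
    have "card (?c e) = (\<Sum>i<length T. if e \<in> \<Union>(set (T ! i)) then 1 else 0)"
      unfolding c[OF e] by (rule card_color_shift)
    also have "\<dots> = (\<Sum>i<length T. length (filter (\<lambda>L. e \<in> L) (T ! i)))"
    proof (rule sum.cong)
      fix i assume "i \<in> {..<length T}"
      then have "T ! i \<in> set T" by simp
      from count_row[OF array_row(1)[OF T this] array_row(3,4)[OF T this]]
      show "(if e \<in> \<Union>(set (T ! i)) then 1 else 0) = length (filter (\<lambda>L. e \<in> L) (T ! i))" by simp
    qed simp
    also have "\<dots> = thick w e"
      using T e unfolding size_filter_concat[symmetric] web_array_def loop_decomposition_def by blast
    finally show ?thesis .
  qed
  have cons: "(\<Union>e\<in>in_edges w v. ?c e) = (\<Union>e\<in>out_edges w v. ?c e)" for v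
  proof -
    have F: "flow (color_edges w ?c i)" for i
    proof (cases "1 \<le> i \<and> i \<le> length T")
      case True
      then have "i - 1 < length T" by auto
      then show ?thesis unfolding color_edges_array_coloring[OF T] using True array_row(4)[OF T row] by simp
    next
      case False
      then show ?thesis unfolding color_edges_array_coloring[OF T] by (auto simp: flow_def)
    qed
    have a: "i \<in> (\<Union>e\<in>in_edges w v. ?c e) \<longleftrightarrow> v \<in> fi ` color_edges w ?c i" for i
      by (auto simp: in_edges_def color_edges_def)
    have b: "i \<in> (\<Union>e\<in>out_edges w v. ?c e) \<longleftrightarrow> v \<in> st ` color_edges w ?c i" for i
      by (auto simp: out_edges_def color_edges_def)
    show ?thesis by (rule set_eqI) (simp only: a b flowD(4)[OF F])
  qed
  have "?c \<in> (\<Pi>\<^sub>E e\<in>edges w. {S. finite S \<and> 0 \<notin> S \<and> card S = thick w e})"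
  proof (rule PiE_I)
    fix e assume e: "e \<in> edges w"
    show "?c e \<in> {S. finite S \<and> 0 \<notin> S \<and> card S = thick w e}"
      using card[OF e] c[OF e] by auto
  qed (simp add: array_coloring_def)
  then show ?thesis using cons by (simp add: colorings_def)
qed

text \<open>The number of rows is an argument because empty rows at the end leave no trace in the
  coloring.\<close>

definition coloring_array :: "nat \<Rightarrow> ('e \<Rightarrow> nat set) \<Rightarrow> 'e set list list" where
  "coloring_array l c = map (\<lambda>i. ordered_loops w (color_edges w c (Suc i))) [0..<l]"

lemma coloring_array_of_array:
  assumes T: "web_array w T"
  shows "coloring_array (length T) (array_coloring w T) = T"
proof (rule nth_equalityI)
  fix i assume "i < length (coloring_array (length T) (array_coloring w T))"
  then have i: "i < length T" by (simp add: coloring_array_def)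
  then show "coloring_array (length T) (array_coloring w T) ! i = T ! i"
    using array_row(6)[OF T, of "T ! i"] by (simp add: coloring_array_def color_edges_array_coloring[OF T])
qed (simp add: coloring_array_def)

lemma coloring_monomial_array_coloring:
  assumes T: "web_array w T"
  shows "coloring_monomial w (array_coloring w T) = monomial_of (shape T)"
proof
  fix i
  have empty: "loops_of {} = {}" using loopD(2) by (auto simp: loops_of_def)
  show "coloring_monomial w (array_coloring w T) i = monomial_of (shape T) i"
  proof (cases "1 \<le> i \<and> i \<le> length T")
    case True
    then have "i - 1 < length T" by auto
    then have m: "T ! (i - 1) \<in> set T" by simp
    show ?thesis
      unfolding coloring_monomial_eq(1)[OF array_coloring_in_colorings[OF T]] color_edges_array_coloring[OF T]
      using True array_row(5)[OF T m] distinct_card[OF array_row(3)[OF T m]] \<open>i - 1 < length T\<close>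
      by (simp add: monomial_of_def shape_def)
  next
    case False
    then show ?thesis
      unfolding coloring_monomial_eq(1)[OF array_coloring_in_colorings[OF T]] color_edges_array_coloring[OF T]
      by (auto simp: monomial_of_def shape_def empty)
  qed
qed

text \<open>Each color class is a flow, and its loops in horizontal order form a row. Colors beyond
  the length of \<open>\<alpha>\<close> have exponent zero, so no edge carries them and no color is
  lost.\<close>

lemma web_array_coloring_array:
  assumes c: "c \<in> colorings w" and m: "coloring_monomial w c = monomial_of \<alpha>"
  shows "web_array w (coloring_array (length \<alpha>) c)" "shape (coloring_array (length \<alpha>) c) = \<alpha>"
    "array_coloring w (coloring_array (length \<alpha>) c) = c"
proof -
  let ?T = "coloring_array (length \<alpha>) c"
  note F = flow_color_edges[OF c]
  have len: "length ?T = length \<alpha>" by (simp add: coloring_array_def)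
  have nth: "?T ! i = ordered_loops w (color_edges w c (Suc i))" if "i < length \<alpha>" for i
    using that by (simp add: coloring_array_def)
  have loops: "set (?T ! i) = loops_of (color_edges w c (Suc i))" "sorted_wrt (loop_prec w) (?T ! i)"
    if "i < length \<alpha>" for i
    unfolding nth[OF that] by (rule ordered_loops[OF F])+
  have isl: "is_loop w L" if "L \<in> set (?T ! i)" "i < length \<alpha>" for L i
    using that loops(1) by (auto simp: loops_of_def)
  have dist: "distinct (?T ! i)" if "i < length \<alpha>" for i
    by (rule sorted_loops_distinct[OF _ loops(2)[OF that]]) (use isl that in blast)
  have un: "\<Union>(set (?T ! i)) = color_edges w c (Suc i)" if "i < length \<alpha>" for i
    unfolding loops(1)[OF that] by (rule Union_loops_of[OF F])
  show sh: "shape ?T = \<alpha>"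
  proof (rule nth_equalityI)
    fix i assume "i < length (shape ?T)"
    then have i: "i < length \<alpha>" by (simp add: shape_def len)
    have "length (?T ! i) = card (set (?T ! i))" using distinct_card[OF dist[OF i]] by simp
    also have "\<dots> = coloring_monomial w c (Suc i)" using loops(1)[OF i] coloring_monomial_eq(1)[OF c] by simp
    finally show "shape ?T ! i = \<alpha> ! i" using i len by (simp add: shape_def m monomial_of_def)
  qed (simp add: shape_def len)
  have cs: "i \<in> {1..length \<alpha>}" if "i \<in> c e" "e \<in> edges w" for i e
  proof (rule ccontr)
    assume "i \<notin> {1..length \<alpha>}"
    then have "coloring_monomial w c i = 0" unfolding m by (auto simp: monomial_of_def)
    then show False using coloring_monomial_zero[OF c _ that(2)] that(1) by blast
  qed
  have cset: "c e = {i \<in> {1..length \<alpha>}. e \<in> \<Union>(set (?T ! (i - 1)))}" if e: "e \<in> edges w" for e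
  proof -
    have mem: "e \<in> \<Union>(set (?T ! (i - 1))) \<longleftrightarrow> i \<in> c e" if "i \<in> {1..length \<alpha>}" for i
    proof -
      have "i - 1 < length \<alpha>" "Suc (i - 1) = i" using that by auto
      then have "\<Union>(set (?T ! (i - 1))) = color_edges w c i" using un[of "i - 1"] by simp
      then show ?thesis using e by (simp add: color_edges_def)
    qed
    show ?thesis
    proof (intro equalityI subsetI)
      fix i assume i: "i \<in> c e"
      have "i \<in> {1..length \<alpha>}" by (rule cs[OF i e])
      moreover from this have "e \<in> \<Union>(set (?T ! (i - 1)))" using i by (rule iffD2[OF mem])
      ultimately show "i \<in> {i \<in> {1..length \<alpha>}. e \<in> \<Union>(set (?T ! (i - 1)))}" by (intro CollectI conjI)
    next
      fix i assume "i \<in> {i \<in> {1..length \<alpha>}. e \<in> \<Union>(set (?T ! (i - 1)))}"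
      then have i: "i \<in> {1..length \<alpha>} \<and> e \<in> \<Union>(set (?T ! (i - 1)))" by (rule CollectD)
      show "i \<in> c e" by (rule iffD1[OF mem[OF conjunct1[OF i]] conjunct2[OF i]])
    qed
  qed
  show "array_coloring w ?T = c"
  proof
    fix e show "array_coloring w ?T e = c e"
    proof (cases "e \<in> edges w")
      case True
      have "array_coloring w ?T e = {i \<in> {1..length \<alpha>}. e \<in> \<Union>(set (?T ! (i - 1)))}"
        using True len by (auto simp: array_coloring_def)
      then show ?thesis using cset[OF True] by simp
    next
      case False then show ?thesis using coloringD(5)[OF c] by (simp add: array_coloring_def)
    qed
  qed
  show "web_array w ?T"
    unfolding web_array_def loop_decomposition_def
  proof (intro conjI ballI)
    show "sum_list (shape ?T) = web_degree w"
      using coloring_monomial_homogeneous(3)[OF c] unfolding sh m sum_monomial_of .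
    fix L assume "L \<in># mset (concat ?T)"
    then obtain r where "r \<in> set ?T" "L \<in> set r" by auto
    then show "is_loop w L" using isl len by (metis in_set_conv_nth)
  next
    fix e assume e: "e \<in> edges w"
    have "size {#L \<in># mset (concat ?T). e \<in> L#} = (\<Sum>i<length \<alpha>. length (filter (\<lambda>L. e \<in> L) (?T ! i)))"
      unfolding size_filter_concat len ..
    also have "\<dots> = (\<Sum>i<length \<alpha>. if e \<in> \<Union>(set (?T ! i)) then 1 else 0)"
    proof (rule sum.cong)
      fix i assume "i \<in> {..<length \<alpha>}"
      then have i: "i < length \<alpha>" by simp
      show "length (filter (\<lambda>L. e \<in> L) (?T ! i)) = (if e \<in> \<Union>(set (?T ! i)) then 1 else 0)"
        by (rule count_row) (use isl i dist un F in auto)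
    qed simp
    also have "\<dots> = card (c e)" unfolding cset[OF e] by (rule card_color_shift[symmetric])
    finally show "size {#L \<in># mset (concat ?T). e \<in> L#} = thick w e" using coloringD(3)[OF c e] by simp
  next
    fix r assume "r \<in> set ?T"
    then show "sorted_wrt (loop_prec w) r" using loops(2) len by (metis in_set_conv_nth)
  qed
qed

lemma chromatic_function_monomial_of:
  "chromatic_function w (monomial_of \<alpha>) = (\<Sum>T | web_array w T \<and> shape T = \<alpha>. q_power (inv_array w T))"
proof -
  have len: "length T = length \<alpha>" if "shape T = \<alpha>" for T :: "'e set list list"
    using that by (auto simp: shape_def)
  show ?thesis
    unfolding chromatic_function_def inv_array_def
  proof (rule sum.reindex_bij_witness[of _ "array_coloring w" "coloring_array (length \<alpha>)"])
    fix c assume "c \<in> {c. c \<in> colorings w \<and> coloring_monomial w c = monomial_of \<alpha>}"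
    then have c: "c \<in> colorings w" "coloring_monomial w c = monomial_of \<alpha>" by auto
    from web_array_coloring_array[OF c]
    show "array_coloring w (coloring_array (length \<alpha>) c) = c"
      "coloring_array (length \<alpha>) c \<in> {T. web_array w T \<and> shape T = \<alpha>}"
      "q_power (inv_coloring w (array_coloring w (coloring_array (length \<alpha>) c))) = q_power (inv_coloring w c)"
      by auto
  next
    fix T assume "T \<in> {T. web_array w T \<and> shape T = \<alpha>}"
    then have T: "web_array w T" "shape T = \<alpha>" by auto
    show "coloring_array (length \<alpha>) (array_coloring w T) = T"
      using coloring_array_of_array[OF T(1)] len[OF T(2)] by simp
    show "array_coloring w T \<in> {c. c \<in> colorings w \<and> coloring_monomial w c = monomial_of \<alpha>}"
      using array_coloring_in_colorings[OF T(1)] coloring_monomial_array_coloring[OF T(1)] T(2) by simp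
  qed
qed

lemma finite_arrays: "finite {T. web_array w T \<and> shape T = \<alpha>}"
proof (rule finite_subset)
  let ?R = "{r. set r \<subseteq> Pow (edges w) \<and> length r \<le> sum_list \<alpha>}"
  have "finite ?R" by (rule finite_lists_length_le) (simp add: finite_edges)
  then show "finite {T. set T \<subseteq> ?R \<and> length T = length \<alpha>}" by (rule finite_lists_length_eq)
  show "{T. web_array w T \<and> shape T = \<alpha>} \<subseteq> {T. set T \<subseteq> ?R \<and> length T = length \<alpha>}"
  proof
    fix T assume "T \<in> {T. web_array w T \<and> shape T = \<alpha>}"
    then have T: "web_array w T" "shape T = \<alpha>" by auto
    have "set r \<subseteq> Pow (edges w) \<and> length r \<le> sum_list \<alpha>" if r: "r \<in> set T" for r
    proof
      show "set r \<subseteq> Pow (edges w)" using array_row(1)[OF T(1) r] loopD(1) by blast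
      have "length r \<in> set \<alpha>" unfolding T(2)[symmetric] shape_def using r by simp
      then show "length r \<le> sum_list \<alpha>" by (intro member_le_sum_list) simp_all
    qed
    moreover have "length T = length \<alpha>" unfolding T(2)[symmetric] by (simp add: shape_def)
    ultimately show "T \<in> {T. set T \<subseteq> ?R \<and> length T = length \<alpha>}" by blast
  qed
qed

end

section \<open>The sign-reversing involution\<close>

context web_context
begin

text \<open>The chosen lift and the logarithm behind the winding number are both continuous
  arguments of the curve, so their difference is a continuous function with discrete values and
  hence constant.\<close>

lemma edge_winding_eq:
  assumes e: "e \<in> edges w" shows "edge_winding w e = high e - low e"
proof -
  let ?p = "snd \<circ> curve w e"
  have path: "path ?p"
    using edge_props(1)[OF e] unfolding path_def simple_path_def o_def by (intro continuous_on_snd) simp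
  have p: "?p s = cis (2 * pi * height e s)" if "s \<in> {0..1}" for s
    using height_props(3)[OF e that] by simp
  have "0 \<notin> path_image ?p"
  proof
    assume "0 \<in> path_image ?p"
    then obtain s where "s \<in> {0..1}" "?p s = 0" by (auto simp: path_image_def)
    then show False using p by simp
  qed
  then obtain q where q: "path q" "pathfinish q - pathstart q = 2 * of_real pi * \<i> * winding_number ?p 0"
      "\<And>t. t \<in> {0..1} \<Longrightarrow> ?p t = 0 + exp (q t)"
    using winding_number_as_continuous_log[OF path] by metis
  define k where "k s = q s - \<i> * of_real (2 * pi * height e s)" for s
  have k1: "exp (k s) = 1" if "s \<in> {0..1}" for s
  proof -
    have "exp (q s) = exp (\<i> * of_real (2 * pi * height e s))"
      using q(3)[OF that] p[OF that] by (simp add: cis_conv_exp)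
    then show ?thesis by (simp add: k_def exp_diff)
  qed
  have "continuous_on {0..1} k"
    unfolding k_def using q(1) height_props(1)[OF e] by (auto simp: path_def intro!: continuous_intros)
  \<comment> \<open>Different values of \<open>k\<close> are multiples of
    \<open>2 * pi * \<i>\<close>, hence at least \<open>2 * pi\<close> apart.\<close>
  moreover have "\<exists>d>0. \<forall>t. t \<in> {0..1} \<and> k t \<noteq> k s \<longrightarrow> d \<le> norm (k t - k s)" if s: "s \<in> {0..1}" for s
  proof (intro exI[of _ "2 * pi"] conjI allI impI)
    fix t assume t: "t \<in> {0..1} \<and> k t \<noteq> k s"
    obtain n m :: int where nm: "Re (k t) = 0" "Im (k t) = of_int (2 * n) * pi" "Re (k s) = 0" "Im (k s) = of_int (2 * m) * pi"
      using k1[of t] k1[OF s] t unfolding exp_eq_1 by blast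
    then have "n \<noteq> m" using t by (auto simp: complex_eq_iff)
    then have "1 \<le> \<bar>real_of_int (n - m)\<bar>" by linarith
    have "2 * pi \<le> \<bar>Im (k t - k s)\<bar>"
    proof -
      have "Im (k t - k s) = 2 * pi * real_of_int (n - m)" using nm by (simp add: algebra_simps)
      then have "\<bar>Im (k t - k s)\<bar> = 2 * pi * \<bar>real_of_int (n - m)\<bar>" by (simp add: abs_mult)
      then show ?thesis using \<open>1 \<le> \<bar>real_of_int (n - m)\<bar>\<close> by simp
    qed
    then show "2 * pi \<le> norm (k t - k s)" using abs_Im_le_cmod[of "k t - k s"] by linarith
  qed simp
  ultimately have "k constant_on {0..1}"
    using continuous_discrete_range_constant[of "{0..1::real}" k] by auto
  then have "k 1 = k 0" by (auto simp: constant_on_def)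
  then have "q 1 - q 0 = \<i> * of_real (2 * pi * (high e - low e))"
    by (simp add: k_def high_def low_def algebra_simps)
  then have "2 * of_real pi * \<i> * winding_number ?p 0 = 2 * of_real pi * \<i> * of_real (high e - low e)"
    using q(2) by (simp add: pathfinish_def pathstart_def)
  then have "winding_number ?p 0 = of_real (high e - low e)" by simp
  then show ?thesis by (simp add: edge_winding_def)
qed

lemma edge_winding_pos: "e \<in> edges w \<Longrightarrow> 0 < edge_winding w e"
  using edge_winding_eq low_less_high by simp

lemma height_surj:
  assumes e: "e \<in> edges w" and t: "low e < t" "t < high e"
  obtains s where "0 < s" "s < 1" "height e s = t"
proof -
  have "t \<in> height e ` {0..1}" using height_image[OF e] t by auto
  then obtain s where s: "s \<in> {0..1}" "height e s = t" by blast
  then have "s \<noteq> 0" "s \<noteq> 1" using t by (auto simp: low_def high_def)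
  then show ?thesis using that[of s] s by auto
qed

lemma height_less_iff:
  assumes "e \<in> edges w" "s \<in> {0..1}" "s' \<in> {0..1}"
  shows "height e s < height e s' \<longleftrightarrow> s < s'"
  using strict_mono_onD[OF height_props(2)[OF assms(1)] assms(2,3)]
    strict_mono_onD[OF height_props(2)[OF assms(1)] assms(3,2)]
  by (cases s s' rule: linorder_cases) auto

lemma slab_width: "lev (N + 1) \<le> lev N + 1"
proof -
  have "lev (N + 1) \<le> lev (N + 1 * int nlev)" unfolding lev_le_iff using nlev_pos by simp
  then show ?thesis by (simp only: lev_add_period of_int_1)
qed

text \<open>Two strands keep their order throughout the slab below \<open>m\<close>, so the order
  arbitrarily close to \<open>m\<close> is that of the last strands of the two edges. The integer
  \<open>k\<close> compares the lifts chosen for them.\<close>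

lemma enters_left_of_iff:
  assumes m: "m \<in> verts w" and a: "a \<in> in_edges w m" and b: "b \<in> in_edges w m"
  shows "enters_left_of w a b \<longleftrightarrow> xi (a, stop a - 1) < xi (b, stop b - 1)"
proof -
  have E: "a \<in> edges w" "b \<in> edges w" using a b in_edges_sub by blast+
  let ?N = "stop a - 1"
  have sa: "(a, ?N) \<in> strand_set" and sb0: "(b, stop b - 1) \<in> strand_set" using stop_strand E by blast+
  have "tgt (a, ?N) = m" "tgt (b, stop b - 1) = m" using tgt_stop E a b by (auto simp: in_edges_def)
  then have "int nlev dvd ?N - (stop b - 1)" using slab_tgt[of a ?N b "stop b - 1"] by simp
  then obtain k where k: "stop b - 1 = ?N + k * int nlev" using slab_shift by blast
  note sb = sb0[unfolded k]
  have hi: "high a = lev (?N + 1)" "high b = lev (?N + 1) + of_int k"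
    using lev_stop[OF E(1)] lev_stop[OF E(2)] k lev_shift(2)[of ?N k] by (simp_all add: algebra_simps)
  have lo: "low a \<le> lev ?N" "low b \<le> lev ?N + of_int k"
    using strandD(2)[OF sa] strandD(2)[OF sb] unfolding lev_shift by auto
  have N1: "lev ?N < lev (?N + 1)" by (rule lev_step)
  have left: "enters_left_of w a b" if less: "xi (a, ?N) < xi (b, ?N + k * int nlev)"
  proof -
    obtain s0 where s0: "0 < s0" "s0 < 1" "height a s0 = mid ?N"
      using height_surj[OF E(1), of "mid ?N"] mid_between[of ?N] lo hi by auto
    obtain s1 where s1: "0 < s1" "s1 < 1" "height b s1 = mid ?N + of_int k"
      using height_surj[OF E(2), of "mid ?N + of_int k"] mid_between[of ?N] lo hi by auto
    \<comment> \<open>Past the parameter \<open>1 - d\<close> both curves are above the middle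
      height of their last slab.\<close>
    define d where "d = min (1 - s0) (1 - s1)"
    have d: "0 < d" "1 - d \<ge> s0" "1 - d \<ge> s1" using s0 s1 by (auto simp: d_def)
    show ?thesis
      unfolding enters_left_of_def
    proof (intro exI[of _ d] conjI ballI impI)
      fix s s' assume s: "s \<in> {1 - d<..<1}" and s': "s' \<in> {1 - d<..<1}" and eq: "snd (curve w a s) = snd (curve w b s')"
      have r: "s \<in> {0..1}" "s' \<in> {0..1}" "s0 \<in> {0..1}" "s1 \<in> {0..1}" "s0 < s" "s1 < s'" "s < 1" "s' < 1"
        using s s' d s0 s1 by auto
      define t where "t = height a s"
      define t' where "t' = height b s'"
      have t: "mid ?N < t" "t < lev (?N + 1)"
        using height_less_iff[OF E(1) r(3,1)] height_less_iff[OF E(1) r(1), of 1] s0(3) r hi(1) by (auto simp: t_def high_def)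
      have t': "mid ?N + of_int k < t'" "t' < lev (?N + 1) + of_int k"
        using height_less_iff[OF E(2) r(4,2)] height_less_iff[OF E(2) r(2), of 1] s1(3) r hi(2) by (auto simp: t'_def high_def)
      have c: "curve w a s = pt a t" "curve w b s' = pt b t'"
        using curve_eq_pt[OF E(1) r(1)] curve_eq_pt[OF E(2) r(2)] by (simp_all add: t_def t'_def)
      have "t' - t \<in> \<int>" using eq c by (simp add: cis_eq_iff[symmetric])
      then obtain j where j: "t' - t = of_int j" by (elim Ints_cases)
      \<comment> \<open>Up to the shift by \<open>k\<close> both heights lie in the upper half of
        one slab, and a slab is at most one turn high.\<close>
      have "\<bar>real_of_int (j - k)\<bar> < 1"
        using t t' j mid_between[of ?N] slab_width[of ?N] by (simp add: abs_less_iff)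
      then have "j = k" by linarith
      then have tt: "t' = t + of_int k" using j by simp
      have "pos a t < pos b (t + of_int k)"
        by (rule pos_less[OF sa sb less]) (use t mid_between[of ?N] in auto)
      then show "fst (curve w a s) < fst (curve w b s')" using c tt by simp
    qed (use d in simp)
  qed
  have not_right: "\<not> enters_left_of w a b" if less: "\<not> xi (a, ?N) < xi (b, ?N + k * int nlev)"
  proof
    assume "enters_left_of w a b"
    then obtain d where d: "d > 0" "\<And>s s'. s \<in> {1-d<..<1} \<Longrightarrow> s' \<in> {1-d<..<1} \<Longrightarrow>
        snd (curve w a s) = snd (curve w b s') \<Longrightarrow> fst (curve w a s) < fst (curve w b s')"
      unfolding enters_left_of_def by blast
    define u where "u = 1 - min d 1 / 2"
    have u: "u \<in> {0..1}" "u \<in> {1-d<..<1}" "u < 1" using d(1) by (auto simp: u_def min_def)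
    have ha: "height a u < lev (?N + 1)" and hb: "height b u < lev (?N + 1) + of_int k"
      using height_less_iff[OF E(1) u(1), of 1] height_less_iff[OF E(2) u(1), of 1] u(3) hi by (simp_all add: high_def)
    \<comment> \<open>A height below the merge that neither curve reaches before the parameter
      \<open>u\<close>, so that the assumed inequality applies there.\<close>
    define t where "t = max (mid ?N) (max (height a u) (height b u - of_int k))"
    have t: "mid ?N \<le> t" "height a u \<le> t" "height b u \<le> t + of_int k" "t < lev (?N + 1)"
      using ha hb mid_between(2)[of ?N] by (auto simp: t_def)
    have tN: "lev ?N < t" using t(1) mid_between(1)[of ?N] by simp
    obtain s where s: "0 < s" "s < 1" "height a s = t"
      by (rule height_surj[OF E(1), of t]) (use tN t lo hi in auto)
    obtain s' where s': "0 < s'" "s' < 1" "height b s' = t + of_int k"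
      by (rule height_surj[OF E(2), of "t + of_int k"]) (use tN t lo hi in auto)
    have us: "u \<le> s" "u \<le> s'"
      using height_less_iff[OF E(1), of s u] height_less_iff[OF E(2), of s' u] s s' u(1) t by auto
    have c: "curve w a s = pt a t" "curve w b s' = pt b (t + of_int k)"
      using curve_eq_pt[OF E(1), of s] curve_eq_pt[OF E(2), of s'] s s' by auto
    have "snd (curve w a s) = snd (curve w b s')" by (simp add: c cis_eq_iff)
    then have lt: "pos a t < pos b (t + of_int k)" using d(2)[of s s'] us u s s' c by simp
    show False
    proof (cases "xi (a, ?N) = xi (b, ?N + k * int nlev)")
      case True
      have "snd (src (a, ?N)) = snd (src (b, ?N + k * int nlev))" by (simp add: slab_src)
      then have "(a, ?N) = (b, ?N + k * int nlev)" using xi_inj[OF sa sb] True by blast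
      then have "a = b" "k = 0" using nlev_pos by auto
      then show False using lt by simp
    next
      case False
      then have gt: "xi (b, ?N + k * int nlev) < xi (a, (?N + k * int nlev) + (- k) * int nlev)" using less by simp
      have "pos b (t + of_int k) < pos a ((t + of_int k) + of_int (- k))"
        by (rule pos_less[OF sb _ gt]) (use sa tN t lev_shift[of ?N k] in simp_all)
      then show False using lt by simp
    qed
  qed
  show ?thesis using left not_right k by metis
qed

text \<open>Evaluates the definite descriptions of \<open>left_in\<close> and
  \<open>right_in\<close>: the last strands of the two incoming edges lie in one slab, where
  \<open>xi\<close> separates them.\<close>

lemma merge_left_right:
  assumes m: "m \<in> merges w"
  obtains l r d where "in_edges w m = {l, r}" "l \<noteq> r" "xi (l, stop l - 1) < xi (r, stop r - 1)"
    "left_in w m = l" "right_in w m = r" "out_edges w m = {d}"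
proof -
  have mv: "m \<in> verts w" using m by (simp add: merges_def)
  have card: "card (in_edges w m) = 2" "card (out_edges w m) = 1" using m by (auto simp: merges_def)
  obtain d where d: "out_edges w m = {d}" using card(2) card_1_singletonE by blast
  obtain a b where ab: "in_edges w m = {a, b}" "a \<noteq> b" using card(1) unfolding card_2_iff by blast
  have main: "left_in w m = l \<and> right_in w m = r"
    if lr: "in_edges w m = {l, r}" "l \<noteq> r" "xi (l, stop l - 1) < xi (r, stop r - 1)" for l r
  proof -
    have i: "enters_left_of w x y \<longleftrightarrow> x = l \<and> y = r" if "x \<in> in_edges w m" "y \<in> in_edges w m" for x y
      using enters_left_of_iff[OF mv that] that lr by auto
    have "left_in w m = l"
      unfolding left_in_def
    proof (rule the_equality)
      show "l \<in> in_edges w m \<and> (\<exists>e'\<in>in_edges w m. enters_left_of w l e')"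
        using i[of l r] lr(1) by simp
      show "e = l" if "e \<in> in_edges w m \<and> (\<exists>e'\<in>in_edges w m. enters_left_of w e e')" for e
        using that i by blast
    qed
    moreover have "right_in w m = r"
      unfolding right_in_def
    proof (rule the_equality)
      show "r \<in> in_edges w m \<and> (\<exists>e'\<in>in_edges w m. enters_left_of w e' r)"
        using i[of l r] lr(1) by simp
      show "e = r" if "e \<in> in_edges w m \<and> (\<exists>e'\<in>in_edges w m. enters_left_of w e' e)" for e
        using that i by blast
    qed
    ultimately show ?thesis by blast
  qed
  have E: "a \<in> edges w" "b \<in> edges w" using ab in_edges_sub by blast+
  have "a \<in> in_edges w m" "b \<in> in_edges w m" using ab by auto
  then have "fi a = fi b" by (simp add: in_edges_def)
  then have "snd (src (a, stop a - 1)) = snd (src (b, stop b - 1))"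
    using same_slab[OF stop_strand[OF E(1)] stop_strand[OF E(2)]] tgt_stop E by simp
  then have "xi (a, stop a - 1) \<noteq> xi (b, stop b - 1)"
    using xi_inj[OF stop_strand[OF E(1)] stop_strand[OF E(2)]] ab(2) by blast
  then consider "xi (a, stop a - 1) < xi (b, stop b - 1)" | "xi (b, stop b - 1) < xi (a, stop a - 1)" by linarith
  then show ?thesis
  proof cases
    case 1 then show ?thesis using that[OF ab 1] main[OF ab 1] d by blast
  next
    case 2
    have ba: "in_edges w m = {b, a}" "b \<noteq> a" using ab by auto
    show ?thesis using that[OF ba 2] main[OF ba 2] d by blast
  qed
qed

end

section \<open>Splitting and joining rows without changing the inversion statistic\<close>

lemma inv_sets_image:
  assumes "inj_on f A" "inj_on f B"
    and "\<And>a b. a \<in> A \<Longrightarrow> b \<in> B \<Longrightarrow> sgn (int (f a) - int (f b)) = sgn (int a - int b)"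
  shows "inv_sets (f ` A) (f ` B) = inv_sets A B"
  unfolding inv_sets_def using assms(1,2)
  by (simp add: sum.reindex) (intro sum.cong refl, simp add: assms(3))

lemma sum_sign_reversing:
  fixes g :: "'b \<Rightarrow> laurent"
  assumes fin: "finite X" and t: "\<And>x. x \<in> X \<Longrightarrow> t x \<in> X" "\<And>x. x \<in> X \<Longrightarrow> t (t x) = x"
    and sign: "\<And>x. x \<in> X \<Longrightarrow> t x \<noteq> x \<Longrightarrow> g (t x) = - g x"
  shows "sum g X = sum g {x \<in> X. t x = x}"
proof -
  let ?N = "{x \<in> X. t x \<noteq> x}"
  have tN: "t x \<in> ?N" if "x \<in> ?N" for x
  proof -
    have "t (t x) = x" "t x \<in> X" "t x \<noteq> x" using t that by auto
    then show ?thesis by (metis (mono_tags, lifting) mem_Collect_eq)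
  qed
  have "sum g ?N = (\<Sum>x\<in>?N. g (t x))"
    by (rule sum.reindex_bij_witness[of _ t t]) (use t tN in auto)
  also have "\<dots> = - sum g ?N" using sign by (simp add: sum_negf[symmetric])
  finally have neg: "sum g ?N = - sum g ?N" .
  \<comment> \<open>Laurent polynomials have integer coefficients, so a sum equal to its negative
    vanishes coefficient by coefficient.\<close>
  have "sum g ?N = 0"
  proof (rule poly_mapping_eqI)
    fix i
    have "Poly_Mapping.lookup (sum g ?N) i = - Poly_Mapping.lookup (sum g ?N) i"
      using arg_cong[OF neg, of "\<lambda>p. Poly_Mapping.lookup p i"] by simp
    then show "Poly_Mapping.lookup (sum g ?N) i = Poly_Mapping.lookup 0 i" by simp
  qed
  moreover have "sum g X = sum g {x \<in> X. t x = x} + sum g ?N"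
  proof -
    have "X = {x \<in> X. t x = x} \<union> ?N" by blast
    then have "sum g X = sum g ({x \<in> X. t x = x} \<union> ?N)" by simp
    also have "\<dots> = sum g {x \<in> X. t x = x} + sum g ?N" by (rule sum.union_disjoint) (use fin in auto)
    finally show ?thesis .
  qed
  ultimately show ?thesis by simp
qed

context web_context
begin

text \<open>The rows are listed in reverse order here, so the last row is the first row of the array, whose
  length must stay at least \<open>k\<close>.\<close>

fun toggle :: "nat \<Rightarrow> 'e set list list \<Rightarrow> 'e set list list" where
  "toggle k ((a # b # r) # R) =
     (if R = [] \<and> length (b # r) < k then (a # b # r) # R else [a] # (b # r) # R)"
| "toggle k ([a] # (b # r) # R) =
     (if loop_prec w a b then (a # b # r) # R else [a] # toggle k ((b # r) # R))"
| "toggle k R = R"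

text \<open>In the order of the array: a first row of length \<open>k\<close> above single boxes,
  that is a hook, in which no single box can be joined to the row above it.\<close>

fun toggle_fixed :: "nat \<Rightarrow> 'e set list list \<Rightarrow> bool" where
  "toggle_fixed k [] = False"
| "toggle_fixed k [r] = (length r = k)"
| "toggle_fixed k (x # y # R) = (length x = 1 \<and> \<not> loop_prec w (hd x) (hd y) \<and> toggle_fixed k (y # R))"

definition valid_rows :: "nat \<Rightarrow> 'e set list list \<Rightarrow> bool" where
  "valid_rows k R \<longleftrightarrow> R \<noteq> [] \<and> (\<forall>r\<in>set R. r \<noteq> [] \<and> sorted_wrt (loop_prec w) r \<and> (\<forall>L\<in>set r. is_loop w L)) \<and>
     k \<le> length (last R)"

lemma concat_toggle: "concat (toggle k R) = concat R"
  by (induction k R rule: toggle.induct) auto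

text \<open>Because the leading loop is unchanged, a comparison that failed before a move further
  inside fails again after it. This is what makes \<open>toggle\<close> an involution.\<close>

lemma toggle_Cons:
  assumes "valid_rows k ((b # r) # R)"
  obtains r' R' where "toggle k ((b # r) # R) = (b # r') # R'"
proof (cases r)
  case (Cons c r')
  then show ?thesis using that[of "c # r'" R] that[of "[]" "(c # r') # R"]
    by (cases "R = [] \<and> length (c # r') < k") auto
next
  case Nil
  show ?thesis
  proof (cases R)
    case Nil' : Nil then show ?thesis using that[of "[]" "[]"] Nil by simp
  next
    case (Cons x R')
    then obtain c r' where "x = c # r'" using assms by (cases x) (auto simp: valid_rows_def)
    then show ?thesis using that Nil Cons by (cases "loop_prec w b c") simp_all
  qed
qed

lemma valid_rows_tail: "valid_rows k (x # y # R) \<Longrightarrow> valid_rows k (y # R)"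
  by (auto simp: valid_rows_def)

lemma prec_Cons: 
  assumes "loop_prec w a b" "sorted_wrt (loop_prec w) (b # r)" "is_loop w b"
  shows "sorted_wrt (loop_prec w) (a # b # r)"
  using assms prec_trans[OF assms(1) _ assms(3)] by auto

lemma valid_rows_toggle:
  assumes "1 \<le> k" "valid_rows k R" shows "valid_rows k (toggle k R)"
  using assms(2)
proof (induction k R rule: toggle.induct)
  case (1 k a b r R)
  then show ?case by (auto simp: valid_rows_def not_less)
next
  case (2 k a b r R)
  show ?case
  proof (cases "loop_prec w a b")
    case True
    then show ?thesis using 2(2) prec_Cons[OF True, of r] by (auto simp: valid_rows_def)
  next
    case False
    have v: "valid_rows k (toggle k ((b # r) # R))" using 2(1)[OF False] valid_rows_tail[OF 2(2)] by simp
    then have "toggle k ((b # r) # R) \<noteq> []" by (simp add: valid_rows_def)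
    then show ?thesis using v False 2(2) by (auto simp: valid_rows_def)
  qed
qed auto

lemma toggle_toggle:
  assumes "1 \<le> k" "valid_rows k R" shows "toggle k (toggle k R) = R"
  using assms(2)
proof (induction k R rule: toggle.induct)
  case (1 k a b r R)
  have "loop_prec w a b" using 1 by (auto simp: valid_rows_def)
  then show ?case by simp
next
  case (2 k a b r R)
  show ?case
  proof (cases "loop_prec w a b")
    case True
    have "\<not> (R = [] \<and> length (b # r) < k)" using 2(2) by (auto simp: valid_rows_def)
    then show ?thesis using True by auto
  next
    case False
    have v: "valid_rows k ((b # r) # R)" using valid_rows_tail[OF 2(2)] by simp
    obtain r' R' where t: "toggle k ((b # r) # R) = (b # r') # R'" using toggle_Cons[OF v] .
    have "toggle k (toggle k ((b # r) # R)) = (b # r) # R" using 2(1)[OF False v] .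
    then show ?thesis using False t by simp
  qed
qed auto

lemma toggle_eq_iff:
  assumes "1 \<le> k" "valid_rows k R" shows "toggle k R = R \<longleftrightarrow> toggle_fixed k R"
  using assms
proof (induction k R rule: toggle.induct)
  case (1 k a b r R)
  then show ?case by (cases R) (auto simp: valid_rows_def)
next
  case (2 k a b r R)
  then show ?case using valid_rows_tail[OF 2(3)] by auto
next
  case ("3_3" k a)
  then have "k \<le> 1" by (auto simp: valid_rows_def)
  then have "k = 1" using \<open>1 \<le> k\<close> by simp
  then show ?case by simp
qed (auto simp: valid_rows_def)

lemma toggle_move:
  assumes "toggle k R \<noteq> R" "valid_rows k R"
  obtains U a b r V where "R = U @ (a # b # r) # V \<and> toggle k R = U @ [a] # (b # r) # V \<or>
      R = U @ [a] # (b # r) # V \<and> toggle k R = U @ (a # b # r) # V" "loop_prec w a b"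
  using assms
proof (induction k R arbitrary: thesis rule: toggle.induct)
  case (1 k a b r R)
  have "loop_prec w a b" using 1 by (auto simp: valid_rows_def)
  then show ?case using 1(1)[of "[]" a b r R] 1(2) by (auto split: if_splits)
next
  case (2 k a b r R)
  show ?case
  proof (cases "loop_prec w a b")
    case True
    then show ?thesis using 2(2)[of "[]" a b r R] by simp
  next
    case False
    have v: "valid_rows k ((b # r) # R)" using valid_rows_tail[OF 2(4)] by simp
    have ne: "toggle k ((b # r) # R) \<noteq> (b # r) # R" using 2(3) False by simp
    obtain U c d s V where UV: "(b # r) # R = U @ (c # d # s) # V \<and> toggle k ((b # r) # R) = U @ [c] # (d # s) # V \<or>
      (b # r) # R = U @ [c] # (d # s) # V \<and> toggle k ((b # r) # R) = U @ (c # d # s) # V" "loop_prec w c d"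
      using 2(1)[OF False _ ne v] by blast
    then show ?thesis using 2(2)[of "[a] # U" c d s V] False by auto
  qed
qed auto

text \<open>Lowering all colors above \<open>p\<close> by one identifies \<open>p\<close> with
  \<open>p + 1\<close> and preserves every other comparison. The loop \<open>a\<close> is disjoint
  from the rest of its row, so the two identified colors never face each other on the incoming edges
  of a merge.\<close>

lemma inv_array_merge:
  assumes T1: "web_array w (X @ (a # b # r) # Y)" and T2: "web_array w (X @ (b # r) # [a] # Y)"
  shows "inv_array w (X @ (b # r) # [a] # Y) = inv_array w (X @ (a # b # r) # Y)"
proof -
  let ?T1 = "X @ (a # b # r) # Y" and ?T2 = "X @ (b # r) # [a] # Y"
  let ?c1 = "array_coloring w ?T1" and ?c2 = "array_coloring w ?T2"
  define p where "p = Suc (length X)"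
  define f where "f i = (if i \<le> p then i else i - 1)" for i :: nat
  have row1: "a # b # r \<in> set ?T1" by simp
  have loops: "is_loop w L" if "L \<in> set (a # b # r)" for L using array_row(1)[OF T1 row1 that] .
  have prec: "loop_prec w a L" if "L \<in> set (b # r)" for L
    using array_row(2)[OF T1 row1] that by auto
  have disj: "carrier_of w a \<inter> carrier_of w L = {}" if "L \<in> set (b # r)" for L
    by (rule prec_carrier_disjoint[OF prec[OF that]])
  note C1 = color_edges_array_coloring[OF T1] and C2 = color_edges_array_coloring[OF T2]
  have c1: "i \<in> ?c1 e \<longleftrightarrow> 1 \<le> i \<and> i \<le> length ?T1 \<and> e \<in> \<Union>(set (?T1 ! (i - 1)))" if "e \<in> edges w" for i e
    using that by (auto simp: array_coloring_def)
  have c2: "i \<in> ?c2 e \<longleftrightarrow> 1 \<le> i \<and> i \<le> length ?T2 \<and> e \<in> \<Union>(set (?T2 ! (i - 1)))" if "e \<in> edges w" for i e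
    using that by (auto simp: array_coloring_def)
  have len1: "length ?T1 = p + length Y" and len2: "length ?T2 = Suc p + length Y" by (simp_all add: p_def)
  have n1: "?T1 ! (i - 1) = (if i < p then X ! (i - 1) else if i = p then a # b # r else Y ! (i - p - 1))" if "1 \<le> i" for i
    using that by (auto simp: nth_append p_def nth_Cons' not_less le_less)
  have n2: "?T2 ! (i - 1) = (if i < p then X ! (i - 1) else if i = p then b # r else if i = Suc p then [a] else Y ! (i - p - 2))" if "1 \<le> i" for i
    using that by (auto simp: nth_append p_def nth_Cons' not_less le_less)
  have p1: "1 \<le> p" by (simp add: p_def)
  have in_p2: "p \<in> ?c2 e \<longleftrightarrow> e \<in> \<Union>(set (b # r))" if "e \<in> edges w" for e
    unfolding c2[OF that] n2[OF p1] len2 using p1 by simp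
  have in_Sp2: "Suc p \<in> ?c2 e \<longleftrightarrow> e \<in> a" if "e \<in> edges w" for e
    unfolding c2[OF that] len2 using n2[of "Suc p"] by simp
  have in_p1: "p \<in> ?c1 e \<longleftrightarrow> e \<in> a \<or> e \<in> \<Union>(set (b # r))" if "e \<in> edges w" for e
    unfolding c1[OF that] n1[OF p1] len1 using p1 by auto
  have low: "i \<in> ?c2 e \<longleftrightarrow> i \<in> ?c1 e" if "e \<in> edges w" "i < p" for i e
    unfolding c1[OF that(1)] c2[OF that(1)] len1 len2
    using n1[of i] n2[of i] that(2) by auto
  have high: "Suc i \<in> ?c2 e \<longleftrightarrow> i \<in> ?c1 e" if "e \<in> edges w" "p < i" for i e
  proof -
    have "?T2 ! (Suc i - 1) = Y ! (i - p - 1)" using n2[of "Suc i"] that(2) by (simp add: numeral_2_eq_2)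
    moreover have "?T1 ! (i - 1) = Y ! (i - p - 1)" using n1[of i] that(2) p1 by simp
    ultimately show ?thesis unfolding c1[OF that(1)] c2[OF that(1)] len1 len2 using that(2) by auto
  qed
  have img: "f ` ?c2 e = ?c1 e" if e: "e \<in> edges w" for e
  proof (intro equalityI subsetI)
    fix i assume "i \<in> f ` ?c2 e"
    then obtain j where j: "j \<in> ?c2 e" "i = f j" by blast
    consider "j < p" | "j = p" | "j = Suc p" | "Suc p < j" by linarith
    then show "i \<in> ?c1 e"
    proof cases
      case 1 then show ?thesis using j low[OF e] by (simp add: f_def)
    next
      case 2 then show ?thesis using j in_p2[OF e] in_p1[OF e] by (simp add: f_def)
    next
      case 3 then show ?thesis using j in_Sp2[OF e] in_p1[OF e] by (simp add: f_def)
    next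
      case 4
      then obtain i' where "j = Suc i'" "p < i'" by (cases j) auto
      then show ?thesis using j high[OF e, of i'] by (simp add: f_def)
    qed
  next
    fix i assume i: "i \<in> ?c1 e"
    consider "i < p" | "i = p" | "p < i" by linarith
    then show "i \<in> f ` ?c2 e"
    proof cases
      case 1
      then have "i \<in> ?c2 e" "i = f i" using i low[OF e] by (simp_all add: f_def)
      then show ?thesis by blast
    next
      case 2
      then consider "p \<in> ?c2 e" | "Suc p \<in> ?c2 e" using i in_p1[OF e] in_p2[OF e] in_Sp2[OF e] by blast
      then show ?thesis
      proof cases
        case 1 then show ?thesis using 2 by (intro image_eqI[of _ _ p]) (simp_all add: f_def)
      next
        case 2 then show ?thesis using \<open>i = p\<close> by (intro image_eqI[of _ _ "Suc p"]) (simp_all add: f_def)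
      qed
    next
      case 3
      then show ?thesis using i high[OF e] by (intro image_eqI[of _ _ "Suc i"]) (simp_all add: f_def)
    qed
  qed
  have e_disj: "a \<inter> L = {}" if "L \<in> set (b # r)" for L
    using prec_disjoint[OF prec[OF that]] loops that by simp
  have f_eq: "x = y \<or> (x = p \<and> y = Suc p) \<or> (x = Suc p \<and> y = p)" if "f x = f y" for x y
    using that by (auto simp: f_def split: if_splits)
  have f_sgn: "sgn (int (f x) - int (f y)) = sgn (int x - int y)"
    if "\<not> (x = p \<and> y = Suc p)" "\<not> (x = Suc p \<and> y = p)" for x y
    using that by (auto simp: f_def sgn_if split: if_splits)
  have inj: "inj_on f (?c2 e)" if e: "e \<in> edges w" for e
  proof (rule inj_onI)
    fix x y assume xy: "x \<in> ?c2 e" "y \<in> ?c2 e" "f x = f y"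
    have "\<not> (p \<in> ?c2 e \<and> Suc p \<in> ?c2 e)" using in_p2[OF e] in_Sp2[OF e] e_disj by blast
    then show "x = y" using f_eq[OF xy(3)] xy(1,2) by blast
  qed
  have "inv_coloring w ?c1 = inv_coloring w ?c2"
    unfolding inv_coloring_def
  proof (rule sum.cong)
    fix m assume m: "m \<in> merges w"
    obtain l r' d where lr: "in_edges w m = {l, r'}" "left_in w m = l" "right_in w m = r'"
      using merge_left_right[OF m] by metis
    have E: "l \<in> edges w" "r' \<in> edges w" and fi: "fi l = m" "fi r' = m"
      using lr(1) in_edges_sub[of m] by (auto simp: in_edges_def)
    have no: "\<not> (e \<in> a \<and> e' \<in> \<Union>(set (b # r)))" if "fi e = m" "fi e' = m" for e e'
    proof
      assume "e \<in> a \<and> e' \<in> \<Union>(set (b # r))"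
      then obtain L where L: "e \<in> a" "e' \<in> L" "L \<in> set (b # r)" by blast
      have "m \<in> path_image (curve w e)" "m \<in> path_image (curve w e')"
        using that pathfinish_in_path_image by metis+
      then have "m \<in> carrier_of w a" "m \<in> carrier_of w L"
        using L unfolding carrier_of_def by blast+
      then show False using disj[OF L(3)] by blast
    qed
    have "inv_sets (f ` ?c2 r') (f ` ?c2 l) = inv_sets (?c2 r') (?c2 l)"
    proof (rule inv_sets_image[OF inj[OF E(2)] inj[OF E(1)]])
      fix x y assume xy: "x \<in> ?c2 r'" "y \<in> ?c2 l"
      show "sgn (int (f x) - int (f y)) = sgn (int x - int y)"
      proof (rule f_sgn)
        show "\<not> (x = p \<and> y = Suc p)"
          using xy in_p2[OF E(2)] in_Sp2[OF E(1)] no[OF fi] by blast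
        show "\<not> (x = Suc p \<and> y = p)"
          using xy in_p2[OF E(1)] in_Sp2[OF E(2)] no[OF fi(2,1)] by blast
      qed
    qed
    then show "inv_sets (?c1 (right_in w m)) (?c1 (left_in w m)) = inv_sets (?c2 (right_in w m)) (?c2 (left_in w m))"
      unfolding lr(2,3) img[OF E(1)] img[OF E(2)] .
  qed simp
  then show ?thesis by (simp add: inv_array_def)
qed

end

context web_context
begin

section \<open>Arrays and tableaux of hook shape\<close>

lemma toggle_fixed_iff:
  "toggle_fixed k R \<longleftrightarrow> R \<noteq> [] \<and> length (last R) = k \<and>
     (\<forall>i. Suc i < length R \<longrightarrow> length (R ! i) = 1 \<and> \<not> loop_prec w (hd (R ! i)) (hd (R ! Suc i)))"
proof (induction k R rule: toggle_fixed.induct)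
  case (3 k x y R)
  have "(\<forall>i. Suc i < length (x # y # R) \<longrightarrow>
          length ((x # y # R) ! i) = 1 \<and> \<not> loop_prec w (hd ((x # y # R) ! i)) (hd ((x # y # R) ! Suc i))) \<longleftrightarrow>
        (length x = 1 \<and> \<not> loop_prec w (hd x) (hd y)) \<and>
        (\<forall>i. Suc i < length (y # R) \<longrightarrow>
          length ((y # R) ! i) = 1 \<and> \<not> loop_prec w (hd ((y # R) ! i)) (hd ((y # R) ! Suc i)))"
    (is "?L \<longleftrightarrow> ?H \<and> ?R")
  proof
    assume L: ?L
    show "?H \<and> ?R"
    proof
      show ?H using L[rule_format, of 0] by simp
      show ?R using L[rule_format, of "Suc _"] by auto
    qed
  next
    assume HR: "?H \<and> ?R"
    show ?L
    proof (intro allI impI)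
      fix i assume "Suc i < length (x # y # R)"
      then show "length ((x # y # R) ! i) = 1 \<and> \<not> loop_prec w (hd ((x # y # R) ! i)) (hd ((x # y # R) ! Suc i))"
        using HR by (cases i) auto
    qed
  qed
  then show ?case using 3 unfolding toggle_fixed.simps by auto
qed auto

lemma web_array_iff:
  "web_array w T \<longleftrightarrow> sum_list (shape T) = web_degree w \<and> loop_decomposition w (mset (concat T)) \<and>
     (\<forall>r\<in>set T. sorted_wrt (loop_prec w) r)"
  by (simp add: web_array_def)

lemma sum_list_shape: "sum_list (shape T) = size (mset (concat T))"
  by (induction T) (auto simp: shape_def)

lemma flow_empty: "flow {}" and loops_of_empty: "loops_of {} = {}"
  using loopD(2) by (auto simp: flow_def loops_of_def)

text \<open>Beyond the only box of row \<open>i\<close> nothing is left, so \<open>B\<close> is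
  empty and the circles to be swapped are the reversed loops of row \<open>i - 1\<close>. None of
  them has winding number zero, so the whole row changes its color.\<close>

lemma SW_hook:
  assumes T: "web_array w T" and len: "length (T ! (i - 1)) = 1" and i: "1 < i" "i \<le> length T"
  shows "SW w i 1 T = T[i - 2 := [], i - 1 := T ! (i - 1) @ T ! (i - 2)]"
proof -
  let ?r = "T ! (i - 2)"
  define A where "A = \<Union>(set ?r)"
  have r: "?r \<in> set T" using i by simp
  note row = array_row[OF T r]
  have F: "flow A" and lA: "loops_of A = set ?r" using row(4,5) by (simp_all add: A_def)
  have AE: "A \<subseteq> edges w" by (rule flowD(1)[OF F])
  have drop: "drop 1 (T ! (i - 1)) = []" using len by simp
  have G: "Gamma A {} = A" by (simp add: Gamma_def)
  have star: "Gamma_star w A {} = A"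
  proof -
    \<comment> \<open>Edges rise, so their winding contributions are all positive and cannot
      cancel.\<close>
    have "comp_winding w A {} C \<noteq> 0" if C: "C \<in> loops_of A" for C
    proof -
      have C': "C \<subseteq> A" "C \<noteq> {}" "finite C" using C loopD(2) flowD(5)[OF F] finite_subset by (auto simp: loops_of_def)
      have "0 < (\<Sum>e\<in>C. edge_winding w e)"
        by (rule sum_pos) (use C' AE edge_winding_pos in auto)
      moreover have "C \<inter> A = C" using C' by blast
      ultimately show ?thesis by (simp add: comp_winding_def)
    qed
    then have "{C \<in> comps w (Gamma A {}). comp_winding w A {} C \<noteq> 0} = loops_of A"
      unfolding G comps_eq_loops_of[OF F] by blast
    then show ?thesis unfolding Gamma_star_def using Union_loops_of[OF F] by simp
  qed
  have o1: "ordered_loops w A = ?r" using row(6) by (simp add: A_def)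
  have o2: "ordered_loops w {} = []" using ordered_loops(1)[OF flow_empty] loops_of_empty by simp
  have "SW w i 1 T = T[i - 2 := take (1 - 1) ?r @ ordered_loops w ((A - Gamma_star w A {}) \<union> ({} \<inter> Gamma_star w A {})),
      i - 1 := take 1 (T ! (i - 1)) @ ordered_loops w (({} - Gamma_star w A {}) \<union> (A \<inter> Gamma_star w A {}))]"
    unfolding SW_def Let_def drop by (simp add: A_def)
  also have "\<dots> = T[i - 2 := [], i - 1 := T ! (i - 1) @ ?r]"
    unfolding star using o1 o2 len by simp
  finally show ?thesis .
qed

text \<open>Only cells in the first column are admissible, since every row below the first has one
  box. There \<open>SW\<close> keeps the multiset of loops, so only the order of the new row
  matters, and by transitivity this is decided by its first two loops.\<close>

lemma hook_array_invertible_iff: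
  assumes T: "web_array w T" and sh: "shape T = hook n k" and k: "1 \<le> k" "k \<le> n"
  shows "invertible_array w T \<longleftrightarrow>
    (\<exists>i. Suc i < length T \<and> loop_prec w (hd (T ! Suc i)) (hd (T ! i)))"
proof -
  have lenT: "length T = Suc (n - k)" using arg_cong[OF sh, of length] by (simp add: shape_def hook_def)
  have len: "length (T ! i) = (if i = 0 then k else 1)" if "i < length T" for i
  proof -
    have "length (T ! i) = shape T ! i" using that by (simp add: shape_def)
    also have "\<dots> = (if i = 0 then k else 1)" using that lenT unfolding sh by (cases i) (auto simp: hook_def)
    finally show ?thesis .
  qed
  have at: "invertible_at w T (Suc (Suc i)) 1 \<longleftrightarrow> loop_prec w (hd (T ! Suc i)) (hd (T ! i))"
    if i: "Suc i < length T" for i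
  proof -
    define X where "X = take i T"
    define Y where "Y = drop (Suc (Suc i)) T"
    have l1: "length (T ! Suc i) = 1" and l0: "1 \<le> length (T ! i)" using len[of "Suc i"] len[of i] i k by (auto split: if_splits)
    obtain a where a: "T ! Suc i = [a]" using l1 by (metis One_nat_def length_0_conv length_Suc_conv)
    obtain b r where b: "T ! i = b # r" using l0 by (cases "T ! i") auto
    have TX: "T = X @ (b # r) # [a] # Y"
      unfolding X_def Y_def using i a b id_take_nth_drop[of i T] Cons_nth_drop_Suc[of "Suc i" T] by simp
    have lX: "length X = i" using i by (simp add: X_def)
    have "SW w (Suc (Suc i)) 1 T = T[i := [], Suc i := T ! Suc i @ T ! i]"
      using SW_hook[OF T, of "Suc (Suc i)"] l1 i by simp
    also have "\<dots> = X @ [] # (a # b # r) # Y"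
    proof -
      have "T[i := [], Suc i := [a] @ b # r] = (X @ (b # r) # [a] # Y)[i := [], Suc i := [a] @ b # r]"
        using TX by simp
      also have "\<dots> = X @ [] # (a # b # r) # Y" using lX by (simp add: list_update_append)
      finally show ?thesis using a b by simp
    qed
    finally have SWT: "SW w (Suc (Suc i)) 1 T = X @ [] # (a # b # r) # Y" .
    have m: "mset (concat (X @ [] # (a # b # r) # Y)) = mset (concat T)" unfolding TX by simp
    have adm: "admissible T (Suc (Suc i)) 1" using i l1 by (simp add: admissible_def)
    have rows: "sorted_wrt (loop_prec w) s" if "s \<in> set T" for s using T that by (simp add: web_array_def)
    have br: "sorted_wrt (loop_prec w) (b # r)" "b # r \<in> set T" using rows[of "b # r"] TX by auto
    have lb: "is_loop w b" using array_row(1)[OF T br(2)] by simp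
    have "web_array w (X @ [] # (a # b # r) # Y) \<longleftrightarrow> sorted_wrt (loop_prec w) (a # b # r)"
    proof
      assume "web_array w (X @ [] # (a # b # r) # Y)"
      then show "sorted_wrt (loop_prec w) (a # b # r)" by (simp add: web_array_def)
    next
      assume s: "sorted_wrt (loop_prec w) (a # b # r)"
      have "sorted_wrt (loop_prec w) t" if "t \<in> set (X @ [] # (a # b # r) # Y)" for t
      proof -
        have "t \<in> set X \<or> t = [] \<or> t = a # b # r \<or> t \<in> set Y" using that by auto
        then show ?thesis using s rows TX by auto
      qed
      then show "web_array w (X @ [] # (a # b # r) # Y)"
        using T unfolding web_array_iff sum_list_shape m by blast
    qed
    also have "\<dots> \<longleftrightarrow> loop_prec w a b" using prec_Cons[OF _ br(1) lb] by auto
    finally show ?thesis using adm SWT a b by (simp add: invertible_at_def)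
  qed
  have adm: "\<exists>i'. i = Suc (Suc i') \<and> Suc i' < length T \<and> j = 1" if "admissible T i j" for i j
  proof -
    have a: "1 < i" "i \<le> length T" "1 \<le> j" "j \<le> length (T ! (i - 1))" using that by (auto simp: admissible_def)
    then have "j = 1" using len[of "i - 1"] by (simp split: if_splits)
    moreover have "i = Suc (Suc (i - 2))" using a(1) by simp
    moreover have "Suc (i - 2) < length T" using a(1,2) by simp
    ultimately show ?thesis by blast
  qed
  show ?thesis
  proof
    assume "invertible_array w T"
    then obtain i j where ij: "invertible_at w T i j" by (auto simp: invertible_array_def)
    then obtain i' where "i = Suc (Suc i')" "Suc i' < length T" "j = 1"
      using adm[of i j] by (auto simp: invertible_at_def)
    then show "\<exists>i. Suc i < length T \<and> loop_prec w (hd (T ! Suc i)) (hd (T ! i))" using at ij by blast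
  next
    assume "\<exists>i. Suc i < length T \<and> loop_prec w (hd (T ! Suc i)) (hd (T ! i))"
    then show "invertible_array w T" using at unfolding invertible_array_def by blast
  qed
qed

text \<open>After reversal the comparisons in which \<open>toggle\<close> would join two rows are
  those that make a hook array invertible; the length conditions say that the shape is a
  hook.\<close>

lemma toggle_fixed_rev_iff:
  assumes T: "web_array w T" and sh: "shape T \<in> compositions n k" and k: "1 \<le> k" "k \<le> n"
  shows "toggle_fixed k (rev T) \<longleftrightarrow> shape T = hook n k \<and> \<not> invertible_array w T"
proof -
  have ne: "T \<noteq> []" and sum: "sum_list (shape T) = n" using sh by (auto simp: compositions_def shape_def)
  have rev_nth: "rev T ! i = T ! (length T - Suc i)" if "i < length T" for i using that by (rule rev_nth)
  have last: "last (rev T) = T ! 0" using ne by (simp add: last_rev hd_conv_nth)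
  have idx: "(\<forall>i. Suc i < length (rev T) \<longrightarrow> P (rev T ! i) (rev T ! Suc i)) \<longleftrightarrow>
      (\<forall>i. Suc i < length T \<longrightarrow> P (T ! Suc i) (T ! i))" for P
  proof
    assume L: "\<forall>i. Suc i < length (rev T) \<longrightarrow> P (rev T ! i) (rev T ! Suc i)"
    show "\<forall>i. Suc i < length T \<longrightarrow> P (T ! Suc i) (T ! i)"
    proof (intro allI impI)
      fix i assume i: "Suc i < length T"
      define j where "j = length T - Suc (Suc i)"
      have j: "Suc j < length (rev T)" "length T - Suc j = Suc i" "length T - Suc (Suc j) = i" using i by (auto simp: j_def)
      then show "P (T ! Suc i) (T ! i)" using L[rule_format, OF j(1)] rev_nth[of j] rev_nth[of "Suc j"] by simp
    qed
  next
    assume R: "\<forall>i. Suc i < length T \<longrightarrow> P (T ! Suc i) (T ! i)"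
    show "\<forall>i. Suc i < length (rev T) \<longrightarrow> P (rev T ! i) (rev T ! Suc i)"
    proof (intro allI impI)
      fix i assume i: "Suc i < length (rev T)"
      define j where "j = length T - Suc (Suc i)"
      have j: "Suc j < length T" "length T - Suc i = Suc j" "length T - Suc (Suc i) = j" using i by (auto simp: j_def)
      then show "P (rev T ! i) (rev T ! Suc i)" using R[rule_format, OF j(1)] rev_nth[of i] rev_nth[of "Suc i"] i by simp
    qed
  qed
  have fixed: "toggle_fixed k (rev T) \<longleftrightarrow> length (T ! 0) = k \<and>
      (\<forall>i. Suc i < length T \<longrightarrow> length (T ! Suc i) = 1 \<and> \<not> loop_prec w (hd (T ! Suc i)) (hd (T ! i)))"
    unfolding toggle_fixed_iff last using ne idx[of "\<lambda>x y. length x = 1 \<and> \<not> loop_prec w (hd x) (hd y)"] by simp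
  have shape_iff: "shape T = hook n k \<longleftrightarrow> length (T ! 0) = k \<and> (\<forall>i. Suc i < length T \<longrightarrow> length (T ! Suc i) = 1)"
  proof
    assume h: "shape T = hook n k"
    have lenT: "length T = Suc (n - k)" using arg_cong[OF h, of length] by (simp add: shape_def hook_def)
    have "length (T ! i) = hook n k ! i" if "i < length T" for i using that unfolding h[symmetric] by (simp add: shape_def)
    then show "length (T ! 0) = k \<and> (\<forall>i. Suc i < length T \<longrightarrow> length (T ! Suc i) = 1)"
      using lenT by (auto simp: hook_def)
  next
    assume R: "length (T ! 0) = k \<and> (\<forall>i. Suc i < length T \<longrightarrow> length (T ! Suc i) = 1)"
    have "shape T = k # replicate (length T - 1) 1"
    proof (rule nth_equalityI)
      fix i assume "i < length (shape T)"
      then show "shape T ! i = (k # replicate (length T - 1) 1) ! i"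
        using R by (cases i) (auto simp: shape_def)
    qed (use ne in \<open>simp add: shape_def\<close>)
    moreover from this have "n = k + (length T - 1)" using sum by (simp add: sum_list_replicate)
    ultimately show "shape T = hook n k" by (simp add: hook_def)
  qed
  show ?thesis
  proof (cases "shape T = hook n k")
    case True
    then show ?thesis unfolding fixed using shape_iff hook_array_invertible_iff[OF T True k] by auto
  next
    case False then show ?thesis unfolding fixed using shape_iff by auto
  qed
qed

lemma hook_functional_chromatic_function:
  assumes n: "web_degree w = n" and k: "1 \<le> k" "k \<le> n"
  shows "hook_functional n k (chromatic_function w) = (\<Sum>T\<in>web_tableaux w (hook n k). q_power (inv_array w T))"
proof -
  define X where "X = {T. web_array w T \<and> shape T \<in> compositions n k}"
  define g where "g T = (-1) ^ (n - k + 1 + length T) * q_power (inv_array w T)" for T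
  define t where "t T = rev (toggle k (rev T))" for T
  have valid_iff: "T \<in> X \<longleftrightarrow> valid_rows k (rev T) \<and> sum_list (shape T) = n \<and> loop_decomposition w (mset (concat T))" for T
  proof -
    have "T = [] \<or> length (hd T) = hd (shape T)" by (cases T) (auto simp: shape_def)
    then show ?thesis
      using n unfolding X_def valid_rows_def compositions_def web_array_iff
      by (auto simp: last_rev shape_def loop_decomposition_def image_iff)
  qed
  have fin: "finite X"
  proof -
    have "X = (\<Union>\<alpha>\<in>compositions n k. {T. web_array w T \<and> shape T = \<alpha>})" by (auto simp: X_def)
    then show ?thesis using finite_compositions finite_arrays by simp
  qed
  have tX: "t T \<in> X" if "T \<in> X" for T
  proof -
    have v: "valid_rows k (rev T)" and s: "sum_list (shape T) = n" "loop_decomposition w (mset (concat T))"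
      using that valid_iff by blast+
    have m: "mset (concat (rev R)) = mset (concat R)" for R :: "'e set list list"
      by (induction R) (auto simp: add.commute)
    have "mset (concat (t T)) = mset (concat T)"
      unfolding t_def m concat_toggle ..
    then show ?thesis
      using valid_rows_toggle[OF k(1) v] s unfolding valid_iff sum_list_shape by (simp add: t_def)
  qed
  have tt: "t (t T) = T" if "T \<in> X" for T
    using toggle_toggle[OF k(1), of "rev T"] that valid_iff by (simp add: t_def)
  \<comment> \<open>A move changes the number of rows by one and keeps \<open>inv\<close>.\<close>
  have sign: "g (t T) = - g T" if T: "T \<in> X" and ne: "t T \<noteq> T" for T
  proof -
    have v: "valid_rows k (rev T)" using T valid_iff by blast
    have ne': "toggle k (rev T) \<noteq> rev T" using ne by (auto simp: t_def)
    obtain U a b r V where UV: "rev T = U @ (a # b # r) # V \<and> toggle k (rev T) = U @ [a] # (b # r) # V \<or>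
      rev T = U @ [a] # (b # r) # V \<and> toggle k (rev T) = U @ (a # b # r) # V"
      using toggle_move[OF ne' v] by metis
    define T1 where "T1 = rev V @ (a # b # r) # rev U"
    define T2 where "T2 = rev V @ (b # r) # [a] # rev U"
    have "T = T1 \<and> t T = T2 \<or> T = T2 \<and> t T = T1"
      using UV by (auto simp: T1_def T2_def t_def rev_swap)
    moreover have "web_array w T" "web_array w (t T)" using T tX[OF T] by (auto simp: X_def)
    ultimately have a: "web_array w T1" "web_array w T2" and c: "T = T1 \<and> t T = T2 \<or> T = T2 \<and> t T = T1" by auto
    have "inv_array w T2 = inv_array w T1"
      using inv_array_merge[OF a[unfolded T1_def T2_def]] by (simp add: T1_def T2_def)
    moreover have "length T2 = Suc (length T1)" by (simp add: T1_def T2_def)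
    ultimately show ?thesis using c by (auto simp: g_def)
  qed
  have "hook_functional n k (chromatic_function w) =
      (\<Sum>\<alpha>\<in>compositions n k. \<Sum>T | web_array w T \<and> shape T = \<alpha>. g T)"
    unfolding hook_functional_def chromatic_function_monomial_of sum_distrib_left
    by (intro sum.cong refl) (auto simp: g_def shape_def)
  also have "\<dots> = sum g (\<Union>\<alpha>\<in>compositions n k. {T. web_array w T \<and> shape T = \<alpha>})"
    by (rule sum.UNION_disjoint[symmetric]) (use finite_compositions finite_arrays in auto)
  also have "(\<Union>\<alpha>\<in>compositions n k. {T. web_array w T \<and> shape T = \<alpha>}) = X" by (auto simp: X_def)
  also have "sum g X = sum g {T \<in> X. t T = T}" by (rule sum_sign_reversing[where t = t, OF fin]) (fact tX tt sign)+
  also have "{T \<in> X. t T = T} = web_tableaux w (hook n k)"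
  proof (intro set_eqI)
    fix T
    have "hook n k \<in> compositions n k" using k by (auto simp: compositions_def hook_def sum_list_replicate)
    moreover have "t T = T \<longleftrightarrow> toggle_fixed k (rev T)" if "T \<in> X"
      using toggle_eq_iff[OF k(1), of "rev T"] that valid_iff by (metis t_def rev_rev_ident)
    ultimately show "T \<in> {T \<in> X. t T = T} \<longleftrightarrow> T \<in> web_tableaux w (hook n k)"
      using toggle_fixed_rev_iff[OF _ _ k, of T] by (auto simp: X_def web_tableaux_def)
  qed
  also have "sum g \<dots> = (\<Sum>T\<in>web_tableaux w (hook n k). q_power (inv_array w T))"
  proof (rule sum.cong)
    fix T assume "T \<in> web_tableaux w (hook n k)"
    then have "shape T = hook n k" by (simp add: web_tableaux_def)
    from arg_cong[OF this, of length] have "length T = Suc (n - k)" by (simp add: shape_def hook_def)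
    \<comment> \<open>On arrays of the hook shape the exponent of the sign is even, so the fixed
      points count positively.\<close>
    then have "n - k + 1 + length T = 2 * Suc (n - k)" by simp
    then show "g T = q_power (inv_array w T)" unfolding g_def by (simp only: power_mult) simp
  qed simp
  finally show ?thesis .
qed

end

section \<open>Symmetry of the chromatic function\<close>

text \<open>Exchanging neighbouring values alters the comparison of two numbers only if these are
  \<open>i\<close> and \<open>Suc i\<close> themselves.\<close>

lemma inv_sets_transpose:
  assumes "finite A" "finite B"
  shows "inv_sets A B - inv_sets (Transposition.transpose i (Suc i) ` A) (Transposition.transpose i (Suc i) ` B) =
    2 * ((if Suc i \<in> A \<and> i \<in> B then 1 else 0) - (if i \<in> A \<and> Suc i \<in> B then 1 else 0))"
proof -
  let ?t = "Transposition.transpose i (Suc i)"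
  have pair: "sgn (int a - int b) - sgn (int (?t a) - int (?t b)) =
      2 * ((if a = Suc i then if b = i then 1 else 0 else 0) - (if a = i then if b = Suc i then 1 else 0 else 0))" for a b
    by (auto simp: Transposition.transpose_def sgn_if)
  have "inv_sets (?t ` A) (?t ` B) = (\<Sum>a\<in>A. \<Sum>b\<in>B. sgn (int (?t a) - int (?t b)))"
    unfolding inv_sets_def by (simp add: sum.reindex)
  then have "inv_sets A B - inv_sets (?t ` A) (?t ` B) =
      (\<Sum>a\<in>A. \<Sum>b\<in>B. sgn (int a - int b) - sgn (int (?t a) - int (?t b)))"
    unfolding inv_sets_def by (simp add: sum_subtractf)
  also have "\<dots> = 2 * ((\<Sum>a\<in>A. \<Sum>b\<in>B. if a = Suc i then if b = i then 1 else 0 else 0)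
      - (\<Sum>a\<in>A. \<Sum>b\<in>B. if a = i then if b = Suc i then 1 else 0 else 0))"
    unfolding pair by (simp add: sum_distrib_left[symmetric] sum_subtractf)
  also have "(\<Sum>a\<in>A. \<Sum>b\<in>B. if a = Suc i then if b = i then 1 else 0 else 0) = (if Suc i \<in> A \<and> i \<in> B then 1 else (0::int))"
  proof -
    have "(\<Sum>b\<in>B. if a = Suc i then if b = i then 1 else 0 else 0) = (if a = Suc i then if i \<in> B then 1 else 0 else (0::int))" for a
      using assms(2) by simp
    then show ?thesis using assms(1) by simp
  qed
  also have "(\<Sum>a\<in>A. \<Sum>b\<in>B. if a = i then if b = Suc i then 1 else 0 else 0) = (if i \<in> A \<and> Suc i \<in> B then 1 else (0::int))"
  proof -
    have "(\<Sum>b\<in>B. if a = i then if b = Suc i then 1 else 0 else 0) = (if a = i then if Suc i \<in> B then 1 else 0 else (0::int))" for a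
      using assms(2) by simp
    then show ?thesis using assms(1) by simp
  qed
  finally show ?thesis .
qed

context web_context
begin

section \<open>The circles formed by the edges with exactly one of two colors\<close>

definition odd_edges :: "nat \<Rightarrow> ('e \<Rightarrow> nat set) \<Rightarrow> 'e set" where
  "odd_edges i c = {e \<in> edges w. (i \<in> c e) \<noteq> (Suc i \<in> c e)}"

text \<open>The orientation of the circles as in \<open>\<Gamma>\<close>: edges of color
  \<open>Suc i\<close> keep their direction, edges of color \<open>i\<close> are reversed.\<close>

definition edge_sign :: "nat \<Rightarrow> ('e \<Rightarrow> nat set) \<Rightarrow> 'e \<Rightarrow> int" where
  "edge_sign i c e = (if Suc i \<in> c e then 1 else -1)"

text \<open>Distinct edges meet only in their ends, so the circles can be formed combinatorially, as
  classes of edges linked by common endpoints.\<close>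

definition touching :: "'e set \<Rightarrow> ('e \<times> 'e) set" where
  "touching G = {(x, y). x \<in> G \<and> y \<in> G \<and> {st x, fi x} \<inter> {st y, fi y} \<noteq> {}}"

definition piece :: "'e set \<Rightarrow> 'e \<Rightarrow> 'e set" where
  "piece G x = {y. (x, y) \<in> (touching G)\<^sup>*}"

text \<open>The winding number of \<open>K\<close>, as a signed number of crossings with the base segment.\<close>

definition crossing_sum :: "nat \<Rightarrow> ('e \<Rightarrow> nat set) \<Rightarrow> 'e set \<Rightarrow> int" where
  "crossing_sum i c K = (\<Sum>s | s \<in> strand_set \<and> int nlev dvd snd s \<and> fst s \<in> K. edge_sign i c (fst s))"

definition essential :: "nat \<Rightarrow> ('e \<Rightarrow> nat set) \<Rightarrow> 'e set" where
  "essential i c = {e \<in> odd_edges i c. crossing_sum i c (piece (odd_edges i c) e) \<noteq> 0}"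

definition swap :: "nat \<Rightarrow> ('e \<Rightarrow> nat set) \<Rightarrow> 'e \<Rightarrow> nat set" where
  "swap i c = (\<lambda>e\<in>edges w. if e \<in> essential i c then Transposition.transpose i (Suc i) ` c e else c e)"

definition turns :: "nat \<Rightarrow> ('e \<Rightarrow> nat set) \<Rightarrow> 'e set \<Rightarrow> int \<Rightarrow> (real \<times> complex) set" where
  "turns i c K e = {m \<in> merges w. left_in w m \<in> K \<and> right_in w m \<in> K \<and>
     edge_sign i c (left_in w m) = - e \<and> edge_sign i c (right_in w m) = e}"

lemma piece_self: "x \<in> piece G x"
  by (simp add: piece_def)

lemma piece_sub: "x \<in> G \<Longrightarrow> piece G x \<subseteq> G"
proof
  fix y assume x: "x \<in> G" and "y \<in> piece G x"
  then have "(x, y) \<in> (touching G)\<^sup>*" by (simp add: piece_def)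
  then show "y \<in> G" by (induction) (use x in \<open>auto simp: touching_def\<close>)
qed

lemma sym_touching: "sym ((touching G)\<^sup>*)"
  by (rule sym_rtrancl) (auto simp: sym_def touching_def)

lemma piece_eq: "y \<in> piece G x \<Longrightarrow> piece G y = piece G x"
  using sym_touching[of G] unfolding piece_def sym_def by (auto intro: rtrancl_trans)

lemma piece_touch: "x \<in> G \<Longrightarrow> y \<in> G \<Longrightarrow> {st x, fi x} \<inter> {st y, fi y} \<noteq> {} \<Longrightarrow> piece G y = piece G x"
  by (rule piece_eq) (auto simp: piece_def touching_def)

lemma odd_edges_sub: "odd_edges i c \<subseteq> edges w" by (auto simp: odd_edges_def)

lemma essential_touch:
  assumes "x \<in> essential i c" "y \<in> odd_edges i c" "{st x, fi x} \<inter> {st y, fi y} \<noteq> {}"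
  shows "y \<in> essential i c"
  using assms piece_touch[of x "odd_edges i c" y] by (auto simp: essential_def)

context
  fixes i :: nat and c :: "'e \<Rightarrow> nat set"
  assumes c: "c \<in> colorings w"
begin

lemma color_in_out:
  assumes v: "v \<in> verts w"
  shows "l \<in> (\<Union>e\<in>in_edges w v. c e) \<longleftrightarrow> l \<in> (\<Union>e\<in>out_edges w v. c e)"
  using coloringD(4)[OF c v] by simp

lemma color_count:
  assumes v: "v \<in> verts w"
  shows "(\<Sum>e\<in>in_edges w v. if l \<in> c e then 1 else (0::int)) = (\<Sum>e\<in>out_edges w v. if l \<in> c e then 1 else 0)"
  using v
proof (cases rule: vertex_cases)
  case (merge a b d)
  have "c a \<inter> c b = {}" using coloring_disjoint(1)[OF c v, of a b] merge by simp
  moreover have "l \<in> c d \<longleftrightarrow> l \<in> c a \<or> l \<in> c b" using color_in_out[OF v, of l] merge by simp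
  ultimately show ?thesis using merge by auto
next
  case (split a b d)
  have "c a \<inter> c b = {}" using coloring_disjoint(2)[OF c v, of a b] split by simp
  moreover have "l \<in> c d \<longleftrightarrow> l \<in> c a \<or> l \<in> c b" using color_in_out[OF v, of l] split by simp
  ultimately show ?thesis using split by auto
qed

lemma odd_iff: "e \<in> edges w \<Longrightarrow> e \<in> odd_edges i c \<longleftrightarrow> (i \<in> c e) \<noteq> (Suc i \<in> c e)"
  by (simp add: odd_edges_def)

text \<open>\<open>d\<close> carries the disjoint union of the colors of \<open>a\<close> and
  \<open>b\<close>, which leaves four patterns. When \<open>d\<close> and one of \<open>a\<close>,
  \<open>b\<close> are odd, the other edge cannot carry both colors and so carries neither; the flow
  argument depends on this addition.\<close>

lemma odd_split:
  assumes E: "a \<in> edges w" "b \<in> edges w" "d \<in> edges w" and disj: "c a \<inter> c b = {}"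
    and mem: "\<And>l. l \<in> c d \<longleftrightarrow> l \<in> c a \<or> l \<in> c b"
  shows "a \<in> odd_edges i c \<and> b \<in> odd_edges i c \<and> d \<notin> odd_edges i c \<and> edge_sign i c a = - edge_sign i c b \<or>
    a \<in> odd_edges i c \<and> b \<notin> odd_edges i c \<and> d \<in> odd_edges i c \<and> edge_sign i c a = edge_sign i c d \<and> i \<notin> c b \<and> Suc i \<notin> c b \<or>
    a \<notin> odd_edges i c \<and> b \<in> odd_edges i c \<and> d \<in> odd_edges i c \<and> edge_sign i c b = edge_sign i c d \<and> i \<notin> c a \<and> Suc i \<notin> c a \<or>
    a \<notin> odd_edges i c \<and> b \<notin> odd_edges i c \<and> d \<notin> odd_edges i c"
proof -
  have "\<not> (i \<in> c a \<and> i \<in> c b)" "\<not> (Suc i \<in> c a \<and> Suc i \<in> c b)" using disj by blast+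
  then show ?thesis
    unfolding odd_iff[OF E(1)] odd_iff[OF E(2)] odd_iff[OF E(3)] edge_sign_def using mem[of i] mem[of "Suc i"] by auto
qed

lemma vertex_odd:
  assumes v: "v \<in> verts w"
  obtains (none) "in_edges w v \<inter> odd_edges i c = {}" "out_edges w v \<inter> odd_edges i c = {}"
  | (through) e e' where "in_edges w v \<inter> odd_edges i c = {e}" "out_edges w v \<inter> odd_edges i c = {e'}"
      "edge_sign i c e = edge_sign i c e'"
      "\<And>x. x \<in> in_edges w v \<union> out_edges w v \<Longrightarrow> x \<notin> odd_edges i c \<Longrightarrow> i \<notin> c x \<and> Suc i \<notin> c x"
  | (max) a b where "v \<in> merges w" "in_edges w v = {a, b}" "a \<noteq> b" "a \<in> odd_edges i c" "b \<in> odd_edges i c"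
      "out_edges w v \<inter> odd_edges i c = {}" "edge_sign i c a = - edge_sign i c b"
  | (min) a b where "out_edges w v = {a, b}" "a \<noteq> b" "a \<in> odd_edges i c" "b \<in> odd_edges i c"
      "in_edges w v \<inter> odd_edges i c = {}" "edge_sign i c a = - edge_sign i c b"
  using v
proof (cases rule: vertex_cases)
  case (merge a b d)
  have disj: "c a \<inter> c b = {}" using coloring_disjoint(1)[OF c v, of a b] merge by simp
  have mem: "l \<in> c d \<longleftrightarrow> l \<in> c a \<or> l \<in> c b" for l using color_in_out[OF v, of l] merge by simp
  have "a \<in> in_edges w v" "b \<in> in_edges w v" "d \<in> out_edges w v" using merge by auto
  then have E: "a \<in> edges w" "b \<in> edges w" "d \<in> edges w" using in_edges_sub out_edges_sub by blast+
  from odd_split[OF E disj mem] show ?thesis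
  proof (elim disjE conjE)
    assume h: "a \<in> odd_edges i c" "b \<in> odd_edges i c" "d \<notin> odd_edges i c" "edge_sign i c a = - edge_sign i c b"
    show ?thesis by (rule max[OF merge(1,2,3) h(1,2) _ h(4)]) (use h merge in auto)
  next
    assume h: "a \<in> odd_edges i c" "b \<notin> odd_edges i c" "d \<in> odd_edges i c" "edge_sign i c a = edge_sign i c d" "i \<notin> c b" "Suc i \<notin> c b"
    show ?thesis by (rule through[of a d]) (use h merge in auto)
  next
    assume h: "a \<notin> odd_edges i c" "b \<in> odd_edges i c" "d \<in> odd_edges i c" "edge_sign i c b = edge_sign i c d" "i \<notin> c a" "Suc i \<notin> c a"
    show ?thesis by (rule through[of b d]) (use h merge in auto)
  next
    assume h: "a \<notin> odd_edges i c" "b \<notin> odd_edges i c" "d \<notin> odd_edges i c"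
    show ?thesis by (rule none) (use h merge in auto)
  qed
next
  case (split a b d)
  have disj: "c a \<inter> c b = {}" using coloring_disjoint(2)[OF c v, of a b] split by simp
  have mem: "l \<in> c d \<longleftrightarrow> l \<in> c a \<or> l \<in> c b" for l using color_in_out[OF v, of l] split by simp
  have "a \<in> out_edges w v" "b \<in> out_edges w v" "d \<in> in_edges w v" using split by auto
  then have E: "a \<in> edges w" "b \<in> edges w" "d \<in> edges w" using in_edges_sub out_edges_sub by blast+
  from odd_split[OF E disj mem] show ?thesis
  proof (elim disjE conjE)
    assume h: "a \<in> odd_edges i c" "b \<in> odd_edges i c" "d \<notin> odd_edges i c" "edge_sign i c a = - edge_sign i c b"
    show ?thesis by (rule min[OF split(3,4) h(1,2) _ h(4)]) (use h split in auto)
  next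
    assume h: "a \<in> odd_edges i c" "b \<notin> odd_edges i c" "d \<in> odd_edges i c" "edge_sign i c a = edge_sign i c d" "i \<notin> c b" "Suc i \<notin> c b"
    show ?thesis by (rule through[of d a]) (use h split in auto)
  next
    assume h: "a \<notin> odd_edges i c" "b \<in> odd_edges i c" "d \<in> odd_edges i c" "edge_sign i c b = edge_sign i c d" "i \<notin> c a" "Suc i \<notin> c a"
    show ?thesis by (rule through[of d b]) (use h split in auto)
  next
    assume h: "a \<notin> odd_edges i c" "b \<notin> odd_edges i c" "d \<notin> odd_edges i c"
    show ?thesis by (rule none) (use h split in auto)
  qed
qed

context
  fixes K x0 assumes x0: "x0 \<in> odd_edges i c" and K: "K = piece (odd_edges i c) x0"
begin

lemma K_sub: "K \<subseteq> odd_edges i c" "K \<subseteq> edges w"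
  using piece_sub[OF x0] odd_edges_sub unfolding K by blast+

lemma K_touch: "x \<in> K \<Longrightarrow> y \<in> odd_edges i c \<Longrightarrow> {st x, fi x} \<inter> {st y, fi y} \<noteq> {} \<Longrightarrow> y \<in> K"
  using piece_touch[of x "odd_edges i c" y] piece_eq[of x "odd_edges i c" x0] piece_self[of y] K_sub unfolding K by blast

lemma K_into_vertex:
  assumes v: "v \<in> verts w"
  shows "{s \<in> strands_of K. tgt s = v} = (\<lambda>e. (e, stop e - 1)) ` (in_edges w v \<inter> K)"
    "{s \<in> strands_of K. src s = v} = (\<lambda>e. (e, start e)) ` (out_edges w v \<inter> K)"
proof -
  have "{s \<in> strands_of K. tgt s = v} = {s \<in> {s \<in> strand_set. tgt s = v}. fst s \<in> K}" by (auto simp: strands_of_def)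
  then show "{s \<in> strands_of K. tgt s = v} = (\<lambda>e. (e, stop e - 1)) ` (in_edges w v \<inter> K)"
    unfolding into_vertex[OF v] by auto
  have "{s \<in> strands_of K. src s = v} = {s \<in> {s \<in> strand_set. src s = v}. fst s \<in> K}" by (auto simp: strands_of_def)
  then show "{s \<in> strands_of K. src s = v} = (\<lambda>e. (e, start e)) ` (out_edges w v \<inter> K)"
    unfolding out_vertex[OF v] by auto
qed

lemma K_vertex:
  assumes v: "v \<in> verts w" and x: "x \<in> K" "x \<in> in_edges w v \<union> out_edges w v"
  shows "in_edges w v \<inter> K = in_edges w v \<inter> odd_edges i c" "out_edges w v \<inter> K = out_edges w v \<inter> odd_edges i c"
proof -
  have vx: "v \<in> {st x, fi x}" using x(2) by (auto simp: in_edges_def out_edges_def)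
  have "y \<in> K" if "y \<in> in_edges w v \<union> out_edges w v" "y \<in> odd_edges i c" for y
  proof -
    have "v \<in> {st y, fi y}" using that(1) by (auto simp: in_edges_def out_edges_def)
    then show ?thesis using K_touch[OF x(1) that(2)] vx by blast
  qed
  then show "in_edges w v \<inter> K = in_edges w v \<inter> odd_edges i c" "out_edges w v \<inter> K = out_edges w v \<inter> odd_edges i c"
    using K_sub by blast+
qed

lemma strand_vertex_edge:
  assumes "v \<in> verts w" "s \<in> strands_of K" "src s = v \<or> tgt s = v"
  shows "fst s \<in> K" "fst s \<in> in_edges w v \<union> out_edges w v"
proof -
  show "fst s \<in> K" using assms(2) by (simp add: strands_of_def)
  have "s \<in> strand_set" using assms(2) by (simp add: strands_of_def)
  then have "s \<in> {s \<in> strand_set. tgt s = v} \<or> s \<in> {s \<in> strand_set. src s = v}" using assms(3) by blast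
  then show "fst s \<in> in_edges w v \<union> out_edges w v"
    unfolding into_vertex[OF assms(1)] out_vertex[OF assms(1)] by auto
qed

lemma xi_in_distinct:
  assumes "a \<in> in_edges w v" "b \<in> in_edges w v" "a \<noteq> b"
  shows "xi (a, stop a - 1) \<noteq> xi (b, stop b - 1)"
proof -
  have E: "a \<in> edges w" "b \<in> edges w" "fi a = fi b" using assms by (auto simp: in_edges_def)
  then have "snd (src (a, stop a - 1)) = snd (src (b, stop b - 1))"
    using same_slab[OF stop_strand[OF E(1)] stop_strand[OF E(2)]] tgt_stop by simp
  then show ?thesis using xi_inj[OF stop_strand[OF E(1)] stop_strand[OF E(2)]] assms(3) by blast
qed

lemma xi_out_distinct:
  assumes "a \<in> out_edges w v" "b \<in> out_edges w v" "a \<noteq> b"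
  shows "xi (a, start a) \<noteq> xi (b, start b)"
proof -
  have E: "a \<in> edges w" "b \<in> edges w" "st a = st b" using assms by (auto simp: out_edges_def)
  then have "snd (src (a, start a)) = snd (src (b, start b))" using src_start by simp
  then show ?thesis using xi_inj[OF start_strand[OF E(1)] start_strand[OF E(2)]] assms(3) by blast
qed

text \<open>A vertex sees zero, one or two odd edges on each side, in the patterns of
  \<open>vertex_odd\<close>, which are the local types of a curve. Connectedness has two layers:
  consecutive strands of one edge, and edges of \<open>K\<close> linked by common endpoints.\<close>

lemma strand_curve_piece:
  "strand_curve strand_set src tgt xi (strands_of K) (\<lambda>s. edge_sign i c (fst s))"
proof unfold_locales
  show "strands_of K \<subseteq> strand_set" by (auto simp: strands_of_def)
  show "edge_sign i c (fst s) = 1 \<or> edge_sign i c (fst s) = -1" for s by (simp add: edge_sign_def)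
next
  fix p assume "p \<in> src ` strands_of K \<union> tgt ` strands_of K"
  then obtain s where s: "s \<in> strands_of K" "src s = p \<or> tgt s = p" by blast
  have sS: "s \<in> strand_set" "fst s \<in> K" using s(1) by (auto simp: strands_of_def)
  let ?e = "\<lambda>s. edge_sign i c (fst s)"
  let ?I = "{s \<in> strands_of K. tgt s = p}" and ?O = "{s \<in> strands_of K. src s = p}"
  show "(\<exists>s s'. ?I = {s} \<and> ?O = {s'} \<and> ?e s = ?e s') \<or>
      (\<exists>l r. ?I = {l, r} \<and> ?O = {} \<and> xi l < xi r \<and> ?e l = - ?e r) \<or>
      (\<exists>l r. ?O = {l, r} \<and> ?I = {} \<and> xi l < xi r \<and> ?e l = - ?e r)"
  proof (cases "p \<in> verts w")
    case False
    obtain N N' where N: "{s \<in> strand_set. tgt s = p} = {(fst s, N)}" "{s \<in> strand_set. src s = p} = {(fst s, N')}"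
      using nonvertex_point[OF False sS(1) s(2)] by blast
    have "?I = {s \<in> {s \<in> strand_set. tgt s = p}. fst s \<in> K}" by (auto simp: strands_of_def)
    also have "\<dots> = {(fst s, N)}" unfolding N(1) using sS(2) by auto
    finally have I: "?I = {(fst s, N)}" .
    have "?O = {s \<in> {s \<in> strand_set. src s = p}. fst s \<in> K}" by (auto simp: strands_of_def)
    also have "\<dots> = {(fst s, N')}" unfolding N(2) using sS(2) by auto
    finally have O: "?O = {(fst s, N')}" .
    show ?thesis
      by (rule disjI1, rule exI[of _ "(fst s, N)"], rule exI[of _ "(fst s, N')"]) (intro conjI I O, simp)
  next
    case True
    have I: "?I = (\<lambda>e. (e, stop e - 1)) ` (in_edges w p \<inter> odd_edges i c)"
      and O: "?O = (\<lambda>e. (e, start e)) ` (out_edges w p \<inter> odd_edges i c)"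
      using K_into_vertex[OF True] K_vertex[OF True strand_vertex_edge[OF True s]] by auto
    from True show ?thesis
    proof (cases rule: vertex_odd)
      case none
      then have "?I = {}" "?O = {}" unfolding I O by simp_all
      then show ?thesis using s by blast
    next
      case (through e e')
      then have "?I = {(e, stop e - 1)} \<and> ?O = {(e', start e')} \<and> ?e (e, stop e - 1) = ?e (e', start e')"
        unfolding I O by simp
      then show ?thesis by blast
    next
      case (max a b)
      have "in_edges w p \<inter> odd_edges i c = {a, b}" using max by auto
      then have IO: "?I = {(a, stop a - 1), (b, stop b - 1)}" "?O = {}" unfolding I O using max by simp_all
      have "a \<in> in_edges w p" "b \<in> in_edges w p" using max by auto
      then consider "xi (a, stop a - 1) < xi (b, stop b - 1)" | "xi (b, stop b - 1) < xi (a, stop a - 1)"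
        using xi_in_distinct[of a p b] max(3) by linarith
      then show ?thesis
      proof cases
        case 1
        then have "?I = {(a, stop a - 1), (b, stop b - 1)} \<and> ?O = {} \<and> xi (a, stop a - 1) < xi (b, stop b - 1) \<and>
            ?e (a, stop a - 1) = - ?e (b, stop b - 1)" using IO max by simp
        then show ?thesis by blast
      next
        case 2
        then have "?I = {(b, stop b - 1), (a, stop a - 1)} \<and> ?O = {} \<and> xi (b, stop b - 1) < xi (a, stop a - 1) \<and>
            ?e (b, stop b - 1) = - ?e (a, stop a - 1)" using IO max by (simp add: insert_commute)
        then show ?thesis by blast
      qed
    next
      case (min a b)
      have "out_edges w p \<inter> odd_edges i c = {a, b}" using min by auto
      then have IO: "?O = {(a, start a), (b, start b)}" "?I = {}" unfolding I O using min by simp_all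
      have "a \<in> out_edges w p" "b \<in> out_edges w p" using min by auto
      then consider "xi (a, start a) < xi (b, start b)" | "xi (b, start b) < xi (a, start a)"
        using xi_out_distinct[of a p b] min(2) by linarith
      then show ?thesis
      proof cases
        case 1
        then have "?O = {(a, start a), (b, start b)} \<and> ?I = {} \<and> xi (a, start a) < xi (b, start b) \<and>
            ?e (a, start a) = - ?e (b, start b)" using IO min by simp
        then show ?thesis by blast
      next
        case 2
        then have "?O = {(b, start b), (a, start a)} \<and> ?I = {} \<and> xi (b, start b) < xi (a, start a) \<and>
            ?e (b, start b) = - ?e (a, start a)" using IO min by (simp add: insert_commute)
        then show ?thesis by blast
      qed
    qed
  qed
next
  fix D assume D: "D \<subseteq> strands_of K" "D \<noteq> {}"
    and closed: "\<And>p s s'. s \<in> D \<Longrightarrow> s' \<in> strands_of K \<Longrightarrow> p \<in> {src s, tgt s} \<Longrightarrow> p \<in> {src s', tgt s'} \<Longrightarrow> s' \<in> D"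
  have mem: "(e, N) \<in> strands_of K" if "e \<in> K" "start e \<le> N" "N < stop e" for e N
    using that K_sub(2) by (auto simp: strands_of_def strand_set_def)
  have edge: "(e, M) \<in> D" if e: "(e, N) \<in> D" and M: "start e \<le> M" "M < stop e" for e N M
  proof -
    have eK: "e \<in> K" and N: "start e \<le> N" "N < stop e" using e D(1) by (auto simp: strands_of_def strand_set_def)
    have up: "(e, N + int k) \<in> D" if "N + int k < stop e" for k
      using that
    proof (induction k)
      case (Suc k)
      have "(e, N + int k) \<in> D" using Suc by simp
      moreover have "(e, N + int (Suc k)) \<in> strands_of K" using Suc.prems N by (intro mem[OF eK]) auto
      moreover have "tgt (e, N + int k) = src (e, N + int (Suc k))" by (simp add: tgt_def src_def add.commute add.left_commute)
      ultimately show ?case using closed[of "(e, N + int k)" "(e, N + int (Suc k))" "tgt (e, N + int k)"] by simp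
    qed (use e in simp)
    have down: "(e, N - int k) \<in> D" if "start e \<le> N - int k" for k
      using that
    proof (induction k)
      case (Suc k)
      have "(e, N - int k) \<in> D" using Suc by simp
      moreover have "(e, N - int (Suc k)) \<in> strands_of K" using Suc.prems N by (intro mem[OF eK]) auto
      moreover have "src (e, N - int k) = tgt (e, N - int (Suc k))" by (simp add: tgt_def src_def)
      ultimately show ?case using closed[of "(e, N - int k)" "(e, N - int (Suc k))" "src (e, N - int k)"] by simp
    qed (use e in simp)
    show ?thesis
    proof (cases "N \<le> M")
      case True then show ?thesis using up[of "nat (M - N)"] M(2) by simp
    next
      case False then show ?thesis using down[of "nat (N - M)"] M(1) by simp
    qed
  qed
  obtain e1 N1 where e1: "(e1, N1) \<in> D" using D(2) by auto
  have e1K: "e1 \<in> K" using e1 D(1) by (auto simp: strands_of_def)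
  have reach: "\<exists>N. (y, N) \<in> D" if "(e1, y) \<in> (touching (odd_edges i c))\<^sup>*" for y
    using that
  proof induction
    case base then show ?case using e1 by blast
  next
    case (step y z)
    then obtain N where N: "(y, N) \<in> D" by blast
    have yK: "y \<in> K" using N D(1) by (auto simp: strands_of_def)
    have yE: "y \<in> edges w" using yK K_sub(2) by blast
    have z: "z \<in> odd_edges i c" "{st y, fi y} \<inter> {st z, fi z} \<noteq> {}" using step(2) by (auto simp: touching_def)
    have zK: "z \<in> K" by (rule K_touch[OF yK z])
    have zE: "z \<in> edges w" using zK K_sub(2) by blast
    have yD: "(y, start y) \<in> D" "(y, stop y - 1) \<in> D" using edge[OF N] start_less_stop[OF yE] by auto
    have zS: "(z, start z) \<in> strands_of K" "(z, stop z - 1) \<in> strands_of K"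
      using start_strand[OF zE] stop_strand[OF zE] zK by (auto simp: strands_of_def)
    obtain q where q: "q = st y \<or> q = fi y" "q = st z \<or> q = fi z" using z(2) by blast
    have "q = src (y, start y) \<or> q = tgt (y, stop y - 1)" using q(1) src_start[OF yE] tgt_stop[OF yE] by simp
    then have "\<exists>s\<in>D. q \<in> {src s, tgt s}" using yD by blast
    then obtain s where s: "s \<in> D" "q \<in> {src s, tgt s}" by (elim bexE)
    have "q = src (z, start z) \<or> q = tgt (z, stop z - 1)" using q(2) src_start[OF zE] tgt_stop[OF zE] by simp
    then have "\<exists>N. (z, N) \<in> strands_of K \<and> q \<in> {src (z, N), tgt (z, N)}" using zS by blast
    then obtain N' where s': "(z, N') \<in> strands_of K" "q \<in> {src (z, N'), tgt (z, N')}" by (elim exE conjE)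
    show ?case by (rule exI, rule closed[OF s(1) s'(1) s(2) s'(2)])
  qed
  have Kreach: "K = piece (odd_edges i c) e1" using piece_eq[of e1 "odd_edges i c" x0] e1K unfolding K by simp
  show "D = strands_of K"
  proof (intro equalityI subsetI)
    fix s assume s: "s \<in> strands_of K"
    then have m: "fst s \<in> K" "start (fst s) \<le> snd s" "snd s < stop (fst s)" by (auto simp: strands_of_def strand_set_def)
    then have "(e1, fst s) \<in> (touching (odd_edges i c))\<^sup>*" unfolding Kreach piece_def by simp
    then obtain N where "(fst s, N) \<in> D" using reach by blast
    then have "(fst s, snd s) \<in> D" using edge m by blast
    then show "s \<in> D" by simp
  qed (use D(1) in auto)
qed

text \<open>As conserved flow serve color \<open>Suc i\<close> for the upward direction and color
  \<open>i\<close> for the downward direction. A strand outside \<open>K\<close> that shares its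
  upper or its lower end with a strand of \<open>K\<close> carries neither color, by the addition to
  \<open>odd_split\<close>.\<close>

lemma card_turns_eq:
  assumes wind: "crossing_sum i c K \<noteq> 0"
  shows "card (turns i c K 1) = card (turns i c K (-1))"
proof -
  interpret V: strand_curve strand_set src tgt xi "strands_of K" "\<lambda>s. edge_sign i c (fst s)"
    by (rule strand_curve_piece)
  \<comment> \<open>Two strands with the same upper end meet in a vertex with two incoming edges,
    that is, in a merge.\<close>
  have maxima: "V.maxima e = turns i c K e" for e
  proof (intro equalityI subsetI)
    fix m assume "m \<in> V.maxima e"
    then obtain l r where lr: "V.into m = {l, r}" "V.out m = {}" "xi l < xi r"
      "edge_sign i c (fst l) = - e" "edge_sign i c (fst r) = e" by (auto simp: V.maxima_def)
    have l: "l \<in> strands_of K" "tgt l = m" and r: "r \<in> strands_of K" "tgt r = m" using lr(1) by (auto simp: V.into_def)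
    have "l \<noteq> r" using lr(3) by auto
    have mv: "m \<in> verts w"
    proof (rule ccontr)
      assume "m \<notin> verts w"
      then obtain N where "{s \<in> strand_set. tgt s = m} = {(fst l, N)}"
        using nonvertex_point[of m l] l by (auto simp: strands_of_def)
      moreover have "l \<in> {s \<in> strand_set. tgt s = m}" "r \<in> {s \<in> strand_set. tgt s = m}"
        using l r by (auto simp: strands_of_def)
      ultimately show False using \<open>l \<noteq> r\<close> by simp
    qed
    have "l \<in> (\<lambda>e. (e, stop e - 1)) ` (in_edges w m \<inter> K)" "r \<in> (\<lambda>e. (e, stop e - 1)) ` (in_edges w m \<inter> K)"
      using K_into_vertex(1)[OF mv] l r by blast+
    then obtain a b where le: "l = (a, stop a - 1)" "a \<in> in_edges w m" "a \<in> K"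
      and re: "r = (b, stop b - 1)" "b \<in> in_edges w m" "b \<in> K" by blast
    have ne: "a \<noteq> b" using \<open>l \<noteq> r\<close> le(1) re(1) by blast
    have "m \<in> merges w"
    proof (rule ccontr)
      assume "m \<notin> merges w"
      then have "m \<in> splits w" using mv verts_eq by blast
      then have "card (in_edges w m) = 1" by (simp add: splits_def)
      then show False using le(2) re(2) ne by (auto simp: card_1_singleton_iff)
    qed
    from merge_left_right[OF this] obtain l' r' d where m': "in_edges w m = {l', r'}" "l' \<noteq> r'"
      "xi (l', stop l' - 1) < xi (r', stop r' - 1)" "left_in w m = l'" "right_in w m = r'" "out_edges w m = {d}" .
    have "a = l' \<and> b = r'"
    proof (rule ccontr)
      assume "\<not> (a = l' \<and> b = r')"
      then have "a = r'" "b = l'" using le(2) re(2) ne m'(1) by auto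
      then show False using lr(3) m'(3) le(1) re(1) by simp
    qed
    then show "m \<in> turns i c K e" using \<open>m \<in> merges w\<close> m'(4,5) le re lr(4,5) by (simp add: turns_def)
  next
    fix m assume "m \<in> turns i c K e"
    then have m: "m \<in> merges w" "left_in w m \<in> K" "right_in w m \<in> K"
      "edge_sign i c (left_in w m) = - e" "edge_sign i c (right_in w m) = e" by (auto simp: turns_def)
    obtain l r d where lr: "in_edges w m = {l, r}" "l \<noteq> r" "xi (l, stop l - 1) < xi (r, stop r - 1)"
      "left_in w m = l" "right_in w m = r" "out_edges w m = {d}" using merge_left_right[OF m(1)] .
    have mv: "m \<in> verts w" using m(1) by (simp add: merges_def)
    have inK: "in_edges w m \<inter> K = {l, r}" using lr m by auto
    have "l \<in> in_edges w m \<union> out_edges w m" "l \<in> K" using lr m by auto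
    then have "out_edges w m \<inter> K = out_edges w m \<inter> odd_edges i c" "in_edges w m \<inter> odd_edges i c = {l, r}"
      using K_vertex[OF mv, of l] inK by auto
    moreover have "out_edges w m \<inter> odd_edges i c = {}"
      using mv
    proof (cases rule: vertex_odd)
      case none then show ?thesis by simp
    next
      case (through x y)
      then have "{l, r} = {x}" using calculation(2) by simp
      then show ?thesis using lr(2) by auto
    next
      case (max a b) then show ?thesis by simp
    next
      case (min a b) then show ?thesis using calculation(2) by auto
    qed
    ultimately have outK: "out_edges w m \<inter> K = {}" by simp
    have io: "V.into m = {(l, stop l - 1), (r, stop r - 1)}" "V.out m = {}"
      unfolding V.into_def V.out_def K_into_vertex[OF mv] inK outK by simp_all
    have "edge_sign i c (fst (l, stop l - 1)) = - e" "edge_sign i c (fst (r, stop r - 1)) = e"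
      using m(4,5) lr(4,5) by simp_all
    then show "m \<in> V.maxima e" unfolding V.maxima_def mem_Collect_eq
      by (intro exI conjI) (rule io lr(3) | assumption)+
  qed
  define g where "g e s = (if (if e = 1 then Suc i else i) \<in> c (fst s) then 1 else (0::int))" for e :: int and s :: "'e \<times> int"
  have "card (V.maxima 1) = card (V.maxima (-1))"
  proof (rule V.card_maxima_eq[where z = "cis (2 * pi * lev 0)" and g = g])
    have "{s \<in> strands_of K. snd (src s) = cis (2 * pi * lev 0)} = {s \<in> strand_set. int nlev dvd snd s \<and> fst s \<in> K}"
      by (auto simp: strands_of_def src_def cis_eq_iff lev_diff_int)
    then show "(\<Sum>s | s \<in> strands_of K \<and> snd (src s) = cis (2 * pi * lev 0). edge_sign i c (fst s)) \<noteq> 0"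
      using wind by (simp add: crossing_sum_def)
  next
    fix e :: int and p
    show "(\<Sum>s | s \<in> strand_set \<and> tgt s = p. g e s) = (\<Sum>s | s \<in> strand_set \<and> src s = p. g e s)"
      unfolding g_def
      by (rule flow_conservation[where g = "\<lambda>x. if (if e = 1 then Suc i else i) \<in> c x then 1 else 0"]) (rule color_count)
  next
    fix e :: int and s assume e: "e = 1 \<or> e = -1" and s: "s \<in> strands_of K"
    have "fst s \<in> odd_edges i c" "fst s \<in> edges w" using s K_sub by (auto simp: strands_of_def)
    then have "(i \<in> c (fst s)) \<noteq> (Suc i \<in> c (fst s))" using odd_iff by blast
    then consider "i \<in> c (fst s)" "Suc i \<notin> c (fst s)" | "i \<notin> c (fst s)" "Suc i \<in> c (fst s)" by blast
    then show "g e s = (if edge_sign i c (fst s) = e then 1 else 0)"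
      unfolding g_def edge_sign_def using e by cases (elim disjE; simp)+
  next
    fix e :: int and s s' assume s: "s \<in> strand_set - strands_of K" and s': "s' \<in> strands_of K" and t: "tgt s = tgt s'"
    have s's: "s' \<in> strand_set" "fst s' \<in> K" using s' by (auto simp: strands_of_def)
    have nK: "fst s \<notin> K" using s by (auto simp: strands_of_def)
    have v: "tgt s' \<in> verts w"
    proof (rule ccontr)
      assume "tgt s' \<notin> verts w"
      then obtain N where "{s \<in> strand_set. tgt s = tgt s'} = {(fst s', N)}" using nonvertex_point[of "tgt s'" s'] s's by blast
      moreover have "s \<in> {s \<in> strand_set. tgt s = tgt s'}" using s t by simp
      ultimately have "s \<in> {(fst s', N)}" by (simp only:)
      then have "fst s = fst s'" by simp
      then show False using nK s's by simp
    qed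
    have "s \<in> {s \<in> strand_set. tgt s = tgt s'}" "s' \<in> {s \<in> strand_set. tgt s = tgt s'}" using s t s's by auto
    then have ine: "fst s \<in> in_edges w (tgt s')" "fst s' \<in> in_edges w (tgt s')" unfolding into_vertex[OF v] by auto
    have no: "fst s \<notin> odd_edges i c"
      using K_vertex(1)[OF v s's(2)] ine nK by blast
    have o: "fst s' \<in> odd_edges i c" using s's(2) K_sub by blast
    from v have "i \<notin> c (fst s) \<and> Suc i \<notin> c (fst s)"
    proof (cases rule: vertex_odd)
      case none then show ?thesis using ine o by blast
    next
      case (through x y) then show ?thesis using ine no by blast
    next
      case (max a b) then show ?thesis using ine no by auto
    next
      case (min a b) then show ?thesis using ine o by blast
    qed
    then show "g e s = 0" by (simp add: g_def)
  next
    fix e :: int and s s' assume s: "s \<in> strand_set - strands_of K" and s': "s' \<in> strands_of K" and t: "src s = src s'"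
    have s's: "s' \<in> strand_set" "fst s' \<in> K" using s' by (auto simp: strands_of_def)
    have nK: "fst s \<notin> K" using s by (auto simp: strands_of_def)
    have v: "src s' \<in> verts w"
    proof (rule ccontr)
      assume "src s' \<notin> verts w"
      then obtain N where "{s \<in> strand_set. src s = src s'} = {(fst s', N)}" using nonvertex_point[of "src s'" s'] s's by blast
      moreover have "s \<in> {s \<in> strand_set. src s = src s'}" using s t by simp
      ultimately have "s \<in> {(fst s', N)}" by (simp only:)
      then have "fst s = fst s'" by simp
      then show False using nK s's by simp
    qed
    have "s \<in> {s \<in> strand_set. src s = src s'}" "s' \<in> {s \<in> strand_set. src s = src s'}" using s t s's by auto
    then have oute: "fst s \<in> out_edges w (src s')" "fst s' \<in> out_edges w (src s')" unfolding out_vertex[OF v] by auto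
    have no: "fst s \<notin> odd_edges i c"
      using K_vertex(2)[OF v s's(2)] oute nK by blast
    have o: "fst s' \<in> odd_edges i c" using s's(2) K_sub by blast
    from v have "i \<notin> c (fst s) \<and> Suc i \<notin> c (fst s)"
    proof (cases rule: vertex_odd)
      case none then show ?thesis using oute o by blast
    next
      case (through x y) then show ?thesis using oute no by blast
    next
      case (max a b) then show ?thesis using oute o by blast
    next
      case (min a b) then show ?thesis using oute no by auto
    qed
    then show "g e s = 0" by (simp add: g_def)
  qed
  then show ?thesis unfolding maxima .
qed

end

end

end

context web_context
begin

section \<open>Exchanging two colors along the essential circles\<close>

lemma essential_sub: "essential i c \<subseteq> odd_edges i c"
  by (auto simp: essential_def)

context
  fixes i :: nat and c :: "'e \<Rightarrow> nat set"
  assumes c: "c \<in> colorings w"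
begin

lemma swap_mem:
  "e \<in> edges w \<Longrightarrow> l \<in> swap i c e \<longleftrightarrow> (if e \<in> essential i c then Transposition.transpose i (Suc i) l \<in> c e else l \<in> c e)"
  by (simp add: swap_def in_transpose_image_iff)

text \<open>The transposition does not affect an edge carrying both or neither of the two colors.
  Next to an essential circle it may therefore be applied to all edges at a vertex.\<close>

lemma swap_touched:
  assumes "e \<in> edges w" "e \<in> odd_edges i c \<Longrightarrow> e \<in> essential i c"
  shows "swap i c e = Transposition.transpose i (Suc i) ` c e"
proof (cases "e \<in> essential i c")
  case False
  then have "(i \<in> c e) = (Suc i \<in> c e)" using assms by (auto simp: odd_edges_def)
  then show ?thesis using assms(1) False transpose_image_eq[of i "c e" "Suc i"] by (simp add: swap_def)
qed (use assms in \<open>simp add: swap_def\<close>)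

lemma odd_edges_swap: "odd_edges i (swap i c) = odd_edges i c"
proof (rule set_eqI)
  fix e show "e \<in> odd_edges i (swap i c) \<longleftrightarrow> e \<in> odd_edges i c"
    by (cases "e \<in> edges w"; cases "e \<in> essential i c") (auto simp: odd_edges_def swap_mem)
qed

lemma edge_sign_swap:
  assumes "e \<in> odd_edges i c"
  shows "edge_sign i (swap i c) e = (if e \<in> essential i c then - edge_sign i c e else edge_sign i c e)"
proof -
  have "e \<in> edges w" "(i \<in> c e) \<noteq> (Suc i \<in> c e)" using assms by (auto simp: odd_edges_def)
  then show ?thesis by (auto simp: edge_sign_def swap_mem)
qed

lemma essential_piece:
  assumes "x \<in> odd_edges i c" "y \<in> piece (odd_edges i c) x"
  shows "y \<in> odd_edges i c" "y \<in> essential i c \<longleftrightarrow> x \<in> essential i c"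
proof -
  show "y \<in> odd_edges i c" using piece_sub[OF assms(1)] assms(2) by blast
  then show "y \<in> essential i c \<longleftrightarrow> x \<in> essential i c" using assms(1) piece_eq[OF assms(2)] by (simp add: essential_def)
qed

text \<open>The exchange reverses an essential circle as a whole, so its crossing sum only changes
  sign and it stays essential. This makes \<open>swap\<close> an involution.\<close>

lemma crossing_sum_swap:
  assumes x: "x \<in> odd_edges i c"
  shows "crossing_sum i (swap i c) (piece (odd_edges i c) x) =
    (if x \<in> essential i c then - crossing_sum i c (piece (odd_edges i c) x) else crossing_sum i c (piece (odd_edges i c) x))"
proof -
  have "crossing_sum i (swap i c) (piece (odd_edges i c) x) =
      (\<Sum>s | s \<in> strand_set \<and> int nlev dvd snd s \<and> fst s \<in> piece (odd_edges i c) x.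
        if x \<in> essential i c then - edge_sign i c (fst s) else edge_sign i c (fst s))"
    unfolding crossing_sum_def
    by (rule sum.cong[OF refl]) (use edge_sign_swap essential_piece[OF x] in simp)
  then show ?thesis by (simp add: crossing_sum_def sum_negf)
qed

lemma essential_swap: "essential i (swap i c) = essential i c"
proof (rule set_eqI)
  fix x show "x \<in> essential i (swap i c) \<longleftrightarrow> x \<in> essential i c"
    unfolding essential_def[of i "swap i c"] odd_edges_swap
    using crossing_sum_swap[of x] by (auto simp: essential_def)
qed

lemma swap_swap: "swap i (swap i c) = c"
proof
  fix e show "swap i (swap i c) e = c e"
  proof (cases "e \<in> edges w")
    case True
    then show ?thesis by (simp add: swap_def[of i "swap i c"] essential_swap) (simp add: swap_def image_image)
  next
    case False
    then show ?thesis using c by (auto simp: swap_def colorings_def PiE_iff extensional_def)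
  qed
qed

text \<open>Odd edges meeting in a vertex belong to the same circle, so at each vertex either all
  color sets are transposed or none. The bound \<open>1 \<le> i\<close> keeps \<open>0\<close> from
  becoming a color.\<close>

lemma swap_coloring:
  assumes i: "1 \<le> i"
  shows "swap i c \<in> colorings w"
proof -
  let ?t = "Transposition.transpose i (Suc i)"
  have "swap i c \<in> (\<Pi>\<^sub>E e\<in>edges w. {S. finite S \<and> 0 \<notin> S \<and> card S = thick w e})"
  proof (rule PiE_I)
    fix e assume e: "e \<in> edges w"
    have "finite (c e) \<and> 0 \<notin> c e \<and> card (c e) = thick w e" using c e by (auto simp: colorings_def PiE_iff)
    moreover have "?t 0 = 0" using i by (simp add: Transposition.transpose_def)
    ultimately show "swap i c e \<in> {S. finite S \<and> 0 \<notin> S \<and> card S = thick w e}"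
      using e by (simp add: swap_def in_transpose_image_iff card_image)
  qed (simp add: swap_def)
  moreover have "(\<Union>e\<in>in_edges w v. swap i c e) = (\<Union>e\<in>out_edges w v. swap i c e)" if v: "v \<in> verts w" for v
  proof (cases "\<exists>x \<in> in_edges w v \<union> out_edges w v. x \<in> essential i c")
    case True
    then obtain x where x: "x \<in> in_edges w v \<union> out_edges w v" "x \<in> essential i c" by blast
    have "swap i c y = ?t ` c y" if y: "y \<in> in_edges w v \<union> out_edges w v" for y
    proof (rule swap_touched)
      show "y \<in> edges w" using y in_edges_sub out_edges_sub by blast
      have "v \<in> {st x, fi x} \<inter> {st y, fi y}" using x(1) y by (auto simp: in_edges_def out_edges_def)
      then show "y \<in> essential i c" if "y \<in> odd_edges i c" using essential_touch[OF x(2) that] by blast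
    qed
    then have "(\<Union>e\<in>in_edges w v. swap i c e) = ?t ` (\<Union>e\<in>in_edges w v. c e)"
      "(\<Union>e\<in>out_edges w v. swap i c e) = ?t ` (\<Union>e\<in>out_edges w v. c e)" by (simp_all add: image_UN)
    then show ?thesis using coloringD(4)[OF c v] by simp
  next
    case False
    have "swap i c y = c y" if y: "y \<in> in_edges w v \<union> out_edges w v" for y
    proof -
      have "y \<in> edges w" using y in_edges_sub out_edges_sub by blast
      then show ?thesis using False y by (simp add: swap_def)
    qed
    then show ?thesis using coloringD(4)[OF c v] by simp
  qed
  ultimately show ?thesis by (simp add: colorings_def)
qed

text \<open>Grouped by circles, every summand is zero by the definition of \<open>essential\<close>.
  In other words, on the edges left alone the two colors cross the base segment equally
  often.\<close>

lemma inessential_crossing_sum: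
  "(\<Sum>s | s \<in> strand_set \<and> int nlev dvd snd s \<and> fst s \<in> odd_edges i c - essential i c. edge_sign i c (fst s)) = 0"
proof -
  let ?G = "odd_edges i c" and ?N = "odd_edges i c - essential i c"
  let ?S = "{s \<in> strand_set. int nlev dvd snd s \<and> fst s \<in> ?N}"
  have fin: "finite ?S" "finite (piece ?G ` ?N)"
    using finite_strand_set finite_subset[OF odd_edges_sub finite_edges] by simp_all
  have "(\<Sum>s\<in>?S. edge_sign i c (fst s)) =
      (\<Sum>K\<in>piece ?G ` ?N. \<Sum>s | s \<in> ?S \<and> piece ?G (fst s) = K. edge_sign i c (fst s))"
    by (rule sum.group[symmetric, OF fin]) auto
  also have "\<dots> = 0"
  proof (rule sum.neutral, rule ballI)
    fix K assume "K \<in> piece ?G ` ?N"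
    then obtain x where x: "x \<in> ?G" "x \<notin> essential i c" "K = piece ?G x" by blast
    have "fst s \<in> ?N \<and> piece ?G (fst s) = K \<longleftrightarrow> fst s \<in> K" for s :: "'e \<times> int"
      using essential_piece[OF x(1), of "fst s"] piece_eq[of "fst s" ?G x] piece_self[of "fst s" ?G] x by auto
    then have "{s \<in> ?S. piece ?G (fst s) = K} = {s \<in> strand_set. int nlev dvd snd s \<and> fst s \<in> K}" by blast
    moreover have "crossing_sum i c K = 0" using x by (auto simp: essential_def)
    ultimately show "(\<Sum>s | s \<in> ?S \<and> piece ?G (fst s) = K. edge_sign i c (fst s)) = 0"
      by (simp only: crossing_sum_def)
  qed
  finally show ?thesis by simp
qed

text \<open>A merge changes its contribution only if its incoming edges carry the two colors
  separately and lie on an essential circle, that is, at a maximum of this circle. The change is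
  \<open>2\<close> or \<open>-2\<close> according to the turn, and \<open>card_turns_eq\<close>
  balances the two kinds on each circle.\<close>

lemma inv_coloring_swap: "inv_coloring w (swap i c) = inv_coloring w c"
proof -
  let ?G = "odd_edges i c" and ?E = "essential i c"
  define T where "T e = {m \<in> merges w. left_in w m \<in> ?E \<and> right_in w m \<in> ?E \<and>
     edge_sign i c (left_in w m) = - e \<and> edge_sign i c (right_in w m) = e}" for e
  have fm: "finite (merges w)" by (rule finite_subset[OF _ finite_verts]) (auto simp: merges_def)
  have diff: "inv_sets (c (right_in w m)) (c (left_in w m)) - inv_sets (swap i c (right_in w m)) (swap i c (left_in w m)) =
      2 * ((if m \<in> T 1 then 1 else 0) - (if m \<in> T (-1) then 1 else 0))" if m: "m \<in> merges w" for m
  proof -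
    obtain l r d where lr: "in_edges w m = {l, r}" "l \<noteq> r" "xi (l, stop l - 1) < xi (r, stop r - 1)"
      "left_in w m = l" "right_in w m = r" "out_edges w m = {d}" using merge_left_right[OF m] .
    have mv: "m \<in> verts w" using m by (simp add: merges_def)
    have lin: "l \<in> in_edges w m" and rin: "r \<in> in_edges w m" using lr(1) by simp_all
    then have le: "l \<in> edges w" and re: "r \<in> edges w" and fi: "fi l = m" "fi r = m" by (auto simp: in_edges_def)
    have disj: "c l \<inter> c r = {}" using coloring_disjoint(1)[OF c mv lin rin lr(2)] .
    have fin: "finite (c l)" "finite (c r)" using c le re by (auto simp: colorings_def PiE_iff)
    show ?thesis
    proof (cases "l \<in> ?E \<or> r \<in> ?E")
      case True
      \<comment> \<open>Odd edges ending at the same merge lie on the same circle, so both incoming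
        color sets are transposed.\<close>
      have lE: "l \<in> ?E" if "l \<in> ?G" using True essential_touch[of r i c l] fi that by auto
      have rE: "r \<in> ?E" if "r \<in> ?G" using True essential_touch[of l i c r] fi that by auto
      have "Suc i \<in> c r \<and> i \<in> c l \<longleftrightarrow> m \<in> T 1"
      proof
        assume h: "Suc i \<in> c r \<and> i \<in> c l"
        then have n: "i \<notin> c r" "Suc i \<notin> c l" using disj by blast+
        then have "l \<in> ?E" "r \<in> ?E" using h lE rE le re by (auto simp: odd_edges_def)
        then show "m \<in> T 1" using h n m lr(4,5) by (simp add: T_def edge_sign_def)
      next
        assume "m \<in> T 1"
        then have "l \<in> ?E" "edge_sign i c l = -1" "edge_sign i c r = 1" using lr(4,5) by (auto simp: T_def)
        moreover then have "l \<in> ?G" using essential_sub by blast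
        ultimately show "Suc i \<in> c r \<and> i \<in> c l" by (auto simp: edge_sign_def odd_edges_def split: if_splits)
      qed
      moreover have "i \<in> c r \<and> Suc i \<in> c l \<longleftrightarrow> m \<in> T (-1)"
      proof
        assume h: "i \<in> c r \<and> Suc i \<in> c l"
        then have n: "Suc i \<notin> c r" "i \<notin> c l" using disj by blast+
        then have "l \<in> ?E" "r \<in> ?E" using h lE rE le re by (auto simp: odd_edges_def)
        then show "m \<in> T (-1)" using h n m lr(4,5) by (simp add: T_def edge_sign_def)
      next
        assume "m \<in> T (-1)"
        then have "r \<in> ?E" "edge_sign i c l = 1" "edge_sign i c r = -1" using lr(4,5) by (auto simp: T_def)
        moreover then have "r \<in> ?G" using essential_sub by blast
        ultimately show "i \<in> c r \<and> Suc i \<in> c l" by (auto simp: edge_sign_def odd_edges_def split: if_splits)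
      qed
      moreover have "swap i c l = Transposition.transpose i (Suc i) ` c l" by (rule swap_touched[OF le lE])
      moreover have "swap i c r = Transposition.transpose i (Suc i) ` c r" by (rule swap_touched[OF re rE])
      ultimately show ?thesis using inv_sets_transpose[OF fin(2,1), of i] lr(4,5) by simp
    next
      case False
      then have "swap i c l = c l" "swap i c r = c r" using le re by (simp_all add: swap_def)
      moreover have "m \<notin> T 1" "m \<notin> T (-1)" using False lr(4,5) by (auto simp: T_def)
      ultimately show ?thesis using lr(4,5) by simp
    qed
  qed
  \<comment> \<open>The merges are grouped by the circle that contains their left incoming edge; it
    contains the right one too.\<close>
  have "card (T e) = (\<Sum>K\<in>piece ?G ` ?E. card (turns i c K e))" for e
  proof -
    have fin: "finite (T e)" "finite (piece ?G ` ?E)"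
      using fm finite_subset[OF subset_trans[OF essential_sub odd_edges_sub] finite_edges] by (simp_all add: T_def)
    have "card (T e) = (\<Sum>K\<in>piece ?G ` ?E. \<Sum>m | m \<in> T e \<and> piece ?G (left_in w m) = K. 1)"
      unfolding card_eq_sum by (rule sum.group[symmetric, OF fin]) (auto simp: T_def)
    also have "\<dots> = (\<Sum>K\<in>piece ?G ` ?E. card (turns i c K e))"
    proof (rule sum.cong[OF refl])
      fix K assume "K \<in> piece ?G ` ?E"
      then obtain x where x: "x \<in> ?E" "K = piece ?G x" by blast
      have xG: "x \<in> ?G" using x essential_sub by blast
      have "{m \<in> T e. piece ?G (left_in w m) = K} = turns i c K e"
      proof (intro equalityI subsetI)
        fix m assume "m \<in> {m \<in> T e. piece ?G (left_in w m) = K}"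
        then have m: "m \<in> T e" "piece ?G (left_in w m) = K" by simp_all
        then have m': "m \<in> merges w" "left_in w m \<in> ?G" "right_in w m \<in> ?G" using essential_sub by (auto simp: T_def)
        obtain l r d where lr: "in_edges w m = {l, r}" "l \<noteq> r" "xi (l, stop l - 1) < xi (r, stop r - 1)"
          "left_in w m = l" "right_in w m = r" "out_edges w m = {d}" using merge_left_right[OF m'(1)] .
        have "fi (left_in w m) = m" "fi (right_in w m) = m" using lr by (auto simp: in_edges_def)
        then have "piece ?G (right_in w m) = K" using piece_touch[OF m'(2,3)] m(2) by simp
        then have "left_in w m \<in> K" "right_in w m \<in> K" using m(2) piece_self by blast+
        then show "m \<in> turns i c K e" using m(1) by (simp add: turns_def T_def)
      next
        fix m assume m: "m \<in> turns i c K e"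
        then have "left_in w m \<in> K" "right_in w m \<in> K" by (simp_all add: turns_def)
        then have "left_in w m \<in> ?E" "right_in w m \<in> ?E" "piece ?G (left_in w m) = K"
          using essential_piece(2)[OF xG] piece_eq x by auto
        then show "m \<in> {m \<in> T e. piece ?G (left_in w m) = K}" using m by (simp add: T_def turns_def)
      qed
      then show "(\<Sum>m | m \<in> T e \<and> piece ?G (left_in w m) = K. 1) = card (turns i c K e)" by (simp only: card_eq_sum)
    qed
    finally show ?thesis .
  qed
  moreover have "card (turns i c K 1) = card (turns i c K (-1))" if K: "K \<in> piece ?G ` ?E" for K
  proof -
    obtain x where x: "x \<in> ?G" "K = piece ?G x" "crossing_sum i c K \<noteq> 0" using K by (auto simp: essential_def)
    show ?thesis by (rule card_turns_eq[OF c x])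
  qed
  ultimately have "card (T 1) = card (T (-1))" by simp
  moreover have "T e \<subseteq> merges w" for e by (auto simp: T_def)
  then have "(\<Sum>m\<in>merges w. if m \<in> T e then 1 else 0) = int (card (T e))" for e
    using fm by (simp add: sum.If_cases Int_absorb1)
  moreover have "inv_coloring w c - inv_coloring w (swap i c) =
      (\<Sum>m\<in>merges w. 2 * ((if m \<in> T 1 then 1 else 0) - (if m \<in> T (-1) then 1 else 0)))"
    unfolding inv_coloring_def sum_subtractf[symmetric] by (rule sum.cong[OF refl]) (rule diff)
  then have "inv_coloring w c - inv_coloring w (swap i c) =
      2 * ((\<Sum>m\<in>merges w. if m \<in> T 1 then 1 else 0) - (\<Sum>m\<in>merges w. if m \<in> T (-1) then 1 else 0))"
    by (simp add: sum_distrib_left[symmetric] sum_subtractf)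
  ultimately show ?thesis by simp
qed

text \<open>On essential circles, and on edges carrying both or neither of the two colors, the new
  coloring is the transposed one. The difference lives on the inessential circles, where the
  crossings with the base segment cancel.\<close>

lemma coloring_monomial_swap:
  assumes i: "1 \<le> i"
  shows "coloring_monomial w (swap i c) l = coloring_monomial w c (Transposition.transpose i (Suc i) l)"
proof -
  let ?t = "Transposition.transpose i (Suc i)"
  let ?S = "{s \<in> strand_set. int nlev dvd snd s}"
  let ?N = "odd_edges i c - essential i c"
  have finS: "finite ?S" using finite_strand_set by simp
  have card: "int (card {s \<in> strand_set. int nlev dvd snd s \<and> P (fst s)}) = (\<Sum>s\<in>?S. if P (fst s) then 1 else 0)" for P
  proof -
    have "{s \<in> strand_set. int nlev dvd snd s \<and> P (fst s)} = ?S \<inter> {s. P (fst s)}" by blast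
    then show ?thesis using finS by (simp add: sum.If_cases)
  qed
  \<comment> \<open>The sign with which an unswapped odd edge enters the difference: color
    \<open>Suc i\<close> contributes its \<open>edge_sign\<close>, color \<open>i\<close> the
    negative, any other color nothing.\<close>
  define \<sigma> :: int where "\<sigma> = (if l = Suc i then 1 else if l = i then -1 else 0)"
  have "int (coloring_monomial w (swap i c) l) - int (coloring_monomial w c (?t l)) =
      (\<Sum>s\<in>?S. (if l \<in> swap i c (fst s) then 1 else 0) - (if ?t l \<in> c (fst s) then 1 else 0))"
    unfolding coloring_monomial_eq(2)[OF swap_coloring[OF i]] coloring_monomial_eq(2)[OF c]
      card[of "\<lambda>e. l \<in> swap i c e"] card[of "\<lambda>e. ?t l \<in> c e"]
    by (rule sum_subtractf[symmetric])
  also have "\<dots> = (\<Sum>s\<in>?S. if fst s \<in> ?N then \<sigma> * edge_sign i c (fst s) else 0)"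
  proof (rule sum.cong[OF refl])
    fix s assume "s \<in> ?S"
    then have e: "fst s \<in> edges w" by (auto simp: strand_set_def)
    have t: "?t i = Suc i" "?t (Suc i) = i" "l \<noteq> i \<Longrightarrow> l \<noteq> Suc i \<Longrightarrow> ?t l = l"
      by (simp_all add: Transposition.transpose_def)
    have E: "fst s \<in> essential i c \<Longrightarrow> fst s \<in> odd_edges i c" using essential_sub by blast
    have G: "fst s \<in> odd_edges i c \<longleftrightarrow> (i \<in> c (fst s)) \<noteq> (Suc i \<in> c (fst s))" using e by (simp add: odd_edges_def)
    consider "l = i" | "l = Suc i" | "l \<noteq> i" "l \<noteq> Suc i" by blast
    then show "(if l \<in> swap i c (fst s) then 1 else 0) - (if ?t l \<in> c (fst s) then 1 else 0) =
        (if fst s \<in> ?N then \<sigma> * edge_sign i c (fst s) else 0)"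
      using E G by cases (auto simp: swap_mem[OF e] \<sigma>_def edge_sign_def t)
  qed
  also have "\<dots> = (\<Sum>s\<in>?S \<inter> {s. fst s \<in> ?N}. \<sigma> * edge_sign i c (fst s))"
    by (simp only: sum.If_cases[OF finS] sum.neutral_const add_0_right)
  also have "?S \<inter> {s. fst s \<in> ?N} = {s \<in> strand_set. int nlev dvd snd s \<and> fst s \<in> ?N}" by blast
  also have "(\<Sum>s\<in>{s \<in> strand_set. int nlev dvd snd s \<and> fst s \<in> ?N}. \<sigma> * edge_sign i c (fst s)) = 0"
    unfolding sum_distrib_left[symmetric] inessential_crossing_sum by simp
  finally show ?thesis by simp
qed

end

lemma symmetric_chromatic_function: "symmetric_series (chromatic_function w)"
  unfolding symmetric_series_def
proof (intro allI impI)
  fix i :: nat and \<mu> assume i: "1 \<le> i"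
  let ?t = "Transposition.transpose i (Suc i)"
  have mono: "coloring_monomial w (swap i c) = coloring_monomial w c \<circ> ?t" if "c \<in> colorings w" for c
    by (rule ext) (simp add: coloring_monomial_swap[OF that i])
  have tt: "\<nu> \<circ> ?t \<circ> ?t = \<nu>" for \<nu> :: monomial by (rule ext) simp
  show "chromatic_function w (\<mu> \<circ> ?t) = chromatic_function w \<mu>"
    unfolding chromatic_function_def
  proof (rule sum.reindex_bij_witness[where i = "swap i" and j = "swap i"])
    fix c assume h: "c \<in> {c \<in> colorings w. coloring_monomial w c = \<mu> \<circ> ?t}"
    then show "swap i (swap i c) = c" "q_power (inv_coloring w (swap i c)) = q_power (inv_coloring w c)"
      by (simp_all add: swap_swap inv_coloring_swap)
    show "swap i c \<in> {c \<in> colorings w. coloring_monomial w c = \<mu>}"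
      using h by (simp add: swap_coloring[OF _ i] mono tt)
  next
    fix c assume h: "c \<in> {c \<in> colorings w. coloring_monomial w c = \<mu>}"
    then show "swap i (swap i c) = c" by (simp add: swap_swap)
    show "swap i c \<in> {c \<in> colorings w. coloring_monomial w c = \<mu> \<circ> ?t}"
      using h by (simp add: swap_coloring[OF _ i] mono)
  qed
qed

end

lemma q_power_nonneg: "q_power m \<in> nonneg_laurent"
  by (simp add: nonneg_laurent_def q_power_def lookup_single when_def)

lemma nonneg_laurent_sum: "(\<And>x. x \<in> A \<Longrightarrow> f x \<in> nonneg_laurent) \<Longrightarrow> sum f A \<in> nonneg_laurent"
  by (auto simp: nonneg_laurent_def Poly_Mapping.lookup_sum intro!: sum_nonneg)

theorem theorem2:
  fixes w :: "'e web" and n k :: nat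
  assumes "annular_web w" and "web_degree w = n" and "1 \<le> k" and "k \<le> n"
  shows "schur_coeff (hook n k) (chromatic_function w) =
           (\<Sum>T\<in>web_tableaux w (hook n k). q_power (inv_array w T)) \<and>
         schur_coeff (hook n k) (chromatic_function w) \<in> nonneg_laurent"
proof -
  interpret web_context w using assms(1) by unfold_locales
  have "schur_coeff (hook n k) (chromatic_function w) = hook_functional n k (chromatic_function w)"
    using schur_coeff_hook[OF symmetric_chromatic_function _ assms(3,4)] homogeneous_chromatic_function assms(2) by simp
  also have "\<dots> = (\<Sum>T\<in>web_tableaux w (hook n k). q_power (inv_array w T))"
    by (rule hook_functional_chromatic_function[OF assms(2-4)])
  finally have coeff: "schur_coeff (hook n k) (chromatic_function w) =
      (\<Sum>T\<in>web_tableaux w (hook n k). q_power (inv_array w T))" .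
  show ?thesis unfolding coeff by (intro conjI refl nonneg_laurent_sum q_power_nonneg)
qed

end
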